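(* Let $f:M\to(N,g)$ be a pluri-harmonic map from a compact complex manifold $M$ to a Riemannian manifold $(N,g)$ with non-positive Riemannian sectional curvature. If $\mathcal O_{T^*_M}(-1)$ is RC-positive, then $f$ is a constant map.
   Context: Manifolds are connected. A smooth map $f:M\to(N,g)$ from a complex manifold to a Riemannian manifold is pluri-harmonic if, in local holomorphic coordinates $z^\alpha$ on $M$ and local coordinates $x^i$ on $N$, $\frac{\partial^2f^i}{\partial z^\alpha\partial\bar z^\beta}+\Gamma^i_{jk}\frac{\partial f^j}{\partial\bar z^\beta}\frac{\partial f^k}{\partial z^\alpha}=0$ for all $i,\alpha,\beta$, with $\Gamma^i_{jk}$ the Christoffel symbols of the Levi-Civita connection of $g$. $\mathbb P(T_M)\to M$ is the bundle whose fiber over $p$ is the set of complex lines in $T_pM=T^{1,0}_pM$; $\mathcal O_{T^*_M}(-1)$ is the tautological line bundle on $\mathbb P(T_M)$ whose fiber at $(p,[W])$ is the line $\mathbb CW\subset T_pM$. A holomorphic line bundle $\mathscr L$ over a complex manifold $X$ is RC-positive if it admits a smooth Hermitian metric $h^{\mathscr L}$ such that its Chern curvature $-\sqrt{-1}\,\partial\bar\partial\log h^{\mathscr L}$ has at least one positive eigenvalue at every point of $X$. *)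

theory Defs
  imports "HOL-Analysis.Analysis" "Jordan_Normal_Form.Char_Poly"
    "Jordan_Normal_Form.Gauss_Jordan_Elimination"
begin

section \<open>Calculus on coordinate spaces\<close>

text \<open>
  The dimension of a manifold is an arbitrary natural number \<open>n\<close> (the construction of
  \<open>P(T_M)\<close> passes from \<open>n\<close> to \<open>2 * n - 1\<close>), so the model spaces \<open>R^n\<close> and \<open>C^n\<close> are
  represented by the sequences vanishing from index \<open>n\<close> on, with the topology of pointwise
  convergence, which on them is the Euclidean topology.
\<close>

definition coord_space :: "nat \<Rightarrow> (nat \<Rightarrow> 'a::zero) set"
  where "coord_space n = {x. \<forall>i\<ge>n. x i = 0}"

text \<open>
  Derivative at \<open>x\<close> in the real direction \<open>e\<close> of the \<open>i\<close>-th coordinate. For \<open>'a = real\<close> and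
  \<open>e = 1\<close> this is the usual partial derivative; for \<open>'a = complex\<close> the directions \<open>e = 1\<close> and
  \<open>e = \<i>\<close> give the derivatives with respect to the real and the imaginary part of the
  \<open>i\<close>-th coordinate.
\<close>

definition pd :: "nat \<Rightarrow> 'a::euclidean_space \<Rightarrow> ((nat \<Rightarrow> 'a) \<Rightarrow> 'b::real_normed_vector)
    \<Rightarrow> (nat \<Rightarrow> 'a) \<Rightarrow> 'b"
  where "pd i e u x = vector_derivative (\<lambda>t::real. u (x(i := x i + t *\<^sub>R e))) (at 0)"

primrec Ck_on :: "nat \<Rightarrow> nat \<Rightarrow> (nat \<Rightarrow> 'a::euclidean_space) set
    \<Rightarrow> ((nat \<Rightarrow> 'a) \<Rightarrow> 'b::real_normed_vector) \<Rightarrow> bool"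
  where
    "Ck_on 0 n U u \<longleftrightarrow> continuous_on U u"
  | "Ck_on (Suc k) n U u \<longleftrightarrow> continuous_on U u \<and>
      (\<forall>i<n. \<forall>e\<in>Basis.
        (\<forall>x\<in>U. (\<lambda>t::real. u (x(i := x i + t *\<^sub>R e))) differentiable (at 0)) \<and>
        Ck_on k n U (pd i e u))"

text \<open>
  Smoothness on a relatively open subset \<open>U\<close> of \<open>coord_space n\<close>. On \<open>C^n\<close> this is
  smoothness in the \<open>2 * n\<close> underlying real coordinates, as \<open>Basis = {1, \<i>}\<close>.
\<close>

definition smooth_on :: "nat \<Rightarrow> (nat \<Rightarrow> 'a::euclidean_space) set
    \<Rightarrow> ((nat \<Rightarrow> 'a) \<Rightarrow> 'b::real_normed_vector) \<Rightarrow> bool"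
  where "smooth_on n U u \<longleftrightarrow> (\<forall>k. Ck_on k n U u)"

text \<open>The Wirtinger operators \<open>\<partial>/\<partial>z^a\<close> and \<open>\<partial>/\<partial>\<bar>z^a\<close>.\<close>

definition dz :: "nat \<Rightarrow> ((nat \<Rightarrow> complex) \<Rightarrow> complex) \<Rightarrow> (nat \<Rightarrow> complex) \<Rightarrow> complex"
  where "dz a u x = (pd a 1 u x - \<i> * pd a \<i> u x) / 2"

definition dzbar :: "nat \<Rightarrow> ((nat \<Rightarrow> complex) \<Rightarrow> complex) \<Rightarrow> (nat \<Rightarrow> complex) \<Rightarrow> complex"
  where "dzbar a u x = (pd a 1 u x + \<i> * pd a \<i> u x) / 2"

definition holomorphic_fun_on ::
    "nat \<Rightarrow> (nat \<Rightarrow> complex) set \<Rightarrow> ((nat \<Rightarrow> complex) \<Rightarrow> complex) \<Rightarrow> bool"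
  where "holomorphic_fun_on n U u \<longleftrightarrow> smooth_on n U u \<and> (\<forall>a<n. \<forall>x\<in>U. dzbar a u x = 0)"

section \<open>Manifolds\<close>

text \<open>
  A manifold is given by its atlas: a set of charts \<open>(U, \<phi>)\<close>, where only the values of \<open>\<phi>\<close> on
  \<open>U\<close> matter. The points of the manifold are those covered by the charts, and its topology is
  the one for which the charts are homeomorphisms onto open subsets of the model space.
\<close>

type_synonym ('p, 'a) chart = "'p set \<times> ('p \<Rightarrow> nat \<Rightarrow> 'a)"

definition points :: "('p, 'a) chart set \<Rightarrow> 'p set"
  where "points A = (\<Union>\<kappa>\<in>A. fst \<kappa>)"

definition mtop :: "('p, 'a::topological_space) chart set \<Rightarrow> 'p topology"
  where "mtop A =
    topology_generated_by {{p \<in> fst \<kappa>. snd \<kappa> p \<in> W} | \<kappa> W. \<kappa> \<in> A \<and> open W}"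

definition chart_inv :: "('p, 'a) chart \<Rightarrow> (nat \<Rightarrow> 'a) \<Rightarrow> 'p"
  where "chart_inv \<kappa> = inv_into (fst \<kappa>) (snd \<kappa>)"

locale manifold_atlas =
  fixes n :: nat and A :: "('p, 'a::{euclidean_space, real_normed_field}) chart set"
  assumes chart_inj: "\<kappa> \<in> A \<Longrightarrow> inj_on (snd \<kappa>) (fst \<kappa>)"
    and chart_open: "\<kappa> \<in> A \<Longrightarrow> \<kappa>' \<in> A \<Longrightarrow>
      openin (top_of_set (coord_space n)) (snd \<kappa> ` (fst \<kappa> \<inter> fst \<kappa>'))"
    and hausdorff: "Hausdorff_space (mtop A)"
    and second_countable: "second_countable (mtop A)"
    and connected: "connected_space (mtop A)"

locale smooth_manifold = manifold_atlas n A
  for n :: nat and A :: "('p, real) chart set" +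
  assumes smooth_transition: "\<kappa> \<in> A \<Longrightarrow> \<kappa>' \<in> A \<Longrightarrow> k < n \<Longrightarrow>
      smooth_on n (snd \<kappa> ` (fst \<kappa> \<inter> fst \<kappa>')) (\<lambda>x. snd \<kappa>' (chart_inv \<kappa> x) k)"

locale complex_manifold = manifold_atlas n A
  for n :: nat and A :: "('p, complex) chart set" +
  assumes holomorphic_transition: "\<kappa> \<in> A \<Longrightarrow> \<kappa>' \<in> A \<Longrightarrow> k < n \<Longrightarrow>
      holomorphic_fun_on n (snd \<kappa> ` (fst \<kappa> \<inter> fst \<kappa>')) (\<lambda>x. snd \<kappa>' (chart_inv \<kappa> x) k)"

definition smooth_map :: "nat \<Rightarrow> ('p, 'a::euclidean_space) chart set
    \<Rightarrow> nat \<Rightarrow> ('q, 'b::real_normed_vector) chart set \<Rightarrow> ('p \<Rightarrow> 'q) \<Rightarrow> bool"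
  where "smooth_map n A m B f \<longleftrightarrow>
    continuous_map (mtop A) (mtop B) f \<and>
    (\<forall>\<kappa>\<in>A. \<forall>\<kappa>'\<in>B. \<forall>i<m.
      smooth_on n (snd \<kappa> ` (fst \<kappa> \<inter> f -` fst \<kappa>')) (\<lambda>x. snd \<kappa>' (f (chart_inv \<kappa> x)) i))"

section \<open>Tangent vectors\<close>

text \<open>
  A tangent vector at \<open>p\<close> is the family of its components: \<open>v (\<kappa>, i)\<close> is the \<open>i\<close>-th component of
  \<open>v\<close> with respect to the coordinates \<open>\<kappa>\<close>, and the components in different charts are related by
  the Jacobian matrix of the coordinate change. Vector space operations are pointwise.

  For a complex manifold \<open>deriv\<close> is the complex derivative, so the Jacobian matrix is
  \<open>\<partial>w^k/\<partial>z^i\<close> and \<open>tangent_space\<close> is the holomorphic tangent space \<open>T^{1,0}_p\<close>; for a smooth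
  manifold it is the usual real tangent space.
\<close>

type_synonym ('p, 'a) tangent = "('p, 'a) chart \<times> nat \<Rightarrow> 'a"

definition jac :: "('p, 'a::real_normed_field) chart \<Rightarrow> ('p, 'a) chart \<Rightarrow> 'p \<Rightarrow> nat \<Rightarrow> nat \<Rightarrow> 'a"
  where "jac \<kappa> \<kappa>' p k i =
    deriv (\<lambda>t. snd \<kappa>' (chart_inv \<kappa> ((snd \<kappa> p)(i := t))) k) (snd \<kappa> p i)"

definition tangent_space ::
    "nat \<Rightarrow> ('p, 'a::real_normed_field) chart set \<Rightarrow> 'p \<Rightarrow> ('p, 'a) tangent set"
  where "tangent_space n A p = {v.
    (\<forall>\<kappa>\<in>A. \<forall>\<kappa>'\<in>A. \<forall>k<n. p \<in> fst \<kappa> \<longrightarrow> p \<in> fst \<kappa>' \<longrightarrow>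
      v (\<kappa>', k) = (\<Sum>i<n. jac \<kappa> \<kappa>' p k i * v (\<kappa>, i))) \<and>
    (\<forall>\<kappa> k. \<kappa> \<notin> A \<or> p \<notin> fst \<kappa> \<or> k \<ge> n \<longrightarrow> v (\<kappa>, k) = 0)}"

text \<open>The coordinate vector field \<open>\<partial>/\<partial>x^i\<close> of the chart \<open>\<kappa>\<close>.\<close>

definition coord_vec :: "nat \<Rightarrow> ('p, 'a::real_normed_field) chart set \<Rightarrow> ('p, 'a) chart
    \<Rightarrow> nat \<Rightarrow> 'p \<Rightarrow> ('p, 'a) tangent"
  where "coord_vec n A \<kappa> i p =
    (\<lambda>(\<kappa>', k). if \<kappa>' \<in> A \<and> p \<in> fst \<kappa>' \<and> k < n then jac \<kappa> \<kappa>' p k i else 0)"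

section \<open>Riemannian manifolds\<close>

definition metric_comp :: "nat \<Rightarrow> ('q, real) chart set
    \<Rightarrow> ('q \<Rightarrow> ('q, real) tangent \<Rightarrow> ('q, real) tangent \<Rightarrow> real)
    \<Rightarrow> ('q, real) chart \<Rightarrow> nat \<Rightarrow> nat \<Rightarrow> (nat \<Rightarrow> real) \<Rightarrow> real"
  where "metric_comp m B g \<kappa> i j x =
    (let q = chart_inv \<kappa> x in g q (coord_vec m B \<kappa> i q) (coord_vec m B \<kappa> j q))"

locale riemannian_manifold = smooth_manifold m B
  for m :: nat and B :: "('q, real) chart set" +
  fixes g :: "'q \<Rightarrow> ('q, real) tangent \<Rightarrow> ('q, real) tangent \<Rightarrow> real"
  assumes metric_add: "q \<in> points B \<Longrightarrow> v \<in> tangent_space m B q \<Longrightarrow> v' \<in> tangent_space m B q \<Longrightarrow>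
      w \<in> tangent_space m B q \<Longrightarrow> g q (\<lambda>a. v a + v' a) w = g q v w + g q v' w"
    and metric_scale: "q \<in> points B \<Longrightarrow> v \<in> tangent_space m B q \<Longrightarrow> w \<in> tangent_space m B q \<Longrightarrow>
      g q (\<lambda>a. c * v a) w = c * g q v w"
    and metric_sym: "q \<in> points B \<Longrightarrow> v \<in> tangent_space m B q \<Longrightarrow> w \<in> tangent_space m B q \<Longrightarrow>
      g q v w = g q w v"
    and metric_pos: "q \<in> points B \<Longrightarrow> v \<in> tangent_space m B q \<Longrightarrow> v \<noteq> (\<lambda>a. 0) \<Longrightarrow> g q v v > 0"
    and metric_smooth: "\<kappa> \<in> B \<Longrightarrow> i < m \<Longrightarrow> j < m \<Longrightarrow>
      smooth_on m (snd \<kappa> ` fst \<kappa>) (metric_comp m B g \<kappa> i j)"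

definition metric_inv_comp :: "nat \<Rightarrow> ('q, real) chart set
    \<Rightarrow> ('q \<Rightarrow> ('q, real) tangent \<Rightarrow> ('q, real) tangent \<Rightarrow> real)
    \<Rightarrow> ('q, real) chart \<Rightarrow> nat \<Rightarrow> nat \<Rightarrow> (nat \<Rightarrow> real) \<Rightarrow> real"
  where "metric_inv_comp m B g \<kappa> i j x =
    the (mat_inverse (Matrix.mat m m (\<lambda>(k, l). metric_comp m B g \<kappa> k l x))) $$ (i, j)"

text \<open>\<open>\<Gamma>^i_{jk}\<close> in the chart \<open>\<kappa>\<close>, as a function of the coordinates.\<close>

definition christoffel :: "nat \<Rightarrow> ('q, real) chart set
    \<Rightarrow> ('q \<Rightarrow> ('q, real) tangent \<Rightarrow> ('q, real) tangent \<Rightarrow> real)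
    \<Rightarrow> ('q, real) chart \<Rightarrow> nat \<Rightarrow> nat \<Rightarrow> nat \<Rightarrow> (nat \<Rightarrow> real) \<Rightarrow> real"
  where "christoffel m B g \<kappa> i j k x =
    (\<Sum>l<m. metric_inv_comp m B g \<kappa> i l x *
      (pd j 1 (metric_comp m B g \<kappa> l k) x + pd k 1 (metric_comp m B g \<kappa> j l) x
        - pd l 1 (metric_comp m B g \<kappa> j k) x)) / 2"

text \<open>
  \<open>R^l_{ijk}\<close>, with \<open>R(\<partial>_i, \<partial>_j) \<partial>_k = R^l_{ijk} \<partial>_l\<close> and
  \<open>R(X, Y) Z = \<nabla>_X \<nabla>_Y Z - \<nabla>_Y \<nabla>_X Z - \<nabla>_{[X, Y]} Z\<close>.
\<close>

definition riemann_comp :: "nat \<Rightarrow> ('q, real) chart set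
    \<Rightarrow> ('q \<Rightarrow> ('q, real) tangent \<Rightarrow> ('q, real) tangent \<Rightarrow> real)
    \<Rightarrow> ('q, real) chart \<Rightarrow> nat \<Rightarrow> nat \<Rightarrow> nat \<Rightarrow> nat \<Rightarrow> (nat \<Rightarrow> real) \<Rightarrow> real"
  where "riemann_comp m B g \<kappa> l i j k x =
    pd i 1 (christoffel m B g \<kappa> l j k) x - pd j 1 (christoffel m B g \<kappa> l i k) x
    + (\<Sum>s<m. christoffel m B g \<kappa> s j k x * christoffel m B g \<kappa> l i s x
              - christoffel m B g \<kappa> s i k x * christoffel m B g \<kappa> l j s x)"

text \<open>
  \<open>K(X, Y) = g(R(X, Y) Y, X) / (g(X, X) g(Y, Y) - g(X, Y)^2)\<close>, the numerator being computed
  in the chart \<open>\<kappa>\<close>.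
\<close>

definition sectional_curvature :: "nat \<Rightarrow> ('q, real) chart set
    \<Rightarrow> ('q \<Rightarrow> ('q, real) tangent \<Rightarrow> ('q, real) tangent \<Rightarrow> real)
    \<Rightarrow> ('q, real) chart \<Rightarrow> 'q \<Rightarrow> ('q, real) tangent \<Rightarrow> ('q, real) tangent \<Rightarrow> real"
  where "sectional_curvature m B g \<kappa> q X Y =
    (\<Sum>i<m. \<Sum>j<m. \<Sum>k<m. \<Sum>l<m. \<Sum>s<m.
      riemann_comp m B g \<kappa> l i j k (snd \<kappa> q) * metric_comp m B g \<kappa> l s (snd \<kappa> q)
      * X (\<kappa>, i) * Y (\<kappa>, j) * Y (\<kappa>, k) * X (\<kappa>, s))
    / (g q X X * g q Y Y - (g q X Y)\<^sup>2)"

definition nonpositive_sectional_curvature :: "nat \<Rightarrow> ('q, real) chart set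
    \<Rightarrow> ('q \<Rightarrow> ('q, real) tangent \<Rightarrow> ('q, real) tangent \<Rightarrow> real) \<Rightarrow> bool"
  where "nonpositive_sectional_curvature m B g \<longleftrightarrow>
    (\<forall>\<kappa>\<in>B. \<forall>q\<in>fst \<kappa>. \<forall>X\<in>tangent_space m B q. \<forall>Y\<in>tangent_space m B q.
      (\<forall>a b. (\<lambda>k. a * X k + b * Y k) = (\<lambda>k. 0) \<longrightarrow> a = 0 \<and> b = 0) \<longrightarrow>
      sectional_curvature m B g \<kappa> q X Y \<le> 0)"

section \<open>Pluri-harmonic maps\<close>

text \<open>
  The \<open>i\<close>-th component \<open>f^i\<close> in charts \<open>\<kappa>\<close> and \<open>\<kappa>'\<close>, regarded as complex-valued so that the
  Wirtinger operators apply.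
\<close>

definition local_rep :: "('p, complex) chart \<Rightarrow> ('q, real) chart \<Rightarrow> ('p \<Rightarrow> 'q)
    \<Rightarrow> nat \<Rightarrow> (nat \<Rightarrow> complex) \<Rightarrow> complex"
  where "local_rep \<kappa> \<kappa>' f i x = complex_of_real (snd \<kappa>' (f (chart_inv \<kappa> x)) i)"

definition pluriharmonic :: "nat \<Rightarrow> ('p, complex) chart set \<Rightarrow> nat \<Rightarrow> ('q, real) chart set
    \<Rightarrow> ('q \<Rightarrow> ('q, real) tangent \<Rightarrow> ('q, real) tangent \<Rightarrow> real) \<Rightarrow> ('p \<Rightarrow> 'q) \<Rightarrow> bool"
  where "pluriharmonic n A m B g f \<longleftrightarrow>
    smooth_map n A m B f \<and>
    (\<forall>\<kappa>\<in>A. \<forall>\<kappa>'\<in>B. \<forall>p \<in> fst \<kappa> \<inter> f -` fst \<kappa>'. \<forall>i<m. \<forall>\<alpha><n. \<forall>\<beta><n.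
      dz \<alpha> (dzbar \<beta> (local_rep \<kappa> \<kappa>' f i)) (snd \<kappa> p)
      + (\<Sum>j<m. \<Sum>k<m. complex_of_real (christoffel m B g \<kappa>' i j k (snd \<kappa>' (f p)))
          * dzbar \<beta> (local_rep \<kappa> \<kappa>' f j) (snd \<kappa> p)
          * dz \<alpha> (local_rep \<kappa> \<kappa>' f k) (snd \<kappa> p)) = 0)"

section \<open>Holomorphic line bundles and RC-positivity\<close>

text \<open>
  The fibre \<open>L q\<close> is a complex line in a space of functions \<open>'i \<Rightarrow> complex\<close> (every complex vector
  space embeds in such a space). The holomorphic structure is given by local
  holomorphic frames \<open>(V, e)\<close>, that is nowhere vanishing sections over open sets with holomorphic
  transition functions.
\<close>

definition complex_line :: "('i \<Rightarrow> complex) \<Rightarrow> ('i \<Rightarrow> complex) set"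
  where "complex_line v = {(\<lambda>a. c * v a) | c. True}"

locale holomorphic_line_bundle = complex_manifold n A
  for n :: nat and A :: "('p, complex) chart set" +
  fixes L :: "'p \<Rightarrow> ('i \<Rightarrow> complex) set"
    and F :: "('p set \<times> ('p \<Rightarrow> 'i \<Rightarrow> complex)) set"
  assumes frames_cover: "points A \<subseteq> (\<Union>\<sigma>\<in>F. fst \<sigma>)"
    and frame_open: "\<sigma> \<in> F \<Longrightarrow> openin (mtop A) (fst \<sigma>)"
    and frame_fibre: "\<sigma> \<in> F \<Longrightarrow> q \<in> fst \<sigma> \<Longrightarrow>
      snd \<sigma> q \<noteq> (\<lambda>a. 0) \<and> L q = complex_line (snd \<sigma> q)"
    and frame_transition: "\<sigma> \<in> F \<Longrightarrow> \<sigma>' \<in> F \<Longrightarrow>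
      \<exists>t. (\<forall>q \<in> fst \<sigma> \<inter> fst \<sigma>'. snd \<sigma>' q = (\<lambda>a. t q * snd \<sigma> q a)) \<and>
        (\<forall>\<kappa>\<in>A. holomorphic_fun_on n (snd \<kappa> ` (fst \<kappa> \<inter> fst \<sigma> \<inter> fst \<sigma>'))
          (\<lambda>x. t (chart_inv \<kappa> x)))"
begin

definition smooth_hermitian_metric ::
    "('p \<Rightarrow> ('i \<Rightarrow> complex) \<Rightarrow> ('i \<Rightarrow> complex) \<Rightarrow> complex) \<Rightarrow> bool"
  where "smooth_hermitian_metric h \<longleftrightarrow>
    (\<forall>q\<in>points A. \<forall>v\<in>L q. \<forall>w\<in>L q.
      (\<forall>v'\<in>L q. h q (\<lambda>a. v a + v' a) w = h q v w + h q v' w) \<and>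
      (\<forall>c. h q (\<lambda>a. c * v a) w = c * h q v w) \<and>
      h q w v = cnj (h q v w)) \<and>
    (\<forall>q\<in>points A. \<forall>v\<in>L q. v \<noteq> (\<lambda>a. 0) \<longrightarrow> Re (h q v v) > 0) \<and>
    (\<forall>\<sigma>\<in>F. \<forall>\<kappa>\<in>A. smooth_on n (snd \<kappa> ` (fst \<kappa> \<inter> fst \<sigma>))
      (\<lambda>x. let q = chart_inv \<kappa> x in h q (snd \<sigma> q) (snd \<sigma> q)))"

text \<open>
  The coefficient matrix \<open>- \<partial>_a \<partial>_{\<bar>b} log h(e, e)\<close> of the Chern curvature form
  \<open>- \<surd>-1 \<partial>\<bar>\<partial> log h = \<surd>-1 \<Theta>_{ab} dz^a \<and> d\<bar>z^b\<close> at \<open>q\<close>, for a local holomorphic frame \<open>e\<close> and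
  in the coordinates \<open>\<kappa>\<close>.
\<close>

definition chern_curvature ::
    "('p \<Rightarrow> ('i \<Rightarrow> complex) \<Rightarrow> ('i \<Rightarrow> complex) \<Rightarrow> complex)
     \<Rightarrow> ('p \<Rightarrow> 'i \<Rightarrow> complex) \<Rightarrow> ('p, complex) chart \<Rightarrow> 'p \<Rightarrow> complex mat"
  where "chern_curvature h e \<kappa> q = Matrix.mat n n (\<lambda>(a, b).
    - dz a (dzbar b (\<lambda>x. let q' = chart_inv \<kappa> x in
        complex_of_real (ln (Re (h q' (e q') (e q')))))) (snd \<kappa> q))"

text \<open>
  The matrix is Hermitian, and it does not depend on the frame; a change of coordinates
  replaces it by a congruent one, so having a positive eigenvalue does not depend on
  the chart.
\<close>

definition RC_positive :: bool
  where "RC_positive \<longleftrightarrow>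
    (\<exists>h. smooth_hermitian_metric h \<and>
      (\<forall>\<kappa>\<in>A. \<forall>\<sigma>\<in>F. \<forall>q \<in> fst \<kappa> \<inter> fst \<sigma>. \<exists>r::real. r > 0 \<and>
        eigenvalue (chern_curvature h (snd \<sigma>) \<kappa> q) (complex_of_real r)))"

end

section \<open>The tautological line bundle on the projectivised tangent bundle\<close>

text \<open>
  A point of \<open>P(T_M)\<close> is a pair \<open>(p, l)\<close> of a point of \<open>M\<close> and a complex line \<open>l\<close> in \<open>T_pM\<close>.
\<close>

type_synonym 'p ptangent = "'p \<times> ('p, complex) tangent set"

definition proj_tangent :: "nat \<Rightarrow> ('p, complex) chart set \<Rightarrow> 'p ptangent set"
  where "proj_tangent n A = {(p, complex_line v) | p v.
    p \<in> points A \<and> v \<in> tangent_space n A p \<and> v \<noteq> (\<lambda>a. 0)}"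

text \<open>
  For a chart \<open>\<kappa>\<close> of \<open>M\<close> and \<open>i < n\<close>, the open set of lines on which the \<open>i\<close>-th component does
  not vanish identically, and the frame over it consisting of the vectors with \<open>i\<close>-th component \<open>1\<close>.
\<close>

definition proj_dom :: "nat \<Rightarrow> ('p, complex) chart set \<Rightarrow> ('p, complex) chart \<Rightarrow> nat
    \<Rightarrow> 'p ptangent set"
  where "proj_dom n A \<kappa> i =
    {(p, l) \<in> proj_tangent n A. p \<in> fst \<kappa> \<and> (\<exists>v\<in>l. v (\<kappa>, i) \<noteq> 0)}"

definition taut_frame :: "('p, complex) chart \<Rightarrow> nat \<Rightarrow> 'p ptangent \<Rightarrow> ('p, complex) tangent"
  where "taut_frame \<kappa> i q = (THE v. v \<in> snd q \<and> v (\<kappa>, i) = 1)"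

text \<open>
  The induced chart: the \<open>n\<close> coordinates of \<open>p\<close>, followed by the \<open>n - 1\<close> inhomogeneous
  coordinates \<open>v^k / v^i\<close> for \<open>k \<noteq> i\<close>, in increasing order of \<open>k\<close>.
\<close>

definition proj_chart :: "nat \<Rightarrow> ('p, complex) chart set \<Rightarrow> ('p, complex) chart \<Rightarrow> nat
    \<Rightarrow> ('p ptangent, complex) chart"
  where "proj_chart n A \<kappa> i = (proj_dom n A \<kappa> i, \<lambda>q j.
    if j < n then snd \<kappa> (fst q) j
    else if j < 2 * n - 1 then
      taut_frame \<kappa> i q (\<kappa>, if j - n < i then j - n else Suc (j - n))
    else 0)"

definition proj_atlas :: "nat \<Rightarrow> ('p, complex) chart set \<Rightarrow> ('p ptangent, complex) chart set"
  where "proj_atlas n A = {proj_chart n A \<kappa> i | \<kappa> i. \<kappa> \<in> A \<and> i < n}"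

definition taut_fibre :: "'p ptangent \<Rightarrow> ('p, complex) tangent set"
  where "taut_fibre q = snd q"

definition taut_frames :: "nat \<Rightarrow> ('p, complex) chart set
    \<Rightarrow> ('p ptangent set \<times> ('p ptangent \<Rightarrow> ('p, complex) tangent)) set"
  where "taut_frames n A = {(proj_dom n A \<kappa> i, taut_frame \<kappa> i) | \<kappa> i. \<kappa> \<in> A \<and> i < n}"

end

theory Submission
  imports Defs
begin

text \<open>
  The function \<open>|\<partial>f(W)|\<^sup>2 / |W|\<^sup>2\<close> on \<open>P(T_M)\<close>, with the numerator measured by \<open>g\<close> and the denominator by the
  metric of the tautological line bundle, attains its maximum. Suppose that the maximum is positive, and
  follow the logarithm of the quotient along a complex line in coordinates whose direction is a positive
  one for the curvature of the line bundle. Pluriharmonicity says that \<open>S = \<partial>f(W)\<close> satisfies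
  \<open>\<nabla>\<^sub>\<bar>\<zeta> S = 0\<close>, hence, with \<open>X = f\<^sub>*\<partial>/\<partial>\<zeta>\<close>,
  \<open>\<partial>\<^sub>\<zeta>\<partial>\<^sub>\<bar>\<zeta> |S|\<^sup>2 = |\<nabla>\<^sub>\<zeta> S|\<^sup>2 + R(\<bar>X, X, S, \<bar>S)\<close>. Differentiating the pluriharmonic equation once more
  gives \<open>R(X, S)\<bar>X = 0\<close>, and then the Bianchi identity writes the curvature term as minus a sum of
  sectional curvature terms of real planes. So \<open>log |S|\<^sup>2\<close> is subharmonic by the Cauchy--Schwarz inequality,
  while \<open>- log |W|\<^sup>2\<close> is strictly subharmonic at the maximum: a contradiction. Therefore \<open>\<partial>f = 0\<close>, and
  \<open>f\<close> is locally constant.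
\<close>

section \<open>Calculus on coordinate spaces\<close>

text \<open>RC-positivity supplies at each point of P(T_M) only one direction of positive curvature,
  which varies with the point without any regularity. This suffices because the maximum principle is
  used at a single point, on a single complex line through it: no trace over M is taken and no
  metric on M enters. The line lives in the coordinates of P(T_M), so base point and vector W both
  move holomorphically along it, and the \<zeta>-bar-derivative of S involves pluriharmonicity
  alone. The direction may even be tangent to a fibre; then X = 0. The identity R(X, S)X-bar = 0
  cannot be read off from the line, on which only X is a derivative of f, so the line is thickened
  to a holomorphic plane whose second direction is W. Smoothness is given through iterated partial
  derivatives in single coordinates, so total differentiability, the chain rule and the symmetry of
  second derivatives must be recovered from these. The hypothesis on the line bundle can be unfolded
  only once P(T_M) is known to be a complex manifold and its tautological bundle a holomorphic line
  bundle.\<close>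

definition coord_box :: "nat \<Rightarrow> (nat \<Rightarrow> 'a::{metric_space,zero}) \<Rightarrow> real \<Rightarrow> (nat \<Rightarrow> 'a) set"
  where "coord_box n x d = {y \<in> coord_space n. \<forall>i<n. dist (y i) (x i) < d}"

lemma coord_space_upd: "x \<in> coord_space n \<Longrightarrow> i < n \<Longrightarrow> x(i := t) \<in> coord_space n"
  by (auto simp: coord_space_def)

text \<open>A product neighbourhood restricts only finitely many coordinates, so the least of their
  radii works for all of them. Beyond index \<open>n\<close> both points vanish and nothing has to
  be checked.\<close>

lemma coord_box_subset_open:
  fixes U :: "(nat \<Rightarrow> 'a::{metric_space,zero}) set"
  assumes "openin (top_of_set (coord_space n)) U" "x \<in> U"
  obtains d where "d > 0" "coord_box n x d \<subseteq> U"
proof -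
  obtain W where W: "open W" "U = coord_space n \<inter> W"
    using assms(1) by (auto simp: openin_open)
  have "openin (product_topology (\<lambda>i. euclidean) UNIV) W"
    using W(1) by (simp add: open_fun_def)
  then obtain V where V: "x \<in> PiE UNIV V" "\<And>i. openin euclidean (V i)"
    "finite {i. V i \<noteq> topspace (euclidean :: 'a topology)}" "PiE UNIV V \<subseteq> W"
    using product_topology_open_contains_basis[of "\<lambda>i. euclidean" UNIV W x] W assms(2) by auto
  have "\<forall>i. \<exists>d>0. ball (x i) d \<subseteq> V i"
    using V(1,2) by (metis PiE_mem UNIV_I open_contains_ball open_openin)
  then obtain D where D: "\<And>i. D i > 0" "\<And>i. ball (x i) (D i) \<subseteq> V i" by metis
  let ?F = "{i. V i \<noteq> UNIV}"
  \<comment> \<open>The element 1 keeps the minimum meaningful when no coordinate is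
    restricted.\<close>
  define d where "d = Min (insert 1 (D ` ?F))"
  have fin: "finite ?F" using V(3) by simp
  have d0: "d > 0" unfolding d_def using fin D(1) by (subst Min_gr_iff) auto
  have "coord_box n x d \<subseteq> U"
  proof
    fix y assume y: "y \<in> coord_box n x d"
    have "y i \<in> V i" for i
    proof (cases "V i = UNIV")
      case False
      hence "d \<le> D i" unfolding d_def using fin by (intro Min_le) auto
      moreover have "dist (y i) (x i) < d"
      proof (cases "i < n")
        case True then show ?thesis using y by (auto simp: coord_box_def)
      next
        case False
        hence "y i = 0" "x i = 0" using y assms(2) W(2) by (auto simp: coord_box_def coord_space_def)
        thus ?thesis using d0 by simp
      qed
      ultimately have "y i \<in> ball (x i) (D i)" by (simp add: dist_commute)
      thus ?thesis using D(2) by blast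
    qed auto
    hence "y \<in> PiE UNIV V" by (auto simp: PiE_def extensional_def)
    thus "y \<in> U" using V(4) W(2) y by (auto simp: coord_box_def)
  qed
  thus ?thesis using d0 that by blast
qed

lemma openin_coord_box: "openin (top_of_set (coord_space n)) (coord_box n x d)"
proof -
  have "coord_box n x d = coord_space n \<inter> (\<Inter>i\<in>{..<n}. (\<lambda>y. y i) -` ball (x i) d)"
    by (auto simp: coord_box_def dist_commute)
  moreover have "open (\<Inter>i\<in>{..<n}. (\<lambda>y. y i) -` ball (x i) d)"
    by (intro open_INT open_vimage ballI) (auto intro: continuous_on_product_coordinates)
  ultimately show ?thesis by (auto simp: openin_open)
qed

lemma coord_box_mono: "d \<le> e \<Longrightarrow> coord_box n x d \<subseteq> coord_box n x e"
  by (auto simp: coord_box_def intro: less_le_trans)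

lemma center_in_coord_box: "x \<in> coord_space n \<Longrightarrow> d > 0 \<Longrightarrow> x \<in> coord_box n x d"
  by (auto simp: coord_box_def)

lemma continuous_on_coord_box:
  fixes u :: "(nat \<Rightarrow> 'a::{metric_space,zero}) \<Rightarrow> 'b::metric_space"
  assumes "openin (top_of_set (coord_space n)) U" "continuous_on U u" "x \<in> U" "e > 0"
  obtains d where "d > 0" "coord_box n x d \<subseteq> U" "\<And>y. y \<in> coord_box n x d \<Longrightarrow> dist (u y) (u x) < e"
proof -
  have "openin (top_of_set U) (U \<inter> u -` ball (u x) e)"
    using assms(2) continuous_openin_preimage_gen open_ball by blast
  hence "openin (top_of_set (coord_space n)) (U \<inter> u -` ball (u x) e)"
    using assms(1) openin_trans by blast
  moreover have "x \<in> U \<inter> u -` ball (u x) e" using assms by auto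
  ultimately obtain d where "d > 0" "coord_box n x d \<subseteq> U \<inter> u -` ball (u x) e"
    using coord_box_subset_open by blast
  thus ?thesis using that by (auto simp: dist_commute subset_eq)
qed

lemma eventually_slice_in:
  fixes U :: "(nat \<Rightarrow> 'a::real_normed_vector) set"
  assumes "openin (top_of_set (coord_space n)) U" "x \<in> U" "i < n"
  shows "\<forall>\<^sub>F t in nhds (0::real). x(i := x i + t *\<^sub>R e) \<in> U"
proof -
  obtain d where d: "d > 0" "coord_box n x d \<subseteq> U" using coord_box_subset_open assms(1,2) by blast
  have xc: "x \<in> coord_space n" using assms(1,2) openin_imp_subset by blast
  have "((\<lambda>t::real. t *\<^sub>R e) \<longlongrightarrow> 0 *\<^sub>R e) (nhds 0)" by (intro tendsto_intros filterlim_ident)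
  hence "\<forall>\<^sub>F t in nhds (0::real). dist (t *\<^sub>R e) 0 < d"
    using d(1) by (auto dest: tendstoD)
  thus ?thesis
  proof eventually_elim
    case (elim t)
    have "x(i := x i + t *\<^sub>R e) \<in> coord_box n x d"
      using elim xc assms(3) d(1) by (auto simp: coord_box_def coord_space_def dist_norm)
    thus ?case using d(2) by blast
  qed
qed

lemma pd_eqI: "((\<lambda>t::real. u (x(i := x i + t *\<^sub>R e))) has_vector_derivative D) (at 0) \<Longrightarrow> pd i e u x = D"
  unfolding pd_def by (rule vector_derivative_at)

lemma pd_cong:
  fixes u v :: "(nat \<Rightarrow> 'a::euclidean_space) \<Rightarrow> 'b::real_normed_vector"
  assumes "openin (top_of_set (coord_space n)) U" "x \<in> U" "i < n" "\<And>y. y \<in> U \<Longrightarrow> u y = v y"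
  shows "pd i e u x = pd i e v x"
  unfolding pd_def
proof (rule vector_derivative_cong_eq)
  have "\<forall>\<^sub>F t in nhds 0. u (x(i := x i + t *\<^sub>R e)) = v (x(i := x i + t *\<^sub>R e))"
    using eventually_slice_in[OF assms(1-3)] by eventually_elim (rule assms(4))
  thus "\<forall>\<^sub>F t in nhds 0. t \<in> UNIV \<longrightarrow>
      u (x(i := x i + t *\<^sub>R e)) = v (x(i := x i + t *\<^sub>R e))" by simp
qed auto

lemma slice_differentiable_cong:
  fixes u v :: "(nat \<Rightarrow> 'a::euclidean_space) \<Rightarrow> 'b::real_normed_vector"
  assumes "openin (top_of_set (coord_space n)) U" "x \<in> U" "i < n" "\<And>y. y \<in> U \<Longrightarrow> u y = v y"
    "(\<lambda>t::real. u (x(i := x i + t *\<^sub>R e))) differentiable (at 0)"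
  shows "(\<lambda>t::real. v (x(i := x i + t *\<^sub>R e))) differentiable (at 0)"
proof -
  obtain D where D: "((\<lambda>t::real. u (x(i := x i + t *\<^sub>R e))) has_derivative D) (at 0)"
    using assms(5) by (auto simp: differentiable_def)
  have "\<forall>\<^sub>F t in nhds 0. u (x(i := x i + t *\<^sub>R e)) = v (x(i := x i + t *\<^sub>R e))"
    using eventually_slice_in[OF assms(1-3)] by eventually_elim (rule assms(4))
  hence "((\<lambda>t::real. v (x(i := x i + t *\<^sub>R e))) has_derivative D) (at 0)"
    using assms(2,4) by (intro has_derivative_transform_eventually[OF D])
      (auto simp: eventually_nhds_conv_at)
  thus ?thesis by (auto simp: differentiable_def)
qed

text \<open>A partial derivative at a point of \<open>U\<close> reads the function on a short slice
  only, and the slice stays in the relatively open \<open>U\<close>. Hence agreement on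
  \<open>U\<close> passes to all iterated derivatives, whatever the functions do elsewhere.\<close>

lemma Ck_on_cong_imp:
  assumes "openin (top_of_set (coord_space n)) U" "\<And>y. y \<in> U \<Longrightarrow> u y = v y" "Ck_on k n U u"
  shows "Ck_on k n U v"
  using assms(2,3)
proof (induction k arbitrary: u v)
  case 0
  then show ?case by (simp cong: continuous_on_cong)
next
  case (Suc k)
  have "continuous_on U v" using Suc.prems by (simp cong: continuous_on_cong)
  moreover have "(\<lambda>t::real. v (x(i := x i + t *\<^sub>R e))) differentiable (at 0)"
    if "i < n" "e \<in> Basis" "x \<in> U" for i e x
    by (rule slice_differentiable_cong[OF assms(1) that(3,1) Suc.prems(1)]) (use Suc.prems(2) that in \<open>auto simp del: fun_upd_apply\<close>)
  moreover have "Ck_on k n U (pd i e v)" if "i < n" "e \<in> Basis" for i e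
    using Suc.IH[of "pd i e u" "pd i e v"] pd_cong[OF assms(1) _ that(1) Suc.prems(1)] Suc.prems(2) that by auto
  ultimately show ?case by auto
qed

lemma Ck_on_continuous: "Ck_on k n U u \<Longrightarrow> continuous_on U u"
  by (cases k) auto

lemma Ck_on_Suc_imp: "Ck_on (Suc k) n U u \<Longrightarrow> Ck_on k n U u"
  by (induction k arbitrary: u) auto

lemma Ck_on_pd: "Ck_on (Suc k) n U u \<Longrightarrow> i < n \<Longrightarrow> e \<in> Basis \<Longrightarrow> Ck_on k n U (pd i e u)"
  by simp

lemma Ck_on_slice:
  "Ck_on (Suc k) n U u \<Longrightarrow> i < n \<Longrightarrow> e \<in> Basis \<Longrightarrow> x \<in> U \<Longrightarrow>
    ((\<lambda>t::real. u (x(i := x i + t *\<^sub>R e))) has_vector_derivative pd i e u x) (at 0)"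
  by (auto simp: pd_def vector_derivative_works)

lemma Ck_on_subset:
  assumes "Ck_on k n U u" "V \<subseteq> U"
  shows "Ck_on k n V u"
  using assms by (induction k arbitrary: u) (auto intro: continuous_on_subset)

text \<open>Replaces the defined operator \<open>pd\<close> by any explicit family \<open>u'\<close>
  of derivatives; the closure properties below then follow by induction on the order, using the
  usual differentiation rules.\<close>

lemma Ck_on_SucI:
  assumes U: "openin (top_of_set (coord_space n)) U" and "continuous_on U u"
    and der: "\<And>i e x. i < n \<Longrightarrow> e \<in> Basis \<Longrightarrow> x \<in> U \<Longrightarrow>
      ((\<lambda>t::real. u (x(i := x i + t *\<^sub>R e))) has_vector_derivative u' i e x) (at 0)"
    and u': "\<And>i e. i < n \<Longrightarrow> e \<in> Basis \<Longrightarrow> Ck_on k n U (u' i e)"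
  shows "Ck_on (Suc k) n U u"
proof -
  have "Ck_on k n U (pd i e u)" if "i < n" "e \<in> Basis" for i e
    by (rule Ck_on_cong_imp[OF U _ u'[OF that]]) (use pd_eqI[OF der] that in auto)
  moreover have "(\<lambda>t::real. u (x(i := x i + t *\<^sub>R e))) differentiable (at 0)"
    if "i < n" "e \<in> Basis" "x \<in> U" for i e x
    by (rule differentiableI_vector[OF der[OF that]])
  ultimately show ?thesis using assms(2) by auto
qed

lemma Ck_on_const: "openin (top_of_set (coord_space n)) U \<Longrightarrow> Ck_on k n U (\<lambda>x. c)"
proof (induction k arbitrary: c)
  case (Suc k)
  show ?case by (rule Ck_on_SucI[where u'="\<lambda>i e x. 0"]) (use Suc in auto)
qed auto

lemma Ck_on_bounded_linear:
  assumes "bounded_linear f" "openin (top_of_set (coord_space n)) U" "Ck_on k n U u"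
  shows "Ck_on k n U (\<lambda>x. f (u x))"
  using assms(3)
proof (induction k arbitrary: u)
  case 0
  then show ?case by (auto intro: bounded_linear.continuous_on[OF assms(1)])
next
  case (Suc k)
  show ?case
  proof (rule Ck_on_SucI[OF assms(2), where u'="\<lambda>i e x. f (pd i e u x)"])
    show "continuous_on U (\<lambda>x. f (u x))"
      by (rule bounded_linear.continuous_on[OF assms(1)]) (use Suc.prems in simp)
    show "((\<lambda>t::real. f (u (x(i := x i + t *\<^sub>R e)))) has_vector_derivative f (pd i e u x)) (at 0)"
      if "i < n" "e \<in> Basis" "x \<in> U" for i e x
      by (rule bounded_linear.has_vector_derivative[OF assms(1) Ck_on_slice[OF Suc.prems that]])
    show "Ck_on k n U (\<lambda>x. f (pd i e u x))" if "i < n" "e \<in> Basis" for i e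
      by (rule Suc.IH) (use Suc.prems that in auto)
  qed
qed

lemma Ck_on_add:
  assumes "openin (top_of_set (coord_space n)) U" "Ck_on k n U u" "Ck_on k n U v"
  shows "Ck_on k n U (\<lambda>x. u x + v x)"
  using assms(2,3)
proof (induction k arbitrary: u v)
  case (Suc k)
  show ?case
    by (rule Ck_on_SucI[OF assms(1), where u'="\<lambda>i e x. pd i e u x + pd i e v x"])
      (use Suc Ck_on_slice[OF Suc.prems(1)] Ck_on_slice[OF Suc.prems(2)] in
        \<open>auto intro!: continuous_intros derivative_intros\<close>)
qed (auto intro: continuous_intros)

lemma Ck_on_sum:
  assumes "openin (top_of_set (coord_space n)) U" "\<And>j. j \<in> J \<Longrightarrow> Ck_on k n U (u j)"
  shows "Ck_on k n U (\<lambda>x. \<Sum>j\<in>J. u j x)"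
  using assms(2)
  by (induction J rule: infinite_finite_induct) (auto intro!: Ck_on_add Ck_on_const assms(1))

lemma Ck_on_mult:
  fixes u v :: "(nat \<Rightarrow> 'a::euclidean_space) \<Rightarrow> 'b::real_normed_algebra"
  assumes "openin (top_of_set (coord_space n)) U" "Ck_on k n U u" "Ck_on k n U v"
  shows "Ck_on k n U (\<lambda>x. u x * v x)"
  using assms(2,3)
proof (induction k arbitrary: u v)
  case (Suc k)
  have *: "Ck_on k n U u" "Ck_on k n U v" using Suc.prems Ck_on_Suc_imp by blast+
  show ?case
  proof (rule Ck_on_SucI[OF assms(1), where u'="\<lambda>i e x. u x * pd i e v x + pd i e u x * v x"])
    fix i :: nat and e :: 'a and x assume ie: "i < n" "e \<in> Basis" "x \<in> U"
    show "((\<lambda>t::real. u (x(i := x i + t *\<^sub>R e)) * v (x(i := x i + t *\<^sub>R e))) has_vector_derivative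
      u x * pd i e v x + pd i e u x * v x) (at 0)"
      using has_vector_derivative_mult[OF Ck_on_slice[OF Suc.prems(1) ie] Ck_on_slice[OF Suc.prems(2) ie]]
      by (simp add: fun_upd_def)
  qed (use Suc.prems * in \<open>auto intro!: continuous_intros Ck_on_add Suc.IH assms(1)\<close>)
qed (auto intro: continuous_intros)

lemma Ck_on_prod:
  fixes u :: "'j \<Rightarrow> (nat \<Rightarrow> 'a::euclidean_space) \<Rightarrow> 'b::{real_normed_algebra,comm_ring_1}"
  assumes "openin (top_of_set (coord_space n)) U" "\<And>j. j \<in> J \<Longrightarrow> Ck_on k n U (u j)"
  shows "Ck_on k n U (\<lambda>x. \<Prod>j\<in>J. u j x)"
  using assms(2)
  by (induction J rule: infinite_finite_induct) (auto intro!: Ck_on_mult Ck_on_const assms(1))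

text \<open>The derivative of the inverse contains the inverse again, but is needed to one order
  less, so the induction hypothesis for the inverse itself feeds the product rule.\<close>

lemma Ck_on_inverse:
  fixes u :: "(nat \<Rightarrow> 'a::euclidean_space) \<Rightarrow> 'b::real_normed_field"
  assumes "openin (top_of_set (coord_space n)) U" "Ck_on k n U u" "\<And>x. x \<in> U \<Longrightarrow> u x \<noteq> 0"
  shows "Ck_on k n U (\<lambda>x. inverse (u x))"
  using assms(2,3)
proof (induction k)
  case (Suc k)
  have *: "Ck_on k n U u" using Suc.prems(1) by (rule Ck_on_Suc_imp)
  have inv: "Ck_on k n U (\<lambda>x. inverse (u x))" by (rule Suc.IH[OF * Suc.prems(2)])
  show ?case
  proof (rule Ck_on_SucI[OF assms(1), where u'="\<lambda>i e x. - 1 * (inverse (u x) * pd i e u x * inverse (u x))"])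
    fix i :: nat and e :: 'a and x assume ie: "i < n" "e \<in> Basis" "x \<in> U"
    have "((\<lambda>t::real. inverse (u (x(i := x i + t *\<^sub>R e)))) has_derivative
      (\<lambda>h. - (inverse (u x) * (h *\<^sub>R pd i e u x) * inverse (u x)))) (at 0)"
      using Deriv.has_derivative_inverse[OF _ Ck_on_slice[OF Suc.prems(1) ie, unfolded has_vector_derivative_def]]
        Suc.prems(2) ie by simp
    thus "((\<lambda>t::real. inverse (u (x(i := x i + t *\<^sub>R e)))) has_vector_derivative
      - 1 * (inverse (u x) * pd i e u x * inverse (u x))) (at 0)"
      by (simp add: has_vector_derivative_def)
  next
    fix i :: nat and e :: 'a assume "i < n" "e \<in> Basis"
    hence "Ck_on k n U (pd i e u)" using Suc.prems by auto
    thus "Ck_on k n U (\<lambda>x. - 1 * (inverse (u x) * pd i e u x * inverse (u x)))"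
      by (intro Ck_on_mult Ck_on_const assms(1) inv)
  qed (use Suc.prems in \<open>auto intro!: continuous_intros\<close>)
qed (auto intro: continuous_intros)

lemma Ck_on_coord:
  assumes "openin (top_of_set (coord_space n)) U" "j < n"
  shows "Ck_on k n U (\<lambda>x. x j :: 'a::euclidean_space)"
proof (cases k)
  case 0
  then show ?thesis using continuous_on_subset[OF continuous_on_product_coordinates subset_UNIV] by simp
next
  case (Suc l)
  have "Ck_on (Suc l) n U (\<lambda>x. x j :: 'a::euclidean_space)"
  proof (rule Ck_on_SucI[OF assms(1), where u'="\<lambda>i e x. if i = j then e else 0"])
    show "continuous_on U (\<lambda>x. x j)"
      by (rule continuous_on_subset[OF continuous_on_product_coordinates subset_UNIV])
    show "((\<lambda>t::real. (x(i := x i + t *\<^sub>R e)) j) has_vector_derivative (if i = j then e else 0)) (at 0)"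
      for i x and e :: 'a
    proof (cases "i = j")
      case True
      have "((\<lambda>t::real. x j + t *\<^sub>R e) has_vector_derivative e) (at 0)"
        by (auto simp: has_vector_derivative_def intro!: derivative_eq_intros)
      then show ?thesis using True by simp
    qed simp
  qed (auto intro: Ck_on_const assms(1))
  thus ?thesis using Suc by simp
qed

section \<open>Total differentiability and the chain rule from continuous partial
  derivatives\<close>

text \<open>Pythagoras. A coordinate may have several real directions (two for complex coordinates)
  while a box measures its norm; shrinking the component in one direction therefore never leaves the
  box.\<close>

lemma norm_diff_partial_component_le:
  assumes "norm e = 1" "0 \<le> s" "s \<le> 1"
  shows "norm (v - (s * (v \<bullet> e)) *\<^sub>R e) \<le> norm v"
proof (rule power2_le_imp_le)
  have ee: "e \<bullet> e = 1" using assms(1) by (simp add: dot_square_norm)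
  have "(norm (v - (s * (v \<bullet> e)) *\<^sub>R e))\<^sup>2 = (norm v)\<^sup>2 - (2 - s) * s * (v \<bullet> e)\<^sup>2"
    unfolding power2_norm_eq_inner
    by (simp add: inner_diff_left inner_diff_right inner_commute ee algebra_simps power2_eq_square)
  also have "\<dots> \<le> (norm v)\<^sup>2" using assms by simp
  finally show "(norm (v - (s * (v \<bullet> e)) *\<^sub>R e))\<^sup>2 \<le> (norm v)\<^sup>2" .
qed simp

lemma Ck_on_slice_at:
  fixes u :: "(nat \<Rightarrow> 'a::euclidean_space) \<Rightarrow> 'b::real_normed_vector"
  assumes "Ck_on (Suc k) n U u" "i < n" "e \<in> Basis" "x(i := x i + s *\<^sub>R e) \<in> U"
  shows "((\<lambda>t::real. u (x(i := x i + t *\<^sub>R e))) has_vector_derivative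
    pd i e u (x(i := x i + s *\<^sub>R e))) (at s)"
proof -
  let ?g = "\<lambda>h::real. u ((x(i := x i + s *\<^sub>R e))(i := (x(i := x i + s *\<^sub>R e)) i + h *\<^sub>R e))"
  have "(?g has_vector_derivative pd i e u (x(i := x i + s *\<^sub>R e))) (at (s - s))"
    using Ck_on_slice[OF assms] by simp
  moreover have "((\<lambda>t. t - s) has_vector_derivative 1) (at s)"
    by (auto simp: has_vector_derivative_def intro!: derivative_eq_intros)
  ultimately have "(?g \<circ> (\<lambda>t. t - s) has_vector_derivative 1 *\<^sub>R pd i e u (x(i := x i + s *\<^sub>R e))) (at s)"
    using vector_diff_chain_at by blast
  moreover have "?g \<circ> (\<lambda>t. t - s) = (\<lambda>t::real. u (x(i := x i + t *\<^sub>R e)))"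
    by (auto simp: fun_eq_iff algebra_simps)
  ultimately show ?thesis by simp
qed

text \<open>\<open>x\<close> is changed into \<open>y\<close> in one real direction of one
  coordinate at a time. Along each such segment the mean value inequality applies, with the
  oscillation of one partial derivative on the box as the constant.\<close>

lemma C1_estimate:
  fixes u :: "(nat \<Rightarrow> 'a::euclidean_space) \<Rightarrow> 'b::real_normed_vector"
  assumes U: "openin (top_of_set (coord_space n)) U" and u: "Ck_on (Suc 0) n U u"
    and x: "x \<in> U" and eps: "\<epsilon> > 0"
  obtains d where "d > 0" "\<And>y. y \<in> coord_box n x d \<Longrightarrow>
    norm (u y - u x - (\<Sum>(i, e)\<in>{..<n} \<times> Basis. ((y i - x i) \<bullet> e) *\<^sub>R pd i e u x))
      \<le> \<epsilon> * (\<Sum>(i, e)\<in>{..<n} \<times> Basis. \<bar>(y i - x i) \<bullet> e\<bar>)"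
proof -
  let ?J = "{..<n} \<times> (Basis :: 'a set)"
  have finJ: "finite ?J" by simp
  have "\<forall>j\<in>?J. \<exists>d>0. coord_box n x d \<subseteq> U \<and>
      (\<forall>y\<in>coord_box n x d. norm (pd (fst j) (snd j) u y - pd (fst j) (snd j) u x) < \<epsilon>)"
  proof
    fix j assume "j \<in> ?J"
    hence "continuous_on U (pd (fst j) (snd j) u)" using u by auto
    from continuous_on_coord_box[OF U this x eps]
    show "\<exists>d>0. coord_box n x d \<subseteq> U \<and>
      (\<forall>y\<in>coord_box n x d. norm (pd (fst j) (snd j) u y - pd (fst j) (snd j) u x) < \<epsilon>)"
      by (metis dist_norm)
  qed
  from bchoice[OF this] obtain D where D0: "\<forall>j\<in>?J. D j > 0 \<and> coord_box n x (D j) \<subseteq> U \<and>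
      (\<forall>y\<in>coord_box n x (D j). norm (pd (fst j) (snd j) u y - pd (fst j) (snd j) u x) < \<epsilon>)" ..
  have D: "D j > 0" "coord_box n x (D j) \<subseteq> U"
    "\<And>y. y \<in> coord_box n x (D j) \<Longrightarrow> norm (pd (fst j) (snd j) u y - pd (fst j) (snd j) u x) < \<epsilon>"
    if "j \<in> ?J" for j
    using bspec[OF D0 that] by auto
  obtain d0 where d0: "d0 > 0" "coord_box n x d0 \<subseteq> U" using coord_box_subset_open[OF U x] .
  define d where "d = Min (insert d0 (D ` ?J))"
  have d: "d > 0" "d \<le> d0" "\<And>j. j \<in> ?J \<Longrightarrow> d \<le> D j"
    unfolding d_def using finJ D(1) d0(1) by (auto simp: Min_gr_iff)
  have box: "coord_box n x d \<subseteq> U" using d0(2) coord_box_mono[OF d(2)] by blast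
  have pdb: "norm (pd i e u y - pd i e u x) \<le> \<epsilon>" if "i < n" "e \<in> Basis" "y \<in> coord_box n x d" for i e y
    using D(3)[of "(i, e)" y] coord_box_mono[OF d(3)[of "(i, e)"]] that by fastforce
  \<comment> \<open>Induction on the set \<open>B\<close> of those real directions in which
    \<open>y\<close> may differ from \<open>x\<close>.\<close>
  have main: "norm (u y - u x - (\<Sum>(i, e)\<in>B. ((y i - x i) \<bullet> e) *\<^sub>R pd i e u x))
      \<le> \<epsilon> * (\<Sum>(i, e)\<in>B. \<bar>(y i - x i) \<bullet> e\<bar>)"
    if "B \<subseteq> ?J" "y \<in> coord_box n x d" "\<forall>(i, e)\<in>?J - B. (y i - x i) \<bullet> e = 0" for B y
    using finite_subset[OF that(1) finJ] that
  proof (induction B arbitrary: y rule: finite_induct)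
    case empty
    have "y i = x i" for i
    proof (cases "i < n")
      case True
      then have "\<forall>e\<in>Basis. (y i - x i) \<bullet> e = 0" using empty.prems(3) by auto
      then show ?thesis by (metis euclidean_all_zero_iff eq_iff_diff_eq_0)
    next
      case False
      then show ?thesis using empty.prems(2) x openin_imp_subset[OF U]
        by (auto simp: coord_box_def coord_space_def)
    qed
    hence "y = x" by auto
    thus ?case by simp
  next
    case (insert j B)
    obtain i e where j: "j = (i, e)" by (cases j)
    have ie: "i < n" "e \<in> Basis" using insert.prems(1) j by auto
    have ne: "norm e = 1" using ie(2) by (rule norm_Basis)
    define \<tau> where "\<tau> = (y i - x i) \<bullet> e"
    \<comment> \<open>\<open>y'\<close> is \<open>y\<close> with the component in the direction
      \<open>j\<close> reset to that of \<open>x\<close>, so the induction hypothesis for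
      \<open>B\<close> covers it and only the segment from \<open>y'\<close> to \<open>y\<close>
      remains.\<close>
    define y' where "y' = y(i := y i - \<tau> *\<^sub>R e)"
    have seg: "y'(i := y' i + s *\<^sub>R e) \<in> coord_box n x d" if s: "s \<in> closed_segment 0 \<tau>" for s
    proof -
      obtain c where c: "0 \<le> c" "c \<le> 1" "s = c * \<tau>" using s by (auto simp: in_segment)
      have eq: "(y'(i := y' i + s *\<^sub>R e)) i - x i = (y i - x i) - ((1 - c) * ((y i - x i) \<bullet> e)) *\<^sub>R e"
        by (simp add: y'_def \<tau>_def c(3) algebra_simps)
      have "norm ((y'(i := y' i + s *\<^sub>R e)) i - x i) \<le> norm (y i - x i)"
        unfolding eq by (rule norm_diff_partial_component_le) (use ne c in auto)
      also have "\<dots> < d" using insert.prems(2) ie by (auto simp: coord_box_def dist_norm)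
      finally show ?thesis
        using insert.prems(2) ie by (auto simp: coord_box_def dist_norm coord_space_def y'_def)
    qed
    have y'box: "y' \<in> coord_box n x d" using seg[of 0] by simp
    have comp: "(y' i' - x i') \<bullet> e' = (if (i', e') = j then 0 else (y i' - x i') \<bullet> e')"
      if "i' < n" "e' \<in> Basis" for i' e'
      using ie that by (auto simp: y'_def j \<tau>_def inner_diff_left inner_Basis)
    have IH: "norm (u y' - u x - (\<Sum>(i, e)\<in>B. ((y' i - x i) \<bullet> e) *\<^sub>R pd i e u x))
      \<le> \<epsilon> * (\<Sum>(i, e)\<in>B. \<bar>(y' i - x i) \<bullet> e\<bar>)"
    proof (rule insert.IH)
      show "\<forall>(i, e)\<in>?J - B. (y' i - x i) \<bullet> e = 0"
      proof clarsimp
        fix a b assume ab: "a < n" "b \<in> Basis" "(a, b) \<notin> B"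
        show "(y' a - x a) \<bullet> b = 0"
        proof (cases "(a, b) = j")
          case False
          hence "(a, b) \<in> ?J - insert j B" using ab by auto
          thus ?thesis using bspec[OF insert.prems(3)] comp[OF ab(1,2)] False by fastforce
        qed (use comp[OF ab(1,2)] in simp)
      qed
    qed (use insert.prems y'box in auto)
    have s1: "(\<Sum>(i, e)\<in>B. ((y' i - x i) \<bullet> e) *\<^sub>R pd i e u x) = (\<Sum>(i, e)\<in>B. ((y i - x i) \<bullet> e) *\<^sub>R pd i e u x)"
      by (rule sum.cong) (use insert.prems(1) insert.hyps(2) comp in auto)
    have s2: "(\<Sum>(i, e)\<in>B. \<bar>(y' i - x i) \<bullet> e\<bar>) = (\<Sum>(i, e)\<in>B. \<bar>(y i - x i) \<bullet> e\<bar>)"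
      by (rule sum.cong) (use insert.prems(1) insert.hyps(2) comp in auto)
    \<comment> \<open>Subtracting the expected linear growth leaves a function whose derivative is
      the difference of two values of one partial derivative, at most \<epsilon> on the box.\<close>
    let ?G = "\<lambda>s. u (y'(i := y' i + s *\<^sub>R e)) - s *\<^sub>R pd i e u x"
    have Gd: "(?G has_derivative (\<lambda>h. h *\<^sub>R (pd i e u (y'(i := y' i + s *\<^sub>R e)) - pd i e u x)))
        (at s within closed_segment 0 \<tau>)" if "s \<in> closed_segment 0 \<tau>" for s
    proof -
      have "((\<lambda>s. u (y'(i := y' i + s *\<^sub>R e))) has_derivative (\<lambda>h. h *\<^sub>R pd i e u (y'(i := y' i + s *\<^sub>R e)))) (at s)"
        using Ck_on_slice_at[OF u ie] seg[OF that] box by (auto simp: has_vector_derivative_def)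
      moreover have "((\<lambda>s. s *\<^sub>R pd i e u x) has_derivative (\<lambda>h. h *\<^sub>R pd i e u x)) (at s)"
        by (auto intro!: derivative_eq_intros)
      ultimately have "(?G has_derivative (\<lambda>h. h *\<^sub>R pd i e u (y'(i := y' i + s *\<^sub>R e)) - h *\<^sub>R pd i e u x)) (at s)"
        by (rule has_derivative_diff)
      thus ?thesis unfolding scaleR_diff_right by (rule has_derivative_at_withinI)
    qed
    have "norm (?G \<tau> - ?G 0) \<le> \<epsilon> * norm (\<tau> - 0)"
    proof (rule differentiable_bound[OF convex_closed_segment Gd])
      fix s assume "s \<in> closed_segment 0 \<tau>"
      hence "norm (pd i e u (y'(i := y' i + s *\<^sub>R e)) - pd i e u x) \<le> \<epsilon>"
        by (rule pdb[OF ie seg])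
      thus "onorm (\<lambda>h. h *\<^sub>R (pd i e u (y'(i := y' i + s *\<^sub>R e)) - pd i e u x)) \<le> \<epsilon>"
        by (intro onorm_le) (simp, subst mult.commute, intro mult_right_mono, auto)
    qed auto
    hence step: "norm (u y - u y' - \<tau> *\<^sub>R pd i e u x) \<le> \<epsilon> * \<bar>\<tau>\<bar>"
      by (simp add: y'_def algebra_simps)
    have "norm (u y - u x - (\<Sum>(i, e)\<in>insert j B. ((y i - x i) \<bullet> e) *\<^sub>R pd i e u x))
      = norm ((u y - u y' - \<tau> *\<^sub>R pd i e u x) + (u y' - u x - (\<Sum>(i, e)\<in>B. ((y i - x i) \<bullet> e) *\<^sub>R pd i e u x)))"
      using insert.hyps by (simp add: j \<tau>_def algebra_simps)
    also have "\<dots> \<le> \<epsilon> * \<bar>\<tau>\<bar> + \<epsilon> * (\<Sum>(i, e)\<in>B. \<bar>(y i - x i) \<bullet> e\<bar>)"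
      using step IH s1 s2 by (intro norm_triangle_mono) auto
    also have "\<dots> = \<epsilon> * (\<Sum>(i, e)\<in>insert j B. \<bar>(y i - x i) \<bullet> e\<bar>)"
      using insert.hyps by (simp add: j \<tau>_def algebra_simps)
    finally show ?case .
  qed
  show ?thesis by (rule that[OF d(1)]) (rule main, auto)
qed

lemma has_derivative_locally_bounded:
  fixes f :: "'e::real_normed_vector \<Rightarrow> 'a::real_normed_vector"
  assumes "(f has_derivative f') (at x)"
  obtains K where "K > 0" "\<forall>\<^sub>F y in nhds x. norm (f y - f x) \<le> K * norm (y - x)"
proof -
  have bl: "bounded_linear f'" using assms by (rule has_derivative_bounded_linear)
  have "\<exists>d>0. \<forall>y. norm (y - x) < d \<longrightarrow> norm (f y - f x - f' (y - x)) \<le> norm (y - x)"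
    using conjunct2[OF assms[unfolded has_derivative_at_alt]] by (elim allE[of _ 1]) simp
  then obtain d where d: "d > 0" "\<And>y. norm (y - x) < d \<Longrightarrow> norm (f y - f x - f' (y - x)) \<le> norm (y - x)"
    by blast
  have "norm (f y - f x) \<le> (onorm f' + 1) * norm (y - x)" if "dist y x < d" for y
  proof -
    have "norm (f y - f x) \<le> norm (f y - f x - f' (y - x)) + norm (f' (y - x))"
      by (metis diff_add_cancel norm_triangle_ineq)
    also have "\<dots> \<le> norm (y - x) + onorm f' * norm (y - x)"
      using d(2)[of y] that onorm[OF bl, of "y - x"] by (intro add_mono) (auto simp: dist_norm)
    finally show ?thesis by (simp add: algebra_simps)
  qed
  hence "\<forall>\<^sub>F y in nhds x. norm (f y - f x) \<le> (onorm f' + 1) * norm (y - x)"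
    using d(1) unfolding eventually_nhds_metric by blast
  moreover have "onorm f' + 1 > 0" using onorm_pos_le[OF bl] by simp
  ultimately show ?thesis using that by blast
qed

text \<open>The outer function is differentiated by single coordinates only, so the inner map is
  required to be differentiable coordinatewise. The linear part of \<open>C1_estimate\<close> is
  composed directly; the remainder is of higher order because every coordinate of \<open>c\<close>
  is Lipschitz at \<open>y0\<close>.\<close>

lemma C1_chain:
  fixes u :: "(nat \<Rightarrow> 'a::euclidean_space) \<Rightarrow> 'b::real_normed_vector"
    and c :: "'e::real_normed_vector \<Rightarrow> nat \<Rightarrow> 'a"
  assumes U: "openin (top_of_set (coord_space n)) U" and u: "Ck_on (Suc 0) n U u"
    and y0: "c y0 \<in> U" and cc: "\<forall>\<^sub>F y in nhds y0. c y \<in> coord_space n"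
    and c': "\<And>i. i < n \<Longrightarrow> ((\<lambda>y. c y i) has_derivative c' i) (at y0)"
  shows "((\<lambda>y. u (c y)) has_derivative (\<lambda>h. \<Sum>i<n. \<Sum>e\<in>Basis. (c' i h \<bullet> e) *\<^sub>R pd i e u (c y0))) (at y0)"
proof -
  let ?J = "{..<n} \<times> (Basis :: 'a set)"
  let ?x = "c y0"
  define L where "L z = (\<Sum>i<n. \<Sum>e\<in>Basis. (z i \<bullet> e) *\<^sub>R pd i e u ?x)" for z
  have Lsum: "(\<Sum>(i, e)\<in>?J. ((y i - ?x i) \<bullet> e) *\<^sub>R pd i e u ?x) = L (\<lambda>i. y i - ?x i)" for y
    by (simp add: L_def sum.cartesian_product)
  have lin: "((\<lambda>y. L (\<lambda>i. c y i - ?x i)) has_derivative (\<lambda>h. L (\<lambda>i. c' i h))) (at y0)"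
    unfolding L_def
  proof (intro has_derivative_sum)
    fix i e assume "i \<in> {..<n}" "e \<in> (Basis :: 'a set)"
    then show "((\<lambda>y. ((c y i - ?x i) \<bullet> e) *\<^sub>R pd i e u ?x) has_derivative
        (\<lambda>h. (c' i h \<bullet> e) *\<^sub>R pd i e u ?x)) (at y0)"
      using c'[of i] by (auto intro!: derivative_eq_intros)
  qed
  have "\<forall>i\<in>{..<n}. \<exists>K>0. \<forall>\<^sub>F y in nhds y0. norm (c y i - ?x i) \<le> K * norm (y - y0)"
    using has_derivative_locally_bounded[OF c'] by (metis lessThan_iff)
  from bchoice[OF this] obtain K where K: "\<And>i. i < n \<Longrightarrow> K i > 0"
    "\<And>i. i < n \<Longrightarrow> \<forall>\<^sub>F y in nhds y0. norm (c y i - ?x i) \<le> K i * norm (y - y0)"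
    by blast
  \<comment> \<open>The sum of the Lipschitz constants over all real directions; the added 1 makes
    it positive also when there are none, so that dividing \<epsilon> by it is legitimate.\<close>
  define M where "M = 1 + (\<Sum>(i, e)\<in>?J. K i)"
  have M: "M > 0" unfolding M_def using K(1) by (intro add_pos_nonneg sum_nonneg) (auto simp: less_imp_le)
  have rem: "((\<lambda>y. u (c y) - u ?x - L (\<lambda>i. c y i - ?x i)) has_derivative (\<lambda>h. 0)) (at y0)"
    unfolding has_derivative_at_alt
  proof (intro conjI allI impI)
    fix \<epsilon> :: real assume eps: "\<epsilon> > 0"
    obtain d where d: "d > 0" "\<And>y. y \<in> coord_box n ?x d \<Longrightarrow>
      norm (u y - u ?x - (\<Sum>(i, e)\<in>?J. ((y i - ?x i) \<bullet> e) *\<^sub>R pd i e u ?x))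
      \<le> \<epsilon> / M * (\<Sum>(i, e)\<in>?J. \<bar>(y i - ?x i) \<bullet> e\<bar>)"
      using C1_estimate[OF U u y0, of "\<epsilon> / M"] eps M by auto
    have "\<forall>\<^sub>F y in nhds y0. \<forall>i\<in>{..<n}. norm (c y i - ?x i) \<le> K i * norm (y - y0)"
      using K(2) by (intro eventually_ball_finite) auto
    moreover have "\<forall>\<^sub>F y in nhds y0. \<forall>i\<in>{..<n}. dist (c y i) (?x i) < d"
    proof (intro eventually_ball_finite ballI)
      fix i assume "i \<in> {..<n}"
      hence "isCont (\<lambda>y. c y i) y0" using c' has_derivative_continuous by blast
      hence "((\<lambda>y. c y i) \<longlongrightarrow> c y0 i) (nhds y0)"
        by (simp add: isCont_def tendsto_at_iff_tendsto_nhds[of "\<lambda>y. c y i"])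
      thus "\<forall>\<^sub>F y in nhds y0. dist (c y i) (?x i) < d"
        using d(1) tendstoD by blast
    qed auto
    ultimately have "\<forall>\<^sub>F y in nhds y0. norm (u (c y) - u ?x - L (\<lambda>i. c y i - ?x i) -
        (u ?x - u ?x - L (\<lambda>i. ?x i - ?x i)) - 0) \<le> \<epsilon> * norm (y - y0)"
      using cc
    proof eventually_elim
      case (elim y)
      have cb: "c y \<in> coord_box n ?x d" using elim by (auto simp: coord_box_def)
      have "norm (u (c y) - u ?x - L (\<lambda>i. c y i - ?x i)) \<le> \<epsilon> / M * (\<Sum>(i, e)\<in>?J. \<bar>(c y i - ?x i) \<bullet> e\<bar>)"
        using d(2)[OF cb] unfolding Lsum .
      also have "\<dots> \<le> \<epsilon> / M * (\<Sum>(i, e)\<in>?J. K i * norm (y - y0))"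
      proof (intro mult_left_mono sum_mono)
        fix j assume "j \<in> ?J"
        then obtain i e where j: "j = (i, e)" "i < n" "e \<in> Basis" by auto
        have "\<bar>(c y i - ?x i) \<bullet> e\<bar> \<le> norm (c y i - ?x i)" using j(3) by (rule Basis_le_norm)
        also have "\<dots> \<le> K i * norm (y - y0)" using elim(1) j(2) by auto
        finally show "(case j of (i, e) \<Rightarrow> \<bar>(c y i - ?x i) \<bullet> e\<bar>) \<le> (case j of (i, e) \<Rightarrow> K i * norm (y - y0))"
          by (simp add: j(1))
      qed (use eps M in auto)
      also have "\<dots> = \<epsilon> / M * ((M - 1) * norm (y - y0))"
        by (simp add: M_def sum_distrib_right case_prod_unfold)
      also have "\<dots> \<le> \<epsilon> / M * (M * norm (y - y0))"
        using eps M by (intro mult_left_mono mult_right_mono) auto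
      also have "\<dots> = \<epsilon> * norm (y - y0)" using M by simp
      finally show ?case by (simp add: L_def)
    qed
    thus "\<exists>d>0. \<forall>y. norm (y - y0) < d \<longrightarrow> norm (u (c y) - u ?x - L (\<lambda>i. c y i - ?x i) -
        (u ?x - u ?x - L (\<lambda>i. ?x i - ?x i)) - 0) \<le> \<epsilon> * norm (y - y0)"
      unfolding eventually_nhds_metric by (simp add: dist_norm)
  qed simp
  have "((\<lambda>y. (u (c y) - u ?x - L (\<lambda>i. c y i - ?x i)) + L (\<lambda>i. c y i - ?x i) + u ?x) has_derivative
      (\<lambda>h. 0 + L (\<lambda>i. c' i h) + 0)) (at y0)"
    by (intro has_derivative_add rem lin has_derivative_const)
  thus ?thesis by (simp add: L_def)
qed

section \<open>Complexified directional derivatives\<close>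

text \<open>A pair \<open>(v, w)\<close> of vectors stands for the complexified direction \<open>v + i w\<close>.\<close>

definition cder :: "'e \<times> 'e \<Rightarrow> ('e::real_normed_vector \<Rightarrow> complex) \<Rightarrow> 'e \<Rightarrow> complex"
  where "cder d u y = frechet_derivative u (at y) (fst d) + \<i> * frechet_derivative u (at y) (snd d)"

text \<open>Second differentiability direction by direction: no derivative with values in a space of
  operators is formed. This is exactly what iterated \<open>cder\<close> and the symmetry of second
  derivatives require.\<close>

definition twice_diff :: "'e set \<Rightarrow> ('e::real_normed_vector \<Rightarrow> 'b::real_normed_vector) \<Rightarrow> bool"
  where "twice_diff N u \<longleftrightarrow> (\<forall>y\<in>N. u differentiable (at y)) \<and>
    (\<forall>v. \<forall>y\<in>N. (\<lambda>z. frechet_derivative u (at z) v) differentiable (at y))"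

lemma differentiable_frechet:
  "u differentiable (at y) \<Longrightarrow> (u has_derivative frechet_derivative u (at y)) (at y)"
  by (simp add: frechet_derivative_works)

lemma frechet_eqI: "(u has_derivative L) (at y) \<Longrightarrow> frechet_derivative u (at y) = L"
  by (metis frechet_derivative_at)

lemma cder_eqI: "(u has_derivative L) (at y) \<Longrightarrow> cder d u y = L (fst d) + \<i> * L (snd d)"
  by (simp add: cder_def frechet_eqI)

lemma cder_cong:
  assumes "open N" "y \<in> N" "\<And>z. z \<in> N \<Longrightarrow> u z = v z" "u differentiable (at y)"
  shows "cder d u y = cder d v y"
  unfolding cder_def by (metis frechet_derivative_transform_within_open[OF assms(4,1,2)] assms(3))

lemma differentiable_cong_open:
  assumes "open N" "y \<in> N" "\<And>z. z \<in> N \<Longrightarrow> u z = v z" "u differentiable (at y)"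
  shows "v differentiable (at y)"
proof -
  obtain D where D: "(u has_derivative D) (at y)" using assms(4) by (auto simp: differentiable_def)
  show ?thesis using has_derivative_transform_within_open[OF D assms(1-3)]
    by (auto simp: differentiable_def)
qed

lemma cder_const [simp]: "cder d (\<lambda>z. c) y = 0"
  using cder_eqI[OF has_derivative_const, of d c y] by simp

lemma cder_add:
  assumes "u differentiable (at y)" "v differentiable (at y)"
  shows "cder d (\<lambda>z. u z + v z) y = cder d u y + cder d v y"
  using cder_eqI[OF has_derivative_add[OF assms[THEN differentiable_frechet]], of d]
  by (simp add: cder_def algebra_simps)

lemma cder_diff:
  assumes "u differentiable (at y)" "v differentiable (at y)"
  shows "cder d (\<lambda>z. u z - v z) y = cder d u y - cder d v y"
  using cder_eqI[OF has_derivative_diff[OF assms[THEN differentiable_frechet]], of d]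
  by (simp add: cder_def algebra_simps)

lemma cder_mult:
  assumes "u differentiable (at y)" "v differentiable (at y)"
  shows "cder d (\<lambda>z. u z * v z) y = cder d u y * v y + u y * cder d v y"
  using cder_eqI[OF has_derivative_mult[OF assms[THEN differentiable_frechet]], of d]
  by (simp add: cder_def algebra_simps)

lemma cder_cmult:
  assumes "u differentiable (at y)"
  shows "cder d (\<lambda>z. c * u z) y = c * cder d u y"
  using cder_mult[OF differentiable_const assms, of d c] by simp

lemma cder_sum:
  assumes "\<And>i. i \<in> I \<Longrightarrow> u i differentiable (at y)"
  shows "cder d (\<lambda>z. \<Sum>i\<in>I. u i z) y = (\<Sum>i\<in>I. cder d (u i) y)"
proof (cases "finite I")
  case True
  have "((\<lambda>z. \<Sum>i\<in>I. u i z) has_derivative (\<lambda>h. \<Sum>i\<in>I. frechet_derivative (u i) (at y) h)) (at y)"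
    by (rule has_derivative_sum) (use assms in \<open>auto intro: differentiable_frechet\<close>)
  from cder_eqI[OF this, of d] show ?thesis by (simp add: cder_def sum.distrib sum_distrib_left)
qed simp

lemma differentiable_cnj:
  "u differentiable (at y) \<Longrightarrow> (\<lambda>z. cnj (u z)) differentiable (at y)"
  by (auto simp: differentiable_def intro: bounded_linear.has_derivative[OF bounded_linear_cnj])

text \<open>The differential is real linear, so conjugating the value turns the direction v + i w
  into v - i w. This exchanges \<partial>/\<partial>\<zeta> and its conjugate.\<close>

lemma cder_cnj:
  assumes "u differentiable (at y)"
  shows "cder d (\<lambda>z. cnj (u z)) y = cnj (cder (fst d, - snd d) u y)"
proof -
  interpret F: bounded_linear "frechet_derivative u (at y)"
    using assms by (auto intro: has_derivative_bounded_linear differentiable_frechet)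
  show ?thesis
    using cder_eqI[OF bounded_linear.has_derivative[OF bounded_linear_cnj differentiable_frechet[OF assms]], of d]
    by (simp add: cder_def F.neg)
qed

lemma twice_diffI:
  assumes "open N" and L: "\<And>y. y \<in> N \<Longrightarrow> (u has_derivative L y) (at y)"
    and d: "\<And>v y. y \<in> N \<Longrightarrow> (\<lambda>z. L z v) differentiable (at y)"
  shows "twice_diff N u"
  unfolding twice_diff_def
proof (intro conjI ballI allI)
  fix y assume y: "y \<in> N"
  show "u differentiable (at y)" using L[OF y] by (rule differentiableI)
  show "(\<lambda>z. frechet_derivative u (at z) v) differentiable (at y)" for v
    by (rule differentiable_cong_open[OF assms(1) y _ d[OF y]]) (simp add: frechet_eqI[OF L])
qed

lemma twice_diff_differentiable: "twice_diff N u \<Longrightarrow> y \<in> N \<Longrightarrow> u differentiable (at y)"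
  by (auto simp: twice_diff_def)

lemma twice_diff_frechet:
  "twice_diff N u \<Longrightarrow> y \<in> N \<Longrightarrow> (u has_derivative frechet_derivative u (at y)) (at y)"
  by (auto simp: twice_diff_def intro: differentiable_frechet)

lemma twice_diff_frechet_differentiable:
  "twice_diff N u \<Longrightarrow> y \<in> N \<Longrightarrow> (\<lambda>z. frechet_derivative u (at z) v) differentiable (at y)"
  by (auto simp: twice_diff_def)

lemma twice_diff_subset: "twice_diff N u \<Longrightarrow> N' \<subseteq> N \<Longrightarrow> twice_diff N' u"
  by (auto simp: twice_diff_def)

lemma cder_differentiable:
  assumes "twice_diff N u" "y \<in> N"
  shows "(\<lambda>z. cder d u z) differentiable (at y)"
  unfolding cder_def using twice_diff_frechet_differentiable[OF assms] by simp

lemma twice_diff_const: "open N \<Longrightarrow> twice_diff N (\<lambda>z. c)"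
  by (rule twice_diffI[where L="\<lambda>y h. 0"]) auto

lemma twice_diff_bounded_linear:
  assumes "bounded_linear f" "open N" "twice_diff N u"
  shows "twice_diff N (\<lambda>z. f (u z))"
proof (rule twice_diffI[OF assms(2)])
  show "((\<lambda>z. f (u z)) has_derivative (\<lambda>h. f (frechet_derivative u (at y) h))) (at y)" if "y \<in> N" for y
    by (rule bounded_linear.has_derivative[OF assms(1) twice_diff_frechet[OF assms(3) that]])
  show "(\<lambda>z. f (frechet_derivative u (at z) v)) differentiable (at y)" if "y \<in> N" for y v
  proof -
    have "((\<lambda>z. frechet_derivative u (at z) v) has_derivative
        frechet_derivative (\<lambda>z. frechet_derivative u (at z) v) (at y)) (at y)"
      by (rule differentiable_frechet[OF twice_diff_frechet_differentiable[OF assms(3) that]])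
    from bounded_linear.has_derivative[OF assms(1) this] show ?thesis by (rule differentiableI)
  qed
qed

lemma twice_diff_linear_map: "bounded_linear f \<Longrightarrow> open N \<Longrightarrow> twice_diff N f"
  by (rule twice_diffI[where L="\<lambda>y. f"]) (auto intro: bounded_linear_imp_has_derivative)

lemma twice_diff_add:
  assumes "open N" "twice_diff N u" "twice_diff N v"
  shows "twice_diff N (\<lambda>z. u z + v z)"
  by (rule twice_diffI[OF assms(1) has_derivative_add[OF twice_diff_frechet[OF assms(2)] twice_diff_frechet[OF assms(3)]]])
    (auto intro!: differentiable_add twice_diff_frechet_differentiable[OF assms(2)] twice_diff_frechet_differentiable[OF assms(3)])

lemma twice_diff_mult:
  fixes u v :: "'e::real_normed_vector \<Rightarrow> 'b::real_normed_algebra"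
  assumes "open N" "twice_diff N u" "twice_diff N v"
  shows "twice_diff N (\<lambda>z. u z * v z)"
proof (rule twice_diffI[OF assms(1) has_derivative_mult[OF twice_diff_frechet[OF assms(2)] twice_diff_frechet[OF assms(3)]]])
  fix w :: 'e and y assume y: "y \<in> N"
  show "(\<lambda>z. u z * frechet_derivative v (at z) w + frechet_derivative u (at z) w * v z) differentiable (at y)"
    by (intro differentiable_add differentiable_mult twice_diff_frechet_differentiable[OF assms(2) y]
      twice_diff_frechet_differentiable[OF assms(3) y] twice_diff_differentiable[OF assms(2) y]
      twice_diff_differentiable[OF assms(3) y])
qed

lemma twice_diff_sum:
  assumes "open N" "\<And>i. i \<in> I \<Longrightarrow> twice_diff N (u i)"
  shows "twice_diff N (\<lambda>z. \<Sum>i\<in>I. u i z)"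
  using assms(2)
  by (induction I rule: infinite_finite_induct) (auto intro!: twice_diff_add twice_diff_const assms(1))

text \<open>By the chain rule a directional derivative of the composite is a sum of products of
  derivatives of the coordinates of \<open>c\<close> with composites of partial derivatives of
  \<open>u\<close>; to the latter the chain rule applies once more.\<close>

lemma twice_diff_compose:
  fixes u :: "(nat \<Rightarrow> 'a::euclidean_space) \<Rightarrow> 'b::real_normed_vector"
    and c :: "'e::real_normed_vector \<Rightarrow> nat \<Rightarrow> 'a"
  assumes U: "openin (top_of_set (coord_space n)) U" and u: "Ck_on (Suc (Suc 0)) n U u"
    and N: "open N" and c: "\<And>y. y \<in> N \<Longrightarrow> c y \<in> U"
    and td: "\<And>i. i < n \<Longrightarrow> twice_diff N (\<lambda>y. c y i)"
  shows "twice_diff N (\<lambda>y. u (c y))"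
proof -
  have cc: "\<forall>\<^sub>F y in nhds y0. c y \<in> coord_space n" if y0: "y0 \<in> N" for y0
    using openin_imp_subset[OF U] c by (intro eventually_nhds_in_open[OF N y0, THEN eventually_mono]) auto
  have u1: "Ck_on (Suc 0) n U u" using u by (rule Ck_on_Suc_imp)
  show ?thesis
  proof (rule twice_diffI[OF N])
    fix y assume y: "y \<in> N"
    show "((\<lambda>y. u (c y)) has_derivative
        (\<lambda>h. \<Sum>i<n. \<Sum>e\<in>Basis. (frechet_derivative (\<lambda>y. c y i) (at y) h \<bullet> e) *\<^sub>R pd i e u (c y))) (at y)"
      by (rule C1_chain[OF U u1 c[OF y] cc[OF y] twice_diff_frechet[OF td y]])
    fix v
    show "(\<lambda>z. \<Sum>i<n. \<Sum>e\<in>Basis. (frechet_derivative (\<lambda>y. c y i) (at z) v \<bullet> e) *\<^sub>R pd i e u (c z))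
        differentiable (at y)"
    proof (intro differentiable_sum ballI finite_lessThan finite_Basis)
      fix i and e :: 'a assume i: "i \<in> {..<n}" and e: "e \<in> Basis"
      have "Ck_on (Suc 0) n U (pd i e u)" using Ck_on_pd[OF u _ e] i by simp
      from C1_chain[OF U this c[OF y] cc[OF y] twice_diff_frechet[OF td y]]
      have "(\<lambda>z. pd i e u (c z)) differentiable (at y)" by (auto intro: differentiableI)
      moreover have "(\<lambda>z. frechet_derivative (\<lambda>y. c y i) (at z) v \<bullet> e) differentiable (at y)"
        using twice_diff_frechet_differentiable[OF td y] i
        by (intro differentiable_inner differentiable_const) auto
      ultimately show "(\<lambda>z. (frechet_derivative (\<lambda>y. c y i) (at z) v \<bullet> e) *\<^sub>R pd i e u (c z)) differentiable (at y)"
        by (rule differentiable_scaleR[rotated])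
    qed
  qed
qed

section \<open>Symmetry of second derivatives\<close>

text \<open>The second difference over a small parallelogram is compared with the iterated
  derivative by the mean value inequality along \<open>v\<close>; only the differentiability at
  \<open>y\<close> of the derivative in direction \<open>v\<close> enters.\<close>

lemma second_difference_estimate:
  fixes u :: "'e::real_normed_vector \<Rightarrow> 'b::real_normed_vector"
  assumes N: "open N" "y \<in> N" and u: "\<And>z. z \<in> N \<Longrightarrow> (u has_derivative u' z) (at z)"
    and A: "((\<lambda>z. u' z v) has_derivative A) (at y)" and eps: "\<epsilon> > 0"
  obtains d where "d > 0" "\<And>t::real. 0 < t \<Longrightarrow> t < d \<Longrightarrow>
    norm (u (y + t *\<^sub>R v + t *\<^sub>R w) - u (y + t *\<^sub>R v) - (u (y + t *\<^sub>R w) - u y) - t\<^sup>2 *\<^sub>R A w) \<le> \<epsilon> * t\<^sup>2"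
proof -
  interpret A: bounded_linear A using A by (rule has_derivative_bounded_linear)
  define K where "K = norm v + norm w + 1"
  have K: "K > 0" by (simp add: K_def add_nonneg_pos)
  obtain r where r: "r > 0" "ball y r \<subseteq> N" using N open_contains_ball by blast
  have "\<epsilon> / (2 * K) > 0" using eps K by simp
  then obtain d1 where d1: "d1 > 0" "\<And>z. norm (z - y) < d1 \<Longrightarrow>
      norm (u' z v - u' y v - A (z - y)) \<le> \<epsilon> / (2 * K) * norm (z - y)"
    using conjunct2[OF A[unfolded has_derivative_at_alt]] by blast
  define d where "d = min r d1 / K"
  have d: "d > 0" using r d1 K by (simp add: d_def)
  have "norm (u (y + t *\<^sub>R v + t *\<^sub>R w) - u (y + t *\<^sub>R v) - (u (y + t *\<^sub>R w) - u y) - t\<^sup>2 *\<^sub>R A w) \<le> \<epsilon> * t\<^sup>2"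
    if t: "0 < t" "t < d" for t :: real
  proof -
    have tK: "t * K < min r d1" using t K by (simp add: d_def field_simps)
    have nb: "norm (s *\<^sub>R v + s' *\<^sub>R w) \<le> t * K" if "\<bar>s\<bar> \<le> t" "\<bar>s'\<bar> \<le> t" for s s'
    proof -
      have "norm (s *\<^sub>R v + s' *\<^sub>R w) \<le> \<bar>s\<bar> * norm v + \<bar>s'\<bar> * norm w"
        by (rule order_trans[OF norm_triangle_ineq]) simp
      also have "\<dots> \<le> t * norm v + t * norm w" using that by (intro add_mono mult_right_mono) auto
      also have "\<dots> \<le> t * K" using t by (simp add: K_def algebra_simps)
      finally show ?thesis .
    qed
    have inN: "y + (s *\<^sub>R v + s' *\<^sub>R w) \<in> N" if "\<bar>s\<bar> \<le> t" "\<bar>s'\<bar> \<le> t" for s s'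
    proof -
      have "y + (s *\<^sub>R v + s' *\<^sub>R w) \<in> ball y r"
        using nb[OF that] tK unfolding mem_ball dist_norm by (subst norm_minus_commute) simp
      thus ?thesis using r(2) by blast
    qed
    have est: "norm (u' (y + (s *\<^sub>R v + s' *\<^sub>R w)) v - u' y v - A (s *\<^sub>R v + s' *\<^sub>R w)) \<le> \<epsilon> / 2 * t"
      if "\<bar>s\<bar> \<le> t" "\<bar>s'\<bar> \<le> t" for s s'
    proof -
      have "norm (u' (y + (s *\<^sub>R v + s' *\<^sub>R w)) v - u' y v - A (s *\<^sub>R v + s' *\<^sub>R w))
          \<le> \<epsilon> / (2 * K) * norm (s *\<^sub>R v + s' *\<^sub>R w)"
        using d1(2)[of "y + (s *\<^sub>R v + s' *\<^sub>R w)"] nb[OF that] tK by simp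
      also have "\<dots> \<le> \<epsilon> / (2 * K) * (t * K)" using nb[OF that] eps K by (intro mult_left_mono) auto
      also have "\<dots> = \<epsilon> / 2 * t" using K by simp
      finally show ?thesis .
    qed
    \<comment> \<open>The increment of \<open>u\<close> across the step
      \<open>t *\<^sub>R w\<close>, as a function of the position along \<open>v\<close>, minus its
      expected growth. Its derivative is a difference of two first-order remainders of
      \<open>u'\<close> at \<open>y\<close>.\<close>
    let ?f = "\<lambda>s. u (y + (s *\<^sub>R v + t *\<^sub>R w)) - u (y + (s *\<^sub>R v + 0 *\<^sub>R w)) - s *\<^sub>R (t *\<^sub>R A w)"
    have fd: "(?f has_derivative (\<lambda>h. h *\<^sub>R (u' (y + (s *\<^sub>R v + t *\<^sub>R w)) v - u' (y + (s *\<^sub>R v + 0 *\<^sub>R w)) v - t *\<^sub>R A w)))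
        (at s within {0..t})" if s: "s \<in> {0..t}" for s
    proof -
      have sd: "((\<lambda>s. u (y + (s *\<^sub>R v + c *\<^sub>R w))) has_derivative (\<lambda>h. h *\<^sub>R u' (y + (s *\<^sub>R v + c *\<^sub>R w)) v)) (at s within {0..t})"
        if c: "\<bar>c\<bar> \<le> t" for c
      proof -
        have z: "y + (s *\<^sub>R v + c *\<^sub>R w) \<in> N" using inN[OF _ c, of s] s by auto
        interpret L: bounded_linear "u' (y + (s *\<^sub>R v + c *\<^sub>R w))" using u[OF z] by (rule has_derivative_bounded_linear)
        have "((\<lambda>s. y + (s *\<^sub>R v + c *\<^sub>R w)) has_derivative (\<lambda>h. h *\<^sub>R v)) (at s within {0..t})"
          by (auto intro!: derivative_eq_intros)
        from has_derivative_compose[OF this u[OF z]] show ?thesis by (simp add: L.scaleR)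
      qed
      have "((\<lambda>s. s *\<^sub>R (t *\<^sub>R A w)) has_derivative (\<lambda>h. h *\<^sub>R (t *\<^sub>R A w))) (at s within {0..t})"
        by (auto intro!: derivative_eq_intros)
      from has_derivative_diff[OF has_derivative_diff[OF sd[of t] sd[of 0]] this] t
      show ?thesis by (simp add: scaleR_diff_right)
    qed
    have "norm (?f t - ?f 0) \<le> (\<epsilon> * t) * norm (t - 0)"
    proof (rule differentiable_bound[OF _ fd])
      fix s assume s: "s \<in> {0..t}"
      have "u' (y + (s *\<^sub>R v + t *\<^sub>R w)) v - u' (y + (s *\<^sub>R v + 0 *\<^sub>R w)) v - t *\<^sub>R A w
          = (u' (y + (s *\<^sub>R v + t *\<^sub>R w)) v - u' y v - A (s *\<^sub>R v + t *\<^sub>R w))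
            - (u' (y + (s *\<^sub>R v + 0 *\<^sub>R w)) v - u' y v - A (s *\<^sub>R v + 0 *\<^sub>R w))"
        by (simp add: A.add A.scaleR)
      also have "norm \<dots> \<le> \<epsilon> / 2 * t + \<epsilon> / 2 * t"
        by (rule order_trans[OF norm_triangle_ineq4]) (intro add_mono est, use s in auto)
      finally have "norm (u' (y + (s *\<^sub>R v + t *\<^sub>R w)) v - u' (y + (s *\<^sub>R v + 0 *\<^sub>R w)) v - t *\<^sub>R A w) \<le> \<epsilon> * t"
        by simp
      thus "onorm (\<lambda>h. h *\<^sub>R (u' (y + (s *\<^sub>R v + t *\<^sub>R w)) v - u' (y + (s *\<^sub>R v + 0 *\<^sub>R w)) v - t *\<^sub>R A w)) \<le> \<epsilon> * t"
        by (intro onorm_le) (simp, subst mult.commute, intro mult_right_mono, auto)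
    qed (use t in auto)
    thus ?thesis using t by (simp add: power2_eq_square algebra_simps)
  qed
  thus ?thesis using d that by blast
qed

text \<open>The second difference does not change when \<open>v\<close> and \<open>w\<close> are
  interchanged, so both iterated derivatives approximate one and the same quantity up to an
  arbitrarily small multiple of the squared step length.\<close>

theorem symmetric_second_derivative:
  fixes u :: "'e::real_normed_vector \<Rightarrow> 'b::real_normed_vector"
  assumes N: "open N" "y \<in> N" and u: "\<And>z. z \<in> N \<Longrightarrow> (u has_derivative u' z) (at z)"
    and A: "((\<lambda>z. u' z v) has_derivative A) (at y)" and B: "((\<lambda>z. u' z w) has_derivative B) (at y)"
  shows "A w = B v"
proof -
  have "norm (A w - B v) \<le> \<epsilon>" if eps: "\<epsilon> > 0" for \<epsilon> :: real
  proof -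
    obtain d1 where d1: "d1 > 0" "\<And>t::real. 0 < t \<Longrightarrow> t < d1 \<Longrightarrow>
      norm (u (y + t *\<^sub>R v + t *\<^sub>R w) - u (y + t *\<^sub>R v) - (u (y + t *\<^sub>R w) - u y) - t\<^sup>2 *\<^sub>R A w) \<le> \<epsilon> / 2 * t\<^sup>2"
      using second_difference_estimate[OF N u A, of "\<epsilon> / 2" w] eps by auto
    obtain d2 where d2: "d2 > 0" "\<And>t::real. 0 < t \<Longrightarrow> t < d2 \<Longrightarrow>
      norm (u (y + t *\<^sub>R w + t *\<^sub>R v) - u (y + t *\<^sub>R w) - (u (y + t *\<^sub>R v) - u y) - t\<^sup>2 *\<^sub>R B v) \<le> \<epsilon> / 2 * t\<^sup>2"
      using second_difference_estimate[OF N u B, of "\<epsilon> / 2" v] eps by auto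
    define t where "t = min d1 d2 / 2"
    have t: "t > 0" "t < d1" "t < d2" using d1(1) d2(1) by (auto simp: t_def)
    have "t\<^sup>2 *\<^sub>R (A w - B v) =
      (u (y + t *\<^sub>R w + t *\<^sub>R v) - u (y + t *\<^sub>R w) - (u (y + t *\<^sub>R v) - u y) - t\<^sup>2 *\<^sub>R B v)
      - (u (y + t *\<^sub>R v + t *\<^sub>R w) - u (y + t *\<^sub>R v) - (u (y + t *\<^sub>R w) - u y) - t\<^sup>2 *\<^sub>R A w)"
      by (simp add: algebra_simps)
    also have "norm \<dots> \<le> \<epsilon> / 2 * t\<^sup>2 + \<epsilon> / 2 * t\<^sup>2"
      by (rule order_trans[OF norm_triangle_ineq4]) (intro add_mono d1(2) d2(2) t)
    finally have "t\<^sup>2 * norm (A w - B v) \<le> t\<^sup>2 * \<epsilon>" by (simp add: mult.commute)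
    thus ?thesis using t(1) by simp
  qed
  hence "norm (A w - B v) \<le> 0" by (rule field_le_epsilon[of _ 0, simplified])
  thus ?thesis by simp
qed

lemma frechet_commute:
  assumes "open N" "twice_diff N u" "y \<in> N"
  shows "frechet_derivative (\<lambda>z. frechet_derivative u (at z) v) (at y) w =
    frechet_derivative (\<lambda>z. frechet_derivative u (at z) w) (at y) v"
  by (rule symmetric_second_derivative[OF assms(1,3) twice_diff_frechet[OF assms(2)]
      differentiable_frechet[OF twice_diff_frechet_differentiable[OF assms(2,3)]]
      differentiable_frechet[OF twice_diff_frechet_differentiable[OF assms(2,3)]]])

lemma cder_cder_eq:
  assumes "open N" "twice_diff N u" "y \<in> N"
  shows "cder d (cder d' u) y =
    frechet_derivative (\<lambda>z. frechet_derivative u (at z) (fst d')) (at y) (fst d)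
    + \<i> * frechet_derivative (\<lambda>z. frechet_derivative u (at z) (snd d')) (at y) (fst d)
    + \<i> * (frechet_derivative (\<lambda>z. frechet_derivative u (at z) (fst d')) (at y) (snd d)
    + \<i> * frechet_derivative (\<lambda>z. frechet_derivative u (at z) (snd d')) (at y) (snd d))"
proof -
  have D: "((\<lambda>z. frechet_derivative u (at z) v) has_derivative
      frechet_derivative (\<lambda>z. frechet_derivative u (at z) v) (at y)) (at y)" for v
    by (rule differentiable_frechet[OF twice_diff_frechet_differentiable[OF assms(2,3)]])
  have "(cder d' u has_derivative (\<lambda>h. frechet_derivative (\<lambda>z. frechet_derivative u (at z) (fst d')) (at y) h
      + \<i> * frechet_derivative (\<lambda>z. frechet_derivative u (at z) (snd d')) (at y) h)) (at y)"
    unfolding cder_def[abs_def] by (intro has_derivative_add D has_derivative_mult_right)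
  from cder_eqI[OF this] show ?thesis .
qed

lemma cder_commute:
  assumes "open N" "twice_diff N u" "y \<in> N"
  shows "cder d (cder d' u) y = cder d' (cder d u) y"
  unfolding cder_cder_eq[OF assms]
  using frechet_commute[OF assms, of "fst d'" "fst d"] frechet_commute[OF assms, of "fst d'" "snd d"]
    frechet_commute[OF assms, of "snd d'" "fst d"] frechet_commute[OF assms, of "snd d'" "snd d"]
  by (simp add: algebra_simps)

lemma differentiable_compose_real:
  fixes G :: "(nat \<Rightarrow> real) \<Rightarrow> real" and c :: "'e::real_normed_vector \<Rightarrow> nat \<Rightarrow> real"
  assumes U: "openin (top_of_set (coord_space m)) U" and G: "Ck_on (Suc 0) m U G"
    and N: "open N" "y \<in> N" "\<And>z. z \<in> N \<Longrightarrow> c z \<in> U"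
    and c: "\<And>i. i < m \<Longrightarrow> (\<lambda>z. c z i) differentiable (at y)"
  shows "(\<lambda>z. complex_of_real (G (c z))) differentiable (at y)"
    and "cder d (\<lambda>z. complex_of_real (G (c z))) y =
      (\<Sum>i<m. complex_of_real (pd i 1 G (c y)) * cder d (\<lambda>z. complex_of_real (c z i)) y)"
proof -
  have ev: "\<forall>\<^sub>F z in nhds y. c z \<in> coord_space m"
    using openin_imp_subset[OF U] N(3) by (intro eventually_nhds_in_open[OF N(1,2), THEN eventually_mono]) auto
  have "((\<lambda>z. G (c z)) has_derivative (\<lambda>h. \<Sum>i<m. \<Sum>e\<in>Basis.
      (frechet_derivative (\<lambda>z. c z i) (at y) h \<bullet> e) *\<^sub>R pd i e G (c y))) (at y)"
    by (rule C1_chain[OF U G N(3)[OF N(2)] ev differentiable_frechet[OF c]])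
  hence *: "((\<lambda>z. complex_of_real (G (c z))) has_derivative (\<lambda>h. \<Sum>i<m.
      complex_of_real (frechet_derivative (\<lambda>z. c z i) (at y) h * pd i 1 G (c y)))) (at y)"
    by (auto dest: bounded_linear.has_derivative[OF bounded_linear_of_real])
  thus "(\<lambda>z. complex_of_real (G (c z))) differentiable (at y)" by (rule differentiableI)
  have "cder d (\<lambda>z. complex_of_real (c z i)) y =
      complex_of_real (frechet_derivative (\<lambda>z. c z i) (at y) (fst d)) +
      \<i> * complex_of_real (frechet_derivative (\<lambda>z. c z i) (at y) (snd d))" if "i < m" for i
    by (rule cder_eqI[OF bounded_linear.has_derivative[OF bounded_linear_of_real differentiable_frechet[OF c[OF that]]]])
  thus "cder d (\<lambda>z. complex_of_real (G (c z))) y =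
      (\<Sum>i<m. complex_of_real (pd i 1 G (c y)) * cder d (\<lambda>z. complex_of_real (c z i)) y)"
    unfolding cder_eqI[OF *] by (simp add: sum_distrib_left sum.distrib[symmetric] algebra_simps)
qed

text \<open>The real differential split into its complex linear and antilinear parts. It translates
  \<open>C1_chain\<close> into a rule in which holomorphic inner maps can be exploited.\<close>

lemma wirtinger_sum:
  "(\<Sum>e\<in>Basis. (w \<bullet> e) *\<^sub>R pd i e u x) = dz i u x * w + dzbar i u x * cnj w"
  by (simp add: Basis_complex_def dz_def dzbar_def inner_complex_def scaleR_conv_of_real
      complex_eq_iff field_simps)

lemma differentiable_compose_complex:
  fixes u :: "(nat \<Rightarrow> complex) \<Rightarrow> complex" and c :: "'e::real_normed_vector \<Rightarrow> nat \<Rightarrow> complex"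
  assumes U: "openin (top_of_set (coord_space n)) U" and u: "Ck_on (Suc 0) n U u"
    and N: "open N" "y \<in> N" "\<And>z. z \<in> N \<Longrightarrow> c z \<in> U"
    and c: "\<And>i. i < n \<Longrightarrow> ((\<lambda>z. c z i) has_derivative c' i) (at y)"
  shows "((\<lambda>z. u (c z)) has_derivative (\<lambda>h. \<Sum>a<n. dz a u (c y) * c' a h + dzbar a u (c y) * cnj (c' a h))) (at y)"
proof -
  have ev: "\<forall>\<^sub>F z in nhds y. c z \<in> coord_space n"
    using openin_imp_subset[OF U] N(3) by (intro eventually_nhds_in_open[OF N(1,2), THEN eventually_mono]) auto
  show ?thesis using C1_chain[OF U u N(3)[OF N(2)] ev c] by (simp add: wirtinger_sum)
qed

section \<open>Charts and tangent vectors\<close>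

lemma eventually_upd_in:
  fixes U :: "(nat \<Rightarrow> 'a::real_normed_vector) set"
  assumes "openin (top_of_set (coord_space n)) U" "x \<in> U" "i < n"
  shows "\<forall>\<^sub>F t in nhds (x i). x(i := t) \<in> U"
proof -
  obtain d where d: "d > 0" "coord_box n x d \<subseteq> U" using coord_box_subset_open assms(1,2) by blast
  have xc: "x \<in> coord_space n" using assms(1,2) openin_imp_subset by blast
  have "\<forall>\<^sub>F t in nhds (x i). dist t (x i) < d"
    using d(1) by (auto simp: eventually_nhds_metric)
  thus ?thesis
  proof eventually_elim
    case (elim t)
    have "x(i := t) \<in> coord_box n x d"
      using elim xc assms(3) d(1) by (auto simp: coord_box_def coord_space_def)
    thus ?case using d(2) by blast
  qed
qed

lemma eventually_coord_space_upd:
  "x \<in> coord_space n \<Longrightarrow> i < n \<Longrightarrow> \<forall>\<^sub>F t in F. x(i := t) \<in> coord_space n"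
  by (simp add: coord_space_upd)

lemma upd_has_field_derivative:
  "((\<lambda>t. (x(i := t)) j) has_field_derivative (if j = i then 1 else 0)) (at (t0 :: 'a::real_normed_field))"
  by (cases "j = i") auto

lemma C1_chain_real:
  fixes u :: "(nat \<Rightarrow> real) \<Rightarrow> real" and c :: "real \<Rightarrow> nat \<Rightarrow> real"
  assumes U: "openin (top_of_set (coord_space n)) U" and u: "Ck_on (Suc 0) n U u"
    and t0: "c t0 \<in> U" and cc: "\<forall>\<^sub>F t in nhds t0. c t \<in> coord_space n"
    and c': "\<And>i. i < n \<Longrightarrow> ((\<lambda>t. c t i) has_field_derivative c' i) (at t0)"
  shows "((\<lambda>t. u (c t)) has_field_derivative (\<Sum>i<n. pd i 1 u (c t0) * c' i)) (at t0)"
proof -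
  have "((\<lambda>t. u (c t)) has_derivative (\<lambda>h. \<Sum>i<n. h * (c' i * pd i 1 u (c t0)))) (at t0)"
    using C1_chain[OF U u t0 cc c'[unfolded has_field_derivative_def]] by (simp add: mult_ac)
  moreover have "(\<lambda>h. \<Sum>i<n. h * (c' i * pd i 1 u (c t0))) = (*) (\<Sum>i<n. pd i 1 u (c t0) * c' i)"
    by (simp add: fun_eq_iff sum_distrib_left mult_ac)
  ultimately show ?thesis by (simp add: has_field_derivative_def)
qed

lemma holomorphic_chain:
  fixes u :: "(nat \<Rightarrow> complex) \<Rightarrow> complex" and c :: "complex \<Rightarrow> nat \<Rightarrow> complex"
  assumes U: "openin (top_of_set (coord_space n)) U" and u: "holomorphic_fun_on n U u"
    and t0: "c t0 \<in> U" and cc: "\<forall>\<^sub>F t in nhds t0. c t \<in> coord_space n"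
    and c': "\<And>i. i < n \<Longrightarrow> ((\<lambda>t. c t i) has_field_derivative c' i) (at t0)"
  shows "((\<lambda>t. u (c t)) has_field_derivative (\<Sum>i<n. dz i u (c t0) * c' i)) (at t0)"
proof -
  have u1: "Ck_on (Suc 0) n U u" and u2: "\<And>a. a < n \<Longrightarrow> dzbar a u (c t0) = 0"
    using u t0 by (auto simp: holomorphic_fun_on_def smooth_on_def simp del: Ck_on.simps)
  have "((\<lambda>t. u (c t)) has_derivative
      (\<lambda>h. \<Sum>i<n. dz i u (c t0) * (c' i * h) + dzbar i u (c t0) * cnj (c' i * h))) (at t0)"
    using C1_chain[OF U u1 t0 cc c'[unfolded has_field_derivative_def]] by (simp add: wirtinger_sum)
  moreover have "(\<lambda>h. \<Sum>i<n. dz i u (c t0) * (c' i * h) + dzbar i u (c t0) * cnj (c' i * h))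
      = (*) (\<Sum>i<n. dz i u (c t0) * c' i)"
    by (simp add: fun_eq_iff sum_distrib_left mult_ac u2)
  ultimately show ?thesis by (simp add: has_field_derivative_def)
qed

section \<open>The topology of an atlas\<close>

text \<open>Charts without the global axioms: P(T_M) is first shown to be of this kind, and its
  Hausdorff property, countable base and connectedness are then derived with the lemmas proved
  here.\<close>

locale charted_atlas =
  fixes n :: nat and A :: "('p, 'a::{euclidean_space, real_normed_field}) chart set"
  assumes chart_inj': "\<kappa> \<in> A \<Longrightarrow> inj_on (snd \<kappa>) (fst \<kappa>)"
    and chart_open': "\<kappa> \<in> A \<Longrightarrow> \<kappa>' \<in> A \<Longrightarrow>
      openin (top_of_set (coord_space n)) (snd \<kappa> ` (fst \<kappa> \<inter> fst \<kappa>'))"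
    and trans_cont: "\<kappa> \<in> A \<Longrightarrow> \<kappa>' \<in> A \<Longrightarrow> k < n \<Longrightarrow>
      continuous_on (snd \<kappa> ` (fst \<kappa> \<inter> fst \<kappa>')) (\<lambda>x. snd \<kappa>' (chart_inv \<kappa> x) k)"
begin

lemma topspace_mtop: "topspace (mtop A) = points A"
proof -
  have "fst \<kappa> = {p \<in> fst \<kappa>. snd \<kappa> p \<in> UNIV}" for \<kappa> :: "('p, 'a) chart" by simp
  hence "\<Union> {{p \<in> fst \<kappa>. snd \<kappa> p \<in> W} | \<kappa> W. \<kappa> \<in> A \<and> open W} = points A"
    unfolding points_def by blast
  thus ?thesis by (simp add: mtop_def topology_generated_by_topspace)
qed

lemma openin_chart_preimage:
  assumes "\<kappa> \<in> A" "open W"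
  shows "openin (mtop A) {p \<in> fst \<kappa>. snd \<kappa> p \<in> W}"
  unfolding mtop_def by (rule topology_generated_by_Basis) (use assms in blast)

lemma openin_chart_domain: "\<kappa> \<in> A \<Longrightarrow> openin (mtop A) (fst \<kappa>)"
  using openin_chart_preimage[of \<kappa> UNIV] by simp

lemma chart_image_open: "\<kappa> \<in> A \<Longrightarrow> openin (top_of_set (coord_space n)) (snd \<kappa> ` fst \<kappa>)"
  using chart_open'[of \<kappa> \<kappa>] by simp

lemma chart_in_coord_space: "\<kappa> \<in> A \<Longrightarrow> p \<in> fst \<kappa> \<Longrightarrow> snd \<kappa> p \<in> coord_space n"
  using openin_imp_subset[OF chart_image_open] by blast

lemma chart_inv_chart [simp]: "\<kappa> \<in> A \<Longrightarrow> p \<in> fst \<kappa> \<Longrightarrow> chart_inv \<kappa> (snd \<kappa> p) = p"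
  using chart_inj' by (simp add: chart_inv_def)

lemma chart_chart_inv: "x \<in> snd \<kappa> ` fst \<kappa> \<Longrightarrow> snd \<kappa> (chart_inv \<kappa> x) = x"
  by (simp add: chart_inv_def f_inv_into_f)

lemma openin_chart_preimage_rel:
  assumes "\<kappa> \<in> A" "openin (top_of_set (coord_space n)) W"
  shows "openin (mtop A) {p \<in> fst \<kappa>. snd \<kappa> p \<in> W}"
proof -
  obtain W' where W': "open W'" "W = coord_space n \<inter> W'" using assms(2) by (auto simp: openin_open)
  have "{p \<in> fst \<kappa>. snd \<kappa> p \<in> W} = {p \<in> fst \<kappa>. snd \<kappa> p \<in> W'}"
    using chart_in_coord_space[OF assms(1)] W'(2) by auto
  thus ?thesis using openin_chart_preimage[OF assms(1) W'(1)] by simp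
qed

text \<open>Induction over the generation of the topology: a generating set belongs to another
  chart, and continuity of the transition map carries it into the present one. Injectivity of the
  chart is what handles intersections.\<close>

lemma openin_chart_image:
  assumes "openin (mtop A) V" "\<kappa> \<in> A"
  shows "openin (top_of_set (coord_space n)) (snd \<kappa> ` (fst \<kappa> \<inter> V))"
proof -
  have "generate_topology_on {{p \<in> fst \<kappa>. snd \<kappa> p \<in> W} | \<kappa> W. \<kappa> \<in> A \<and> open W} V"
    using assms(1) by (simp add: mtop_def openin_topology_generated_by_iff)
  thus ?thesis
  proof induction
    case (Int a b)
    have "snd \<kappa> ` (fst \<kappa> \<inter> (a \<inter> b)) = snd \<kappa> ` (fst \<kappa> \<inter> a) \<inter> snd \<kappa> ` (fst \<kappa> \<inter> b)"
      using chart_inj'[OF assms(2)] by (auto simp: inj_on_def)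
    then show ?case using Int.IH by (simp add: openin_Int)
  next
    case (UN K)
    have "snd \<kappa> ` (fst \<kappa> \<inter> \<Union> K) = (\<Union>k\<in>K. snd \<kappa> ` (fst \<kappa> \<inter> k))" by auto
    then show ?case using UN.IH by auto
  next
    case (Basis s)
    then obtain \<kappa>' W where s: "\<kappa>' \<in> A" "open W" "s = {p \<in> fst \<kappa>'. snd \<kappa>' p \<in> W}" by auto
    let ?D = "snd \<kappa> ` (fst \<kappa> \<inter> fst \<kappa>')"
    have cont: "continuous_on ?D (\<lambda>x. snd \<kappa>' (chart_inv \<kappa> x))"
    proof (rule continuous_on_coordinatewise_then_product)
      fix k
      show "continuous_on ?D (\<lambda>x. snd \<kappa>' (chart_inv \<kappa> x) k)"
      proof (cases "k < n")
        case True
        then show ?thesis using trans_cont assms(2) s(1) by blast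
      next
        case False
        have "snd \<kappa>' (chart_inv \<kappa> x) k = 0" if "x \<in> ?D" for x
          using chart_in_coord_space[OF s(1), of "chart_inv \<kappa> x"] that False assms(2)
          by (auto simp: coord_space_def)
        thus ?thesis by (simp cong: continuous_on_cong)
      qed
    qed
    have "snd \<kappa> ` (fst \<kappa> \<inter> s) = ?D \<inter> (\<lambda>x. snd \<kappa>' (chart_inv \<kappa> x)) -` W"
      using assms(2) by (auto simp: s(3) image_iff)
    moreover have "openin (top_of_set ?D) (?D \<inter> (\<lambda>x. snd \<kappa>' (chart_inv \<kappa> x)) -` W)"
      by (rule continuous_openin_preimage_gen[OF cont s(2)])
    ultimately show ?case using openin_trans[OF _ chart_open'[OF assms(2) s(1)]] by simp
  qed auto
qed

end

section \<open>Jacobian matrices and tangent spaces\<close>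

text \<open>A common interface for real and complex manifolds: the chain rule for curves whose
  parameter is a scalar of the base field. Tangent spaces need nothing more, so they are treated
  once for both.\<close>

locale differentiable_atlas = charted_atlas n A
  for n :: nat and A :: "('p, 'a::{euclidean_space, real_normed_field}) chart set" +
  assumes trans_chain: "\<kappa> \<in> A \<Longrightarrow> \<kappa>' \<in> A \<Longrightarrow> k < n \<Longrightarrow> c t0 \<in> snd \<kappa> ` (fst \<kappa> \<inter> fst \<kappa>') \<Longrightarrow>
    \<forall>\<^sub>F t in nhds t0. c t \<in> coord_space n \<Longrightarrow>
    (\<And>i. i < n \<Longrightarrow> ((\<lambda>t::'a. c t i) has_field_derivative c' i) (at t0)) \<Longrightarrow>
    ((\<lambda>t. snd \<kappa>' (chart_inv \<kappa> (c t)) k) has_field_derivative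
      (\<Sum>i<n. jac \<kappa> \<kappa>' (chart_inv \<kappa> (c t0)) k i * c' i)) (at t0)"
begin

lemma trans_slice:
  assumes "\<kappa> \<in> A" "\<kappa>' \<in> A" "k < n" "p \<in> fst \<kappa>" "p \<in> fst \<kappa>'" "i < n"
  shows "((\<lambda>t. snd \<kappa>' (chart_inv \<kappa> ((snd \<kappa> p)(i := t))) k) has_field_derivative jac \<kappa> \<kappa>' p k i)
    (at (snd \<kappa> p i))"
proof -
  have "((\<lambda>t. snd \<kappa>' (chart_inv \<kappa> ((snd \<kappa> p)(i := t))) k) has_field_derivative
      (\<Sum>j<n. jac \<kappa> \<kappa>' (chart_inv \<kappa> ((snd \<kappa> p)(i := snd \<kappa> p i))) k j * (if j = i then 1 else 0)))
    (at (snd \<kappa> p i))"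
    by (rule trans_chain[OF assms(1-3) _ eventually_coord_space_upd upd_has_field_derivative])
       (use assms chart_in_coord_space in auto)
  thus ?thesis using assms by (simp add: if_distrib[of "\<lambda>x. _ * x"] sum.delta cong: if_cong)
qed

text \<open>The chain rule along a coordinate line of \<kappa>1, viewed as a curve in the
  coordinates of \<kappa>2.\<close>

lemma jac_cocycle:
  assumes "\<kappa>1 \<in> A" "\<kappa>2 \<in> A" "\<kappa>3 \<in> A" "p \<in> fst \<kappa>1" "p \<in> fst \<kappa>2" "p \<in> fst \<kappa>3" "k < n" "i < n"
  shows "jac \<kappa>1 \<kappa>3 p k i = (\<Sum>j<n. jac \<kappa>2 \<kappa>3 p k j * jac \<kappa>1 \<kappa>2 p j i)"
proof -
  let ?x = "snd \<kappa>1 p"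
  let ?c = "\<lambda>t. snd \<kappa>2 (chart_inv \<kappa>1 (?x(i := t)))"
  have ev: "\<forall>\<^sub>F t in nhds (?x i). ?x(i := t) \<in> snd \<kappa>1 ` (fst \<kappa>1 \<inter> fst \<kappa>2)"
    by (rule eventually_upd_in[OF chart_open'[OF assms(1,2)]]) (use assms in auto)
  have c0: "?c (?x i) = snd \<kappa>2 p" using assms by simp
  have "((\<lambda>t. snd \<kappa>3 (chart_inv \<kappa>2 (?c t)) k) has_field_derivative
      (\<Sum>j<n. jac \<kappa>2 \<kappa>3 (chart_inv \<kappa>2 (?c (?x i))) k j * jac \<kappa>1 \<kappa>2 p j i)) (at (?x i))"
  proof (rule trans_chain)
    show "?c (?x i) \<in> snd \<kappa>2 ` (fst \<kappa>2 \<inter> fst \<kappa>3)" unfolding c0 using assms by blast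
    show "\<forall>\<^sub>F t in nhds (?x i). ?c t \<in> coord_space n"
      using ev by eventually_elim (use assms chart_in_coord_space[OF assms(2)] in auto)
    show "((\<lambda>t. ?c t j) has_field_derivative jac \<kappa>1 \<kappa>2 p j i) (at (?x i))" if "j < n" for j
      by (rule trans_slice) (use that assms in auto)
  qed (use assms in auto)
  hence "((\<lambda>t. snd \<kappa>3 (chart_inv \<kappa>2 (?c t)) k) has_field_derivative
      (\<Sum>j<n. jac \<kappa>2 \<kappa>3 p k j * jac \<kappa>1 \<kappa>2 p j i)) (at (?x i))"
    unfolding c0 using assms by simp
  moreover have "\<forall>\<^sub>F t in nhds (?x i). snd \<kappa>3 (chart_inv \<kappa>2 (?c t)) k = snd \<kappa>3 (chart_inv \<kappa>1 (?x(i := t))) k"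
    using ev by eventually_elim (use assms in auto)
  ultimately have "((\<lambda>t. snd \<kappa>3 (chart_inv \<kappa>1 (?x(i := t))) k) has_field_derivative
      (\<Sum>j<n. jac \<kappa>2 \<kappa>3 p k j * jac \<kappa>1 \<kappa>2 p j i)) (at (?x i))"
    by (subst (asm) DERIV_cong_ev[OF refl _ refl])
  thus ?thesis using DERIV_unique trans_slice[OF assms(1,3,7,4,6,8)] by blast
qed

lemma jac_self:
  assumes "\<kappa> \<in> A" "p \<in> fst \<kappa>" "k < n" "i < n"
  shows "jac \<kappa> \<kappa> p k i = (if k = i then 1 else 0)"
proof -
  let ?x = "snd \<kappa> p"
  have ev: "\<forall>\<^sub>F t in nhds (?x i). ?x(i := t) \<in> snd \<kappa> ` fst \<kappa>"
    by (rule eventually_upd_in[OF chart_image_open[OF assms(1)]]) (use assms in auto)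
  have eq: "\<forall>\<^sub>F t in nhds (?x i). snd \<kappa> (chart_inv \<kappa> (?x(i := t))) k = (?x(i := t)) k"
    using ev by eventually_elim (simp add: chart_chart_inv)
  have "((\<lambda>t. snd \<kappa> (chart_inv \<kappa> (?x(i := t))) k) has_field_derivative (if k = i then 1 else 0)) (at (?x i))"
    by (rule iffD2[OF DERIV_cong_ev[OF refl eq refl] upd_has_field_derivative])
  thus ?thesis using DERIV_unique trans_slice[OF assms(1,1,3,2,2,4)] by blast
qed

text \<open>Inverse to reading off the components in \<kappa>; that the result obeys the
  transformation law is \<open>jac_cocycle\<close>.\<close>

definition tangent_vec :: "('p, 'a) chart \<Rightarrow> (nat \<Rightarrow> 'a) \<Rightarrow> 'p \<Rightarrow> ('p, 'a) tangent"
  where "tangent_vec \<kappa> w p =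
    (\<lambda>(\<kappa>', k). if \<kappa>' \<in> A \<and> p \<in> fst \<kappa>' \<and> k < n then \<Sum>i<n. jac \<kappa> \<kappa>' p k i * w i else 0)"

lemma tangent_vec_in_tangent_space:
  assumes "\<kappa> \<in> A" "p \<in> fst \<kappa>"
  shows "tangent_vec \<kappa> w p \<in> tangent_space n A p"
  unfolding tangent_space_def
proof (intro CollectI conjI ballI allI impI)
  fix \<kappa>1 \<kappa>2 k assume *: "\<kappa>1 \<in> A" "\<kappa>2 \<in> A" "k < n" "p \<in> fst \<kappa>1" "p \<in> fst \<kappa>2"
  have "tangent_vec \<kappa> w p (\<kappa>2, k) = (\<Sum>i<n. (\<Sum>j<n. jac \<kappa>1 \<kappa>2 p k j * jac \<kappa> \<kappa>1 p j i) * w i)"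
    using * jac_cocycle[OF assms(1) *(1,2) assms(2) *(4,5,3)] by (simp add: tangent_vec_def)
  also have "\<dots> = (\<Sum>j<n. \<Sum>i<n. jac \<kappa>1 \<kappa>2 p k j * jac \<kappa> \<kappa>1 p j i * w i)"
    by (simp add: sum_distrib_right) (rule sum.swap)
  also have "\<dots> = (\<Sum>j<n. jac \<kappa>1 \<kappa>2 p k j * tangent_vec \<kappa> w p (\<kappa>1, j))"
    using * by (simp add: tangent_vec_def sum_distrib_left mult.assoc)
  finally show "tangent_vec \<kappa> w p (\<kappa>2, k) = (\<Sum>i<n. jac \<kappa>1 \<kappa>2 p k i * tangent_vec \<kappa> w p (\<kappa>1, i))" .
qed (auto simp: tangent_vec_def)

lemma tangent_vec_component:
  assumes "\<kappa> \<in> A" "p \<in> fst \<kappa>" "k < n"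
  shows "tangent_vec \<kappa> w p (\<kappa>, k) = w k"
proof -
  have "tangent_vec \<kappa> w p (\<kappa>, k) = (\<Sum>i<n. (if k = i then 1 else 0) * w i)"
    using assms by (simp add: tangent_vec_def jac_self)
  also have "\<dots> = (\<Sum>i<n. if k = i then w i else 0)" by (rule sum.cong) auto
  finally show ?thesis using assms(3) by simp
qed

lemma tangent_space_eq_tangent_vec:
  assumes "\<kappa> \<in> A" "p \<in> fst \<kappa>" "v \<in> tangent_space n A p"
  shows "v = tangent_vec \<kappa> (\<lambda>i. v (\<kappa>, i)) p"
proof
  fix x :: "('p, 'a) chart \<times> nat"
  obtain \<kappa>' k where x: "x = (\<kappa>', k)" by (cases x)
  show "v x = tangent_vec \<kappa> (\<lambda>i. v (\<kappa>, i)) p x"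
  proof (cases "\<kappa>' \<in> A \<and> p \<in> fst \<kappa>' \<and> k < n")
    case True
    then have "v (\<kappa>', k) = (\<Sum>i<n. jac \<kappa> \<kappa>' p k i * v (\<kappa>, i))"
      using assms unfolding tangent_space_def by blast
    then show ?thesis using True by (simp add: x tangent_vec_def)
  next
    case False
    then have "\<kappa>' \<notin> A \<or> p \<notin> fst \<kappa>' \<or> k \<ge> n" by auto
    then have "v (\<kappa>', k) = 0" using assms(3) unfolding tangent_space_def by blast
    then show ?thesis using False by (auto simp: x tangent_vec_def)
  qed
qed

lemma tangent_space_eqI:
  assumes "\<kappa> \<in> A" "p \<in> fst \<kappa>" "v \<in> tangent_space n A p" "w \<in> tangent_space n A p"
    "\<And>i. i < n \<Longrightarrow> v (\<kappa>, i) = w (\<kappa>, i)"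
  shows "v = w"
proof -
  have "tangent_vec \<kappa> (\<lambda>i. v (\<kappa>, i)) p = tangent_vec \<kappa> (\<lambda>i. w (\<kappa>, i)) p"
    unfolding tangent_vec_def using assms(5) by (intro ext) (auto intro!: sum.cong)
  thus ?thesis using tangent_space_eq_tangent_vec assms by metis
qed

lemma tangent_vec_cong:
  "(\<And>i. i < n \<Longrightarrow> w i = w' i) \<Longrightarrow> tangent_vec \<kappa> w p = tangent_vec \<kappa> w' p"
  unfolding tangent_vec_def by (intro ext) (auto intro!: sum.cong)

lemma coord_vec_eq: "i < n \<Longrightarrow> coord_vec n A \<kappa> i p = tangent_vec \<kappa> (\<lambda>j. if j = i then 1 else 0) p"
  unfolding coord_vec_def tangent_vec_def
  by (intro ext) (auto simp: if_distrib[of "\<lambda>x. _ * x"] cong: if_cong)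

lemma tangent_space_lincomb:
  assumes "v \<in> tangent_space n A p" "w \<in> tangent_space n A p"
  shows "(\<lambda>x. a * v x + b * w x) \<in> tangent_space n A p"
  unfolding tangent_space_def
proof (intro CollectI conjI ballI allI impI)
  fix \<kappa>1 \<kappa>2 k assume *: "\<kappa>1 \<in> A" "\<kappa>2 \<in> A" "k < n" "p \<in> fst \<kappa>1" "p \<in> fst \<kappa>2"
  have v: "v (\<kappa>2, k) = (\<Sum>i<n. jac \<kappa>1 \<kappa>2 p k i * v (\<kappa>1, i))"
    and w: "w (\<kappa>2, k) = (\<Sum>i<n. jac \<kappa>1 \<kappa>2 p k i * w (\<kappa>1, i))"
    using assms * unfolding tangent_space_def by blast+
  show "a * v (\<kappa>2, k) + b * w (\<kappa>2, k) = (\<Sum>i<n. jac \<kappa>1 \<kappa>2 p k i * (a * v (\<kappa>1, i) + b * w (\<kappa>1, i)))"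
    unfolding v w by (simp add: sum_distrib_left sum.distrib algebra_simps)
next
  fix \<kappa> k assume "\<kappa> \<notin> A \<or> p \<notin> fst \<kappa> \<or> n \<le> k"
  hence "v (\<kappa>, k) = 0" "w (\<kappa>, k) = 0" using assms unfolding tangent_space_def by blast+
  thus "a * v (\<kappa>, k) + b * w (\<kappa>, k) = 0" by simp
qed

lemma tangent_space_scale:
  assumes "v \<in> tangent_space n A p"
  shows "(\<lambda>x. a * v x) \<in> tangent_space n A p"
  using tangent_space_lincomb[OF assms assms, of a 0] by simp

end

context smooth_manifold
begin

lemma transition_C1:
  "\<kappa> \<in> A \<Longrightarrow> \<kappa>' \<in> A \<Longrightarrow> k < n \<Longrightarrow>
    Ck_on l n (snd \<kappa> ` (fst \<kappa> \<inter> fst \<kappa>')) (\<lambda>x. snd \<kappa>' (chart_inv \<kappa> x) k)"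
  using smooth_transition by (auto simp: smooth_on_def)

sublocale charted_atlas n A
  by unfold_locales (use chart_inj chart_open transition_C1[THEN Ck_on_continuous] in auto)

lemma jac_eq_pd:
  assumes "\<kappa> \<in> A" "\<kappa>' \<in> A" "k < n" "p \<in> fst \<kappa>" "p \<in> fst \<kappa>'" "i < n"
  shows "jac \<kappa> \<kappa>' p k i = pd i 1 (\<lambda>x. snd \<kappa>' (chart_inv \<kappa> x) k) (snd \<kappa> p)"
proof -
  have "((\<lambda>t. (\<lambda>x. snd \<kappa>' (chart_inv \<kappa> x) k) ((snd \<kappa> p)(i := t))) has_field_derivative
      (\<Sum>j<n. pd j 1 (\<lambda>x. snd \<kappa>' (chart_inv \<kappa> x) k) ((snd \<kappa> p)(i := snd \<kappa> p i)) * (if j = i then 1 else 0)))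
    (at (snd \<kappa> p i))"
    by (rule C1_chain_real[OF chart_open[OF assms(1,2)] transition_C1[OF assms(1-3)] _
        eventually_coord_space_upd upd_has_field_derivative])
      (use assms chart_in_coord_space in auto)
  hence "((\<lambda>t. snd \<kappa>' (chart_inv \<kappa> ((snd \<kappa> p)(i := t))) k) has_field_derivative
      pd i 1 (\<lambda>x. snd \<kappa>' (chart_inv \<kappa> x) k) (snd \<kappa> p)) (at (snd \<kappa> p i))"
    using assms(6) by (simp add: if_distrib[of "\<lambda>x. _ * x"] cong: if_cong)
  thus ?thesis unfolding jac_def by (rule DERIV_imp_deriv)
qed

sublocale differentiable_atlas n A
proof unfold_locales
  fix \<kappa> \<kappa>' k and c :: "real \<Rightarrow> nat \<Rightarrow> real" and t0 c'
  assume *: "\<kappa> \<in> A" "\<kappa>' \<in> A" "k < n" "c t0 \<in> snd \<kappa> ` (fst \<kappa> \<inter> fst \<kappa>')"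
    "\<forall>\<^sub>F t in nhds t0. c t \<in> coord_space n"
    "\<And>i. i < n \<Longrightarrow> ((\<lambda>t. c t i) has_field_derivative c' i) (at t0)"
  obtain p where p: "p \<in> fst \<kappa>" "p \<in> fst \<kappa>'" "c t0 = snd \<kappa> p" using *(4) by auto
  have "((\<lambda>t. snd \<kappa>' (chart_inv \<kappa> (c t)) k) has_field_derivative
      (\<Sum>i<n. pd i 1 (\<lambda>x. snd \<kappa>' (chart_inv \<kappa> x) k) (c t0) * c' i)) (at t0)"
    by (rule C1_chain_real[OF chart_open[OF *(1,2)] transition_C1[OF *(1-3)] *(4-6)])
  thus "((\<lambda>t. snd \<kappa>' (chart_inv \<kappa> (c t)) k) has_field_derivative
      (\<Sum>i<n. jac \<kappa> \<kappa>' (chart_inv \<kappa> (c t0)) k i * c' i)) (at t0)"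
    using p * jac_eq_pd[OF *(1-3) p(1,2)] by simp
qed

end

context complex_manifold
begin

lemma transition_Ck:
  "\<kappa> \<in> A \<Longrightarrow> \<kappa>' \<in> A \<Longrightarrow> k < n \<Longrightarrow>
    Ck_on l n (snd \<kappa> ` (fst \<kappa> \<inter> fst \<kappa>')) (\<lambda>x. snd \<kappa>' (chart_inv \<kappa> x) k)"
  using holomorphic_transition by (auto simp: holomorphic_fun_on_def smooth_on_def)

sublocale charted_atlas n A
  by unfold_locales (use chart_inj chart_open transition_Ck[THEN Ck_on_continuous] in auto)

lemma jac_eq_dz:
  assumes "\<kappa> \<in> A" "\<kappa>' \<in> A" "k < n" "p \<in> fst \<kappa>" "p \<in> fst \<kappa>'" "i < n"
  shows "jac \<kappa> \<kappa>' p k i = dz i (\<lambda>x. snd \<kappa>' (chart_inv \<kappa> x) k) (snd \<kappa> p)"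
proof -
  have "((\<lambda>t. (\<lambda>x. snd \<kappa>' (chart_inv \<kappa> x) k) ((snd \<kappa> p)(i := t))) has_field_derivative
      (\<Sum>j<n. dz j (\<lambda>x. snd \<kappa>' (chart_inv \<kappa> x) k) ((snd \<kappa> p)(i := snd \<kappa> p i)) * (if j = i then 1 else 0)))
    (at (snd \<kappa> p i))"
    by (rule holomorphic_chain[OF chart_open[OF assms(1,2)] holomorphic_transition[OF assms(1-3)] _
        eventually_coord_space_upd upd_has_field_derivative])
      (use assms chart_in_coord_space in auto)
  hence "((\<lambda>t. snd \<kappa>' (chart_inv \<kappa> ((snd \<kappa> p)(i := t))) k) has_field_derivative
      dz i (\<lambda>x. snd \<kappa>' (chart_inv \<kappa> x) k) (snd \<kappa> p)) (at (snd \<kappa> p i))"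
    using assms(6) by (simp add: if_distrib[of "\<lambda>x. _ * x"] cong: if_cong)
  thus ?thesis unfolding jac_def by (rule DERIV_imp_deriv)
qed

sublocale differentiable_atlas n A
proof unfold_locales
  fix \<kappa> \<kappa>' k and c :: "complex \<Rightarrow> nat \<Rightarrow> complex" and t0 c'
  assume *: "\<kappa> \<in> A" "\<kappa>' \<in> A" "k < n" "c t0 \<in> snd \<kappa> ` (fst \<kappa> \<inter> fst \<kappa>')"
    "\<forall>\<^sub>F t in nhds t0. c t \<in> coord_space n"
    "\<And>i. i < n \<Longrightarrow> ((\<lambda>t. c t i) has_field_derivative c' i) (at t0)"
  obtain p where p: "p \<in> fst \<kappa>" "p \<in> fst \<kappa>'" "c t0 = snd \<kappa> p" using *(4) by auto
  have "((\<lambda>t. snd \<kappa>' (chart_inv \<kappa> (c t)) k) has_field_derivative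
      (\<Sum>i<n. dz i (\<lambda>x. snd \<kappa>' (chart_inv \<kappa> x) k) (c t0) * c' i)) (at t0)"
    by (rule holomorphic_chain[OF chart_open[OF *(1,2)] holomorphic_transition[OF *(1-3)] *(4-6)])
  thus "((\<lambda>t. snd \<kappa>' (chart_inv \<kappa> (c t)) k) has_field_derivative
      (\<Sum>i<n. jac \<kappa> \<kappa>' (chart_inv \<kappa> (c t0)) k i * c' i)) (at t0)"
    using p * jac_eq_dz[OF *(1-3) p(1,2)] by simp
qed

end

section \<open>Holomorphic functions of several variables\<close>

lemma pd_add:
  assumes "Ck_on (Suc 0) n U u" "Ck_on (Suc 0) n U v" "x \<in> U" "i < n" "e \<in> Basis"
  shows "pd i e (\<lambda>x. u x + v x) x = pd i e u x + pd i e v x"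
  by (rule pd_eqI) (intro has_vector_derivative_add Ck_on_slice[OF assms(1,4,5,3)] Ck_on_slice[OF assms(2,4,5,3)])

lemma pd_mult:
  fixes u v :: "(nat \<Rightarrow> 'a::euclidean_space) \<Rightarrow> 'b::real_normed_algebra"
  assumes "Ck_on (Suc 0) n U u" "Ck_on (Suc 0) n U v" "x \<in> U" "i < n" "e \<in> Basis"
  shows "pd i e (\<lambda>x. u x * v x) x = u x * pd i e v x + pd i e u x * v x"
  by (rule pd_eqI)
    (use has_vector_derivative_mult[OF Ck_on_slice[OF assms(1,4,5,3)] Ck_on_slice[OF assms(2,4,5,3)]]
      in \<open>simp add: fun_upd_def\<close>)

lemma pd_inverse:
  fixes u :: "(nat \<Rightarrow> 'a::euclidean_space) \<Rightarrow> 'b::real_normed_field"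
  assumes "Ck_on (Suc 0) n U u" "x \<in> U" "i < n" "e \<in> Basis" "u x \<noteq> 0"
  shows "pd i e (\<lambda>x. inverse (u x)) x = - (pd i e u x / (u x)\<^sup>2)"
proof (rule pd_eqI)
  have "((\<lambda>t::real. inverse (u (x(i := x i + t *\<^sub>R e)))) has_derivative
      (\<lambda>h. - (inverse (u x) * (h *\<^sub>R pd i e u x) * inverse (u x)))) (at 0)"
    using Deriv.has_derivative_inverse[OF _ Ck_on_slice[OF assms(1,3,4,2), unfolded has_vector_derivative_def]]
      assms(5) by simp
  thus "((\<lambda>t::real. inverse (u (x(i := x i + t *\<^sub>R e)))) has_vector_derivative
      - (pd i e u x / (u x)\<^sup>2)) (at 0)"
    using assms(5) by (simp add: has_vector_derivative_def field_simps power2_eq_square)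
qed

text \<open>Restricting \<open>u\<close> to the real plane through \<open>x\<close> spanned by the
  two directions turns both iterated partial derivatives into iterated directional derivatives on a
  normed space, where the symmetry theorem applies.\<close>

lemma pd_commute:
  fixes u :: "(nat \<Rightarrow> 'a::euclidean_space) \<Rightarrow> 'b::real_normed_vector"
  assumes U: "openin (top_of_set (coord_space n)) U" and u: "Ck_on (Suc (Suc 0)) n U u" and x: "x \<in> U"
    and i: "i < n" "e \<in> Basis" and j: "j < n" "e' \<in> Basis"
  shows "pd i e (pd j e' u) x = pd j e' (pd i e u) x"
proof -
  \<comment> \<open>The displacements are added, not assigned, so the case i = j is included; it is
    needed for the real and imaginary directions of one complex coordinate.\<close>
  define c where "c y k = x k + (if k = i then fst y *\<^sub>R e else 0) + (if k = j then snd y *\<^sub>R e' else 0)"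
    for y :: "real \<times> real" and k
  define c' where "c' k h = (if k = i then fst h *\<^sub>R e else 0) + (if k = j then snd h *\<^sub>R e' else 0)"
    for h :: "real \<times> real" and k
  have xc: "x \<in> coord_space n" using x openin_imp_subset[OF U] by blast
  have c0: "c 0 = x" by (auto simp: c_def)
  have cc: "c y \<in> coord_space n" for y
    using xc i j by (auto simp: c_def coord_space_def)
  have bl: "bounded_linear (c' k)" for k
    using bounded_linear_compose[OF bounded_linear_scaleR_left bounded_linear_fst, of e]
      bounded_linear_compose[OF bounded_linear_scaleR_left bounded_linear_snd, of e']
    unfolding c'_def[abs_def]
    by (cases "k = i"; cases "k = j") (simp_all add: bounded_linear_add bounded_linear_zero)
  have ceq: "c y k = x k + c' k y" for y k by (simp add: c_def c'_def)
  have cd: "((\<lambda>y. c y k) has_derivative c' k) (at y)" for y k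
    unfolding ceq using bl[of k]
    by (auto intro!: derivative_eq_intros bounded_linear_imp_has_derivative)
  define N where "N = c -` U"
  have cont: "continuous_on UNIV c"
    by (rule continuous_on_coordinatewise_then_product)
      (metis cd continuous_at_imp_continuous_on has_derivative_continuous)
  obtain W where W: "open W" "U = coord_space n \<inter> W" using U by (auto simp: openin_open)
  have "N = c -` W" using W(2) cc by (auto simp: N_def)
  hence N: "open N" using W(1) cont by (simp add: open_vimage)
  have N0: "0 \<in> N" using x by (simp add: N_def c0)
  have td: "twice_diff N (\<lambda>y. u (c y))"
  proof (rule twice_diff_compose[OF U u N])
    show "twice_diff N (\<lambda>y. c y k)" for k
      unfolding ceq by (intro twice_diff_add twice_diff_const twice_diff_linear_map bl N)
  qed (simp add: N_def)
  have chain: "((\<lambda>y. w (c y)) has_derivative (\<lambda>h. \<Sum>k<n. \<Sum>b\<in>Basis. (c' k h \<bullet> b) *\<^sub>R pd k b w (c y))) (at y)"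
    if "Ck_on (Suc 0) n U w" "y \<in> N" for w :: "(nat \<Rightarrow> 'a) \<Rightarrow> 'b" and y
    by (rule C1_chain[OF U that(1)]) (use that(2) cc cd in \<open>auto simp: N_def\<close>)
  have fst_d: "(\<Sum>k<n. \<Sum>b\<in>Basis. (c' k (1, 0) \<bullet> b) *\<^sub>R pd k b w z) = pd i e w z" for w z
  proof -
    have "(\<Sum>k<n. \<Sum>b\<in>Basis. (c' k (1, 0) \<bullet> b) *\<^sub>R pd k b w z) = (\<Sum>k<n. if k = i then pd i e w z else 0)"
      using i by (intro sum.cong) (auto simp: c'_def inner_Basis if_distrib[of "\<lambda>r. r *\<^sub>R _"] cong: if_cong)
    thus ?thesis using i by simp
  qed
  have snd_d: "(\<Sum>k<n. \<Sum>b\<in>Basis. (c' k (0, 1) \<bullet> b) *\<^sub>R pd k b w z) = pd j e' w z" for w z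
  proof -
    have "(\<Sum>k<n. \<Sum>b\<in>Basis. (c' k (0, 1) \<bullet> b) *\<^sub>R pd k b w z) = (\<Sum>k<n. if k = j then pd j e' w z else 0)"
      using j by (intro sum.cong) (auto simp: c'_def inner_Basis if_distrib[of "\<lambda>r. r *\<^sub>R _"] cong: if_cong)
    thus ?thesis using j by simp
  qed
  have u1: "Ck_on (Suc 0) n U u" using u by (rule Ck_on_Suc_imp)
  have f1: "frechet_derivative (\<lambda>y. u (c y)) (at y) (1, 0) = pd i e u (c y)"
    and f2: "frechet_derivative (\<lambda>y. u (c y)) (at y) (0, 1) = pd j e' u (c y)" if "y \<in> N" for y
    using frechet_eqI[OF chain[OF u1 that]] fst_d snd_d by simp_all
  have p1: "Ck_on (Suc 0) n U (pd i e u)" and p2: "Ck_on (Suc 0) n U (pd j e' u)"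
    using Ck_on_pd[OF u] i j by auto
  have "((\<lambda>y. frechet_derivative (\<lambda>y. u (c y)) (at y) (1, 0)) has_derivative
      (\<lambda>h. \<Sum>k<n. \<Sum>b\<in>Basis. (c' k h \<bullet> b) *\<^sub>R pd k b (pd i e u) (c 0))) (at 0)"
    by (rule has_derivative_transform_within_open[OF chain[OF p1 N0] N N0]) (simp add: f1)
  hence g1: "frechet_derivative (\<lambda>y. frechet_derivative (\<lambda>y. u (c y)) (at y) (1, 0)) (at 0) (0, 1)
      = pd j e' (pd i e u) x"
    using snd_d[of "pd i e u" x] by (simp add: frechet_eqI c0)
  have "((\<lambda>y. frechet_derivative (\<lambda>y. u (c y)) (at y) (0, 1)) has_derivative
      (\<lambda>h. \<Sum>k<n. \<Sum>b\<in>Basis. (c' k h \<bullet> b) *\<^sub>R pd k b (pd j e' u) (c 0))) (at 0)"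
    by (rule has_derivative_transform_within_open[OF chain[OF p2 N0] N N0]) (simp add: f2)
  hence g2: "frechet_derivative (\<lambda>y. frechet_derivative (\<lambda>y. u (c y)) (at y) (0, 1)) (at 0) (1, 0)
      = pd i e (pd j e' u) x"
    using fst_d[of "pd j e' u" x] by (simp add: frechet_eqI c0)
  show ?thesis using frechet_commute[OF N td N0, of "(1, 0)" "(0, 1)"] g1 g2 by simp
qed

lemma smooth_on_imp_C1: "smooth_on n U u \<Longrightarrow> Ck_on (Suc 0) n U u"
  unfolding smooth_on_def by blast

lemma holomorphic_fun_on_smooth: "holomorphic_fun_on n U u \<Longrightarrow> smooth_on n U u"
  by (simp add: holomorphic_fun_on_def)

lemma smooth_on_pd: "smooth_on n U u \<Longrightarrow> i < n \<Longrightarrow> e \<in> Basis \<Longrightarrow> smooth_on n U (pd i e u)"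
  unfolding smooth_on_def using Ck_on_pd by blast

lemma smooth_on_add:
  "openin (top_of_set (coord_space n)) U \<Longrightarrow> smooth_on n U u \<Longrightarrow> smooth_on n U v \<Longrightarrow>
    smooth_on n U (\<lambda>x. u x + v x)"
  unfolding smooth_on_def using Ck_on_add by blast

lemma smooth_on_mult:
  fixes u v :: "(nat \<Rightarrow> 'a::euclidean_space) \<Rightarrow> 'b::real_normed_algebra"
  shows "openin (top_of_set (coord_space n)) U \<Longrightarrow> smooth_on n U u \<Longrightarrow> smooth_on n U v \<Longrightarrow>
    smooth_on n U (\<lambda>x. u x * v x)"
  unfolding smooth_on_def using Ck_on_mult by blast

lemma smooth_on_inverse:
  fixes u :: "(nat \<Rightarrow> 'a::euclidean_space) \<Rightarrow> 'b::real_normed_field"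
  shows "openin (top_of_set (coord_space n)) U \<Longrightarrow> smooth_on n U u \<Longrightarrow> (\<And>x. x \<in> U \<Longrightarrow> u x \<noteq> 0) \<Longrightarrow>
    smooth_on n U (\<lambda>x. inverse (u x))"
  unfolding smooth_on_def using Ck_on_inverse by blast

lemma smooth_on_const: "openin (top_of_set (coord_space n)) U \<Longrightarrow> smooth_on n U (\<lambda>x. c)"
  unfolding smooth_on_def using Ck_on_const by blast

lemma smooth_on_dz:
  assumes "openin (top_of_set (coord_space n)) U" "smooth_on n U u" "a < n"
  shows "smooth_on n U (dz a u)"
proof -
  have eq: "dz a u = (\<lambda>x. inverse 2 * (pd a 1 u x + (- \<i>) * pd a \<i> u x))"
    by (simp add: dz_def fun_eq_iff)
  show ?thesis unfolding eq
    by (intro smooth_on_mult smooth_on_add smooth_on_const smooth_on_pd assms)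
      (auto simp: Basis_complex_def)
qed

lemma dzbar_add:
  assumes "Ck_on (Suc 0) n U u" "Ck_on (Suc 0) n U v" "x \<in> U" "a < n"
  shows "dzbar a (\<lambda>x. u x + v x) x = dzbar a u x + dzbar a v x"
  using pd_add[OF assms(1-4), of 1] pd_add[OF assms(1-4), of \<i>]
  by (simp add: dzbar_def Basis_complex_def field_simps)

lemma dzbar_mult:
  assumes "Ck_on (Suc 0) n U u" "Ck_on (Suc 0) n U v" "x \<in> U" "a < n"
  shows "dzbar a (\<lambda>x. u x * v x) x = u x * dzbar a v x + dzbar a u x * v x"
  using pd_mult[OF assms(1-4), of 1] pd_mult[OF assms(1-4), of \<i>]
  by (simp add: dzbar_def Basis_complex_def field_simps)

lemma dzbar_inverse:
  assumes "Ck_on (Suc 0) n U u" "x \<in> U" "a < n" "u x \<noteq> 0"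
  shows "dzbar a (\<lambda>x. inverse (u x)) x = - (dzbar a u x / (u x)\<^sup>2)"
  using pd_inverse[OF assms(1-3) _ assms(4), of 1] pd_inverse[OF assms(1-3) _ assms(4), of \<i>]
  by (simp add: dzbar_def Basis_complex_def add_divide_distrib)

lemma dzbar_cong:
  assumes "openin (top_of_set (coord_space n)) U" "x \<in> U" "a < n" "\<And>y. y \<in> U \<Longrightarrow> u y = v y"
  shows "dzbar a u x = dzbar a v x"
  using pd_cong[OF assms(1-3), of u v] assms(4) by (simp add: dzbar_def)

lemma dz_cong:
  assumes "openin (top_of_set (coord_space n)) U" "x \<in> U" "a < n" "\<And>y. y \<in> U \<Longrightarrow> u y = v y"
  shows "dz a u x = dz a v x"
  using pd_cong[OF assms(1-3), of u v] assms(4) by (simp add: dz_def)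

lemma dzbar_const: "dzbar a (\<lambda>x. c) x = 0" and dz_const: "dz a (\<lambda>x. c) x = 0"
  by (simp_all add: dzbar_def dz_def pd_def)

lemma dzbar_dz_commute:
  assumes "openin (top_of_set (coord_space n)) U" "smooth_on n U u" "x \<in> U" "a < n" "b < n"
  shows "dzbar b (dz a u) x = dz a (dzbar b u) x"
proof -
  have u2: "Ck_on (Suc (Suc 0)) n U u" using assms(2) by (auto simp only: smooth_on_def)
  have c: "Ck_on (Suc 0) n U (pd k e u)" if "k < n" "e \<in> Basis" for k e using Ck_on_pd[OF u2 that] .
  have B: "1 \<in> (Basis :: complex set)" "\<i> \<in> (Basis :: complex set)" by (auto simp: Basis_complex_def)
  have lin: "pd k e (\<lambda>x. (pd l 1 u x + z * pd l \<i> u x) / 2) x = (pd k e (pd l 1 u) x + z * pd k e (pd l \<i> u) x) / 2"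
    if kl: "k < n" "l < n" "e \<in> Basis" for k l e z
  proof -
    have "pd k e (\<lambda>x. inverse 2 * (pd l 1 u x + z * pd l \<i> u x)) x
        = inverse 2 * (pd k e (pd l 1 u) x + z * pd k e (pd l \<i> u) x)"
      using pd_mult[OF Ck_on_const[OF assms(1)] Ck_on_add[OF assms(1) c[OF kl(2) B(1)]
          Ck_on_mult[OF assms(1) Ck_on_const[OF assms(1)] c[OF kl(2) B(2)]]] assms(3) kl(1,3), of "inverse 2" z]
        pd_add[OF c[OF kl(2) B(1)] Ck_on_mult[OF assms(1) Ck_on_const[OF assms(1)] c[OF kl(2) B(2)]] assms(3) kl(1,3), of z]
        pd_mult[OF Ck_on_const[OF assms(1)] c[OF kl(2) B(2)] assms(3) kl(1,3), of z]
      by (simp add: pd_def[of _ _ "\<lambda>x. _"])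
    thus ?thesis by (simp add: field_simps)
  qed
  have e1: "dz a u = (\<lambda>x. (pd a 1 u x + (- \<i>) * pd a \<i> u x) / 2)" by (simp add: dz_def fun_eq_iff)
  have e2: "dzbar b u = (\<lambda>x. (pd b 1 u x + \<i> * pd b \<i> u x) / 2)" by (simp add: dzbar_def fun_eq_iff)
  have com: "pd b e (pd a e' u) x = pd a e' (pd b e u) x" if "e \<in> Basis" "e' \<in> Basis" for e e'
    by (rule pd_commute[OF assms(1) u2 assms(3,5) that(1) assms(4) that(2)])
  show ?thesis
    unfolding dzbar_def[of b "dz a u"] dz_def[of a "dzbar b u"]
    unfolding e1 e2 lin[OF assms(5,4) B(1)] lin[OF assms(5,4) B(2)] lin[OF assms(4,5) B(1)] lin[OF assms(4,5) B(2)]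
    using com[OF B(1,1)] com[OF B(1,2)] com[OF B(2,1)] com[OF B(2,2)]
    by (simp add: field_simps)
qed

lemma holomorphic_fun_on_cong:
  assumes "openin (top_of_set (coord_space n)) U" "\<And>y. y \<in> U \<Longrightarrow> u y = v y" "holomorphic_fun_on n U u"
  shows "holomorphic_fun_on n U v"
proof -
  have "smooth_on n U v"
    using assms(3) Ck_on_cong_imp[OF assms(1,2)] by (auto simp: holomorphic_fun_on_def smooth_on_def)
  moreover have "dzbar a v x = 0" if "a < n" "x \<in> U" for a x
    using dzbar_cong[OF assms(1) that(2,1), of u v] assms(2,3) that by (simp add: holomorphic_fun_on_def)
  ultimately show ?thesis by (simp add: holomorphic_fun_on_def)
qed

lemma holomorphic_fun_on_subset: "holomorphic_fun_on n U u \<Longrightarrow> V \<subseteq> U \<Longrightarrow> holomorphic_fun_on n V u"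
  unfolding holomorphic_fun_on_def smooth_on_def using Ck_on_subset by blast

lemma holomorphic_fun_on_add:
  assumes "openin (top_of_set (coord_space n)) U" "holomorphic_fun_on n U u" "holomorphic_fun_on n U v"
  shows "holomorphic_fun_on n U (\<lambda>x. u x + v x)"
  using assms smooth_on_add[of n U u v] dzbar_add[of n U u v] smooth_on_imp_C1[of n U u] smooth_on_imp_C1[of n U v]
  by (simp add: holomorphic_fun_on_def)

lemma holomorphic_fun_on_mult:
  assumes "openin (top_of_set (coord_space n)) U" "holomorphic_fun_on n U u" "holomorphic_fun_on n U v"
  shows "holomorphic_fun_on n U (\<lambda>x. u x * v x)"
  using assms smooth_on_mult[of n U u v] dzbar_mult[of n U u v] smooth_on_imp_C1[of n U u] smooth_on_imp_C1[of n U v]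
  by (simp add: holomorphic_fun_on_def)

lemma holomorphic_fun_on_inverse:
  assumes "openin (top_of_set (coord_space n)) U" "holomorphic_fun_on n U u" "\<And>x. x \<in> U \<Longrightarrow> u x \<noteq> 0"
  shows "holomorphic_fun_on n U (\<lambda>x. inverse (u x))"
  using assms smooth_on_inverse[of n U u] dzbar_inverse[of n U u] smooth_on_imp_C1[of n U u]
  by (simp add: holomorphic_fun_on_def)

lemma holomorphic_fun_on_const:
  "openin (top_of_set (coord_space n)) U \<Longrightarrow> holomorphic_fun_on n U (\<lambda>x. c)"
  by (simp add: holomorphic_fun_on_def smooth_on_const dzbar_const)

lemma holomorphic_fun_on_sum:
  assumes "openin (top_of_set (coord_space n)) U" "\<And>j. j \<in> J \<Longrightarrow> holomorphic_fun_on n U (u j)"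
  shows "holomorphic_fun_on n U (\<lambda>x. \<Sum>j\<in>J. u j x)"
  using assms(2)
  by (induction J rule: infinite_finite_induct)
    (auto intro!: holomorphic_fun_on_add holomorphic_fun_on_const assms(1))

lemma pd_coord: "pd i e (\<lambda>x. x j) x = (if i = j then e else 0)"
proof (rule pd_eqI)
  show "((\<lambda>t::real. (x(i := x i + t *\<^sub>R e)) j) has_vector_derivative (if i = j then e else 0)) (at 0)"
  proof (cases "i = j")
    case True
    have "((\<lambda>t::real. x j + t *\<^sub>R e) has_vector_derivative e) (at 0)"
      by (auto simp: has_vector_derivative_def intro!: derivative_eq_intros)
    then show ?thesis using True by simp
  qed simp
qed

lemma holomorphic_fun_on_coord:
  "openin (top_of_set (coord_space n)) U \<Longrightarrow> j < n \<Longrightarrow> holomorphic_fun_on n U (\<lambda>x. x j)"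
  by (auto simp: holomorphic_fun_on_def smooth_on_def Ck_on_coord dzbar_def pd_coord)

text \<open>Needed for the entries of the Jacobian matrix, which occur in the fibre coordinates of
  the transition maps of P(T_M).\<close>

lemma holomorphic_fun_on_dz:
  assumes "openin (top_of_set (coord_space n)) U" "holomorphic_fun_on n U u" "a < n"
  shows "holomorphic_fun_on n U (dz a u)"
proof -
  have "dzbar b (dz a u) x = 0" if "b < n" "x \<in> U" for b x
  proof -
    have "dzbar b (dz a u) x = dz a (dzbar b u) x"
      by (rule dzbar_dz_commute[OF assms(1) holomorphic_fun_on_smooth[OF assms(2)] that(2) assms(3) that(1)])
    also have "\<dots> = dz a (\<lambda>x. 0) x"
      by (rule dz_cong[OF assms(1) that(2) assms(3)]) (use assms(2) that(1) in \<open>auto simp: holomorphic_fun_on_def\<close>)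
    finally show ?thesis by (simp add: dz_const)
  qed
  thus ?thesis using smooth_on_dz[OF assms(1) holomorphic_fun_on_smooth[OF assms(2)] assms(3)]
    by (simp add: holomorphic_fun_on_def)
qed

section \<open>Pullback along the projection to the first coordinates\<close>

text \<open>The induced charts of P(T_M) list the base coordinates first, so this is the bundle
  projection in coordinates. Padding by zeros keeps the result in the model space.\<close>

definition trunc :: "nat \<Rightarrow> (nat \<Rightarrow> 'a::zero) \<Rightarrow> nat \<Rightarrow> 'a"
  where "trunc n x = (\<lambda>j. if j < n then x j else 0)"

lemma trunc_in_coord_space [simp]: "trunc n x \<in> coord_space n"
  by (auto simp: trunc_def coord_space_def)

lemma trunc_upd: "trunc n (x(j := t)) = (if j < n then (trunc n x)(j := t) else trunc n x)"
  by (auto simp: trunc_def)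

lemma continuous_on_trunc: "continuous_on S (trunc n :: (nat \<Rightarrow> 'a::{zero,topological_space}) \<Rightarrow> _)"
proof (rule continuous_on_coordinatewise_then_product)
  show "continuous_on S (\<lambda>x :: nat \<Rightarrow> 'a. trunc n x i)" for i
    using continuous_on_subset[OF continuous_on_product_coordinates[of i] subset_UNIV]
    by (cases "i < n") (simp_all add: trunc_def)
qed

lemma openin_trunc:
  fixes U :: "(nat \<Rightarrow> 'a::{zero,topological_space}) set"
  assumes "openin (top_of_set (coord_space n)) U"
  shows "openin (top_of_set (coord_space N)) {x \<in> coord_space N. trunc n x \<in> U}"
proof -
  obtain W where W: "open W" "U = coord_space n \<inter> W" using assms by (auto simp: openin_open)
  have "{x \<in> coord_space N. trunc n x \<in> U} = coord_space N \<inter> trunc n -` W" using W(2) by auto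
  moreover have "open (trunc n -` W)" using W(1) continuous_on_trunc by (rule open_vimage)
  ultimately show ?thesis by (auto simp: openin_open)
qed

lemma pd_trunc: "pd j e (\<lambda>x. u (trunc n x)) x = (if j < n then pd j e u (trunc n x) else 0)"
  by (auto simp: pd_def trunc_upd) (simp add: trunc_def)

lemma Ck_on_trunc:
  assumes U: "openin (top_of_set (coord_space n)) U" and "Ck_on k n U u"
  shows "Ck_on k N {x \<in> coord_space N. trunc n x \<in> U} (\<lambda>x. u (trunc n x))"
  using assms(2)
proof (induction k arbitrary: u)
  case 0
  show ?case using 0 by (auto intro!: continuous_on_compose2[OF _ continuous_on_trunc])
next
  case (Suc k)
  let ?V = "{x \<in> coord_space N. trunc n x \<in> U}"
  show ?case
  proof (rule Ck_on_SucI[where u'="\<lambda>j e x. if j < n then pd j e u (trunc n x) else 0"])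
    show "openin (top_of_set (coord_space N)) ?V" by (rule openin_trunc[OF U])
    show "continuous_on ?V (\<lambda>x. u (trunc n x))"
      using Ck_on_continuous[OF Suc.prems] by (auto intro!: continuous_on_compose2[OF _ continuous_on_trunc])
  next
    fix j and e :: 'a and x assume *: "j < N" "e \<in> Basis" "x \<in> ?V"
    show "((\<lambda>t::real. u (trunc n (x(j := x j + t *\<^sub>R e)))) has_vector_derivative
        (if j < n then pd j e u (trunc n x) else 0)) (at 0)"
    proof (cases "j < n")
      case True
      have "trunc n (x(j := x j + t *\<^sub>R e)) = (trunc n x)(j := (trunc n x) j + t *\<^sub>R e)" for t
        using True by (auto simp: trunc_def)
      thus ?thesis using Ck_on_slice[OF Suc.prems True *(2)] *(3) True by (simp del: fun_upd_apply)
    qed (simp add: trunc_upd)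
  next
    fix j and e :: 'a assume *: "j < N" "e \<in> Basis"
    show "Ck_on k N ?V (\<lambda>x. if j < n then pd j e u (trunc n x) else 0)"
      using Suc.IH[of "pd j e u"] Ck_on_pd[OF Suc.prems _ *(2)] Ck_on_const[OF openin_trunc[OF U]]
      by (cases "j < n") auto
  qed
qed

lemma smooth_on_trunc:
  assumes "openin (top_of_set (coord_space n)) U" "smooth_on n U u"
  shows "smooth_on N {x \<in> coord_space N. trunc n x \<in> U} (\<lambda>x. u (trunc n x))"
  using Ck_on_trunc[OF assms(1)] assms(2) by (auto simp: smooth_on_def)

lemma holomorphic_fun_on_trunc:
  assumes "openin (top_of_set (coord_space n)) U" "holomorphic_fun_on n U u"
  shows "holomorphic_fun_on N {x \<in> coord_space N. trunc n x \<in> U} (\<lambda>x. u (trunc n x))"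
proof -
  have "dzbar a (\<lambda>x. u (trunc n x)) x = 0" if "trunc n x \<in> U" for a x
  proof (cases "a < n")
    case True
    then have "dzbar a (\<lambda>x. u (trunc n x)) x = dzbar a u (trunc n x)" by (simp add: dzbar_def pd_trunc)
    then show ?thesis using assms(2) that True by (simp add: holomorphic_fun_on_def)
  qed (simp add: dzbar_def pd_trunc)
  thus ?thesis using smooth_on_trunc[OF assms(1) holomorphic_fun_on_smooth[OF assms(2)]]
    by (simp add: holomorphic_fun_on_def)
qed

section \<open>The projectivised tangent bundle\<close>

lemma holomorphic_fun_on_continuous: "holomorphic_fun_on n U u \<Longrightarrow> continuous_on U u"
  unfolding holomorphic_fun_on_def smooth_on_def using Ck_on_continuous by blast

lemma complex_line_scale:
  assumes "c \<noteq> 0"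
  shows "complex_line (\<lambda>a. c * v a) = complex_line v"
proof -
  have "(\<lambda>a. k * v a) = (\<lambda>a. (k / c) * (c * v a))" for k using assms by (simp add: fun_eq_iff)
  moreover have "(\<lambda>a. k * (c * v a)) = (\<lambda>a. (k * c) * v a)" for k by (simp add: fun_eq_iff mult.assoc)
  ultimately show ?thesis unfolding complex_line_def by blast
qed

lemma complex_line_self: "v \<in> complex_line v"
  unfolding complex_line_def by (auto intro!: exI[of _ 1])

text \<open>The fibre coordinates of the chart \<open>proj_chart n A \<kappa> i\<close> as a vector with \<open>i\<close>-th entry \<open>1\<close>.\<close>

definition hom_vec :: "nat \<Rightarrow> nat \<Rightarrow> (nat \<Rightarrow> complex) \<Rightarrow> nat \<Rightarrow> complex"
  where "hom_vec n i x j = (if j = i then 1 else if j < i then x (n + j) else x (n + j - 1))"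

lemma hom_vec_self [simp]: "hom_vec n i x i = 1"
  by (simp add: hom_vec_def)

lemma hom_vec_index:
  assumes "i < n" "k < n" "k \<noteq> i"
  shows "\<exists>j. n \<le> j \<and> j < 2 * n - 1 \<and> k = (if j - n < i then j - n else Suc (j - n)) \<and>
    (\<forall>x. hom_vec n i x k = x j)"
proof (cases "k < i")
  case True
  show ?thesis by (rule exI[of _ "n + k"]) (use True assms in \<open>auto simp: hom_vec_def\<close>)
next
  case False
  show ?thesis by (rule exI[of _ "n + k - 1"]) (use False assms in \<open>auto simp: hom_vec_def\<close>)
qed

lemma hom_vec_at:
  assumes "n \<le> j"
  shows "hom_vec n i x (if j - n < i then j - n else Suc (j - n)) = x j"
  using assms by (auto simp: hom_vec_def)

lemma continuous_hom_vec: "continuous_on S (\<lambda>x. hom_vec n i x j)"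
  using continuous_on_subset[OF continuous_on_product_coordinates subset_UNIV]
  by (cases "j = i"; cases "j < i") (simp_all add: hom_vec_def)

lemma holomorphic_hom_vec:
  assumes "openin (top_of_set (coord_space (2 * n - 1))) U" "i < n" "j < n"
  shows "holomorphic_fun_on (2 * n - 1) U (\<lambda>x. hom_vec n i x j)"
  using assms
  by (cases "j = i"; cases "j < i")
    (auto simp: hom_vec_def intro!: holomorphic_fun_on_coord holomorphic_fun_on_const)

context complex_manifold
begin

lemma proj_domE:
  assumes "q \<in> proj_dom n A \<kappa> i"
  obtains v where "q = (fst q, complex_line v)" "fst q \<in> fst \<kappa>" "v \<in> tangent_space n A (fst q)" "v (\<kappa>, i) = 1"
    "fst q \<in> points A"
proof -
  obtain p v w where q: "q = (p, complex_line v)" "p \<in> points A" "v \<in> tangent_space n A p" "p \<in> fst \<kappa>"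
      "w \<in> complex_line v" "w (\<kappa>, i) \<noteq> 0"
    using assms by (auto simp: proj_dom_def proj_tangent_def)
  have nz: "v (\<kappa>, i) \<noteq> 0" using q(5,6) by (auto simp: complex_line_def)
  define v' where "v' = (\<lambda>a. inverse (v (\<kappa>, i)) * v a)"
  have "complex_line v' = complex_line v" unfolding v'_def by (rule complex_line_scale) (use nz in simp)
  moreover have "v' \<in> tangent_space n A p" unfolding v'_def by (rule tangent_space_scale[OF q(3)])
  ultimately show ?thesis using q nz by (intro that[of v']) (auto simp: v'_def)
qed

lemma proj_domI:
  assumes "\<kappa> \<in> A" "p \<in> fst \<kappa>" "v \<in> tangent_space n A p" "v (\<kappa>, i) \<noteq> 0"
  shows "(p, complex_line v) \<in> proj_dom n A \<kappa> i"
proof -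
  have "p \<in> points A" "v \<noteq> (\<lambda>a. 0)" using assms by (auto simp: points_def)
  thus ?thesis using assms complex_line_self[of v] by (auto simp: proj_dom_def proj_tangent_def)
qed

lemma taut_frame_eq:
  assumes "v (\<kappa>, i) = 1"
  shows "taut_frame \<kappa> i (p, complex_line v) = v"
  unfolding taut_frame_def
proof (rule the_equality)
  show "v \<in> snd (p, complex_line v) \<and> v (\<kappa>, i) = 1" using assms complex_line_self by simp
  fix w assume "w \<in> snd (p, complex_line v) \<and> w (\<kappa>, i) = 1"
  then show "w = v" using assms by (auto simp: complex_line_def)
qed

lemma taut_frame_props:
  assumes "q \<in> proj_dom n A \<kappa> i"
  shows "taut_frame \<kappa> i q \<in> tangent_space n A (fst q)" "taut_frame \<kappa> i q (\<kappa>, i) = 1"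
    "snd q = complex_line (taut_frame \<kappa> i q)" "fst q \<in> fst \<kappa>" "fst q \<in> points A"
proof -
  obtain v where v: "q = (fst q, complex_line v)" "fst q \<in> fst \<kappa>" "v \<in> tangent_space n A (fst q)"
    "v (\<kappa>, i) = 1" "fst q \<in> points A" using proj_domE[OF assms] .
  have sq: "snd q = complex_line v" using v(1) by (metis snd_conv)
  have "taut_frame \<kappa> i q = v" using taut_frame_eq[of v \<kappa> i "fst q", OF v(4)] v(1) by simp
  thus "taut_frame \<kappa> i q \<in> tangent_space n A (fst q)" "taut_frame \<kappa> i q (\<kappa>, i) = 1"
    "snd q = complex_line (taut_frame \<kappa> i q)" "fst q \<in> fst \<kappa>" "fst q \<in> points A"
    using v sq by simp_all
qed

text \<open>All vectors of a line are multiples of its frame vector, so a component vanishes on the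
  whole line as soon as it vanishes on that vector.\<close>

lemma proj_dom_iff:
  assumes "q \<in> proj_dom n A \<kappa> i" "\<kappa>' \<in> A"
  shows "q \<in> proj_dom n A \<kappa>' i' \<longleftrightarrow> fst q \<in> fst \<kappa>' \<and> taut_frame \<kappa> i q (\<kappa>', i') \<noteq> 0"
proof
  assume q': "q \<in> proj_dom n A \<kappa>' i'"
  have "taut_frame \<kappa>' i' q \<in> complex_line (taut_frame \<kappa> i q)"
    using taut_frame_props(3)[OF q'] taut_frame_props(3)[OF assms(1)] complex_line_self by metis
  then show "fst q \<in> fst \<kappa>' \<and> taut_frame \<kappa> i q (\<kappa>', i') \<noteq> 0"
    using taut_frame_props(2,4)[OF q'] by (auto simp: complex_line_def)
next
  assume *: "fst q \<in> fst \<kappa>' \<and> taut_frame \<kappa> i q (\<kappa>', i') \<noteq> 0"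
  have "(fst q, complex_line (taut_frame \<kappa> i q)) \<in> proj_dom n A \<kappa>' i'"
    by (rule proj_domI) (use * assms(2) taut_frame_props[OF assms(1)] in auto)
  thus "q \<in> proj_dom n A \<kappa>' i'" using taut_frame_props(3)[OF assms(1)] by (metis prod.collapse)
qed

text \<open>This factor is the transition function of the tautological bundle and at the same time
  the denominator in the change of inhomogeneous coordinates.\<close>

lemma taut_frame_change:
  assumes "q \<in> proj_dom n A \<kappa> i" "q \<in> proj_dom n A \<kappa>' i'"
  shows "taut_frame \<kappa>' i' q = (\<lambda>a. inverse (taut_frame \<kappa> i q (\<kappa>', i')) * taut_frame \<kappa> i q a)"
proof -
  have "taut_frame \<kappa>' i' q \<in> complex_line (taut_frame \<kappa> i q)"
    using taut_frame_props(3)[OF assms(1)] taut_frame_props(3)[OF assms(2)] complex_line_self by metis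
  then obtain c where c: "taut_frame \<kappa>' i' q = (\<lambda>a. c * taut_frame \<kappa> i q a)" by (auto simp: complex_line_def)
  have "c * taut_frame \<kappa> i q (\<kappa>', i') = 1" using taut_frame_props(2)[OF assms(2)] c by metis
  hence "c = inverse (taut_frame \<kappa> i q (\<kappa>', i'))" by (metis inverse_unique mult.commute)
  thus ?thesis using c by simp
qed

section \<open>The induced charts and their transition maps\<close>

text \<open>An explicit inverse of the induced chart, through which functions on P(T_M) are computed
  in coordinates.\<close>

definition proj_point :: "('p, complex) chart \<Rightarrow> nat \<Rightarrow> (nat \<Rightarrow> complex) \<Rightarrow> 'p ptangent"
  where "proj_point \<kappa> i x = (let p = chart_inv \<kappa> (trunc n x) in
    (p, complex_line (tangent_vec \<kappa> (hom_vec n i x) p)))"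

text \<open>The coordinates of all lines over \<open>S\<close> that lie in one induced chart: a
  cylinder, since the fibre coordinates are unrestricted. That is why the index \<open>i\<close>
  does not occur.\<close>

definition proj_region :: "('p, complex) chart \<Rightarrow> 'p set \<Rightarrow> (nat \<Rightarrow> complex) set"
  where "proj_region \<kappa> S = {x \<in> coord_space (2 * n - 1). trunc n x \<in> snd \<kappa> ` (fst \<kappa> \<inter> S)}"

lemma fst_proj_point: "fst (proj_point \<kappa> i x) = chart_inv \<kappa> (trunc n x)"
  by (simp add: proj_point_def Let_def)

lemma proj_region_chart_inv:
  assumes "\<kappa> \<in> A" "x \<in> proj_region \<kappa> S"
  shows "chart_inv \<kappa> (trunc n x) \<in> fst \<kappa>" "chart_inv \<kappa> (trunc n x) \<in> S"
    "snd \<kappa> (chart_inv \<kappa> (trunc n x)) = trunc n x"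
  using assms by (auto simp: proj_region_def)

lemma openin_proj_region:
  "\<kappa> \<in> A \<Longrightarrow> openin (mtop A) S \<Longrightarrow> openin (top_of_set (coord_space (2 * n - 1))) (proj_region \<kappa> S)"
  unfolding proj_region_def by (intro openin_trunc openin_chart_image)

lemma proj_point_in_dom:
  assumes "\<kappa> \<in> A" "i < n" "x \<in> proj_region \<kappa> S"
  shows "proj_point \<kappa> i x \<in> proj_dom n A \<kappa> i"
    and "taut_frame \<kappa> i (proj_point \<kappa> i x) = tangent_vec \<kappa> (hom_vec n i x) (chart_inv \<kappa> (trunc n x))"
proof -
  note p = proj_region_chart_inv[OF assms(1,3)]
  have c: "tangent_vec \<kappa> (hom_vec n i x) (chart_inv \<kappa> (trunc n x)) (\<kappa>, i) = 1"
    using tangent_vec_component[OF assms(1) p(1) assms(2)] by simp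
  show "proj_point \<kappa> i x \<in> proj_dom n A \<kappa> i"
    unfolding proj_point_def Let_def
    by (rule proj_domI) (use assms p c tangent_vec_in_tangent_space in auto)
  show "taut_frame \<kappa> i (proj_point \<kappa> i x) = tangent_vec \<kappa> (hom_vec n i x) (chart_inv \<kappa> (trunc n x))"
    unfolding proj_point_def Let_def by (rule taut_frame_eq) (rule c)
qed

lemma proj_chart_in_coord_space: "snd (proj_chart n A \<kappa> i) q \<in> coord_space (2 * n - 1)"
  by (auto simp: proj_chart_def coord_space_def)

lemma fst_proj_chart [simp]: "fst (proj_chart n A \<kappa> i) = proj_dom n A \<kappa> i"
  by (simp add: proj_chart_def)

lemma snd_proj_chart: "snd (proj_chart n A \<kappa> i) q j = (if j < n then snd \<kappa> (fst q) j
    else if j < 2 * n - 1 then taut_frame \<kappa> i q (\<kappa>, if j - n < i then j - n else Suc (j - n)) else 0)"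
  by (simp add: proj_chart_def)

lemma trunc_proj_chart:
  assumes "\<kappa> \<in> A" "i < n" "q \<in> proj_dom n A \<kappa> i"
  shows "trunc n (snd (proj_chart n A \<kappa> i) q) = snd \<kappa> (fst q)"
proof -
  have "snd \<kappa> (fst q) \<in> coord_space n"
    by (rule chart_in_coord_space[OF assms(1) taut_frame_props(4)[OF assms(3)]])
  thus ?thesis by (auto simp: trunc_def snd_proj_chart fun_eq_iff coord_space_def)
qed

lemma proj_point_proj_chart:
  assumes "\<kappa> \<in> A" "i < n" "q \<in> proj_dom n A \<kappa> i"
  shows "proj_point \<kappa> i (snd (proj_chart n A \<kappa> i) q) = q"
    and "fst q \<in> S \<Longrightarrow> snd (proj_chart n A \<kappa> i) q \<in> proj_region \<kappa> S"
proof -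
  note t = trunc_proj_chart[OF assms] and v = taut_frame_props[OF assms(3)]
  have hv: "hom_vec n i (snd (proj_chart n A \<kappa> i) q) k = taut_frame \<kappa> i q (\<kappa>, k)" if k: "k < n" for k
  proof (cases "k = i")
    case False
    obtain j where j: "n \<le> j" "j < 2 * n - 1" "k = (if j - n < i then j - n else Suc (j - n))"
      "\<forall>x. hom_vec n i x k = x j" using hom_vec_index[OF assms(2) k False] by blast
    show ?thesis unfolding j(4)[rule_format] snd_proj_chart using j(1-3) by simp
  qed (simp add: v(2))
  have "tangent_vec \<kappa> (hom_vec n i (snd (proj_chart n A \<kappa> i) q)) (fst q) = taut_frame \<kappa> i q"
  proof -
    have "tangent_vec \<kappa> (hom_vec n i (snd (proj_chart n A \<kappa> i) q)) (fst q)
        = tangent_vec \<kappa> (\<lambda>k. taut_frame \<kappa> i q (\<kappa>, k)) (fst q)"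
      by (rule tangent_vec_cong) (rule hv)
    thus ?thesis using tangent_space_eq_tangent_vec[OF assms(1) v(4,1)] by simp
  qed
  thus "proj_point \<kappa> i (snd (proj_chart n A \<kappa> i) q) = q"
    using assms v unfolding proj_point_def Let_def t by simp (metis prod.collapse)
  show "snd (proj_chart n A \<kappa> i) q \<in> proj_region \<kappa> S" if "fst q \<in> S"
    unfolding proj_region_def using that t v(4) proj_chart_in_coord_space by auto
qed

lemma proj_chart_proj_point:
  assumes "\<kappa> \<in> A" "i < n" "x \<in> proj_region \<kappa> S"
  shows "snd (proj_chart n A \<kappa> i) (proj_point \<kappa> i x) = x"
proof
  fix j
  note p = proj_region_chart_inv[OF assms(1,3)]
  show "snd (proj_chart n A \<kappa> i) (proj_point \<kappa> i x) j = x j"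
  proof (cases "j < n")
    case True
    then show ?thesis by (simp add: snd_proj_chart fst_proj_point p(3)) (simp add: trunc_def)
  next
    case False
    show ?thesis
    proof (cases "j < 2 * n - 1")
      case True
      have lt: "(if j - n < i then j - n else Suc (j - n)) < n" using True False assms(2) by auto
      have "snd (proj_chart n A \<kappa> i) (proj_point \<kappa> i x) j
          = hom_vec n i x (if j - n < i then j - n else Suc (j - n))"
        unfolding snd_proj_chart proj_point_in_dom(2)[OF assms]
        using False True tangent_vec_component[OF assms(1) p(1) lt] by simp
      also have "\<dots> = x j" by (rule hom_vec_at) (use False in simp)
      finally show ?thesis .
    next
      case *: False
      then show ?thesis using assms(3) False by (simp add: snd_proj_chart proj_region_def coord_space_def)
    qed
  qed
qed

lemma proj_chart_image:
  assumes "\<kappa> \<in> A" "i < n"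
  shows "snd (proj_chart n A \<kappa> i) ` {q \<in> proj_dom n A \<kappa> i. fst q \<in> S} = proj_region \<kappa> S"
proof (intro equalityI subsetI)
  fix x assume "x \<in> proj_region \<kappa> S"
  thus "x \<in> snd (proj_chart n A \<kappa> i) ` {q \<in> proj_dom n A \<kappa> i. fst q \<in> S}"
    using proj_chart_proj_point[OF assms, of x S] proj_point_in_dom(1)[OF assms, of x S]
      proj_region_chart_inv[OF assms(1), of x S] fst_proj_point[of \<kappa> i x]
    by (metis (mono_tags, lifting) imageI mem_Collect_eq)
qed (use proj_point_proj_chart(2)[OF assms] in auto)

lemma chart_inv_proj_chart:
  assumes "\<kappa> \<in> A" "i < n" "x \<in> proj_region \<kappa> S"
  shows "chart_inv (proj_chart n A \<kappa> i) x = proj_point \<kappa> i x"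
  unfolding chart_inv_def
proof (rule inv_into_f_eq)
  show "inj_on (snd (proj_chart n A \<kappa> i)) (fst (proj_chart n A \<kappa> i))"
    by (rule inj_on_inverseI[of _ "proj_point \<kappa> i"]) (simp add: proj_point_proj_chart(1)[OF assms(1,2)])
qed (use proj_point_in_dom(1)[OF assms] proj_chart_proj_point[OF assms] in auto)

text \<open>The components in another chart of the frame vector; the fibre part of every transition
  map, and every transition function of the line bundle, is a quotient of two of these.\<close>

definition hom_comp :: "('p, complex) chart \<Rightarrow> nat \<Rightarrow> ('p, complex) chart \<Rightarrow> nat \<Rightarrow> (nat \<Rightarrow> complex) \<Rightarrow> complex"
  where "hom_comp \<kappa> i \<kappa>' k x = taut_frame \<kappa> i (proj_point \<kappa> i x) (\<kappa>', k)"

text \<open>In coordinates it is a row of the Jacobian matrix, pulled back from the base, multiplied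
  by the vector of homogeneous coordinates; both factors are holomorphic.\<close>

lemma hom_comp_holomorphic:
  assumes "\<kappa> \<in> A" "i < n" "\<kappa>' \<in> A" "k < n"
  shows "holomorphic_fun_on (2 * n - 1) (proj_region \<kappa> (fst \<kappa>')) (hom_comp \<kappa> i \<kappa>' k)"
proof -
  let ?U = "proj_region \<kappa> (fst \<kappa>')"
  have U: "openin (top_of_set (coord_space (2 * n - 1))) ?U"
    by (intro openin_proj_region assms openin_chart_domain)
  let ?V = "snd \<kappa> ` (fst \<kappa> \<inter> fst \<kappa>')"
  let ?\<tau> = "\<lambda>x. snd \<kappa>' (chart_inv \<kappa> x) k"
  have "holomorphic_fun_on (2 * n - 1) ?U (\<lambda>x. \<Sum>a<n. dz a ?\<tau> (trunc n x) * hom_vec n i x a)"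
  proof (intro holomorphic_fun_on_sum holomorphic_fun_on_mult U holomorphic_hom_vec assms)
    fix a assume a: "a \<in> {..<n}"
    have "holomorphic_fun_on n ?V (dz a ?\<tau>)"
      by (intro holomorphic_fun_on_dz chart_open holomorphic_transition assms) (use a in simp)
    from holomorphic_fun_on_trunc[OF chart_open[OF assms(1,3)] this]
    show "holomorphic_fun_on (2 * n - 1) ?U (\<lambda>x. dz a ?\<tau> (trunc n x))"
      unfolding proj_region_def by simp
  qed auto
  thus ?thesis
  proof (rule holomorphic_fun_on_cong[OF U, rotated])
    fix x assume x: "x \<in> ?U"
    note p = proj_region_chart_inv[OF assms(1) x]
    show "(\<Sum>a<n. dz a ?\<tau> (trunc n x) * hom_vec n i x a) = hom_comp \<kappa> i \<kappa>' k x"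
      unfolding hom_comp_def proj_point_in_dom(2)[OF assms(1,2) x]
      using p assms jac_eq_dz[OF assms(1,3,4) p(1,2)] by (simp add: tangent_vec_def)
  qed
qed

lemma proj_overlap_image:
  assumes "\<kappa> \<in> A" "i < n" "\<kappa>' \<in> A"
  shows "snd (proj_chart n A \<kappa> i) ` (proj_dom n A \<kappa> i \<inter> proj_dom n A \<kappa>' i') =
    {x \<in> proj_region \<kappa> (fst \<kappa>'). hom_comp \<kappa> i \<kappa>' i' x \<noteq> 0}"
proof -
  let ?S = "{q \<in> proj_dom n A \<kappa> i. fst q \<in> fst \<kappa>'}"
  have 1: "proj_dom n A \<kappa> i \<inter> proj_dom n A \<kappa>' i' = {q \<in> ?S. taut_frame \<kappa> i q (\<kappa>', i') \<noteq> 0}"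
    using proj_dom_iff[OF _ assms(3)] by blast
  have inv: "proj_point \<kappa> i (snd (proj_chart n A \<kappa> i) q) = q" if "q \<in> ?S" for q
    using proj_point_proj_chart(1)[OF assms(1,2)] that by blast
  have 2: "snd (proj_chart n A \<kappa> i) ` {q \<in> ?S. taut_frame \<kappa> i q (\<kappa>', i') \<noteq> 0} =
      {x \<in> snd (proj_chart n A \<kappa> i) ` ?S. taut_frame \<kappa> i (proj_point \<kappa> i x) (\<kappa>', i') \<noteq> 0}"
  proof (intro equalityI subsetI)
    fix x assume "x \<in> snd (proj_chart n A \<kappa> i) ` {q \<in> ?S. taut_frame \<kappa> i q (\<kappa>', i') \<noteq> 0}"
    then obtain q where q: "q \<in> ?S" "taut_frame \<kappa> i q (\<kappa>', i') \<noteq> 0" "x = snd (proj_chart n A \<kappa> i) q" by blast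
    show "x \<in> {x \<in> snd (proj_chart n A \<kappa> i) ` ?S. taut_frame \<kappa> i (proj_point \<kappa> i x) (\<kappa>', i') \<noteq> 0}"
      using q(1,2) inv[OF q(1)] unfolding q(3) by (metis (mono_tags, lifting) imageI mem_Collect_eq)
  next
    fix x assume x: "x \<in> {x \<in> snd (proj_chart n A \<kappa> i) ` ?S. taut_frame \<kappa> i (proj_point \<kappa> i x) (\<kappa>', i') \<noteq> 0}"
    then obtain q where q: "q \<in> ?S" "x = snd (proj_chart n A \<kappa> i) q" by blast
    have "taut_frame \<kappa> i q (\<kappa>', i') \<noteq> 0" using x inv[OF q(1)] q(2) by simp
    thus "x \<in> snd (proj_chart n A \<kappa> i) ` {q \<in> ?S. taut_frame \<kappa> i q (\<kappa>', i') \<noteq> 0}" using q by blast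
  qed
  show ?thesis unfolding 1 2 proj_chart_image[OF assms(1,2)] hom_comp_def ..
qed

lemma openin_hom_comp_nz:
  assumes "\<kappa> \<in> A" "i < n" "\<kappa>' \<in> A" "i' < n"
  shows "openin (top_of_set (coord_space (2 * n - 1))) {x \<in> proj_region \<kappa> (fst \<kappa>'). hom_comp \<kappa> i \<kappa>' i' x \<noteq> 0}"
proof -
  let ?U = "proj_region \<kappa> (fst \<kappa>')"
  have U: "openin (top_of_set (coord_space (2 * n - 1))) ?U"
    by (intro openin_proj_region assms openin_chart_domain)
  have "continuous_on ?U (hom_comp \<kappa> i \<kappa>' i')"
    by (rule holomorphic_fun_on_continuous[OF hom_comp_holomorphic[OF assms]])
  hence "openin (top_of_set ?U) (?U \<inter> hom_comp \<kappa> i \<kappa>' i' -` (- {0}))"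
    by (intro continuous_openin_preimage_gen) auto
  moreover have "?U \<inter> hom_comp \<kappa> i \<kappa>' i' -` (- {0}) = {x \<in> ?U. hom_comp \<kappa> i \<kappa>' i' x \<noteq> 0}" by auto
  ultimately show ?thesis using openin_trans U by metis
qed

text \<open>The base coordinates change as on M; a fibre coordinate becomes the component in the new
  chart divided by the component with index \<open>i'\<close>, which does not vanish on the
  overlap.\<close>

lemma proj_transition_holomorphic:
  assumes "\<kappa> \<in> A" "i < n" "\<kappa>' \<in> A" "i' < n" "k < 2 * n - 1"
  shows "holomorphic_fun_on (2 * n - 1) (snd (proj_chart n A \<kappa> i) ` (proj_dom n A \<kappa> i \<inter> proj_dom n A \<kappa>' i'))
    (\<lambda>x. snd (proj_chart n A \<kappa>' i') (chart_inv (proj_chart n A \<kappa> i) x) k)"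
  unfolding proj_overlap_image[OF assms(1-3)]
proof -
  let ?U = "{x \<in> proj_region \<kappa> (fst \<kappa>'). hom_comp \<kappa> i \<kappa>' i' x \<noteq> 0}"
  note U = openin_hom_comp_nz[OF assms(1-4)]
  have q: "proj_point \<kappa> i x \<in> proj_dom n A \<kappa> i" "proj_point \<kappa> i x \<in> proj_dom n A \<kappa>' i'"
    if "x \<in> ?U" for x
  proof -
    show 1: "proj_point \<kappa> i x \<in> proj_dom n A \<kappa> i" using proj_point_in_dom(1)[OF assms(1,2)] that by blast
    show "proj_point \<kappa> i x \<in> proj_dom n A \<kappa>' i'"
      unfolding proj_dom_iff[OF 1 assms(3)] fst_proj_point
      using that proj_region_chart_inv(2)[OF assms(1)] by (auto simp: hom_comp_def)
  qed
  show "holomorphic_fun_on (2 * n - 1) ?U (\<lambda>x. snd (proj_chart n A \<kappa>' i') (chart_inv (proj_chart n A \<kappa> i) x) k)"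
  proof (cases "k < n")
    case True
    have "holomorphic_fun_on (2 * n - 1) (proj_region \<kappa> (fst \<kappa>')) (\<lambda>x. snd \<kappa>' (chart_inv \<kappa> (trunc n x)) k)"
      unfolding proj_region_def
      by (rule holomorphic_fun_on_trunc[OF chart_open[OF assms(1,3)] holomorphic_transition[OF assms(1,3) True]])
    hence "holomorphic_fun_on (2 * n - 1) ?U (\<lambda>x. snd \<kappa>' (chart_inv \<kappa> (trunc n x)) k)"
      by (rule holomorphic_fun_on_subset) auto
    thus ?thesis
    proof (rule holomorphic_fun_on_cong[OF U, rotated])
      fix x assume "x \<in> ?U"
      hence "chart_inv (proj_chart n A \<kappa> i) x = proj_point \<kappa> i x" using chart_inv_proj_chart[OF assms(1,2)] by blast
      thus "snd \<kappa>' (chart_inv \<kappa> (trunc n x)) k = snd (proj_chart n A \<kappa>' i') (chart_inv (proj_chart n A \<kappa> i) x) k"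
        using True by (simp add: snd_proj_chart fst_proj_point)
    qed
  next
    case False
    let ?k = "if k - n < i' then k - n else Suc (k - n)"
    have k: "?k < n" using False assms(4,5) by auto
    have sub: "?U \<subseteq> proj_region \<kappa> (fst \<kappa>')" by auto
    have "holomorphic_fun_on (2 * n - 1) ?U (\<lambda>x. inverse (hom_comp \<kappa> i \<kappa>' i' x) * hom_comp \<kappa> i \<kappa>' ?k x)"
      by (intro holomorphic_fun_on_mult holomorphic_fun_on_inverse U
          holomorphic_fun_on_subset[OF hom_comp_holomorphic[OF assms(1-3) k] sub]
          holomorphic_fun_on_subset[OF hom_comp_holomorphic[OF assms(1-4)] sub]) auto
    thus ?thesis
    proof (rule holomorphic_fun_on_cong[OF U, rotated])
      fix x assume x: "x \<in> ?U"
      hence "chart_inv (proj_chart n A \<kappa> i) x = proj_point \<kappa> i x" using chart_inv_proj_chart[OF assms(1,2)] by blast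
      thus "inverse (hom_comp \<kappa> i \<kappa>' i' x) * hom_comp \<kappa> i \<kappa>' ?k x =
          snd (proj_chart n A \<kappa>' i') (chart_inv (proj_chart n A \<kappa> i) x) k"
        using False assms(5) taut_frame_change[OF q[OF x]] by (simp add: snd_proj_chart hom_comp_def)
    qed
  qed
qed

lemma proj_charted_atlas: "charted_atlas (2 * n - 1) (proj_atlas n A)"
proof
  fix \<mu> assume "\<mu> \<in> proj_atlas n A"
  then obtain \<kappa> i where \<mu>: "\<mu> = proj_chart n A \<kappa> i" "\<kappa> \<in> A" "i < n" by (auto simp: proj_atlas_def)
  show "inj_on (snd \<mu>) (fst \<mu>)" unfolding \<mu>(1)
    by (rule inj_on_inverseI[of _ "proj_point \<kappa> i"]) (simp add: proj_point_proj_chart(1)[OF \<mu>(2,3)])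
  fix \<mu>' assume "\<mu>' \<in> proj_atlas n A"
  then obtain \<kappa>' i' where \<mu>': "\<mu>' = proj_chart n A \<kappa>' i'" "\<kappa>' \<in> A" "i' < n" by (auto simp: proj_atlas_def)
  show "openin (top_of_set (coord_space (2 * n - 1))) (snd \<mu> ` (fst \<mu> \<inter> fst \<mu>'))"
    unfolding \<mu>(1) \<mu>'(1) fst_proj_chart proj_overlap_image[OF \<mu>(2,3) \<mu>'(2)]
    by (rule openin_hom_comp_nz[OF \<mu>(2,3) \<mu>'(2,3)])
  fix k assume "k < 2 * n - 1"
  from proj_transition_holomorphic[OF \<mu>(2,3) \<mu>'(2,3) this]
  show "continuous_on (snd \<mu> ` (fst \<mu> \<inter> fst \<mu>')) (\<lambda>x. snd \<mu>' (chart_inv \<mu> x) k)"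
    unfolding \<mu>(1) \<mu>'(1) fst_proj_chart by (rule holomorphic_fun_on_continuous)
qed

sublocale proj: charted_atlas "2 * n - 1" "proj_atlas n A"
  by (rule proj_charted_atlas)

lemma proj_chart_in_atlas: "\<kappa> \<in> A \<Longrightarrow> i < n \<Longrightarrow> proj_chart n A \<kappa> i \<in> proj_atlas n A"
  unfolding proj_atlas_def by blast

lemma points_proj_atlas: "points (proj_atlas n A) = (\<Union>\<kappa>\<in>A. \<Union>i<n. proj_dom n A \<kappa> i)"
proof (intro equalityI subsetI)
  fix q assume "q \<in> points (proj_atlas n A)"
  then obtain \<kappa> i where "\<kappa> \<in> A" "i < n" "q \<in> fst (proj_chart n A \<kappa> i)"
    unfolding points_def proj_atlas_def by blast
  thus "q \<in> (\<Union>\<kappa>\<in>A. \<Union>i<n. proj_dom n A \<kappa> i)" unfolding fst_proj_chart by blast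
next
  fix q assume "q \<in> (\<Union>\<kappa>\<in>A. \<Union>i<n. proj_dom n A \<kappa> i)"
  then obtain \<kappa> i where "\<kappa> \<in> A" "i < n" "q \<in> fst (proj_chart n A \<kappa> i)" unfolding fst_proj_chart by blast
  thus "q \<in> points (proj_atlas n A)" unfolding points_def using proj_chart_in_atlas by blast
qed

section \<open>The topology of P(T_M)\<close>

lemma openin_proj_preimage:
  assumes "\<kappa> \<in> A" "i < n" "openin (mtop A) S" "open W"
  shows "openin (mtop (proj_atlas n A)) {q \<in> proj_dom n A \<kappa> i. fst q \<in> S \<and> snd (proj_chart n A \<kappa> i) q \<in> W}"
proof -
  have "openin (top_of_set (coord_space (2 * n - 1))) (proj_region \<kappa> S \<inter> W)"
    using openin_proj_region[OF assms(1,3)] assms(4) by (simp add: openin_Int_open)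
  from proj.openin_chart_preimage_rel[OF proj_chart_in_atlas[OF assms(1,2)] this]
  have "openin (mtop (proj_atlas n A)) {q \<in> proj_dom n A \<kappa> i. snd (proj_chart n A \<kappa> i) q \<in> proj_region \<kappa> S \<inter> W}"
    by simp
  moreover have "snd (proj_chart n A \<kappa> i) q \<in> proj_region \<kappa> S \<longleftrightarrow> fst q \<in> S" if "q \<in> proj_dom n A \<kappa> i" for q
    using proj_point_proj_chart[OF assms(1,2) that] proj_region_chart_inv(2)[OF assms(1)] fst_proj_point by metis
  ultimately show ?thesis by (simp cong: conj_cong)
qed

lemma openin_proj_fst:
  assumes "openin (mtop A) S"
  shows "openin (mtop (proj_atlas n A)) {q \<in> points (proj_atlas n A). fst q \<in> S}"
proof -
  have "{q \<in> points (proj_atlas n A). fst q \<in> S} = (\<Union>\<kappa>\<in>A. \<Union>i<n. {q \<in> proj_dom n A \<kappa> i. fst q \<in> S})"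
    by (auto simp: points_proj_atlas)
  moreover have "openin (mtop (proj_atlas n A)) \<dots>"
    using openin_proj_preimage[OF _ _ assms open_UNIV] by (intro openin_Union) auto
  ultimately show ?thesis by simp
qed

text \<open>A tangent vector is determined by its components in one chart, so a nonzero one has a
  nonzero component in every chart around its base point.\<close>

lemma proj_point_cases:
  assumes "q \<in> points (proj_atlas n A)" "\<kappa> \<in> A" "fst q \<in> fst \<kappa>"
  obtains i where "i < n" "q \<in> proj_dom n A \<kappa> i"
proof -
  obtain \<kappa>1 i1 where q1: "q \<in> proj_dom n A \<kappa>1 i1" "\<kappa>1 \<in> A" "i1 < n" using assms(1) by (auto simp: points_proj_atlas)
  have "\<exists>i<n. taut_frame \<kappa>1 i1 q (\<kappa>, i) \<noteq> 0"
  proof (rule ccontr)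
    assume "\<not> ?thesis"
    hence "taut_frame \<kappa>1 i1 q = (\<lambda>a. 0 * taut_frame \<kappa>1 i1 q a)"
      by (intro tangent_space_eqI[OF assms(2,3)] tangent_space_scale taut_frame_props(1)[OF q1(1)]) auto
    moreover have "taut_frame \<kappa>1 i1 q (\<kappa>1, i1) = 1" by (rule taut_frame_props(2)[OF q1(1)])
    ultimately show False by (metis mult_zero_left zero_neq_one)
  qed
  then obtain i where "i < n" "taut_frame \<kappa>1 i1 q (\<kappa>, i) \<noteq> 0" by blast
  thus ?thesis using that proj_dom_iff[OF q1(1) assms(2)] assms(3) by blast
qed

text \<open>Lines over different points are separated on M, and two lines in a common induced chart
  by their coordinates. The remaining case is a pair over one point such that each line lies outside
  the chart chosen for the other.\<close>

lemma proj_Hausdorff: "Hausdorff_space (mtop (proj_atlas n A))"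
  unfolding Hausdorff_space_def proj.topspace_mtop
proof (intro allI impI)
  let ?X = "mtop (proj_atlas n A)"
  fix q q' assume *: "q \<in> points (proj_atlas n A) \<and> q' \<in> points (proj_atlas n A) \<and> q \<noteq> q'"
  obtain \<kappa> i where q: "q \<in> proj_dom n A \<kappa> i" "\<kappa> \<in> A" "i < n" using * by (auto simp: points_proj_atlas)
  note v = taut_frame_props[OF q(1)]
  obtain \<kappa>' i' where q': "q' \<in> proj_dom n A \<kappa>' i'" "\<kappa>' \<in> A" "i' < n" using * by (auto simp: points_proj_atlas)
  show "\<exists>U V. openin ?X U \<and> openin ?X V \<and> q \<in> U \<and> q' \<in> V \<and> disjnt U V"
  proof (cases "fst q = fst q'")
    case False
    have "fst q \<in> topspace (mtop A)" "fst q' \<in> topspace (mtop A)"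
      using v(5) taut_frame_props(5)[OF q'(1)] by (simp_all add: topspace_mtop)
    then obtain U V where UV: "openin (mtop A) U" "openin (mtop A) V" "fst q \<in> U" "fst q' \<in> V" "disjnt U V"
      using hausdorff False unfolding Hausdorff_space_def by blast
    show ?thesis
      by (intro exI conjI) (rule openin_proj_fst[OF UV(1)], rule openin_proj_fst[OF UV(2)],
        use * UV(3-5) in \<open>auto simp: disjnt_iff\<close>)
  next
    case True
    obtain j where j: "j < n" "q' \<in> proj_dom n A \<kappa> j"
      using proj_point_cases[of q' \<kappa>] * q(2) v(4) True by auto
    note v' = taut_frame_props[OF j(2)]
    have sep: ?thesis if k: "k < n" "q \<in> proj_dom n A \<kappa> k" "q' \<in> proj_dom n A \<kappa> k" for k
    proof -
      have neq: "snd (proj_chart n A \<kappa> k) q \<noteq> snd (proj_chart n A \<kappa> k) q'"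
        using proj_point_proj_chart(1)[OF q(2) k(1)] k * by metis
      obtain W W' where W: "open W" "open W'" "snd (proj_chart n A \<kappa> k) q \<in> W"
        "snd (proj_chart n A \<kappa> k) q' \<in> W'" "W \<inter> W' = {}"
        using iffD1[OF separation_t2 neq] by (elim exE conjE) rule
      show ?thesis
        by (intro exI conjI)
          (rule openin_proj_preimage[OF q(2) k(1) openin_chart_domain[OF q(2)] W(1)],
           rule openin_proj_preimage[OF q(2) k(1) openin_chart_domain[OF q(2)] W(2)],
           use k W v v' in \<open>auto simp: disjnt_iff\<close>)
    qed
    show ?thesis
    proof (cases "q' \<in> proj_dom n A \<kappa> i \<or> q \<in> proj_dom n A \<kappa> j")
      case True
      then show ?thesis using sep q(1,3) j by blast
    next
      case False
      \<comment> \<open>The lines on which the j-th component is smaller in modulus than the i-th.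
        In the remaining case \<open>q\<close> lies in \<open>T i j\<close> and \<open>q'\<close> in
        \<open>T j i\<close>, because the component in question is 0; the two sets are disjoint
        because the two ratios are inverse to each other.\<close>
      define T where "T i j = {q \<in> proj_dom n A \<kappa> i. fst q \<in> fst \<kappa> \<and>
        snd (proj_chart n A \<kappa> i) q \<in> {x. norm (hom_vec n i x j) < 1}}" for i j
      have op: "openin ?X (T i j)" if "i < n" for i j
        unfolding T_def
        by (rule openin_proj_preimage[OF q(2) that openin_chart_domain[OF q(2)]])
          (intro open_Collect_less continuous_on_norm continuous_hom_vec continuous_on_const)
      have hv: "hom_vec n i (snd (proj_chart n A \<kappa> i) r) j = taut_frame \<kappa> i r (\<kappa>, j)"
        if "r \<in> proj_dom n A \<kappa> i" "i < n" "j < n" for r i j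
      proof -
        note r = proj_point_proj_chart[OF q(2) that(2,1)]
        have reg: "snd (proj_chart n A \<kappa> i) r \<in> proj_region \<kappa> UNIV" by (rule r(2)) simp
        show ?thesis
          using proj_point_in_dom(2)[OF q(2) that(2) reg] r(1)
            tangent_vec_component[OF q(2) proj_region_chart_inv(1)[OF q(2) reg] that(3)] by simp
      qed
      have "taut_frame \<kappa> i q (\<kappa>, j) = 0" "taut_frame \<kappa> j q' (\<kappa>, i) = 0"
        using False proj_dom_iff[OF q(1,2)] proj_dom_iff[OF j(2) q(2)] v(4) v'(4) by auto
      hence "q \<in> T i j" "q' \<in> T j i"
        using q j v(4) v'(4) hv[OF q(1,3) j(1)] hv[OF j(2,1) q(3)] by (auto simp: T_def)
      moreover have "disjnt (T i j) (T j i)"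
        unfolding disjnt_iff
      proof (intro allI notI)
        fix r assume r: "r \<in> T i j \<and> r \<in> T j i"
        have ri: "r \<in> proj_dom n A \<kappa> i" and rj: "r \<in> proj_dom n A \<kappa> j" using r by (simp_all add: T_def)
        have lt: "norm (taut_frame \<kappa> i r (\<kappa>, j)) < 1" "norm (taut_frame \<kappa> j r (\<kappa>, i)) < 1"
          using r hv[OF ri q(3) j(1)] hv[OF rj j(1) q(3)] by (simp_all add: T_def)
        have "taut_frame \<kappa> j r (\<kappa>, i) = inverse (taut_frame \<kappa> i r (\<kappa>, j))"
          using taut_frame_change[OF ri rj] taut_frame_props(2)[OF ri] by simp
        hence "norm (taut_frame \<kappa> j r (\<kappa>, i)) * norm (taut_frame \<kappa> i r (\<kappa>, j)) = 1"
          using proj_dom_iff[OF ri q(2)] rj by (simp add: norm_mult[symmetric])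
        moreover have "norm (taut_frame \<kappa> j r (\<kappa>, i)) * norm (taut_frame \<kappa> i r (\<kappa>, j)) < 1 * 1"
          using lt by (intro mult_strict_mono') auto
        ultimately show False by simp
      qed
      ultimately show ?thesis using op[OF q(3)] op[OF j(1)] by blast
    qed
  qed
qed

text \<open>The atlas may be uncountable, so a base cannot be indexed by charts. Instead one chart
  is chosen for every basic open set of M that fits into a chart, and the base is indexed by such
  sets, a component index and a basic open set of the model space.\<close>

lemma proj_second_countable: "second_countable (mtop (proj_atlas n A))"
proof -
  obtain \<B> where \<B>0: "countable \<B> \<and> (\<forall>V\<in>\<B>. openin (mtop A) V) \<and>
      (\<forall>U x. openin (mtop A) U \<and> x \<in> U \<longrightarrow> (\<exists>V\<in>\<B>. x \<in> V \<and> V \<subseteq> U))"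
    using second_countable unfolding second_countable_def by (elim exE) rule
  have \<B>: "countable \<B>" "\<And>V. V \<in> \<B> \<Longrightarrow> openin (mtop A) V"
    "\<And>U x. openin (mtop A) U \<Longrightarrow> x \<in> U \<Longrightarrow> \<exists>V\<in>\<B>. x \<in> V \<and> V \<subseteq> U"
    using \<B>0 by simp_all
  obtain \<W> :: "(nat \<Rightarrow> complex) set set" where \<W>: "countable \<W>" "topological_basis \<W>"
    using ex_countable_basis by blast
  define K where "K V = (SOME \<kappa>. \<kappa> \<in> A \<and> V \<subseteq> fst \<kappa>)" for V
  have K: "K V \<in> A" "V \<subseteq> fst (K V)" if "\<exists>\<kappa>\<in>A. V \<subseteq> fst \<kappa>" for V
    using someI_ex[of "\<lambda>\<kappa>. \<kappa> \<in> A \<and> V \<subseteq> fst \<kappa>"] that unfolding K_def by blast+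
  define S where "S V i W = {q \<in> proj_dom n A (K V) i. fst q \<in> V \<and> snd (proj_chart n A (K V) i) q \<in> W}" for V i W
  define \<B>' where "\<B>' = {V \<in> \<B>. \<exists>\<kappa>\<in>A. V \<subseteq> fst \<kappa>}"
  have "countable \<B>'" unfolding \<B>'_def using \<B>(1) by (rule countable_subset[rotated]) auto
  define \<C> where "\<C> = (\<lambda>(V, i, W). S V i W) ` (\<B>' \<times> {..<n} \<times> \<W>)"
  have "countable \<C>" unfolding \<C>_def using \<open>countable \<B>'\<close> \<W>(1) by (intro countable_image countable_SIGMA) auto
  moreover have "openin (mtop (proj_atlas n A)) C" if CC: "C \<in> \<C>" for C
  proof -
    obtain V i W where C0: "C = S V i W" "V \<in> \<B>'" "i < n" "W \<in> \<W>"
      using CC unfolding \<C>_def by auto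
    have C: "C = S V i W" "V \<in> \<B>" "\<exists>\<kappa>\<in>A. V \<subseteq> fst \<kappa>" "i < n" "W \<in> \<W>"
      using C0 unfolding \<B>'_def by blast+
    show ?thesis unfolding C(1) S_def
      by (rule openin_proj_preimage[OF K(1)[OF C(3)] C(4) \<B>(2)[OF C(2)] topological_basis_open[OF \<W>(2) C(5)]])
  qed
  moreover have "\<exists>C\<in>\<C>. q \<in> C \<and> C \<subseteq> U" if U: "openin (mtop (proj_atlas n A)) U" and q: "q \<in> U" for U q
  proof -
    have qp: "q \<in> points (proj_atlas n A)" using openin_subset[OF U] q proj.topspace_mtop by blast
    then obtain \<kappa> i where \<kappa>: "\<kappa> \<in> A" "q \<in> proj_dom n A \<kappa> i" by (auto simp: points_proj_atlas)
    obtain V where V: "V \<in> \<B>" "fst q \<in> V" "V \<subseteq> fst \<kappa>"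
      using \<B>(3)[OF openin_chart_domain[OF \<kappa>(1)] taut_frame_props(4)[OF \<kappa>(2)]] by blast
    have ex: "\<exists>\<kappa>\<in>A. V \<subseteq> fst \<kappa>" using V \<kappa> by blast
    note KV = K[OF ex]
    obtain j where j: "j < n" "q \<in> proj_dom n A (K V) j" using proj_point_cases[OF qp KV(1)] V(2) KV(2) by blast
    have mem: "proj_chart n A (K V) j \<in> proj_atlas n A" by (rule proj_chart_in_atlas[OF KV(1) j(1)])
    obtain W' where W': "open W'" "snd (proj_chart n A (K V) j) ` (proj_dom n A (K V) j \<inter> U) = coord_space (2 * n - 1) \<inter> W'"
      using proj.openin_chart_image[OF U mem] by (auto simp: openin_open)
    have "snd (proj_chart n A (K V) j) q \<in> W'" using W'(2) j(2) q by blast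
    then obtain W where W: "W \<in> \<W>" "snd (proj_chart n A (K V) j) q \<in> W" "W \<subseteq> W'"
      using topological_basisE[OF \<W>(2) W'(1)] by blast
    have "S V j W \<subseteq> U"
    proof
      fix r assume r: "r \<in> S V j W"
      hence rd: "r \<in> proj_dom n A (K V) j" by (simp add: S_def)
      have "snd (proj_chart n A (K V) j) r \<in> snd (proj_chart n A (K V) j) ` (proj_dom n A (K V) j \<inter> U)"
        unfolding W'(2) using r W(3) proj_chart_in_coord_space by (auto simp: S_def)
      then obtain r' where "r' \<in> proj_dom n A (K V) j" "r' \<in> U"
        "snd (proj_chart n A (K V) j) r = snd (proj_chart n A (K V) j) r'" by auto
      thus "r \<in> U" using proj_point_proj_chart(1)[OF KV(1) j(1)] rd by metis
    qed
    moreover have "q \<in> S V j W" using j V W by (simp add: S_def)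
    moreover have "S V j W \<in> \<C>" unfolding \<C>_def
      by (rule image_eqI[of _ _ "(V, j, W)"]) (use V(1) ex j(1) W(1) in \<open>simp_all add: \<B>'_def\<close>)
    ultimately show ?thesis by blast
  qed
  ultimately show ?thesis unfolding second_countable_def by blast
qed

text \<open>Within one induced chart the fibre is an affine space, so the two lines are joined by a
  segment of fibre coordinates. A clopen set pulls back to a clopen subset of the real line.\<close>

lemma proj_clopen_fibre_chart:
  assumes T: "openin (mtop (proj_atlas n A)) T" "openin (mtop (proj_atlas n A)) (points (proj_atlas n A) - T)"
    and \<kappa>: "\<kappa> \<in> A" "i < n" and q: "q \<in> proj_dom n A \<kappa> i" "q' \<in> proj_dom n A \<kappa> i" "fst q = fst q'" "q \<in> T"
  shows "q' \<in> T"
proof -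
  let ?x = "snd (proj_chart n A \<kappa> i) q" and ?x' = "snd (proj_chart n A \<kappa> i) q'"
  define c where "c t = (\<lambda>j. ?x j + of_real t * (?x' j - ?x j))" for t :: real
  have xx: "?x \<in> coord_space (2 * n - 1)" "?x' \<in> coord_space (2 * n - 1)" by (rule proj_chart_in_coord_space)+
  have "trunc n ?x = trunc n ?x'" using trunc_proj_chart[OF \<kappa>] q by simp
  hence tr: "trunc n (c t) = trunc n ?x" for t
    by (auto simp: trunc_def c_def fun_eq_iff split: if_splits)
  have reg: "c t \<in> proj_region \<kappa> UNIV" for t
    using xx tr trunc_proj_chart[OF \<kappa> q(1)] taut_frame_props(4)[OF q(1)]
    by (auto simp: proj_region_def c_def coord_space_def)
  have cont: "continuous_on UNIV c"
    unfolding c_def by (intro continuous_on_coordinatewise_then_product continuous_intros)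
  have op: "open (c -` (snd (proj_chart n A \<kappa> i) ` (proj_dom n A \<kappa> i \<inter> V)))"
    if V: "openin (mtop (proj_atlas n A)) V" for V
  proof -
    obtain W where W: "open W" "snd (proj_chart n A \<kappa> i) ` (proj_dom n A \<kappa> i \<inter> V) = coord_space (2 * n - 1) \<inter> W"
      using proj.openin_chart_image[OF V proj_chart_in_atlas[OF \<kappa>]] by (auto simp: openin_open)
    have "c -` (snd (proj_chart n A \<kappa> i) ` (proj_dom n A \<kappa> i \<inter> V)) = c -` W"
      unfolding W(2) using reg by (auto simp: proj_region_def)
    thus ?thesis using W(1) cont by (simp add: open_vimage)
  qed
  have mem: "c t \<in> snd (proj_chart n A \<kappa> i) ` (proj_dom n A \<kappa> i \<inter> V) \<longleftrightarrow> proj_point \<kappa> i (c t) \<in> V" for t V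
  proof
    assume "c t \<in> snd (proj_chart n A \<kappa> i) ` (proj_dom n A \<kappa> i \<inter> V)"
    then obtain r where "r \<in> proj_dom n A \<kappa> i" "r \<in> V" "c t = snd (proj_chart n A \<kappa> i) r" by blast
    thus "proj_point \<kappa> i (c t) \<in> V" using proj_point_proj_chart(1)[OF \<kappa>] by simp
  next
    assume "proj_point \<kappa> i (c t) \<in> V"
    thus "c t \<in> snd (proj_chart n A \<kappa> i) ` (proj_dom n A \<kappa> i \<inter> V)"
      using proj_point_in_dom(1)[OF \<kappa> reg, of t] proj_chart_proj_point[OF \<kappa> reg, of t]
      by (intro image_eqI[of _ _ "proj_point \<kappa> i (c t)"]) simp_all
  qed
  let ?G = "{t. proj_point \<kappa> i (c t) \<in> T}"
  have "open ?G" using op[OF T(1)] by (simp add: vimage_def mem)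
  moreover have "open (- ?G)"
  proof -
    have "- ?G = {t. proj_point \<kappa> i (c t) \<in> points (proj_atlas n A) - T}"
      using proj_point_in_dom(1)[OF \<kappa> reg] \<kappa> by (auto simp: points_proj_atlas)
    thus ?thesis using op[OF T(2)] by (simp add: vimage_def mem)
  qed
  ultimately have "?G = {} \<or> ?G = UNIV" using clopen by (metis closed_def)
  moreover have "0 \<in> ?G" using q proj_point_proj_chart(1)[OF \<kappa> q(1)] by (simp add: c_def)
  ultimately have "1 \<in> ?G" by blast
  thus ?thesis using proj_point_proj_chart(1)[OF \<kappa> q(2)] by (simp add: c_def)
qed

lemma proj_clopen_fibre:
  assumes T: "openin (mtop (proj_atlas n A)) T" "openin (mtop (proj_atlas n A)) (points (proj_atlas n A) - T)"
    and q: "q \<in> T" "q' \<in> points (proj_atlas n A)" "fst q = fst q'"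
  shows "q' \<in> T"
proof -
  have qp: "q \<in> points (proj_atlas n A)" using openin_subset[OF T(1)] q(1) proj.topspace_mtop by blast
  obtain \<kappa> i where \<kappa>: "\<kappa> \<in> A" "i < n" "q \<in> proj_dom n A \<kappa> i" using qp by (auto simp: points_proj_atlas)
  obtain j where j: "j < n" "q' \<in> proj_dom n A \<kappa> j"
    using proj_point_cases[OF q(2) \<kappa>(1)] taut_frame_props(4)[OF \<kappa>(3)] q(3) by metis
  \<comment> \<open>All components of this vector in \<kappa> are 1, so its line belongs to every
    induced chart of \<kappa> and links any two of them.\<close>
  define r where "r = (fst q, complex_line (tangent_vec \<kappa> (\<lambda>_. 1) (fst q)))"
  have r: "r \<in> proj_dom n A \<kappa> k" if "k < n" for k
    unfolding r_def using taut_frame_props(4)[OF \<kappa>(3)] tangent_vec_component[OF \<kappa>(1) _ that] \<kappa>(1)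
    by (intro proj_domI tangent_vec_in_tangent_space) auto
  have "r \<in> T" by (rule proj_clopen_fibre_chart[OF T \<kappa>(1,2,3) r[OF \<kappa>(2)] _ q(1)]) (simp add: r_def)
  thus ?thesis
    by (rule proj_clopen_fibre_chart[OF T \<kappa>(1) j(1) r[OF j(1)] j(2), rotated]) (simp add: r_def q(3))
qed

text \<open>In coordinates the bundle projection is a coordinate projection, hence open.\<close>

lemma openin_image_fst:
  assumes "openin (mtop (proj_atlas n A)) T"
  shows "openin (mtop A) (fst ` T)"
  unfolding openin_subopen[of _ "fst ` T"]
proof (rule ballI)
  fix p assume "p \<in> fst ` T"
  then obtain q where q: "q \<in> T" "p = fst q" by auto
  have "q \<in> points (proj_atlas n A)" using openin_subset[OF assms] q(1) proj.topspace_mtop by blast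
  then obtain \<kappa> i where \<kappa>: "\<kappa> \<in> A" "i < n" "q \<in> proj_dom n A \<kappa> i" by (auto simp: points_proj_atlas)
  let ?c = "snd (proj_chart n A \<kappa> i)"
  have "openin (top_of_set (coord_space (2 * n - 1))) (?c ` (proj_dom n A \<kappa> i \<inter> T))"
    using proj.openin_chart_image[OF assms proj_chart_in_atlas[OF \<kappa>(1,2)]] by simp
  moreover have "?c q \<in> ?c ` (proj_dom n A \<kappa> i \<inter> T)" using \<kappa>(3) q(1) by blast
  ultimately obtain d where d: "d > 0" "coord_box (2 * n - 1) (?c q) d \<subseteq> ?c ` (proj_dom n A \<kappa> i \<inter> T)"
    using coord_box_subset_open by blast
  let ?B = "{p' \<in> fst \<kappa>. snd \<kappa> p' \<in> coord_box n (snd \<kappa> p) d}"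
  have pk: "p \<in> fst \<kappa>" using taut_frame_props(4)[OF \<kappa>(3)] q(2) by simp
  have "openin (mtop A) ?B" by (rule openin_chart_preimage_rel[OF \<kappa>(1) openin_coord_box])
  moreover have "p \<in> ?B" using pk center_in_coord_box[OF chart_in_coord_space[OF \<kappa>(1) pk] d(1)] by simp
  moreover have "?B \<subseteq> fst ` T"
  proof
    fix p' assume p': "p' \<in> ?B"
    \<comment> \<open>The base coordinates are those of \<open>p'\<close>; the fibre coordinates of
      \<open>q\<close> are kept, which leaves the point inside the box around
      \<open>q\<close>.\<close>
    define y where "y j = (if j < n then snd \<kappa> p' j else ?c q j)" for j
    have "y \<in> coord_box (2 * n - 1) (?c q) d"
      using p' d(1) trunc_proj_chart[OF \<kappa>] proj_chart_in_coord_space[of \<kappa> i q] \<kappa>(2)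
      by (auto simp: coord_box_def y_def coord_space_def snd_proj_chart q(2))
    then obtain q' where q': "q' \<in> proj_dom n A \<kappa> i" "q' \<in> T" "y = ?c q'" using d(2) by blast
    have "snd \<kappa> (fst q') = trunc n y" using trunc_proj_chart[OF \<kappa>(1,2) q'(1)] q'(3) by simp
    also have "\<dots> = snd \<kappa> p'"
      using p' by (auto simp: trunc_def y_def fun_eq_iff coord_box_def coord_space_def)
    finally have "fst q' = p'"
      using chart_inj[OF \<kappa>(1)] taut_frame_props(4)[OF q'(1)] p' by (auto dest: inj_onD)
    thus "p' \<in> fst ` T" using q'(2) by blast
  qed
  ultimately show "\<exists>B. openin (mtop A) B \<and> p \<in> B \<and> B \<subseteq> fst ` T" by blast
qed

text \<open>The fibres are connected, so a clopen set is a union of fibres. Since the projection is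
  open, the images of the set and of its complement would be disjoint open sets that cover
  M.\<close>

lemma proj_connected: "connected_space (mtop (proj_atlas n A))"
  unfolding connected_space_clopen_in proj.topspace_mtop
proof (intro allI impI)
  let ?X = "mtop (proj_atlas n A)" and ?P = "points (proj_atlas n A)"
  fix T assume "openin ?X T \<and> closedin ?X T"
  hence T: "openin ?X T" "openin ?X (?P - T)" "T \<subseteq> ?P"
    using proj.topspace_mtop openin_subset by (auto simp: closedin_def)
  show "T = {} \<or> T = ?P"
  proof (rule ccontr)
    assume "\<not> ?thesis"
    then obtain q q' where q: "q \<in> T" "q' \<in> ?P - T" using T(3) by blast
    have cov: "fst r \<in> points A" if "r \<in> ?P" for r
      using that taut_frame_props(5) unfolding points_proj_atlas by blast
    have npos: "n > 0" using q by (auto simp: points_proj_atlas)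
    have "points A \<subseteq> fst ` T \<union> fst ` (?P - T)"
    proof
      fix p assume "p \<in> points A"
      then obtain \<kappa> where \<kappa>: "\<kappa> \<in> A" "p \<in> fst \<kappa>" by (auto simp: points_def)
      have "(p, complex_line (tangent_vec \<kappa> (\<lambda>_. 1) p)) \<in> proj_dom n A \<kappa> 0"
        using \<kappa> tangent_vec_component[OF \<kappa> npos] by (intro proj_domI tangent_vec_in_tangent_space) auto
      hence "(p, complex_line (tangent_vec \<kappa> (\<lambda>_. 1) p)) \<in> ?P" using \<kappa> npos by (auto simp: points_proj_atlas)
      thus "p \<in> fst ` T \<union> fst ` (?P - T)" by (metis DiffI UnI1 UnI2 fst_conv image_eqI)
    qed
    moreover have "fst ` T \<inter> fst ` (?P - T) = {}"
      using proj_clopen_fibre[OF T(1,2)] by auto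
    ultimately show False
      using connected openin_image_fst[OF T(1)] openin_image_fst[OF T(2)] q
      unfolding connected_space_def topspace_mtop by blast
  qed
qed

lemma proj_complex_manifold: "complex_manifold (2 * n - 1) (proj_atlas n A)"
proof unfold_locales
  fix \<mu> \<mu>' k assume "\<mu> \<in> proj_atlas n A" "\<mu>' \<in> proj_atlas n A" and k: "k < 2 * n - 1"
  then obtain \<kappa> i \<kappa>' i' where "\<mu> = proj_chart n A \<kappa> i" "\<kappa> \<in> A" "i < n"
    "\<mu>' = proj_chart n A \<kappa>' i'" "\<kappa>' \<in> A" "i' < n" by (auto simp: proj_atlas_def)
  thus "holomorphic_fun_on (2 * n - 1) (snd \<mu> ` (fst \<mu> \<inter> fst \<mu>')) (\<lambda>x. snd \<mu>' (chart_inv \<mu> x) k)"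
    using proj_transition_holomorphic k by simp
qed (use proj.chart_inj' proj.chart_open' proj_Hausdorff proj_second_countable proj_connected in auto)

section \<open>The tautological bundle as a holomorphic line bundle\<close>

text \<open>RC-positivity is defined inside the locale \<open>holomorphic_line_bundle\<close>, so
  the hypothesis of the theorem can be opened only after the locale has been verified for this
  bundle.\<close>

lemma taut_line_bundle: "holomorphic_line_bundle (2 * n - 1) (proj_atlas n A) taut_fibre (taut_frames n A)"
proof (rule holomorphic_line_bundle.intro[OF proj_complex_manifold], unfold_locales)
  show "points (proj_atlas n A) \<subseteq> (\<Union>\<sigma>\<in>taut_frames n A. fst \<sigma>)"
    by (fastforce simp: points_proj_atlas taut_frames_def)
next
  fix \<sigma> assume "\<sigma> \<in> taut_frames n A"
  then obtain \<kappa> i where \<sigma>: "\<sigma> = (proj_dom n A \<kappa> i, taut_frame \<kappa> i)" "\<kappa> \<in> A" "i < n" by (auto simp: taut_frames_def)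
  show "openin (mtop (proj_atlas n A)) (fst \<sigma>)"
    using proj.openin_chart_domain[OF proj_chart_in_atlas[OF \<sigma>(2,3)]] \<sigma>(1) by simp
  show "snd \<sigma> q \<noteq> (\<lambda>a. 0) \<and> taut_fibre q = complex_line (snd \<sigma> q)" if "q \<in> fst \<sigma>" for q
    using taut_frame_props(2,3)[of q \<kappa> i] that \<sigma>(1) by (auto simp: taut_fibre_def)
  fix \<sigma>' assume "\<sigma>' \<in> taut_frames n A"
  then obtain \<kappa>' i' where \<sigma>': "\<sigma>' = (proj_dom n A \<kappa>' i', taut_frame \<kappa>' i')" "\<kappa>' \<in> A" "i' < n" by (auto simp: taut_frames_def)
  let ?t = "\<lambda>q. inverse (taut_frame \<kappa> i q (\<kappa>', i'))"
  have hol: "holomorphic_fun_on (2 * n - 1) (snd \<mu> ` (fst \<mu> \<inter> fst \<sigma> \<inter> fst \<sigma>')) (\<lambda>x. ?t (chart_inv \<mu> x))"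
    if "\<mu> \<in> proj_atlas n A" for \<mu>
  proof -
    obtain \<kappa>3 j where \<mu>: "\<mu> = proj_chart n A \<kappa>3 j" "\<kappa>3 \<in> A" "j < n" using \<open>\<mu> \<in> proj_atlas n A\<close> by (auto simp: proj_atlas_def)
    let ?U1 = "{x \<in> proj_region \<kappa>3 (fst \<kappa>). hom_comp \<kappa>3 j \<kappa> i x \<noteq> 0}"
    let ?U2 = "{x \<in> proj_region \<kappa>3 (fst \<kappa>'). hom_comp \<kappa>3 j \<kappa>' i' x \<noteq> 0}"
    have inj: "inj_on (snd (proj_chart n A \<kappa>3 j)) (proj_dom n A \<kappa>3 j)"
      using proj.chart_inj'[OF proj_chart_in_atlas[OF \<mu>(2,3)]] by simp
    have im: "snd \<mu> ` (fst \<mu> \<inter> fst \<sigma> \<inter> fst \<sigma>') = ?U1 \<inter> ?U2"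
    proof -
      have "fst \<mu> \<inter> fst \<sigma> \<inter> fst \<sigma>' = (proj_dom n A \<kappa>3 j \<inter> proj_dom n A \<kappa> i) \<inter> (proj_dom n A \<kappa>3 j \<inter> proj_dom n A \<kappa>' i')"
        by (auto simp: \<mu>(1) \<sigma>(1) \<sigma>'(1))
      thus ?thesis
        unfolding proj_overlap_image[OF \<mu>(2,3) \<sigma>(2), symmetric] proj_overlap_image[OF \<mu>(2,3) \<sigma>'(2), symmetric]
        using inj_on_image_Int[OF inj, of "proj_dom n A \<kappa>3 j \<inter> proj_dom n A \<kappa> i" "proj_dom n A \<kappa>3 j \<inter> proj_dom n A \<kappa>' i'"]
        by (simp add: \<mu>(1))
    qed
    have U: "openin (top_of_set (coord_space (2 * n - 1))) (?U1 \<inter> ?U2)"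
      by (intro openin_Int openin_hom_comp_nz \<mu> \<sigma> \<sigma>')
    \<comment> \<open>The transition function is compared with the frame of the third chart, whose
      components are holomorphic in the coordinates of that chart.\<close>
    have "holomorphic_fun_on (2 * n - 1) (?U1 \<inter> ?U2) (\<lambda>x. hom_comp \<kappa>3 j \<kappa> i x * inverse (hom_comp \<kappa>3 j \<kappa>' i' x))"
      by (intro holomorphic_fun_on_mult holomorphic_fun_on_inverse U
          holomorphic_fun_on_subset[OF hom_comp_holomorphic[OF \<mu>(2,3) \<sigma>(2,3)]]
          holomorphic_fun_on_subset[OF hom_comp_holomorphic[OF \<mu>(2,3) \<sigma>'(2,3)]]) auto
    thus ?thesis unfolding im
    proof (rule holomorphic_fun_on_cong[OF U, rotated])
      fix x assume x: "x \<in> ?U1 \<inter> ?U2"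
      have ci: "chart_inv \<mu> x = proj_point \<kappa>3 j x" unfolding \<mu>(1) using chart_inv_proj_chart[OF \<mu>(2,3)] x by blast
      have q3: "proj_point \<kappa>3 j x \<in> proj_dom n A \<kappa>3 j" using proj_point_in_dom(1)[OF \<mu>(2,3)] x by blast
      have q1: "proj_point \<kappa>3 j x \<in> proj_dom n A \<kappa> i"
        unfolding proj_dom_iff[OF q3 \<sigma>(2)] fst_proj_point
        using x proj_region_chart_inv(2)[OF \<mu>(2)] by (auto simp: hom_comp_def)
      show "hom_comp \<kappa>3 j \<kappa> i x * inverse (hom_comp \<kappa>3 j \<kappa>' i' x) = ?t (chart_inv \<mu> x)"
        unfolding ci using taut_frame_change[OF q3 q1] by (simp add: hom_comp_def)
    qed
  qed
  have eq: "\<forall>q \<in> fst \<sigma> \<inter> fst \<sigma>'. snd \<sigma>' q = (\<lambda>a. ?t q * snd \<sigma> q a)"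
    using taut_frame_change[of _ \<kappa> i \<kappa>' i'] by (simp add: \<sigma>(1) \<sigma>'(1))
  show "\<exists>t. (\<forall>q \<in> fst \<sigma> \<inter> fst \<sigma>'. snd \<sigma>' q = (\<lambda>a. t q * snd \<sigma> q a)) \<and>
      (\<forall>\<mu>\<in>proj_atlas n A. holomorphic_fun_on (2 * n - 1) (snd \<mu> ` (fst \<mu> \<inter> fst \<sigma> \<inter> fst \<sigma>')) (\<lambda>x. t (chart_inv \<mu> x)))"
    by (rule exI[of _ ?t], intro conjI eq ballI hol)
qed

end

section \<open>Connections and curvature in coordinates\<close>

type_synonym cvec = "nat \<Rightarrow> complex"

text \<open>The formula of \<open>riemann_comp\<close> for arbitrary connection coefficients, so
  that the tensor calculus can be done in an abstract chart.\<close>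

definition riem :: "nat \<Rightarrow> (nat \<Rightarrow> nat \<Rightarrow> nat \<Rightarrow> (nat \<Rightarrow> real) \<Rightarrow> real) \<Rightarrow> nat \<Rightarrow> nat \<Rightarrow> nat \<Rightarrow> nat \<Rightarrow> (nat \<Rightarrow> real) \<Rightarrow> real"
  where "riem m \<Gamma> l i j k x = pd i 1 (\<Gamma> l j k) x - pd j 1 (\<Gamma> l i k) x
    + (\<Sum>s<m. \<Gamma> s j k x * \<Gamma> l i s x - \<Gamma> s i k x * \<Gamma> l j s x)"

definition gam :: "nat \<Rightarrow> (nat \<Rightarrow> nat \<Rightarrow> nat \<Rightarrow> (nat \<Rightarrow> real) \<Rightarrow> real) \<Rightarrow> (nat \<Rightarrow> real) \<Rightarrow> cvec \<Rightarrow> cvec \<Rightarrow> cvec"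
  where "gam m \<Gamma> x a b l = (\<Sum>j<m. \<Sum>k<m. complex_of_real (\<Gamma> l j k x) * a j * b k)"

definition dgam :: "nat \<Rightarrow> (nat \<Rightarrow> nat \<Rightarrow> nat \<Rightarrow> (nat \<Rightarrow> real) \<Rightarrow> real) \<Rightarrow> (nat \<Rightarrow> real) \<Rightarrow> cvec \<Rightarrow> cvec \<Rightarrow> cvec \<Rightarrow> cvec"
  where "dgam m \<Gamma> x e a b l =
    (\<Sum>j<m. \<Sum>k<m. (\<Sum>i<m. complex_of_real (pd i 1 (\<Gamma> l j k) x) * e i) * a j * b k)"

definition curv :: "nat \<Rightarrow> (nat \<Rightarrow> nat \<Rightarrow> nat \<Rightarrow> (nat \<Rightarrow> real) \<Rightarrow> real) \<Rightarrow> (nat \<Rightarrow> real) \<Rightarrow> cvec \<Rightarrow> cvec \<Rightarrow> cvec \<Rightarrow> cvec"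
  where "curv m \<Gamma> x a b c l =
    (\<Sum>i<m. \<Sum>j<m. \<Sum>k<m. complex_of_real (riem m \<Gamma> l i j k x) * a i * b j * c k)"

text \<open>The complex bilinear, not sesquilinear, extension of the metric: covariant
  differentiation and curvature stay complex multilinear, and the squared Hermitian norm is the
  value on a vector and its conjugate.\<close>

definition ip :: "nat \<Rightarrow> (nat \<Rightarrow> nat \<Rightarrow> (nat \<Rightarrow> real) \<Rightarrow> real) \<Rightarrow> (nat \<Rightarrow> real) \<Rightarrow> cvec \<Rightarrow> cvec \<Rightarrow> complex"
  where "ip m G x a b = (\<Sum>i<m. \<Sum>j<m. complex_of_real (G i j x) * a i * b j)"

lemma gam_gam:
  "gam m \<Gamma> x a (gam m \<Gamma> x b c) l =
    (\<Sum>i<m. \<Sum>j<m. \<Sum>k<m. (\<Sum>s<m. complex_of_real (\<Gamma> s j k x * \<Gamma> l i s x)) * a i * b j * c k)"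
proof -
  have "gam m \<Gamma> x a (gam m \<Gamma> x b c) l =
      (\<Sum>i<m. \<Sum>s<m. \<Sum>j<m. \<Sum>k<m. complex_of_real (\<Gamma> s j k x * \<Gamma> l i s x) * a i * b j * c k)"
    unfolding gam_def by (simp add: sum_distrib_left mult_ac)
  also have "\<dots> = (\<Sum>i<m. \<Sum>j<m. \<Sum>s<m. \<Sum>k<m. complex_of_real (\<Gamma> s j k x * \<Gamma> l i s x) * a i * b j * c k)"
    by (intro sum.cong refl sum.swap)
  also have "\<dots> = (\<Sum>i<m. \<Sum>j<m. \<Sum>k<m. \<Sum>s<m. complex_of_real (\<Gamma> s j k x * \<Gamma> l i s x) * a i * b j * c k)"
    by (intro sum.cong refl sum.swap)
  finally show ?thesis by (simp add: sum_distrib_right)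
qed

lemma dgam_eq:
  "dgam m \<Gamma> x a b c l =
    (\<Sum>i<m. \<Sum>j<m. \<Sum>k<m. complex_of_real (pd i 1 (\<Gamma> l j k) x) * a i * b j * c k)"
proof -
  have "dgam m \<Gamma> x a b c l =
      (\<Sum>j<m. \<Sum>k<m. \<Sum>i<m. complex_of_real (pd i 1 (\<Gamma> l j k) x) * a i * b j * c k)"
    unfolding dgam_def by (simp add: sum_distrib_right)
  also have "\<dots> = (\<Sum>j<m. \<Sum>i<m. \<Sum>k<m. complex_of_real (pd i 1 (\<Gamma> l j k) x) * a i * b j * c k)"
    by (intro sum.cong refl sum.swap)
  also have "\<dots> = (\<Sum>i<m. \<Sum>j<m. \<Sum>k<m. complex_of_real (pd i 1 (\<Gamma> l j k) x) * a i * b j * c k)"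
    by (rule sum.swap)
  finally show ?thesis .
qed

text \<open>The curvature written with the Christoffel form and its derivative only. Antisymmetry,
  the Bianchi identity and the commutator formula are then cancellations of whole terms instead of
  manipulations of indices.\<close>

lemma curv_eq:
  "curv m \<Gamma> x a b c l = dgam m \<Gamma> x a b c l - dgam m \<Gamma> x b a c l
    + gam m \<Gamma> x a (gam m \<Gamma> x b c) l - gam m \<Gamma> x b (gam m \<Gamma> x a c) l"
proof -
  have 1: "dgam m \<Gamma> x b a c l = (\<Sum>i<m. \<Sum>j<m. \<Sum>k<m. complex_of_real (pd j 1 (\<Gamma> l i k) x) * a i * b j * c k)"
    unfolding dgam_eq by (subst sum.swap) (simp add: mult_ac)
  have 2: "gam m \<Gamma> x b (gam m \<Gamma> x a c) l =
      (\<Sum>i<m. \<Sum>j<m. \<Sum>k<m. (\<Sum>s<m. complex_of_real (\<Gamma> s i k x * \<Gamma> l j s x)) * a i * b j * c k)"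
    unfolding gam_gam by (subst sum.swap) (simp add: mult_ac)
  show ?thesis unfolding 1 2
    unfolding dgam_eq gam_gam curv_def sum_subtractf[symmetric] sum.distrib[symmetric]
    by (intro sum.cong refl) (simp add: riem_def sum_subtractf ring_distribs)
qed

lemma gam_add_right: "gam m \<Gamma> x a (\<lambda>k. b k + c k) l = gam m \<Gamma> x a b l + gam m \<Gamma> x a c l"
  by (simp add: gam_def sum.distrib algebra_simps)

lemma gam_cong: "(\<And>j. j < m \<Longrightarrow> a j = a' j) \<Longrightarrow> (\<And>j. j < m \<Longrightarrow> b j = b' j) \<Longrightarrow>
    gam m \<Gamma> x a b l = gam m \<Gamma> x a' b' l"
  unfolding gam_def by (intro sum.cong) auto

lemma ip_cong: "(\<And>j. j < m \<Longrightarrow> a j = a' j) \<Longrightarrow> (\<And>j. j < m \<Longrightarrow> b j = b' j) \<Longrightarrow>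
    ip m G x a b = ip m G x a' b'"
  unfolding ip_def by (intro sum.cong) auto

lemma curv_cong: "(\<And>j. j < m \<Longrightarrow> a j = a' j) \<Longrightarrow> (\<And>j. j < m \<Longrightarrow> b j = b' j) \<Longrightarrow>
    (\<And>j. j < m \<Longrightarrow> c j = c' j) \<Longrightarrow> curv m \<Gamma> x a b c l = curv m \<Gamma> x a' b' c' l"
  unfolding curv_def by (intro sum.cong) auto

lemma ip_add_left: "ip m G x (\<lambda>i. a i + a' i) b = ip m G x a b + ip m G x a' b"
  by (simp add: ip_def sum.distrib algebra_simps)

lemma ip_diff_left: "ip m G x (\<lambda>i. a i - a' i) b = ip m G x a b - ip m G x a' b"
  by (simp add: ip_def sum_subtractf algebra_simps)

lemma ip_add_right: "ip m G x a (\<lambda>i. b i + b' i) = ip m G x a b + ip m G x a b'"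
  by (simp add: ip_def sum.distrib algebra_simps)

lemma ip_diff_right: "ip m G x a (\<lambda>i. b i - b' i) = ip m G x a b - ip m G x a b'"
  by (simp add: ip_def sum_subtractf algebra_simps)

lemma ip_scale_left: "ip m G x (\<lambda>i. t * a i) b = t * ip m G x a b"
  by (simp add: ip_def sum_distrib_left mult_ac)

lemma ip_scale_right: "ip m G x a (\<lambda>i. t * b i) = t * ip m G x a b"
  by (simp add: ip_def sum_distrib_left mult_ac)

lemma cnj_ip: "cnj (ip m G x a b) = ip m G x (\<lambda>i. cnj (a i)) (\<lambda>i. cnj (b i))"
  by (simp add: ip_def)

lemma cnj_curv: "cnj (curv m \<Gamma> x a b c l) = curv m \<Gamma> x (\<lambda>i. cnj (a i)) (\<lambda>i. cnj (b i)) (\<lambda>i. cnj (c i)) l"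
  by (simp add: curv_def)

lemma cnj_gam: "cnj (gam m \<Gamma> x a b l) = gam m \<Gamma> x (\<lambda>i. cnj (a i)) (\<lambda>i. cnj (b i)) l"
  by (simp add: gam_def)

text \<open>The pairing of R(a, b)c with d; in this convention the numerator of the sectional
  curvature of a and b is the value on a, b, b, a.\<close>

definition Rm :: "nat \<Rightarrow> (nat \<Rightarrow> nat \<Rightarrow> nat \<Rightarrow> (nat \<Rightarrow> real) \<Rightarrow> real) \<Rightarrow> (nat \<Rightarrow> nat \<Rightarrow> (nat \<Rightarrow> real) \<Rightarrow> real)
    \<Rightarrow> (nat \<Rightarrow> real) \<Rightarrow> cvec \<Rightarrow> cvec \<Rightarrow> cvec \<Rightarrow> cvec \<Rightarrow> complex"
  where "Rm m \<Gamma> G x a b c d = ip m G x (curv m \<Gamma> x a b c) d"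

lemma curv_lin1: "curv m \<Gamma> x (\<lambda>i. a i + t * a' i) b c l = curv m \<Gamma> x a b c l + t * curv m \<Gamma> x a' b c l"
  by (simp add: curv_def sum.distrib sum_distrib_left algebra_simps)

lemma curv_lin2: "curv m \<Gamma> x a (\<lambda>i. b i + t * b' i) c l = curv m \<Gamma> x a b c l + t * curv m \<Gamma> x a b' c l"
  by (simp add: curv_def sum.distrib sum_distrib_left algebra_simps)

lemma curv_lin3: "curv m \<Gamma> x a b (\<lambda>i. c i + t * c' i) l = curv m \<Gamma> x a b c l + t * curv m \<Gamma> x a b c' l"
  by (simp add: curv_def sum.distrib sum_distrib_left algebra_simps)

lemma Rm_lin:
  "Rm m \<Gamma> G x (\<lambda>i. a i + t * a' i) b c d = Rm m \<Gamma> G x a b c d + t * Rm m \<Gamma> G x a' b c d"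
  "Rm m \<Gamma> G x a (\<lambda>i. b i + t * b' i) c d = Rm m \<Gamma> G x a b c d + t * Rm m \<Gamma> G x a b' c d"
  "Rm m \<Gamma> G x a b (\<lambda>i. c i + t * c' i) d = Rm m \<Gamma> G x a b c d + t * Rm m \<Gamma> G x a b c' d"
  "Rm m \<Gamma> G x a b c (\<lambda>i. d i + t * d' i) = Rm m \<Gamma> G x a b c d + t * Rm m \<Gamma> G x a b c d'"
  unfolding Rm_def curv_lin1 curv_lin2 curv_lin3 ip_add_left ip_add_right ip_scale_left ip_scale_right by simp_all

lemma Rm_real:
  "Im (Rm m \<Gamma> G x (\<lambda>i. complex_of_real (a i)) (\<lambda>i. complex_of_real (b i))
    (\<lambda>i. complex_of_real (c i)) (\<lambda>i. complex_of_real (d i))) = 0"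
proof -
  have "cnj (Rm m \<Gamma> G x (\<lambda>i. complex_of_real (a i)) (\<lambda>i. complex_of_real (b i))
    (\<lambda>i. complex_of_real (c i)) (\<lambda>i. complex_of_real (d i))) = Rm m \<Gamma> G x (\<lambda>i. complex_of_real (a i)) (\<lambda>i. complex_of_real (b i))
    (\<lambda>i. complex_of_real (c i)) (\<lambda>i. complex_of_real (d i))"
    unfolding Rm_def cnj_ip cnj_curv by simp
  from arg_cong[OF this, of Im] show ?thesis by simp
qed

section \<open>Metric, connection and curvature at a point of a chart\<close>

text \<open>The two characteristic properties of the Levi-Civita connection, symmetry and
  compatibility with the metric, are taken as axioms; the formula for the Christoffel symbols is
  used only to verify them.\<close>

locale metric_chart =
  fixes m :: nat and U :: "(nat \<Rightarrow> real) set"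
    and G :: "nat \<Rightarrow> nat \<Rightarrow> (nat \<Rightarrow> real) \<Rightarrow> real"
    and \<Gamma> :: "nat \<Rightarrow> nat \<Rightarrow> nat \<Rightarrow> (nat \<Rightarrow> real) \<Rightarrow> real"
  assumes U_open: "openin (top_of_set (coord_space m)) U"
    and G_C2: "i < m \<Longrightarrow> j < m \<Longrightarrow> Ck_on (Suc (Suc 0)) m U (G i j)"
    and Gam_C1: "l < m \<Longrightarrow> j < m \<Longrightarrow> k < m \<Longrightarrow> Ck_on (Suc 0) m U (\<Gamma> l j k)"
    and Gam_sym: "x \<in> U \<Longrightarrow> l < m \<Longrightarrow> j < m \<Longrightarrow> k < m \<Longrightarrow> \<Gamma> l j k x = \<Gamma> l k j x"
    and G_sym: "x \<in> U \<Longrightarrow> i < m \<Longrightarrow> j < m \<Longrightarrow> G i j x = G j i x"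
    and compat: "x \<in> U \<Longrightarrow> i < m \<Longrightarrow> j < m \<Longrightarrow> k < m \<Longrightarrow>
      pd k 1 (G i j) x = (\<Sum>l<m. \<Gamma> l k i x * G l j x) + (\<Sum>l<m. \<Gamma> l k j x * G i l x)"
    and posdef: "x \<in> U \<Longrightarrow> \<exists>i<m. a i \<noteq> 0 \<Longrightarrow> (\<Sum>i<m. \<Sum>j<m. G i j x * a i * a j) > 0"
begin

lemma G_C1: "i < m \<Longrightarrow> j < m \<Longrightarrow> Ck_on (Suc 0) m U (G i j)"
  using G_C2 Ck_on_Suc_imp by blast

lemma gam_sym: "x \<in> U \<Longrightarrow> l < m \<Longrightarrow> gam m \<Gamma> x a b l = gam m \<Gamma> x b a l"
  unfolding gam_def by (subst sum.swap) (auto intro!: sum.cong simp: Gam_sym mult_ac)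

lemma dgam_sym:
  assumes "x \<in> U" "l < m"
  shows "dgam m \<Gamma> x e a b l = dgam m \<Gamma> x e b a l"
proof -
  have "pd i 1 (\<Gamma> l j k) x = pd i 1 (\<Gamma> l k j) x" if "i < m" "j < m" "k < m" for i j k
    by (rule pd_cong[OF U_open assms(1) that(1)]) (use Gam_sym that assms(2) in auto)
  thus ?thesis unfolding dgam_def by (subst sum.swap) (auto intro!: sum.cong simp: mult_ac)
qed

lemma ip_sym: "x \<in> U \<Longrightarrow> ip m G x a b = ip m G x b a"
  unfolding ip_def by (subst sum.swap) (auto intro!: sum.cong simp: G_sym mult_ac)

lemma curv_antisym: "curv m \<Gamma> x a b c l = - curv m \<Gamma> x b a c l"
  unfolding curv_eq by simp

text \<open>The connection is symmetric, hence so are the Christoffel form and its derivative in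
  their last two arguments; the cyclic sum of \<open>curv_eq\<close> then cancels in pairs.\<close>

lemma bianchi:
  assumes "x \<in> U" "l < m"
  shows "curv m \<Gamma> x a b c l + curv m \<Gamma> x b c a l + curv m \<Gamma> x c a b l = 0"
proof -
  have g: "gam m \<Gamma> x a (gam m \<Gamma> x b c) l = gam m \<Gamma> x a (gam m \<Gamma> x c b) l" for a b c
    by (rule gam_cong) (auto intro: gam_sym assms(1))
  show ?thesis unfolding curv_eq
    using dgam_sym[OF assms, of a b c] dgam_sym[OF assms, of b a c] dgam_sym[OF assms, of c a b]
      g[of a b c] g[of b a c] g[of c a b] by simp
qed

text \<open>Compatibility with the metric, contracted with vectors. It replaces the derivative of
  the metric by Christoffel terms and so yields the product rule for covariant derivatives.\<close>

lemma dG_contract: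
  assumes "x \<in> U"
  shows "(\<Sum>i<m. \<Sum>j<m. (\<Sum>k<m. complex_of_real (pd k 1 (G i j) x) * e k) * a i * b j) =
    ip m G x (gam m \<Gamma> x e a) b + ip m G x a (gam m \<Gamma> x e b)"
proof -
  have 1: "ip m G x (gam m \<Gamma> x e a) b =
      (\<Sum>i<m. \<Sum>j<m. (\<Sum>k<m. complex_of_real (\<Sum>l<m. \<Gamma> l k i x * G l j x) * e k) * a i * b j)" for a b
  proof -
    have "ip m G x (gam m \<Gamma> x e a) b =
      (\<Sum>l<m. \<Sum>j<m. \<Sum>k<m. \<Sum>i<m. complex_of_real (\<Gamma> l k i x * G l j x) * e k * a i * b j)"
      unfolding ip_def gam_def by (simp add: sum_distrib_left sum_distrib_right mult_ac)
    also have "\<dots> = (\<Sum>j<m. \<Sum>l<m. \<Sum>k<m. \<Sum>i<m. complex_of_real (\<Gamma> l k i x * G l j x) * e k * a i * b j)"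
      by (rule sum.swap)
    also have "\<dots> = (\<Sum>j<m. \<Sum>l<m. \<Sum>i<m. \<Sum>k<m. complex_of_real (\<Gamma> l k i x * G l j x) * e k * a i * b j)"
      by (intro sum.cong refl sum.swap)
    also have "\<dots> = (\<Sum>j<m. \<Sum>i<m. \<Sum>l<m. \<Sum>k<m. complex_of_real (\<Gamma> l k i x * G l j x) * e k * a i * b j)"
      by (intro sum.cong refl sum.swap)
    also have "\<dots> = (\<Sum>i<m. \<Sum>j<m. \<Sum>l<m. \<Sum>k<m. complex_of_real (\<Gamma> l k i x * G l j x) * e k * a i * b j)"
      by (rule sum.swap)
    also have "\<dots> = (\<Sum>i<m. \<Sum>j<m. \<Sum>k<m. \<Sum>l<m. complex_of_real (\<Gamma> l k i x * G l j x) * e k * a i * b j)"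
      by (intro sum.cong refl sum.swap)
    finally show ?thesis by (simp add: sum_distrib_left sum_distrib_right)
  qed
  have 2: "ip m G x a (gam m \<Gamma> x e b) =
      (\<Sum>i<m. \<Sum>j<m. (\<Sum>k<m. complex_of_real (\<Sum>l<m. \<Gamma> l k j x * G i l x) * e k) * a i * b j)"
  proof -
    have "ip m G x a (gam m \<Gamma> x e b) = ip m G x (gam m \<Gamma> x e b) a" by (rule ip_sym[OF assms])
    also have "\<dots> = (\<Sum>j<m. \<Sum>i<m. (\<Sum>k<m. complex_of_real (\<Sum>l<m. \<Gamma> l k j x * G l i x) * e k) * b j * a i)"
      by (rule 1)
    also have "\<dots> = (\<Sum>i<m. \<Sum>j<m. (\<Sum>k<m. complex_of_real (\<Sum>l<m. \<Gamma> l k j x * G l i x) * e k) * b j * a i)"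
      by (rule sum.swap)
    also have "\<dots> = (\<Sum>i<m. \<Sum>j<m. (\<Sum>k<m. complex_of_real (\<Sum>l<m. \<Gamma> l k j x * G i l x) * e k) * a i * b j)"
      using G_sym[OF assms] by (intro sum.cong refl) (simp add: mult_ac)
    finally show ?thesis .
  qed
  have "(\<Sum>i<m. \<Sum>j<m. (\<Sum>k<m. complex_of_real (pd k 1 (G i j) x) * e k) * a i * b j) =
    (\<Sum>i<m. \<Sum>j<m. (\<Sum>k<m. complex_of_real ((\<Sum>l<m. \<Gamma> l k i x * G l j x) + (\<Sum>l<m. \<Gamma> l k j x * G i l x)) * e k) * a i * b j)"
    using compat[OF assms] by (intro sum.cong refl arg_cong2[where f="(*)"]) auto
  also have "\<dots> = (\<Sum>i<m. \<Sum>j<m. (\<Sum>k<m. complex_of_real (\<Sum>l<m. \<Gamma> l k i x * G l j x) * e k) * a i * b j)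
      + (\<Sum>i<m. \<Sum>j<m. (\<Sum>k<m. complex_of_real (\<Sum>l<m. \<Gamma> l k j x * G i l x) * e k) * a i * b j)"
    by (simp only: of_real_add distrib_right sum.distrib)
  finally show ?thesis unfolding 1 2 .
qed

lemma ip_self:
  "ip m G x a (\<lambda>i. cnj (a i)) =
    complex_of_real ((\<Sum>i<m. \<Sum>j<m. G i j x * Re (a i) * Re (a j)) + (\<Sum>i<m. \<Sum>j<m. G i j x * Im (a i) * Im (a j)))"
  if "x \<in> U"
proof -
  have c: "cnj (ip m G x a (\<lambda>i. cnj (a i))) = ip m G x a (\<lambda>i. cnj (a i))"
    unfolding cnj_ip using ip_sym[OF that] by simp
  hence im: "Im (ip m G x a (\<lambda>i. cnj (a i))) = 0" by (simp add: complex_eq_iff)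
  have "Re (ip m G x a (\<lambda>i. cnj (a i))) =
    (\<Sum>i<m. \<Sum>j<m. G i j x * Re (a i) * Re (a j)) + (\<Sum>i<m. \<Sum>j<m. G i j x * Im (a i) * Im (a j))"
    by (simp add: ip_def sum.distrib algebra_simps)
  thus ?thesis using im by (simp add: complex_eq_iff)
qed

lemma ip_self_nonneg:
  assumes "x \<in> U"
  shows "Re (ip m G x a (\<lambda>i. cnj (a i))) \<ge> 0" "Im (ip m G x a (\<lambda>i. cnj (a i))) = 0"
proof -
  have "(\<Sum>i<m. \<Sum>j<m. G i j x * b i * b j) \<ge> 0" for b
  proof (cases "\<exists>i<m. b i \<noteq> 0")
    case True
    then show ?thesis using posdef[OF assms] by (simp add: less_imp_le)
  qed (simp add: sum.neutral)
  thus "Re (ip m G x a (\<lambda>i. cnj (a i))) \<ge> 0" "Im (ip m G x a (\<lambda>i. cnj (a i))) = 0"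
    unfolding ip_self[OF assms] by simp_all
qed

lemma ip_self_zero:
  assumes "x \<in> U" "ip m G x a (\<lambda>i. cnj (a i)) = 0" "i < m"
  shows "a i = 0"
proof -
  have nn: "(\<Sum>i<m. \<Sum>j<m. G i j x * b i * b j) \<ge> 0" for b
  proof (cases "\<exists>i<m. b i \<noteq> 0")
    case True
    then show ?thesis using posdef[OF assms(1)] by (simp add: less_imp_le)
  qed (simp add: sum.neutral)
  have "(\<Sum>i<m. \<Sum>j<m. G i j x * Re (a i) * Re (a j)) + (\<Sum>i<m. \<Sum>j<m. G i j x * Im (a i) * Im (a j)) = 0"
    using assms(2) unfolding ip_self[OF assms(1)] by (simp only: of_real_eq_0_iff)
  hence "(\<Sum>i<m. \<Sum>j<m. G i j x * Re (a i) * Re (a j)) = 0" "(\<Sum>i<m. \<Sum>j<m. G i j x * Im (a i) * Im (a j)) = 0"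
    using nn[of "\<lambda>i. Re (a i)"] nn[of "\<lambda>i. Im (a i)"] by linarith+
  hence "Re (a i) = 0" "Im (a i) = 0"
    using posdef[OF assms(1), of "\<lambda>i. Re (a i)"] posdef[OF assms(1), of "\<lambda>i. Im (a i)"] assms(3) by force+
  thus ?thesis by (simp add: complex_eq_iff)
qed

lemma ip_cauchy_schwarz:
  assumes "x \<in> U"
  shows "(norm (ip m G x p (\<lambda>i. cnj (s i))))\<^sup>2 \<le>
    Re (ip m G x p (\<lambda>i. cnj (p i))) * Re (ip m G x s (\<lambda>i. cnj (s i)))"
proof -
  let ?ss = "ip m G x s (\<lambda>i. cnj (s i))" and ?ps = "ip m G x p (\<lambda>i. cnj (s i))"
    and ?pp = "ip m G x p (\<lambda>i. cnj (p i))" and ?sp = "ip m G x s (\<lambda>i. cnj (p i))"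
  have ss: "?ss = of_real (Re ?ss)" and pp: "?pp = of_real (Re ?pp)"
    using ip_self_nonneg[OF assms] by (simp_all add: complex_eq_iff)
  have sp: "?sp = cnj ?ps" unfolding cnj_ip using ip_sym[OF assms] by simp
  show ?thesis
  proof (cases "?ss = 0")
    case True
    have "s i = 0" if "i < m" for i by (rule ip_self_zero[OF assms True that])
    hence "?ps = ip m G x p (\<lambda>i. 0)" by (intro ip_cong) auto
    hence "?ps = 0" by (simp add: ip_def)
    thus ?thesis using True by simp
  next
    case False
    hence pos: "Re ?ss > 0" using ip_self_nonneg(1)[OF assms, of s] ss by (metis of_real_0 order_le_less)
    \<comment> \<open>The component of \<open>p\<close> orthogonal to \<open>s\<close>, multiplied
      by the squared norm of \<open>s\<close> to avoid a division; its squared norm is that factor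
      times the defect in the inequality.\<close>
    let ?q = "\<lambda>i. ?ss * p i - ?ps * s i"
    have cq: "(\<lambda>i. cnj (?q i)) = (\<lambda>i. cnj ?ss * cnj (p i) - cnj ?ps * cnj (s i))" by simp
    have "ip m G x ?q (\<lambda>i. cnj (?q i)) = ?ss * cnj ?ss * ?pp - ?ss * cnj ?ps * ?ps - ?ps * cnj ?ss * ?sp + ?ps * cnj ?ps * ?ss"
      unfolding cq ip_diff_left ip_diff_right ip_scale_left ip_scale_right by (simp add: algebra_simps)
    also have "\<dots> = ?ss * (?ss * ?pp - ?ps * cnj ?ps)"
      unfolding sp using ss by (simp add: complex_eq_iff algebra_simps)
    also have "\<dots> = of_real (Re ?ss * (Re ?ss * Re ?pp - (norm ?ps)\<^sup>2))"
      using ss pp by (metis complex_norm_square of_real_diff of_real_mult)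
    finally have "Re ?ss * (Re ?ss * Re ?pp - (norm ?ps)\<^sup>2) \<ge> 0"
      using ip_self_nonneg(1)[OF assms, of ?q] by simp
    thus ?thesis using pos by (simp add: zero_le_mult_iff mult.commute)
  qed
qed

end

section \<open>Covariant differentiation along a map\<close>

text \<open>The connection pulled back by \<open>c\<close>, complexified: the covariant derivative,
  in the direction \<open>d\<close>, of the vector field \<open>T\<close> along the map.\<close>

definition covd :: "nat \<Rightarrow> (nat \<Rightarrow> nat \<Rightarrow> nat \<Rightarrow> (nat \<Rightarrow> real) \<Rightarrow> real) \<Rightarrow> ('e::real_normed_vector \<Rightarrow> nat \<Rightarrow> real)
    \<Rightarrow> 'e \<times> 'e \<Rightarrow> (nat \<Rightarrow> 'e \<Rightarrow> complex) \<Rightarrow> nat \<Rightarrow> 'e \<Rightarrow> complex"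
  where "covd m \<Gamma> c d T l z = cder d (T l) z +
    gam m \<Gamma> (c z) (\<lambda>j. cder d (\<lambda>z. complex_of_real (c z j)) z) (\<lambda>k. T k z) l"

locale metric_map = metric_chart m U G \<Gamma>
  for m U G \<Gamma> +
  fixes c :: "'e::real_normed_vector \<Rightarrow> nat \<Rightarrow> real" and N :: "'e set"
  assumes N_open: "open N" and c_in: "z \<in> N \<Longrightarrow> c z \<in> U"
    and c_td: "j < m \<Longrightarrow> twice_diff N (\<lambda>z. c z j)"
begin

definition cd :: "'e \<times> 'e \<Rightarrow> 'e \<Rightarrow> cvec"
  where "cd d z j = cder d (\<lambda>z. complex_of_real (c z j)) z"

lemma c_diff: "j < m \<Longrightarrow> z \<in> N \<Longrightarrow> (\<lambda>z. c z j) differentiable (at z)"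
  using twice_diff_differentiable c_td by blast

lemma c_td_complex: "j < m \<Longrightarrow> twice_diff N (\<lambda>z. complex_of_real (c z j))"
  by (rule twice_diff_bounded_linear[OF bounded_linear_of_real N_open c_td])

lemma cd_diff: "j < m \<Longrightarrow> z \<in> N \<Longrightarrow> (\<lambda>z. cd d z j) differentiable (at z)"
  unfolding cd_def by (rule cder_differentiable[OF c_td_complex])

lemma compose_diff:
  assumes "Ck_on (Suc 0) m U h" "z \<in> N"
  shows "(\<lambda>z. complex_of_real (h (c z))) differentiable (at z)"
    and "cder d (\<lambda>z. complex_of_real (h (c z))) z = (\<Sum>i<m. complex_of_real (pd i 1 h (c z)) * cd d z i)"
  using differentiable_compose_real[OF U_open assms(1) N_open assms(2) c_in c_diff] assms(2)
  by (simp_all add: cd_def)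

lemma cder_bilinear:
  assumes H: "\<And>j k. j < m \<Longrightarrow> k < m \<Longrightarrow> Ck_on (Suc 0) m U (H j k)" and z: "z \<in> N"
    and a: "\<And>j. j < m \<Longrightarrow> a j differentiable (at z)" and b: "\<And>j. j < m \<Longrightarrow> b j differentiable (at z)"
  shows "(\<lambda>z. \<Sum>j<m. \<Sum>k<m. complex_of_real (H j k (c z)) * a j z * b k z) differentiable (at z)"
    and "cder d (\<lambda>z. \<Sum>j<m. \<Sum>k<m. complex_of_real (H j k (c z)) * a j z * b k z) z =
      (\<Sum>j<m. \<Sum>k<m. (\<Sum>i<m. complex_of_real (pd i 1 (H j k) (c z)) * cd d z i) * a j z * b k z)
      + (\<Sum>j<m. \<Sum>k<m. complex_of_real (H j k (c z)) * cder d (a j) z * b k z)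
      + (\<Sum>j<m. \<Sum>k<m. complex_of_real (H j k (c z)) * a j z * cder d (b k) z)"
proof -
  have Hd: "(\<lambda>z. complex_of_real (H j k (c z))) differentiable (at z)" if "j < m" "k < m" for j k
    by (rule compose_diff(1)[OF H[OF that] z])
  have t: "(\<lambda>z. complex_of_real (H j k (c z)) * a j z * b k z) differentiable (at z)" if "j < m" "k < m" for j k
    using Hd a b that by (intro differentiable_mult) auto
  show "(\<lambda>z. \<Sum>j<m. \<Sum>k<m. complex_of_real (H j k (c z)) * a j z * b k z) differentiable (at z)"
    using t by (intro differentiable_sum ballI) auto
  have summand: "cder d (\<lambda>z. complex_of_real (H j k (c z)) * a j z * b k z) z =
      (\<Sum>i<m. complex_of_real (pd i 1 (H j k) (c z)) * cd d z i) * a j z * b k z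
      + complex_of_real (H j k (c z)) * cder d (a j) z * b k z
      + complex_of_real (H j k (c z)) * a j z * cder d (b k) z" if "j < m" "k < m" for j k
    using cder_mult[OF differentiable_mult[OF Hd[OF that] a[OF that(1)]] b[OF that(2)], of d]
      cder_mult[OF Hd[OF that] a[OF that(1)], of d] compose_diff(2)[OF H[OF that] z, of d]
    by (simp add: algebra_simps)
  have "cder d (\<lambda>z. \<Sum>j<m. \<Sum>k<m. complex_of_real (H j k (c z)) * a j z * b k z) z =
      (\<Sum>j<m. \<Sum>k<m. cder d (\<lambda>z. complex_of_real (H j k (c z)) * a j z * b k z) z)"
    using t by (subst cder_sum) (auto intro!: sum.cong cder_sum differentiable_sum)
  also have "\<dots> = (\<Sum>j<m. \<Sum>k<m. (\<Sum>i<m. complex_of_real (pd i 1 (H j k) (c z)) * cd d z i) * a j z * b k z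
      + complex_of_real (H j k (c z)) * cder d (a j) z * b k z
      + complex_of_real (H j k (c z)) * a j z * cder d (b k) z)"
    by (intro sum.cong refl summand) auto
  finally show "cder d (\<lambda>z. \<Sum>j<m. \<Sum>k<m. complex_of_real (H j k (c z)) * a j z * b k z) z =
      (\<Sum>j<m. \<Sum>k<m. (\<Sum>i<m. complex_of_real (pd i 1 (H j k) (c z)) * cd d z i) * a j z * b k z)
      + (\<Sum>j<m. \<Sum>k<m. complex_of_real (H j k (c z)) * cder d (a j) z * b k z)
      + (\<Sum>j<m. \<Sum>k<m. complex_of_real (H j k (c z)) * a j z * cder d (b k) z)"
    by (simp only: sum.distrib)
qed

lemma cder_gam:
  assumes "l < m" "z \<in> N" "\<And>j. j < m \<Longrightarrow> a j differentiable (at z)" "\<And>j. j < m \<Longrightarrow> b j differentiable (at z)"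
  shows "(\<lambda>z. gam m \<Gamma> (c z) (\<lambda>j. a j z) (\<lambda>j. b j z) l) differentiable (at z)"
    and "cder d (\<lambda>z. gam m \<Gamma> (c z) (\<lambda>j. a j z) (\<lambda>j. b j z) l) z =
      dgam m \<Gamma> (c z) (cd d z) (\<lambda>j. a j z) (\<lambda>j. b j z) l
      + gam m \<Gamma> (c z) (\<lambda>j. cder d (a j) z) (\<lambda>j. b j z) l + gam m \<Gamma> (c z) (\<lambda>j. a j z) (\<lambda>j. cder d (b j) z) l"
  unfolding gam_def dgam_def
  using cder_bilinear[where H="\<lambda>j k. \<Gamma> l j k" and a=a and b=b, OF Gam_C1[OF assms(1)] assms(2-4)] by blast+

lemma cder_ip:
  assumes "z \<in> N" "\<And>j. j < m \<Longrightarrow> T j differentiable (at z)" "\<And>j. j < m \<Longrightarrow> V j differentiable (at z)"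
  shows "(\<lambda>z. ip m G (c z) (\<lambda>j. T j z) (\<lambda>j. V j z)) differentiable (at z)"
    and "cder d (\<lambda>z. ip m G (c z) (\<lambda>j. T j z) (\<lambda>j. V j z)) z =
      ip m G (c z) (\<lambda>l. covd m \<Gamma> c d T l z) (\<lambda>j. V j z) + ip m G (c z) (\<lambda>j. T j z) (\<lambda>l. covd m \<Gamma> c d V l z)"
proof -
  note b = cder_bilinear[where H=G and a=T and b=V, OF G_C1 assms]
  show "(\<lambda>z. ip m G (c z) (\<lambda>j. T j z) (\<lambda>j. V j z)) differentiable (at z)"
    unfolding ip_def by (rule b(1))
  have "cder d (\<lambda>z. ip m G (c z) (\<lambda>j. T j z) (\<lambda>j. V j z)) z =
      ip m G (c z) (gam m \<Gamma> (c z) (cd d z) (\<lambda>j. T j z)) (\<lambda>j. V j z) + ip m G (c z) (\<lambda>j. T j z) (gam m \<Gamma> (c z) (cd d z) (\<lambda>j. V j z))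
      + ip m G (c z) (\<lambda>j. cder d (T j) z) (\<lambda>j. V j z) + ip m G (c z) (\<lambda>j. T j z) (\<lambda>j. cder d (V j) z)"
    unfolding dG_contract[OF c_in[OF assms(1)], symmetric] unfolding ip_def by (rule b(2))
  thus "cder d (\<lambda>z. ip m G (c z) (\<lambda>j. T j z) (\<lambda>j. V j z)) z =
      ip m G (c z) (\<lambda>l. covd m \<Gamma> c d T l z) (\<lambda>j. V j z) + ip m G (c z) (\<lambda>j. T j z) (\<lambda>l. covd m \<Gamma> c d V l z)"
    unfolding covd_def cd_def[symmetric] ip_add_left ip_add_right by (simp add: cd_def[abs_def])
qed

lemma covd_differentiable:
  assumes "l < m" "z \<in> N" "\<And>k. k < m \<Longrightarrow> twice_diff N (T k)"
  shows "covd m \<Gamma> c d T l differentiable (at z)"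
  unfolding covd_def[abs_def]
  by (intro differentiable_add cder_differentiable[OF assms(3)[OF assms(1)] assms(2)] cder_gam(1)[OF assms(1,2)]
      cd_diff[unfolded cd_def, OF _ assms(2)] twice_diff_differentiable[OF assms(3) assms(2)])

text \<open>The directions are constant, so no bracket term arises. All terms of the expansion
  symmetric in \<open>d\<close> and \<open>d'\<close> cancel, by the symmetry of the second
  derivatives of \<open>T\<close> and of \<open>c\<close>; what remains is
  \<open>curv_eq\<close>.\<close>

lemma covd_commutator:
  assumes "l < m" "z \<in> N" and T: "\<And>k. k < m \<Longrightarrow> twice_diff N (T k)"
  shows "covd m \<Gamma> c d (covd m \<Gamma> c d' T) l z - covd m \<Gamma> c d' (covd m \<Gamma> c d T) l z =
    curv m \<Gamma> (c z) (cd d z) (cd d' z) (\<lambda>k. T k z) l"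
proof -
  have main: "covd m \<Gamma> c d (covd m \<Gamma> c d' T) l z =
      cder d (cder d' (T l)) z + dgam m \<Gamma> (c z) (cd d z) (cd d' z) (\<lambda>k. T k z) l
      + gam m \<Gamma> (c z) (\<lambda>j. cder d (\<lambda>z. cd d' z j) z) (\<lambda>k. T k z) l
      + gam m \<Gamma> (c z) (cd d' z) (\<lambda>k. cder d (T k) z) l
      + gam m \<Gamma> (c z) (cd d z) (\<lambda>k. cder d' (T k) z) l
      + gam m \<Gamma> (c z) (cd d z) (gam m \<Gamma> (c z) (cd d' z) (\<lambda>k. T k z)) l" for d d'
  proof -
    have 1: "cder d' (T l) differentiable (at z)" by (rule cder_differentiable[OF T[OF assms(1)] assms(2)])
    have 2: "(\<lambda>z. gam m \<Gamma> (c z) (\<lambda>j. cd d' z j) (\<lambda>k. T k z) l) differentiable (at z)"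
      by (rule cder_gam(1)[OF assms(1,2) cd_diff[OF _ assms(2)] twice_diff_differentiable[OF T assms(2)]])
    have 3: "cder d (\<lambda>z. gam m \<Gamma> (c z) (\<lambda>j. cd d' z j) (\<lambda>k. T k z) l) z =
      dgam m \<Gamma> (c z) (cd d z) (\<lambda>j. cd d' z j) (\<lambda>j. T j z) l
      + gam m \<Gamma> (c z) (\<lambda>j. cder d (\<lambda>z. cd d' z j) z) (\<lambda>j. T j z) l
      + gam m \<Gamma> (c z) (\<lambda>j. cd d' z j) (\<lambda>j. cder d (T j) z) l"
      by (rule cder_gam(2)[OF assms(1,2) cd_diff[OF _ assms(2)] twice_diff_differentiable[OF T assms(2)]])
    have 4: "covd m \<Gamma> c d' T l = (\<lambda>z. cder d' (T l) z + gam m \<Gamma> (c z) (\<lambda>j. cd d' z j) (\<lambda>k. T k z) l)" for l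
      by (simp add: fun_eq_iff covd_def cd_def)
    have 5: "covd m \<Gamma> c d (covd m \<Gamma> c d' T) l z = cder d (covd m \<Gamma> c d' T l) z
        + gam m \<Gamma> (c z) (cd d z) (\<lambda>k. covd m \<Gamma> c d' T k z) l"
      by (simp add: covd_def[of m \<Gamma> c d] cd_def[abs_def])
    show ?thesis unfolding 5 unfolding 4 cder_add[OF 1 2] 3 gam_add_right by simp
  qed
  have c1: "cder d (cder d' (T l)) z = cder d' (cder d (T l)) z"
    by (rule cder_commute[OF N_open T[OF assms(1)] assms(2)])
  have c2: "gam m \<Gamma> (c z) (\<lambda>j. cder d (\<lambda>z. cd d' z j) z) (\<lambda>k. T k z) l =
      gam m \<Gamma> (c z) (\<lambda>j. cder d' (\<lambda>z. cd d z j) z) (\<lambda>k. T k z) l"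
    unfolding cd_def by (rule gam_cong) (auto intro: cder_commute[OF N_open c_td_complex assms(2)])
  show ?thesis unfolding main[of d d'] main[of d' d] curv_eq c1 c2 by simp
qed

text \<open>The scalar function given by the inner product of \<open>T\<close> and \<open>V\<close>
  has commuting derivatives; expanding both orders by the product rule leaves only the curvature
  terms. This gives the skew symmetry of the curvature operator without differentiating the metric
  twice in indices.\<close>

lemma ip_commutator:
  assumes "z \<in> N" and T: "\<And>k. k < m \<Longrightarrow> twice_diff N (T k)" and V: "\<And>k. k < m \<Longrightarrow> twice_diff N (V k)"
    and td: "twice_diff N (\<lambda>z. ip m G (c z) (\<lambda>j. T j z) (\<lambda>j. V j z))"
  shows "ip m G (c z) (curv m \<Gamma> (c z) (cd d z) (cd d' z) (\<lambda>k. T k z)) (\<lambda>k. V k z) +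
    ip m G (c z) (\<lambda>k. T k z) (curv m \<Gamma> (c z) (cd d z) (cd d' z) (\<lambda>k. V k z)) = 0"
proof -
  let ?f = "\<lambda>z. ip m G (c z) (\<lambda>j. T j z) (\<lambda>j. V j z)"
  have Td: "T k differentiable (at z)" and Vd: "V k differentiable (at z)" if "k < m" "z \<in> N" for k z
    using twice_diff_differentiable T V that by blast+
  have 1: "cder d (cder d' ?f) z =
      ip m G (c z) (\<lambda>l. covd m \<Gamma> c d (covd m \<Gamma> c d' T) l z) (\<lambda>j. V j z)
      + ip m G (c z) (\<lambda>l. covd m \<Gamma> c d' T l z) (\<lambda>j. covd m \<Gamma> c d V j z)
      + (ip m G (c z) (\<lambda>l. covd m \<Gamma> c d T l z) (\<lambda>j. covd m \<Gamma> c d' V j z)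
      + ip m G (c z) (\<lambda>j. T j z) (\<lambda>l. covd m \<Gamma> c d (covd m \<Gamma> c d' V) l z))" for d d'
  proof -
    have "cder d (cder d' ?f) z = cder d (\<lambda>z. ip m G (c z) (\<lambda>l. covd m \<Gamma> c d' T l z) (\<lambda>j. V j z)
        + ip m G (c z) (\<lambda>j. T j z) (\<lambda>l. covd m \<Gamma> c d' V l z)) z"
      by (rule cder_cong[OF N_open assms(1) cder_ip(2)[OF _ Td Vd] cder_differentiable[OF td assms(1)]])
    also have "\<dots> = cder d (\<lambda>z. ip m G (c z) (\<lambda>l. covd m \<Gamma> c d' T l z) (\<lambda>j. V j z)) z
        + cder d (\<lambda>z. ip m G (c z) (\<lambda>j. T j z) (\<lambda>l. covd m \<Gamma> c d' V l z)) z"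
      by (intro cder_add cder_ip(1) covd_differentiable assms Td Vd T V)
    also have "cder d (\<lambda>z. ip m G (c z) (\<lambda>l. covd m \<Gamma> c d' T l z) (\<lambda>j. V j z)) z =
        ip m G (c z) (\<lambda>l. covd m \<Gamma> c d (covd m \<Gamma> c d' T) l z) (\<lambda>j. V j z)
        + ip m G (c z) (\<lambda>l. covd m \<Gamma> c d' T l z) (\<lambda>j. covd m \<Gamma> c d V j z)"
      by (intro cder_ip(2) covd_differentiable assms Td Vd T V)
    also have "cder d (\<lambda>z. ip m G (c z) (\<lambda>j. T j z) (\<lambda>l. covd m \<Gamma> c d' V l z)) z =
        ip m G (c z) (\<lambda>l. covd m \<Gamma> c d T l z) (\<lambda>j. covd m \<Gamma> c d' V j z)
        + ip m G (c z) (\<lambda>j. T j z) (\<lambda>l. covd m \<Gamma> c d (covd m \<Gamma> c d' V) l z)"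
      by (intro cder_ip(2) covd_differentiable assms Td Vd T V)
    finally show ?thesis .
  qed
  have e: "ip m G (c z) (curv m \<Gamma> (c z) (cd d z) (cd d' z) (\<lambda>k. T k z)) (\<lambda>k. V k z) =
      ip m G (c z) (\<lambda>l. covd m \<Gamma> c d (covd m \<Gamma> c d' T) l z) (\<lambda>j. V j z)
      - ip m G (c z) (\<lambda>l. covd m \<Gamma> c d' (covd m \<Gamma> c d T) l z) (\<lambda>j. V j z)"
    unfolding ip_diff_left[symmetric]
    by (rule ip_cong) (use covd_commutator[OF _ assms(1) T] in simp_all)
  have e': "ip m G (c z) (\<lambda>k. T k z) (curv m \<Gamma> (c z) (cd d z) (cd d' z) (\<lambda>k. V k z)) =
      ip m G (c z) (\<lambda>j. T j z) (\<lambda>l. covd m \<Gamma> c d (covd m \<Gamma> c d' V) l z)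
      - ip m G (c z) (\<lambda>j. T j z) (\<lambda>l. covd m \<Gamma> c d' (covd m \<Gamma> c d V) l z)"
    unfolding ip_diff_right[symmetric]
    by (rule ip_cong) (use covd_commutator[OF _ assms(1) V] in simp_all)
  show ?thesis using 1[of d d'] 1[of d' d] cder_commute[OF N_open td assms(1), of d d'] unfolding e e' by (simp add: algebra_simps)
qed

lemma ip_twice_diff:
  assumes "\<And>k. k < m \<Longrightarrow> twice_diff N (T k)" "\<And>k. k < m \<Longrightarrow> twice_diff N (V k)"
  shows "twice_diff N (\<lambda>z. ip m G (c z) (\<lambda>j. T j z) (\<lambda>j. V j z))"
proof -
  have "twice_diff N (\<lambda>z. complex_of_real (G i j (c z)))" if "i < m" "j < m" for i j
    by (intro twice_diff_bounded_linear[OF bounded_linear_of_real N_open]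
        twice_diff_compose[OF U_open G_C2[OF that] N_open c_in c_td])
  thus ?thesis unfolding ip_def
    by (intro twice_diff_sum twice_diff_mult N_open) (use assms in auto)
qed

end

text \<open>The Wirtinger derivations \<open>\<partial>/\<partial>\<zeta>\<close>, \<open>\<partial>/\<partial>\<bar>\<zeta>\<close> and \<open>\<partial>/\<partial>\<eta>\<close> as complexified directions of \<open>C \<times> C\<close>.\<close>

definition d\<zeta> :: "(complex \<times> complex) \<times> (complex \<times> complex)" where "d\<zeta> = ((1/2, 0), (- \<i> / 2, 0))"
definition d\<zeta>' :: "(complex \<times> complex) \<times> (complex \<times> complex)" where "d\<zeta>' = ((1/2, 0), (\<i> / 2, 0))"
definition d\<eta> :: "(complex \<times> complex) \<times> (complex \<times> complex)" where "d\<eta> = ((0, 1/2), (0, - \<i> / 2))"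

context metric_chart
begin

lemma Rm_antisym_last:
  assumes x: "x \<in> U"
  shows "ip m G x (curv m \<Gamma> x a b v) w + ip m G x v (curv m \<Gamma> x a b w) = 0"
proof -
  \<comment> \<open>a map with \<open>\<partial>c/\<partial>\<zeta> = a\<close> and \<open>\<partial>c/\<partial>\<eta> = b\<close>, to which the commutator formula for constant \<open>v\<close> and \<open>w\<close> applies\<close>
  define c' where "c' j h = (if j < m then Re (2 * a j * fst h) + Re (2 * b j * snd h) else 0)"
    for j and h :: "complex \<times> complex"
  define c where "c z = (\<lambda>j. x j + c' j z)" for z
  have bl: "bounded_linear (c' j)" for j
  proof (cases "j < m")
    case True
    have "c' j = (\<lambda>h. Re (2 * a j * fst h) + Re (2 * b j * snd h))" using True by (simp add: c'_def fun_eq_iff)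
    moreover have "bounded_linear (\<lambda>h :: complex \<times> complex. Re (2 * a j * fst h) + Re (2 * b j * snd h))"
      by (intro bounded_linear_add bounded_linear_compose[OF bounded_linear_Re]
          bounded_linear_compose[OF bounded_linear_mult_right] bounded_linear_fst bounded_linear_snd)
    ultimately show ?thesis by simp
  next
    case False
    hence "c' j = (\<lambda>h. 0)" by (simp add: c'_def fun_eq_iff)
    then show ?thesis by simp
  qed
  have xc: "x \<in> coord_space m" using x openin_imp_subset[OF U_open] by blast
  have cc: "c z \<in> coord_space m" for z using xc by (auto simp: c_def c'_def coord_space_def)
  have c0: "c 0 = x" by (auto simp: c_def c'_def fun_eq_iff)
  obtain W where W: "open W" "U = coord_space m \<inter> W" using U_open by (auto simp: openin_open)
  have cont: "continuous_on UNIV c"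
  proof (rule continuous_on_coordinatewise_then_product)
    fix j
    show "continuous_on UNIV (\<lambda>z. c z j)" unfolding c_def
      by (intro continuous_on_add continuous_on_const linear_continuous_on bl)
  qed
  have Neq: "c -` U = c -` W" using W(2) cc by auto
  interpret M: metric_map m U G \<Gamma> c "c -` U"
  proof
    show "open (c -` U)" unfolding Neq using W(1) cont by (simp add: open_vimage)
    thus "twice_diff (c -` U) (\<lambda>z. c z j)" for j
      unfolding c_def by (intro twice_diff_add twice_diff_const twice_diff_linear_map bl)
  qed auto
  have N0: "0 \<in> c -` U" by (simp add: c0 x)
  have hd: "((\<lambda>z. complex_of_real (c z j)) has_derivative (\<lambda>h. complex_of_real (c' j h))) (at 0)" for j
  proof -
    have "((\<lambda>z. x j + c' j z) has_derivative (\<lambda>h. 0 + c' j h)) (at 0)"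
      by (intro has_derivative_add has_derivative_const bounded_linear_imp_has_derivative bl)
    hence "((\<lambda>z. c z j) has_derivative (\<lambda>h. c' j h)) (at 0)" by (simp add: c_def)
    thus ?thesis by (rule bounded_linear.has_derivative[OF bounded_linear_of_real])
  qed
  \<comment> \<open>The derivative \<partial>/\<partial>\<zeta> of the real part of 2 a \<zeta> is
    a; this accounts for the factor 2 in \<open>c'\<close>.\<close>
  have ca: "M.cd d\<zeta> 0 j = a j" "M.cd d\<eta> 0 j = b j" if "j < m" for j
    using that unfolding M.cd_def cder_eqI[OF hd] by (simp_all add: d\<zeta>_def d\<eta>_def c'_def complex_eq_iff)
  have td: "twice_diff (c -` U) (\<lambda>z. v k)" for v :: cvec and k by (rule twice_diff_const[OF M.N_open])
  have tdi: "twice_diff (c -` U) (\<lambda>z. ip m G (c z) (\<lambda>j. v j) (\<lambda>j. w j))"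
    by (rule M.ip_twice_diff) (rule td)+
  have "ip m G (c 0) (curv m \<Gamma> (c 0) (M.cd d\<zeta> 0) (M.cd d\<eta> 0) (\<lambda>k. v k)) (\<lambda>k. w k) +
      ip m G (c 0) (\<lambda>k. v k) (curv m \<Gamma> (c 0) (M.cd d\<zeta> 0) (M.cd d\<eta> 0) (\<lambda>k. w k)) = 0"
    by (rule M.ip_commutator[where T="\<lambda>k z. v k" and V="\<lambda>k z. w k", OF N0]) (rule td tdi)+
  hence "ip m G x (curv m \<Gamma> x (M.cd d\<zeta> 0) (M.cd d\<eta> 0) v) w +
      ip m G x v (curv m \<Gamma> x (M.cd d\<zeta> 0) (M.cd d\<eta> 0) w) = 0"
    by (simp add: c0)
  moreover have "curv m \<Gamma> x (M.cd d\<zeta> 0) (M.cd d\<eta> 0) v = curv m \<Gamma> x a b v" for v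
    by (rule ext, rule curv_cong) (auto simp: ca)
  ultimately show ?thesis by simp
qed

text \<open>With \<open>R(X, S)\<bar>X = 0\<close>, the Bianchi identity turns \<open>R(\<bar>X, X, S, \<bar>S)\<close> into minus twice a
  sum of four sectional curvature terms, those of the planes spanned by the real or imaginary
  part of \<open>X\<close> and the real or imaginary part of \<open>S\<close>.\<close>

lemma Rm_nonneg:
  assumes x: "x \<in> U" and sec: "\<And>a b. Re (Rm m \<Gamma> G x (\<lambda>i. complex_of_real (a i)) (\<lambda>i. complex_of_real (b i))
      (\<lambda>i. complex_of_real (b i)) (\<lambda>i. complex_of_real (a i))) \<le> 0"
    and vanish: "\<And>l. l < m \<Longrightarrow> curv m \<Gamma> x X S (\<lambda>i. cnj (X i)) l = 0"
  shows "Re (Rm m \<Gamma> G x (\<lambda>i. cnj (X i)) X S (\<lambda>i. cnj (S i))) \<ge> 0"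
proof -
  let ?R = "Rm m \<Gamma> G x"
  define A B C D where "A = (\<lambda>i. Re (X i))" and "B = (\<lambda>i. Im (X i))" and "C = (\<lambda>i. Re (S i))" and "D = (\<lambda>i. Im (S i))"
  define r where "r a = (\<lambda>i::nat. complex_of_real (a i))" for a
  have X: "X = (\<lambda>i. r A i + \<i> * r B i)" "(\<lambda>i. cnj (X i)) = (\<lambda>i. r A i + (- \<i>) * r B i)"
    and S: "S = (\<lambda>i. r C i + \<i> * r D i)" "(\<lambda>i. cnj (S i)) = (\<lambda>i. r C i + (- \<i>) * r D i)"
    by (auto simp: A_def B_def C_def D_def r_def complex_eq_iff fun_eq_iff)
  have zero: "?R X S (\<lambda>i. cnj (X i)) (\<lambda>i. cnj (S i)) = 0"
  proof -
    have "?R X S (\<lambda>i. cnj (X i)) (\<lambda>i. cnj (S i)) = ip m G x (\<lambda>i. 0) (\<lambda>i. cnj (S i))"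
      unfolding Rm_def by (rule ip_cong) (simp_all add: vanish)
    thus ?thesis by (simp add: ip_def)
  qed
  have zero': "?R (\<lambda>i. cnj (X i)) (\<lambda>i. cnj (S i)) X S = 0"
    using arg_cong[OF zero, of cnj] unfolding Rm_def cnj_ip cnj_curv by simp
  have "ip m G x (\<lambda>l. curv m \<Gamma> x (\<lambda>i. cnj (X i)) X S l + curv m \<Gamma> x X S (\<lambda>i. cnj (X i)) l
      + curv m \<Gamma> x S (\<lambda>i. cnj (X i)) X l) (\<lambda>i. cnj (S i)) = ip m G x (\<lambda>l. 0) (\<lambda>i. cnj (S i))"
    by (rule ip_cong) (auto intro: bianchi[OF x])
  hence "?R (\<lambda>i. cnj (X i)) X S (\<lambda>i. cnj (S i)) + ?R X S (\<lambda>i. cnj (X i)) (\<lambda>i. cnj (S i))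
      + ?R S (\<lambda>i. cnj (X i)) X (\<lambda>i. cnj (S i)) = 0"
    unfolding Rm_def ip_add_left by (simp add: ip_def)
  moreover have "?R S (\<lambda>i. cnj (X i)) X (\<lambda>i. cnj (S i)) = - ?R (\<lambda>i. cnj (X i)) S X (\<lambda>i. cnj (S i))"
  proof -
    have "curv m \<Gamma> x S (\<lambda>i. cnj (X i)) X = (\<lambda>l. (-1) * curv m \<Gamma> x (\<lambda>i. cnj (X i)) S X l)"
      by (rule ext) (subst curv_antisym, simp)
    thus ?thesis unfolding Rm_def by (simp only: ip_scale_left) simp
  qed
  \<comment> \<open>The last term is the vanishing \<open>zero'\<close>. It is added to make the
    right-hand side symmetric in S and its conjugate, so that the mixed terms in the real and
    imaginary parts of S cancel in \<open>h\<close>.\<close>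
  ultimately have main: "?R (\<lambda>i. cnj (X i)) X S (\<lambda>i. cnj (S i)) =
      ?R (\<lambda>i. cnj (X i)) S X (\<lambda>i. cnj (S i)) + ?R (\<lambda>i. cnj (X i)) (\<lambda>i. cnj (S i)) X S"
    using zero zero' by simp
  have h: "?R Y S Z (\<lambda>i. cnj (S i)) + ?R Y (\<lambda>i. cnj (S i)) Z S = 2 * (?R Y (r C) Z (r C) + ?R Y (r D) Z (r D))" for Y Z
    unfolding S(2) by (subst (1 2) S(1)) (simp only: Rm_lin, simp add: algebra_simps)
  have im: "Im (?R (r a) (r b) (r c) (r d)) = 0" for a b c d unfolding r_def by (rule Rm_real)
  have nn: "Re (?R (r a) (r b) (r a) (r b)) \<ge> 0" for a b
  proof -
    have "?R (r a) (r b) (r a) (r b) = - ?R (r a) (r b) (r b) (r a)"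
      using Rm_antisym_last[OF x, of "r a" "r b" "r a" "r b"]
        ip_sym[OF x, of "curv m \<Gamma> x (r a) (r b) (r b)" "r a"]
      unfolding Rm_def by (simp add: add_eq_0_iff2)
    thus ?thesis using sec[of a b] unfolding r_def by simp
  qed
  \<comment> \<open>The mixed terms in the real and imaginary parts of X need not vanish, but they
    are i times a real number and do not contribute to the real part.\<close>
  have e: "?R (\<lambda>i. cnj (X i)) (r c) X (r c) = ?R (r A) (r c) (r A) (r c) + ?R (r B) (r c) (r B) (r c)
      + \<i> * (?R (r A) (r c) (r B) (r c) - ?R (r B) (r c) (r A) (r c))" for c
    unfolding X(2) by (subst X(1)) (simp only: Rm_lin, simp add: algebra_simps)
  show ?thesis unfolding main h e using nn[of A C] nn[of B C] nn[of A D] nn[of B D] im by simp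
qed

end

section \<open>The Levi-Civita connection of a Riemannian manifold\<close>

lemma Ck_on_det:
  fixes a :: "nat \<Rightarrow> nat \<Rightarrow> (nat \<Rightarrow> real) \<Rightarrow> real"
  assumes U: "openin (top_of_set (coord_space m)) U" and "\<And>i j. i < N \<Longrightarrow> j < N \<Longrightarrow> Ck_on k m U (a i j)"
  shows "Ck_on k m U (\<lambda>x. Determinant.det (Matrix.mat N N (\<lambda>(i, j). a i j x)))"
proof -
  have "Determinant.det (Matrix.mat N N (\<lambda>(i, j). a i j x)) =
      (\<Sum>p\<in>{p. p permutes {0..<N}}. signof p * (\<Prod>i\<in>{0..<N}. a i (p i) x))" for x
  proof -
    have "(\<Prod>i\<in>{0..<N}. Matrix.mat N N (\<lambda>(i, j). a i j x) $$ (i, p i)) = (\<Prod>i\<in>{0..<N}. a i (p i) x)"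
      if "p permutes {0..<N}" for p
      using permutes_in_image[OF that] by (intro prod.cong) auto
    thus ?thesis by (subst det_def'[of _ N]) (auto intro!: sum.cong)
  qed
  moreover have "Ck_on k m U (\<lambda>x. \<Sum>p\<in>{p. p permutes {0..<N}}. signof p * (\<Prod>i\<in>{0..<N}. a i (p i) x))"
  proof (intro Ck_on_sum Ck_on_mult Ck_on_prod Ck_on_const U)
    fix p i assume "p \<in> {p. p permutes {0..<N}}" "i \<in> {0..<N}"
    thus "Ck_on k m U (a i (p i))" using assms(2) permutes_in_image[of p "{0..<N}" i] by auto
  qed
  ultimately show ?thesis by simp
qed

lemma Ck_on_adj_mat:
  fixes a :: "nat \<Rightarrow> nat \<Rightarrow> (nat \<Rightarrow> real) \<Rightarrow> real"
  assumes U: "openin (top_of_set (coord_space m)) U" and a: "\<And>i j. i < N \<Longrightarrow> j < N \<Longrightarrow> Ck_on k m U (a i j)"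
    and ij: "i < N" "j < N"
  shows "Ck_on k m U (\<lambda>x. adj_mat (Matrix.mat N N (\<lambda>(i, j). a i j x)) $$ (i, j))"
proof -
  \<comment> \<open>\<open>d p q\<close> is the p-th of the indices that remain when q is
    deleted.\<close>
  define d where "d p q = (if p < q then p else Suc p)" for p q :: nat
  have "adj_mat (Matrix.mat N N (\<lambda>(i, j). a i j x)) $$ (i, j) =
      (-1) ^ (j + i) * Determinant.det (Matrix.mat (N - 1) (N - 1) (\<lambda>(p, q). a (d p j) (d q i) x))" for x
  proof -
    have "mat_delete (Matrix.mat N N (\<lambda>(i, j). a i j x)) j i =
        Matrix.mat (N - 1) (N - 1) (\<lambda>(p, q). a (d p j) (d q i) x)"
      using ij by (intro eq_matI) (auto simp: mat_delete_def d_def)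
    thus ?thesis using ij by (simp add: adj_mat_def cofactor_def)
  qed
  moreover have "Ck_on k m U (\<lambda>x. (-1) ^ (j + i) *
      Determinant.det (Matrix.mat (N - 1) (N - 1) (\<lambda>(p, q). a (d p j) (d q i) x)))"
    by (intro Ck_on_mult Ck_on_const Ck_on_det U a) (auto simp: d_def)
  ultimately show ?thesis by simp
qed

lemma sum_swap3:
  "(\<Sum>l\<in>L. \<Sum>s\<in>S. \<Sum>i\<in>I. h l s i) = (\<Sum>i\<in>I. \<Sum>l\<in>L. \<Sum>s\<in>S. h l s i)"
proof -
  have "(\<Sum>l\<in>L. \<Sum>s\<in>S. \<Sum>i\<in>I. h l s i) = (\<Sum>l\<in>L. \<Sum>i\<in>I. \<Sum>s\<in>S. h l s i)"
    by (intro sum.cong refl sum.swap)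
  also have "\<dots> = (\<Sum>i\<in>I. \<Sum>l\<in>L. \<Sum>s\<in>S. h l s i)" by (rule sum.swap)
  finally show ?thesis .
qed

context riemannian_manifold
begin

lemma metric_zero: "q \<in> points B \<Longrightarrow> w \<in> tangent_space m B q \<Longrightarrow> g q (\<lambda>a. 0) w = 0"
  using metric_scale[of q w w 0] by simp

lemma metric_sum:
  fixes k :: nat
  assumes q: "q \<in> points B" and w: "w \<in> tangent_space m B q"
    and v: "\<And>i. i < k \<Longrightarrow> v i \<in> tangent_space m B q"
  shows "(\<lambda>x. \<Sum>i<k. c i * v i x) \<in> tangent_space m B q \<and>
    g q (\<lambda>x. \<Sum>i<k. c i * v i x) w = (\<Sum>i<k. c i * g q (v i) w)"
  using v
proof (induction k)
  case 0
  show ?case using metric_zero[OF q w] tangent_space_scale[OF w, of 0] by simp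
next
  case (Suc k)
  have IH: "(\<lambda>x. \<Sum>i<k. c i * v i x) \<in> tangent_space m B q"
    "g q (\<lambda>x. \<Sum>i<k. c i * v i x) w = (\<Sum>i<k. c i * g q (v i) w)" using Suc by auto
  have vk: "v k \<in> tangent_space m B q" using Suc.prems by simp
  have s: "(\<lambda>x. c k * v k x) \<in> tangent_space m B q" by (rule tangent_space_scale[OF vk])
  show ?case
    using tangent_space_lincomb[OF IH(1) s, of 1 1] metric_add[OF q IH(1) s w] IH(2) metric_scale[OF q vk w] by simp
qed

lemma tangent_vec_sum:
  "tangent_vec \<kappa> a q = (\<lambda>x. \<Sum>i<m. a i * coord_vec m B \<kappa> i q x)"
  unfolding tangent_vec_def coord_vec_def
  by (rule ext) (auto simp: mult.commute split: prod.splits)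

lemma point_of_chart: "\<kappa> \<in> B \<Longrightarrow> q \<in> fst \<kappa> \<Longrightarrow> q \<in> points B"
  by (auto simp: points_def)

lemma coord_vec_in:
  assumes "\<kappa> \<in> B" "q \<in> fst \<kappa>" "i < m"
  shows "coord_vec m B \<kappa> i q \<in> tangent_space m B q"
  unfolding coord_vec_eq[OF assms(3)] by (rule tangent_vec_in_tangent_space[OF assms(1,2)])

lemma metric_tangent_vec:
  assumes \<kappa>: "\<kappa> \<in> B" "q \<in> fst \<kappa>"
  shows "g q (tangent_vec \<kappa> a q) (tangent_vec \<kappa> b q) =
    (\<Sum>i<m. \<Sum>j<m. metric_comp m B g \<kappa> i j (snd \<kappa> q) * a i * b j)"
proof -
  note q = point_of_chart[OF \<kappa>] and cv = coord_vec_in[OF \<kappa>]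
    and tv = tangent_vec_in_tangent_space[OF \<kappa>]
  have 1: "g q (tangent_vec \<kappa> a q) w = (\<Sum>i<m. a i * g q (coord_vec m B \<kappa> i q) w)"
    if "w \<in> tangent_space m B q" for a w
    unfolding tangent_vec_sum using metric_sum[OF q that, of m "\<lambda>i. coord_vec m B \<kappa> i q"] cv by simp
  have "g q (coord_vec m B \<kappa> i q) (tangent_vec \<kappa> b q) = (\<Sum>j<m. b j * g q (coord_vec m B \<kappa> i q) (coord_vec m B \<kappa> j q))"
    if "i < m" for i
    using metric_sym[OF q cv[OF that] tv] 1[OF cv[OF that]] metric_sym[OF q cv cv[OF that]] by simp
  hence "g q (tangent_vec \<kappa> a q) (tangent_vec \<kappa> b q) =
      (\<Sum>i<m. a i * (\<Sum>j<m. b j * g q (coord_vec m B \<kappa> i q) (coord_vec m B \<kappa> j q)))"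
    using 1[OF tv] by simp
  thus ?thesis using \<kappa> by (simp add: metric_comp_def Let_def sum_distrib_left mult_ac)
qed

lemma metric_comp_sym:
  assumes "\<kappa> \<in> B" "x \<in> snd \<kappa> ` fst \<kappa>" "i < m" "j < m"
  shows "metric_comp m B g \<kappa> i j x = metric_comp m B g \<kappa> j i x"
proof -
  obtain q where q: "q \<in> fst \<kappa>" "x = snd \<kappa> q" using assms(2) by auto
  show ?thesis using assms q metric_sym[OF point_of_chart[OF assms(1) q(1)] coord_vec_in coord_vec_in]
    by (simp add: metric_comp_def Let_def)
qed

lemma metric_comp_pos:
  assumes "\<kappa> \<in> B" "x \<in> snd \<kappa> ` fst \<kappa>" "\<exists>i<m. a i \<noteq> 0"
  shows "(\<Sum>i<m. \<Sum>j<m. metric_comp m B g \<kappa> i j x * a i * a j) > 0"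
proof -
  obtain q where q: "q \<in> fst \<kappa>" "x = snd \<kappa> q" using assms(2) by auto
  have "tangent_vec \<kappa> a q \<noteq> (\<lambda>a. 0)"
    using assms(3) tangent_vec_component[OF assms(1) q(1)] by metis
  from metric_pos[OF point_of_chart[OF assms(1) q(1)] tangent_vec_in_tangent_space[OF assms(1) q(1)] this]
  show ?thesis unfolding metric_tangent_vec[OF assms(1) q(1)] q(2) .
qed

definition gmat :: "('q, real) chart \<Rightarrow> (nat \<Rightarrow> real) \<Rightarrow> real mat"
  where "gmat \<kappa> x = Matrix.mat m m (\<lambda>(k, l). metric_comp m B g \<kappa> k l x)"

lemma gmat_carrier: "gmat \<kappa> x \<in> carrier_mat m m"
  by (simp add: gmat_def)

text \<open>The metric would vanish on a nonzero vector of the kernel.\<close>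

lemma det_gmat_nonzero:
  assumes "\<kappa> \<in> B" "x \<in> snd \<kappa> ` fst \<kappa>"
  shows "Determinant.det (gmat \<kappa> x) \<noteq> 0"
proof
  assume "Determinant.det (gmat \<kappa> x) = 0"
  then obtain v where v: "v \<in> carrier_vec m" "v \<noteq> 0\<^sub>v m" "gmat \<kappa> x *\<^sub>v v = 0\<^sub>v m"
    using det_0_iff_vec_prod_zero_field[OF gmat_carrier] by blast
  define a where "a = vec_index v"
  have "\<exists>i<m. a i \<noteq> 0" using v(1,2) unfolding a_def by (metis eq_vecI carrier_vecD index_zero_vec(1,2))
  hence pos: "(\<Sum>i<m. \<Sum>j<m. metric_comp m B g \<kappa> i j x * a i * a j) > 0" by (rule metric_comp_pos[OF assms])
  have "(\<Sum>j<m. metric_comp m B g \<kappa> i j x * a j) = 0" if "i < m" for i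
  proof -
    have "vec_index (gmat \<kappa> x *\<^sub>v v) i = (\<Sum>j<m. metric_comp m B g \<kappa> i j x * a j)"
      using that v(1) by (simp add: gmat_def a_def scalar_prod_def atLeast0LessThan)
    thus ?thesis using v(3) that by simp
  qed
  hence "(\<Sum>i<m. \<Sum>j<m. metric_comp m B g \<kappa> i j x * a i * a j) = 0"
    by (simp add: sum_distrib_left[symmetric] mult.assoc mult.left_commute[of _ "a _"])
  thus False using pos by simp
qed

text \<open>\<open>mat_inverse\<close> is given by an elimination procedure and offers no formula
  that could be differentiated; Cramer's rule supplies one.\<close>

lemma metric_inverse:
  assumes "\<kappa> \<in> B" "x \<in> snd \<kappa> ` fst \<kappa>"
  shows "i < m \<Longrightarrow> j < m \<Longrightarrow> metric_inv_comp m B g \<kappa> i j x =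
      inverse (Determinant.det (gmat \<kappa> x)) * adj_mat (gmat \<kappa> x) $$ (i, j)"
    and "s < m \<Longrightarrow> j < m \<Longrightarrow> (\<Sum>l<m. metric_comp m B g \<kappa> j l x * metric_inv_comp m B g \<kappa> l s x) = (if j = s then 1 else 0)"
proof -
  let ?M = "gmat \<kappa> x"
  note M = gmat_carrier[of \<kappa> x] and d = det_gmat_nonzero[OF assms]
  have "mat_inverse ?M \<noteq> None" using mat_inverse(1)[OF M, where b="()"] det_non_zero_imp_unit[OF M d, where b="()"] by blast
  then obtain I where I: "mat_inverse ?M = Some I" by blast
  hence I': "?M * I = 1\<^sub>m m" "I * ?M = 1\<^sub>m m" "I \<in> carrier_mat m m" using mat_inverse(2)[OF M] by auto
  have inv: "metric_inv_comp m B g \<kappa> i j x = I $$ (i, j)" for i j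
    using I by (simp add: metric_inv_comp_def gmat_def)
  note adj = adj_mat[OF M]
  have "adj_mat ?M = (I * ?M) * adj_mat ?M" using I'(2) adj(1) by simp
  also have "\<dots> = I * (?M * adj_mat ?M)" by (rule assoc_mult_mat[OF I'(3) M adj(1)])
  also have "\<dots> = Determinant.det ?M \<cdot>\<^sub>m I" unfolding adj(2)
    using mult_smult_distrib[OF I'(3) one_carrier_mat, of "Determinant.det ?M"] right_mult_one_mat[OF I'(3)] by simp
  finally have "adj_mat ?M $$ (i, j) = Determinant.det ?M * I $$ (i, j)" if "i < m" "j < m" for i j
    using that I'(3) by simp
  thus "i < m \<Longrightarrow> j < m \<Longrightarrow> metric_inv_comp m B g \<kappa> i j x = inverse (Determinant.det ?M) * adj_mat ?M $$ (i, j)"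
    using d by (simp add: inv)
  assume "s < m" "j < m"
  have "(?M * I) $$ (j, s) = (\<Sum>l<m. metric_comp m B g \<kappa> j l x * I $$ (l, s))"
    using \<open>s < m\<close> \<open>j < m\<close> I'(3) M by (simp add: scalar_prod_def atLeast0LessThan) (simp add: gmat_def)
  thus "(\<Sum>l<m. metric_comp m B g \<kappa> j l x * metric_inv_comp m B g \<kappa> l s x) = (if j = s then 1 else 0)"
    unfolding inv I'(1) using \<open>s < m\<close> \<open>j < m\<close> by simp
qed

lemma metric_inv_comp_Ck:
  assumes "\<kappa> \<in> B" "i < m" "j < m"
  shows "Ck_on k m (snd \<kappa> ` fst \<kappa>) (metric_inv_comp m B g \<kappa> i j)"
proof -
  note U = chart_image_open[OF assms(1)]
  have a: "Ck_on k m (snd \<kappa> ` fst \<kappa>) (metric_comp m B g \<kappa> i j)" if "i < m" "j < m" for i j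
    using metric_smooth[OF assms(1) that] unfolding smooth_on_def by blast
  have "Ck_on k m (snd \<kappa> ` fst \<kappa>) (\<lambda>x. inverse (Determinant.det (gmat \<kappa> x)) * adj_mat (gmat \<kappa> x) $$ (i, j))"
    by (intro Ck_on_mult Ck_on_inverse U det_gmat_nonzero[OF assms(1)])
      (unfold gmat_def, auto intro: Ck_on_det[OF U] Ck_on_adj_mat[OF U] a assms)
  thus ?thesis
    by (rule Ck_on_cong_imp[OF U, rotated]) (use metric_inverse(1)[OF assms(1)] assms in auto)
qed

lemma metric_chart_coordinates:
  assumes \<kappa>: "\<kappa> \<in> B"
  shows "metric_chart m (snd \<kappa> ` fst \<kappa>) (metric_comp m B g \<kappa>) (christoffel m B g \<kappa>)"
proof
  let ?U = "snd \<kappa> ` fst \<kappa>" and ?G = "metric_comp m B g \<kappa>" and ?I = "metric_inv_comp m B g \<kappa>"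
  let ?\<Gamma> = "christoffel m B g \<kappa>"
  show U: "openin (top_of_set (coord_space m)) ?U" by (rule chart_image_open[OF \<kappa>])
  have GC: "Ck_on k m ?U (?G i j)" if "i < m" "j < m" for i j k
    using metric_smooth[OF \<kappa> that] unfolding smooth_on_def by blast
  show "Ck_on (Suc (Suc 0)) m ?U (?G i j)" if "i < m" "j < m" for i j by (rule GC[OF that])
  have pdC: "Ck_on (Suc 0) m ?U (pd k 1 (?G i j))" if "i < m" "j < m" "k < m" for i j k
    using Ck_on_pd[OF GC[OF that(1,2)] that(3)] by (simp del: Ck_on.simps)
  show "Ck_on (Suc 0) m ?U (?\<Gamma> i j k)" if "i < m" "j < m" "k < m" for i j k
  proof -
    have "?\<Gamma> i j k = (\<lambda>x. inverse 2 * (\<Sum>l<m. ?I i l x * (pd j 1 (?G l k) x + (pd k 1 (?G j l) x + (-1) * pd l 1 (?G j k) x))))"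
      by (simp add: christoffel_def fun_eq_iff algebra_simps)
    moreover have "Ck_on (Suc 0) m ?U \<dots>"
      by (intro Ck_on_mult Ck_on_sum Ck_on_add Ck_on_const U pdC metric_inv_comp_Ck[OF \<kappa>] that) auto
    ultimately show ?thesis by simp
  qed
  have pds: "pd k 1 (?G i j) x = pd k 1 (?G j i) x" if "i < m" "j < m" "k < m" "x \<in> ?U" for i j k x
    by (rule pd_cong[OF U that(4,3)]) (rule metric_comp_sym[OF \<kappa> _ that(1,2)])
  show "?\<Gamma> l j k x = ?\<Gamma> l k j x" if "x \<in> ?U" "l < m" "j < m" "k < m" for l j k x
    unfolding christoffel_def using pds that by (intro arg_cong2[where f="(/)"] sum.cong refl) (simp add: add.commute)
  show "?G i j x = ?G j i x" if "x \<in> ?U" "i < m" "j < m" for i j x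
    by (rule metric_comp_sym[OF \<kappa> that])
  show "(\<Sum>i<m. \<Sum>j<m. ?G i j x * a i * a j) > 0" if "x \<in> ?U" "\<exists>i<m. a i \<noteq> 0" for x a
    by (rule metric_comp_pos[OF \<kappa> that])
  fix x i j k assume x: "x \<in> ?U" and ijk: "i < m" "j < m" "k < m"
  \<comment> \<open>Lowering the upper index cancels the inverse matrix and gives the Christoffel
    symbols of the first kind. Adding two of these, with i and j exchanged, leaves the derivative of
    one metric coefficient.\<close>
  have low: "(\<Sum>l<m. ?\<Gamma> l k i x * ?G j l x) = (pd k 1 (?G j i) x + pd i 1 (?G k j) x - pd j 1 (?G k i) x) / 2"
    if "i < m" "j < m" for i j
  proof -
    let ?P = "\<lambda>s. pd k 1 (?G s i) x + pd i 1 (?G k s) x - pd s 1 (?G k i) x"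
    have "(\<Sum>l<m. ?\<Gamma> l k i x * ?G j l x) = (\<Sum>l<m. \<Sum>s<m. ?G j l x * ?I l s x * ?P s / 2)"
      unfolding christoffel_def by (simp add: sum_distrib_left sum_distrib_right sum_divide_distrib mult_ac)
    also have "\<dots> = (\<Sum>s<m. \<Sum>l<m. ?G j l x * ?I l s x * ?P s / 2)" by (rule sum.swap)
    also have "\<dots> = (\<Sum>s<m. (\<Sum>l<m. ?G j l x * ?I l s x) * (?P s / 2))"
      by (simp add: sum_distrib_right sum_divide_distrib)
    also have "\<dots> = (\<Sum>s<m. if j = s then ?P s / 2 else 0)"
      by (intro sum.cong refl) (simp add: metric_inverse(2)[OF \<kappa> x _ that(2)])
    also have "\<dots> = ?P j / 2" using that(2) by simp
    finally show ?thesis .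
  qed
  have "(\<Sum>l<m. ?\<Gamma> l k i x * ?G l j x) = (\<Sum>l<m. ?\<Gamma> l k i x * ?G j l x)"
    by (intro sum.cong refl) (simp add: metric_comp_sym[OF \<kappa> x _ ijk(2)])
  also have "\<dots> = (pd k 1 (?G j i) x + pd i 1 (?G k j) x - pd j 1 (?G k i) x) / 2" by (rule low[OF ijk(1,2)])
  finally show "pd k 1 (?G i j) x = (\<Sum>l<m. ?\<Gamma> l k i x * ?G l j x) + (\<Sum>l<m. ?\<Gamma> l k j x * ?G i l x)"
    using low[OF ijk(2,1)] pds[OF ijk(1,2,3) x] by simp
qed

lemma riem_eq: "riemann_comp m B g \<kappa> = riem m (christoffel m B g \<kappa>)"
  by (simp add: fun_eq_iff riemann_comp_def riem_def)

lemma Rm_sum: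
  "Rm m \<Gamma> G x (\<lambda>i. complex_of_real (a i)) (\<lambda>i. complex_of_real (b i)) (\<lambda>i. complex_of_real (b i)) (\<lambda>i. complex_of_real (a i))
    = complex_of_real (\<Sum>i<m. \<Sum>j<m. \<Sum>k<m. \<Sum>l<m. \<Sum>s<m. riem m \<Gamma> l i j k x * G l s x * a i * b j * b k * a s)"
proof -
  have "Rm m \<Gamma> G x (\<lambda>i. complex_of_real (a i)) (\<lambda>i. complex_of_real (b i)) (\<lambda>i. complex_of_real (b i)) (\<lambda>i. complex_of_real (a i))
    = (\<Sum>l<m. \<Sum>s<m. \<Sum>i<m. \<Sum>j<m. \<Sum>k<m. complex_of_real (riem m \<Gamma> l i j k x * G l s x * a i * b j * b k * a s))"
    unfolding Rm_def ip_def curv_def by (simp add: sum_distrib_left sum_distrib_right mult_ac)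
  also have "\<dots> = (\<Sum>i<m. \<Sum>l<m. \<Sum>s<m. \<Sum>j<m. \<Sum>k<m. complex_of_real (riem m \<Gamma> l i j k x * G l s x * a i * b j * b k * a s))"
    by (rule sum_swap3)
  also have "\<dots> = (\<Sum>i<m. \<Sum>j<m. \<Sum>l<m. \<Sum>s<m. \<Sum>k<m. complex_of_real (riem m \<Gamma> l i j k x * G l s x * a i * b j * b k * a s))"
    by (intro sum.cong refl sum_swap3)
  also have "\<dots> = (\<Sum>i<m. \<Sum>j<m. \<Sum>k<m. \<Sum>l<m. \<Sum>s<m. complex_of_real (riem m \<Gamma> l i j k x * G l s x * a i * b j * b k * a s))"
    by (intro sum.cong refl sum_swap3)
  finally show ?thesis by simp
qed

text \<open>The denominator of the sectional curvature is positive, so its numerator has the same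
  sign.\<close>

lemma metric_gram_pos:
  assumes q: "q \<in> points B" and X: "X \<in> tangent_space m B q" and Y: "Y \<in> tangent_space m B q"
    and ind: "\<forall>a b. (\<lambda>k. a * X k + b * Y k) = (\<lambda>k. 0) \<longrightarrow> a = 0 \<and> b = 0"
  shows "g q X X * g q Y Y - (g q X Y)\<^sup>2 > 0"
proof -
  have lin: "g q (\<lambda>k. a * X k + b * Y k) W = a * g q X W + b * g q Y W" if "W \<in> tangent_space m B q" for a b W
    using metric_add[OF q tangent_space_scale[OF X] tangent_space_scale[OF Y] that, of a b]
      metric_scale[OF q X that] metric_scale[OF q Y that] by simp
  have "Y \<noteq> (\<lambda>k. 0)" using ind[rule_format, of 0 1] by auto
  hence yy: "g q Y Y > 0" by (rule metric_pos[OF q Y])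
  \<comment> \<open>Gram-Schmidt without division: a X + b Y is orthogonal to Y, and its squared
    length is the squared length of Y times the Gram determinant.\<close>
  define a b where "a = g q Y Y" and "b = - g q X Y"
  let ?Z = "\<lambda>k. a * X k + b * Y k"
  have Z: "?Z \<in> tangent_space m B q" by (rule tangent_space_lincomb[OF X Y])
  have "?Z \<noteq> (\<lambda>k. 0)" using ind[rule_format, of a b] yy by (auto simp: a_def)
  hence "g q ?Z ?Z > 0" by (rule metric_pos[OF q Z])
  also have "g q ?Z ?Z = a * g q ?Z X + b * g q ?Z Y"
    unfolding lin[OF Z] metric_sym[OF q X Z] metric_sym[OF q Y Z] ..
  also have "\<dots> = g q Y Y * (g q X X * g q Y Y - (g q X Y)\<^sup>2)"
    unfolding lin[OF X] lin[OF Y] metric_sym[OF q Y X] by (simp add: a_def b_def power2_eq_square algebra_simps)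
  finally show ?thesis using yy by (simp add: zero_less_mult_iff)
qed

lemma curv_parallel: "curv m \<Gamma> x (\<lambda>i. t * b i) b v l = 0" "curv m \<Gamma> x b (\<lambda>i. t * b i) v l = 0"
proof -
  have "curv m \<Gamma> x b b v l = 0" unfolding curv_eq by simp
  thus "curv m \<Gamma> x (\<lambda>i. t * b i) b v l = 0" "curv m \<Gamma> x b (\<lambda>i. t * b i) v l = 0"
    using curv_lin1[of m \<Gamma> x "\<lambda>i. 0" t b b v l] curv_lin2[of m \<Gamma> x b "\<lambda>i. 0" t b v l] by (simp_all add: curv_def)
qed

text \<open>The hypothesis speaks of linearly independent pairs only. For dependent ones the
  curvature operator vanishes by antisymmetry, so the sign holds for all pairs, as is needed for the
  arbitrary real and imaginary parts of X and S.\<close>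

lemma nonpositive_curvature_Rm:
  assumes np: "nonpositive_sectional_curvature m B g" and \<kappa>: "\<kappa> \<in> B" and x: "x \<in> snd \<kappa> ` fst \<kappa>"
  shows "Re (Rm m (christoffel m B g \<kappa>) (metric_comp m B g \<kappa>) x (\<lambda>i. complex_of_real (a i)) (\<lambda>i. complex_of_real (b i))
      (\<lambda>i. complex_of_real (b i)) (\<lambda>i. complex_of_real (a i))) \<le> 0"
proof -
  let ?\<Gamma> = "christoffel m B g \<kappa>" and ?G = "metric_comp m B g \<kappa>"
  obtain q where q: "q \<in> fst \<kappa>" "x = snd \<kappa> q" using x by auto
  let ?X = "tangent_vec \<kappa> a q" and ?Y = "tangent_vec \<kappa> b q"
  note X = tangent_vec_in_tangent_space[OF \<kappa> q(1), of a] and Y = tangent_vec_in_tangent_space[OF \<kappa> q(1), of b]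
  note qp = point_of_chart[OF \<kappa> q(1)]
  show ?thesis
  proof (cases "\<forall>\<alpha> \<beta>. (\<lambda>k. \<alpha> * ?X k + \<beta> * ?Y k) = (\<lambda>k. 0) \<longrightarrow> \<alpha> = 0 \<and> \<beta> = 0")
    case True
    have "sectional_curvature m B g \<kappa> q ?X ?Y \<le> 0"
      using np \<kappa> q(1) X Y True unfolding nonpositive_sectional_curvature_def by blast
    moreover have "sectional_curvature m B g \<kappa> q ?X ?Y = Re (Rm m ?\<Gamma> ?G x (\<lambda>i. complex_of_real (a i)) (\<lambda>i. complex_of_real (b i))
      (\<lambda>i. complex_of_real (b i)) (\<lambda>i. complex_of_real (a i))) / (g q ?X ?X * g q ?Y ?Y - (g q ?X ?Y)\<^sup>2)"
      unfolding sectional_curvature_def Rm_sum q(2) riem_eq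
      using tangent_vec_component[OF \<kappa> q(1)] by simp
    ultimately show ?thesis using metric_gram_pos[OF qp X Y True] by (simp add: divide_le_0_iff)
  next
    case False
    then obtain \<alpha> \<beta> where ab: "(\<lambda>k. \<alpha> * ?X k + \<beta> * ?Y k) = (\<lambda>k. 0)" "\<alpha> \<noteq> 0 \<or> \<beta> \<noteq> 0" by blast
    have lin: "\<alpha> * a i + \<beta> * b i = 0" if "i < m" for i
      using fun_cong[OF ab(1), of "(\<kappa>, i)"] tangent_vec_component[OF \<kappa> q(1) that] by simp
    have "curv m ?\<Gamma> x (\<lambda>i. complex_of_real (a i)) (\<lambda>i. complex_of_real (b i)) v l = 0" for v l
    proof (cases "\<alpha> = 0")
      case False
      have "complex_of_real (a i) = complex_of_real (- \<beta> / \<alpha>) * complex_of_real (b i)" if "i < m" for i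
        unfolding of_real_mult[symmetric] of_real_eq_iff using lin[OF that] False by (simp add: field_simps)
      hence "curv m ?\<Gamma> x (\<lambda>i. complex_of_real (a i)) (\<lambda>i. complex_of_real (b i)) v l =
          curv m ?\<Gamma> x (\<lambda>i. complex_of_real (- \<beta> / \<alpha>) * complex_of_real (b i)) (\<lambda>i. complex_of_real (b i)) v l"
        by (intro curv_cong) auto
      thus ?thesis unfolding curv_parallel .
    next
      case True
      hence "b i = 0" if "i < m" for i using lin[OF that] ab(2) by simp
      hence "curv m ?\<Gamma> x (\<lambda>i. complex_of_real (a i)) (\<lambda>i. complex_of_real (b i)) v l =
          curv m ?\<Gamma> x (\<lambda>i. complex_of_real (a i)) (\<lambda>i. 0 * complex_of_real (a i)) v l"
        by (intro curv_cong) auto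
      thus ?thesis unfolding curv_parallel .
    qed
    thus ?thesis by (simp add: Rm_def ip_def)
  qed
qed

end

section \<open>Complex lines in coordinate space and pluriharmonicity\<close>

text \<open>A complex affine plane in coordinate space with two complex parameters. The parameter
  space is normed, so Frechet derivatives are available on it.\<close>

definition aff :: "(nat \<Rightarrow> complex) \<Rightarrow> (nat \<Rightarrow> complex) \<Rightarrow> (nat \<Rightarrow> complex) \<Rightarrow> complex \<times> complex \<Rightarrow> nat \<Rightarrow> complex"
  where "aff x p q z = (\<lambda>j. x j + (fst z * p j + snd z * q j))"

lemma aff_zero [simp]: "aff x p q 0 = x"
  by (simp add: aff_def)

lemma aff_coord_space:
  "x \<in> coord_space n \<Longrightarrow> p \<in> coord_space n \<Longrightarrow> q \<in> coord_space n \<Longrightarrow> aff x p q z \<in> coord_space n"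
  by (auto simp: aff_def coord_space_def)

lemma aff_bounded_linear: "bounded_linear (\<lambda>z :: complex \<times> complex. fst z * a + snd z * b)"
  by (intro bounded_linear_add bounded_linear_compose[OF bounded_linear_mult_left]
      bounded_linear_fst bounded_linear_snd)

lemma aff_has_derivative: "((\<lambda>z. aff x p q z j) has_derivative (\<lambda>h. fst h * p j + snd h * q j)) (at z)"
proof -
  have "((\<lambda>z. x j + (fst z * p j + snd z * q j)) has_derivative (\<lambda>h. 0 + (fst h * p j + snd h * q j))) (at z)"
    by (intro has_derivative_add has_derivative_const bounded_linear_imp_has_derivative aff_bounded_linear)
  thus ?thesis by (simp add: aff_def)
qed

lemma aff_twice_diff: "open N \<Longrightarrow> twice_diff N (\<lambda>z. aff x p q z j)"
  unfolding aff_def by (intro twice_diff_add twice_diff_const twice_diff_linear_map aff_bounded_linear)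

lemma open_aff_vimage:
  assumes "openin (top_of_set (coord_space n)) U" "x \<in> coord_space n" "p \<in> coord_space n" "q \<in> coord_space n"
  shows "open (aff x p q -` U)"
proof -
  obtain W where W: "open W" "U = coord_space n \<inter> W" using assms(1) by (auto simp: openin_open)
  have "aff x p q -` U = aff x p q -` W" using W(2) aff_coord_space[OF assms(2-4)] by auto
  moreover have "continuous_on UNIV (aff x p q)"
    by (intro continuous_on_coordinatewise_then_product continuous_at_imp_continuous_on ballI
        has_derivative_continuous[OF aff_has_derivative])
  ultimately show ?thesis using W(1) by (simp add: open_vimage)
qed

text \<open>The plane is holomorphically parametrised, so derivatives by \<zeta> and \<eta> see only
  the operators \<open>dz\<close>, and the conjugate derivative by \<zeta> only
  \<open>dzbar\<close>.\<close>

lemma aff_cder: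
  assumes U: "openin (top_of_set (coord_space n)) U" and w: "Ck_on (Suc 0) n U w"
    and xpq: "x \<in> coord_space n" "p \<in> coord_space n" "q \<in> coord_space n" and z: "aff x p q z \<in> U"
  shows "(\<lambda>z. w (aff x p q z)) differentiable (at z)"
    and "cder d\<zeta> (\<lambda>z. w (aff x p q z)) z = (\<Sum>a<n. p a * dz a w (aff x p q z))"
    and "cder d\<zeta>' (\<lambda>z. w (aff x p q z)) z = (\<Sum>a<n. cnj (p a) * dzbar a w (aff x p q z))"
    and "cder d\<eta> (\<lambda>z. w (aff x p q z)) z = (\<Sum>a<n. q a * dz a w (aff x p q z))"
proof -
  have hd: "((\<lambda>z. w (aff x p q z)) has_derivative (\<lambda>h. \<Sum>a<n. dz a w (aff x p q z) * (fst h * p a + snd h * q a)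
      + dzbar a w (aff x p q z) * cnj (fst h * p a + snd h * q a))) (at z)"
    by (rule differentiable_compose_complex[OF U w open_aff_vimage[OF U xpq] _ _ aff_has_derivative])
      (use z in auto)
  show "(\<lambda>z. w (aff x p q z)) differentiable (at z)" using hd by (rule differentiableI)
  note c = cder_eqI[OF hd]
  show "cder d\<zeta> (\<lambda>z. w (aff x p q z)) z = (\<Sum>a<n. p a * dz a w (aff x p q z))"
    unfolding c sum_distrib_left sum.distrib[symmetric]
    by (intro sum.cong refl) (simp add: d\<zeta>_def complex_eq_iff field_simps)
  show "cder d\<zeta>' (\<lambda>z. w (aff x p q z)) z = (\<Sum>a<n. cnj (p a) * dzbar a w (aff x p q z))"
    unfolding c sum_distrib_left sum.distrib[symmetric]
    by (intro sum.cong refl) (simp add: d\<zeta>'_def complex_eq_iff field_simps)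
  show "cder d\<eta> (\<lambda>z. w (aff x p q z)) z = (\<Sum>a<n. q a * dz a w (aff x p q z))"
    unfolding c sum_distrib_left sum.distrib[symmetric]
    by (intro sum.cong refl) (simp add: d\<eta>_def complex_eq_iff field_simps)
qed

lemma aff_compose_twice_diff:
  assumes U: "openin (top_of_set (coord_space n)) U" and w: "Ck_on (Suc (Suc 0)) n U w"
    and N: "open N" "\<And>z. z \<in> N \<Longrightarrow> aff x p q z \<in> U"
  shows "twice_diff N (\<lambda>z. w (aff x p q z))"
  by (rule twice_diff_compose[OF U w N aff_twice_diff[OF N(1)]])

lemma conj_wirtinger: "(fst d\<zeta>, - snd d\<zeta>) = d\<zeta>'" "(fst d\<zeta>', - snd d\<zeta>') = d\<zeta>"
  by (simp_all add: d\<zeta>_def d\<zeta>'_def)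

section \<open>The complex Hessian at a maximum\<close>

text \<open>The mixed real derivatives cancel by symmetry. In this form the complex Hessian can be
  bounded by two applications of the real second derivative test.\<close>

lemma laplacian_cder:
  assumes "open N" "twice_diff N u" "y \<in> N"
  shows "4 * cder d\<zeta>' (cder d\<zeta> u) y =
    frechet_derivative (\<lambda>z. frechet_derivative u (at z) (1, 0)) (at y) (1, 0)
    + frechet_derivative (\<lambda>z. frechet_derivative u (at z) (\<i>, 0)) (at y) (\<i>, 0)"
proof -
  define H where "H v w = frechet_derivative (\<lambda>z. frechet_derivative u (at z) v) (at y) w" for v w
  have 1: "H v (r *\<^sub>R w) = r *\<^sub>R H v w" for v w r
  proof -
    have "bounded_linear (H v)" unfolding H_def[abs_def]
      by (intro has_derivative_bounded_linear[OF differentiable_frechet] twice_diff_frechet_differentiable[OF assms(2,3)])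
    then interpret bounded_linear "H v" .
    show ?thesis by (rule scaleR)
  qed
  have sym: "H v w = H w v" for v w unfolding H_def by (rule frechet_commute[OF assms])
  have 2: "H (r *\<^sub>R v) w = r *\<^sub>R H v w" for v w r using 1 sym by metis
  have e: "(1/2, 0) = (1/2) *\<^sub>R (1::complex, 0::complex)" "(- \<i> / 2, 0) = (-1/2) *\<^sub>R (\<i>, 0::complex)" "(\<i> / 2, 0) = (1/2) *\<^sub>R (\<i>, 0::complex)"
    by (simp_all add: complex_eq_iff)
  have "cder d\<zeta>' (cder d\<zeta> u) y = H (1/2, 0) (1/2, 0) + \<i> * H (- \<i> / 2, 0) (1/2, 0)
      + \<i> * (H (1/2, 0) (\<i> / 2, 0) + \<i> * H (- \<i> / 2, 0) (\<i> / 2, 0))"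
    unfolding cder_cder_eq[OF assms] H_def by (simp add: d\<zeta>_def d\<zeta>'_def)
  also have "\<dots> = (H (1, 0) (1, 0) + H (\<i>, 0) (\<i>, 0)) / 4"
    unfolding e 1 2 using sym[of "(1, 0)" "(\<i>, 0)"] by (simp add: complex_eq_iff field_simps)
  finally show ?thesis by (simp add: H_def mult.commute)
qed

text \<open>Second derivatives are not known to be continuous. On the slice the first derivative
  vanishes at 0; a positive second derivative would make it positive just to the right of 0, and the
  mean value theorem would give a larger value.\<close>

lemma second_derivative_test:
  fixes u :: "'e::real_normed_vector \<Rightarrow> complex"
  assumes N: "open N" "twice_diff N u" "0 \<in> N" and max: "\<And>y. y \<in> N \<Longrightarrow> Re (u y) \<le> Re (u 0)"
  shows "Re (frechet_derivative (\<lambda>z. frechet_derivative u (at z) w) (at 0) w) \<le> 0"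
proof (rule ccontr)
  let ?k = "Re (frechet_derivative (\<lambda>z. frechet_derivative u (at z) w) (at 0) w)"
  assume "\<not> ?thesis"
  hence k: "?k > 0" by simp
  let ?c = "\<lambda>t::real. t *\<^sub>R w"
  define \<rho> where "\<rho> t = Re (u (?c t))" for t
  define \<rho>' where "\<rho>' t = Re (frechet_derivative u (at (?c t)) w)" for t
  have c: "(?c has_derivative (\<lambda>h. h *\<^sub>R w)) (at t)" for t by (auto intro!: derivative_eq_intros)
  have \<rho>d: "(\<rho> has_real_derivative \<rho>' t) (at t)" if t: "?c t \<in> N" for t
  proof -
    interpret L: bounded_linear "frechet_derivative u (at (?c t))"
      using twice_diff_frechet[OF N(2) t] by (rule has_derivative_bounded_linear)
    have "((\<lambda>t. u (?c t)) has_derivative (\<lambda>h. frechet_derivative u (at (?c t)) (h *\<^sub>R w))) (at t)"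
      by (rule has_derivative_compose[OF c twice_diff_frechet[OF N(2) t]])
    from bounded_linear.has_derivative[OF bounded_linear_Re this]
    show ?thesis unfolding \<rho>_def[abs_def] \<rho>'_def has_field_derivative_def by (simp add: L.scaleR mult_commute_abs)
  qed
  have "(\<rho>' has_real_derivative ?k) (at 0)"
  proof -
    have D: "((\<lambda>z. frechet_derivative u (at z) w) has_derivative
        frechet_derivative (\<lambda>z. frechet_derivative u (at z) w) (at 0)) (at (?c 0))"
      using differentiable_frechet[OF twice_diff_frechet_differentiable[OF N(2,3)]] by simp
    interpret L: bounded_linear "frechet_derivative (\<lambda>z. frechet_derivative u (at z) w) (at 0)"
      using D by (rule has_derivative_bounded_linear)
    have "((\<lambda>t. frechet_derivative u (at (?c t)) w) has_derivative
        (\<lambda>h. frechet_derivative (\<lambda>z. frechet_derivative u (at z) w) (at 0) (h *\<^sub>R w))) (at 0)"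
      by (rule has_derivative_compose[OF c D])
    from bounded_linear.has_derivative[OF bounded_linear_Re this]
    show ?thesis unfolding \<rho>'_def[abs_def] has_field_derivative_def by (simp add: L.scaleR mult_commute_abs)
  qed
  from DERIV_pos_inc_right[OF this k] obtain d1 where d1: "d1 > 0" "\<And>h. 0 < h \<Longrightarrow> h < d1 \<Longrightarrow> \<rho>' 0 < \<rho>' h"
    by auto
  have "continuous_on UNIV ?c" by (intro continuous_intros)
  hence "open (?c -` N)" using N(1) by (simp add: open_vimage)
  moreover have "0 \<in> ?c -` N" using N(3) by simp
  ultimately obtain d2 where d2: "d2 > 0" "ball 0 d2 \<subseteq> ?c -` N" using open_contains_ball by blast
  have inN: "?c t \<in> N" if "\<bar>t\<bar> < d2" for t using d2(2) that by (auto simp: subset_eq)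
  have "\<rho>' 0 = 0"
    by (rule DERIV_local_max[OF \<rho>d d2(1)]) (use N(3) inN max in \<open>auto simp: \<rho>_def\<close>)
  define t where "t = min d1 d2 / 2"
  have t: "t > 0" "t < d1" "t < d2" using d1(1) d2(1) by (auto simp: t_def)
  obtain s where s: "0 < s" "s < t" "\<rho> t - \<rho> 0 = (t - 0) * \<rho>' s"
    using MVT2[OF t(1), of \<rho> \<rho>'] \<rho>d inN t by auto
  have "\<rho>' s > 0" using d1(2)[of s] s t \<open>\<rho>' 0 = 0\<close> by simp
  hence "0 < (t - 0) * \<rho>' s" using t(1) by simp
  hence "\<rho> t > \<rho> 0" using s(3) by linarith
  moreover have "\<rho> t \<le> \<rho> 0" using max[OF inN[of t]] t by (simp add: \<rho>_def)
  ultimately show False by simp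
qed

lemma twice_diff_ln:
  fixes u :: "'e::real_normed_vector \<Rightarrow> complex"
  assumes N: "open N" "twice_diff N u" and pos: "\<And>z. z \<in> N \<Longrightarrow> Re (u z) > 0" and im: "\<And>z. z \<in> N \<Longrightarrow> Im (u z) = 0"
  shows "twice_diff N (\<lambda>z. complex_of_real (ln (Re (u z))))"
    and "y \<in> N \<Longrightarrow> cder d (\<lambda>z. complex_of_real (ln (Re (u z)))) y = cder d u y * inverse (u y)"
proof -
  have real: "u z = complex_of_real (Re (u z))" if "z \<in> N" for z using im[OF that] by (simp add: complex_eq_iff)
  have L: "((\<lambda>z. complex_of_real (ln (Re (u z)))) has_derivative
      (\<lambda>h. frechet_derivative u (at y) h * inverse (u y))) (at y)" if y: "y \<in> N" for y
  proof -
    note D = twice_diff_frechet[OF N(2) y]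
    have DR: "((\<lambda>z. Re (u z)) has_derivative (\<lambda>h. Re (frechet_derivative u (at y) h))) (at y)"
      by (rule bounded_linear.has_derivative[OF bounded_linear_Re D])
    \<comment> \<open>\<open>u\<close> is real on an open set, so its differential has real values
      there; this allows passing between \<open>u\<close> and its real part.\<close>
    have "(u has_derivative (\<lambda>h. complex_of_real (Re (frechet_derivative u (at y) h)))) (at y)"
      by (rule has_derivative_transform_within_open[OF bounded_linear.has_derivative[OF bounded_linear_of_real DR] N(1) y])
        (use real in auto)
    hence Fr: "frechet_derivative u (at y) = (\<lambda>h. complex_of_real (Re (frechet_derivative u (at y) h)))"
      by (rule frechet_eqI)
    have "(ln has_derivative (\<lambda>h. inverse (Re (u y)) * h)) (at (Re (u y)))"
      using DERIV_ln[OF pos[OF y]] by (simp add: has_field_derivative_def)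
    from has_derivative_compose[OF DR this]
    have "((\<lambda>z. ln (Re (u z))) has_derivative (\<lambda>h. inverse (Re (u y)) * Re (frechet_derivative u (at y) h))) (at y)" .
    from bounded_linear.has_derivative[OF bounded_linear_of_real this]
    have "((\<lambda>z. complex_of_real (ln (Re (u z)))) has_derivative
        (\<lambda>h. complex_of_real (inverse (Re (u y)) * Re (frechet_derivative u (at y) h)))) (at y)" .
    moreover have "complex_of_real (inverse (Re (u y)) * Re (frechet_derivative u (at y) h)) =
        frechet_derivative u (at y) h * inverse (u y)" for h
    proof -
      have F: "complex_of_real (Re (frechet_derivative u (at y) h)) = frechet_derivative u (at y) h"
        by (rule fun_cong[OF Fr, of h, symmetric])
      show ?thesis unfolding of_real_mult of_real_inverse F real[OF y, symmetric] by (rule mult.commute)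
    qed
    ultimately show ?thesis by simp
  qed
  have nz: "u z \<noteq> 0" if "z \<in> N" for z using pos[OF that] by auto
  show "twice_diff N (\<lambda>z. complex_of_real (ln (Re (u z))))"
  proof (rule twice_diffI[OF N(1) L])
    fix v y assume y: "y \<in> N"
    show "(\<lambda>z. frechet_derivative u (at z) v * inverse (u z)) differentiable (at y)"
      by (intro differentiable_mult differentiable_inverse twice_diff_frechet_differentiable[OF N(2) y]
          twice_diff_differentiable[OF N(2) y] nz[OF y])
  qed
  show "cder d (\<lambda>z. complex_of_real (ln (Re (u z)))) y = cder d u y * inverse (u y)" if "y \<in> N"
    unfolding cder_eqI[OF L[OF that]] by (simp add: cder_def algebra_simps)
qed

lemma differentiable_inverse_complex:
  fixes u :: "'e::real_normed_vector \<Rightarrow> complex"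
  assumes "u differentiable (at y)" "u y \<noteq> 0"
  shows "(\<lambda>z. inverse (u z)) differentiable (at y)"
    and "cder d (\<lambda>z. inverse (u z)) y = - cder d u y * (inverse (u y))\<^sup>2"
proof -
  have "((\<lambda>z. inverse (u z)) has_derivative (\<lambda>h. - (inverse (u y) * frechet_derivative u (at y) h * inverse (u y)))) (at y)"
    by (rule Deriv.has_derivative_inverse[OF assms(2) differentiable_frechet[OF assms(1)]])
  note L = this
  show "(\<lambda>z. inverse (u z)) differentiable (at y)" using L by (rule differentiableI)
  show "cder d (\<lambda>z. inverse (u z)) y = - cder d u y * (inverse (u y))\<^sup>2"
    unfolding cder_eqI[OF L] by (simp add: cder_def power2_eq_square algebra_simps)
qed

lemma gam_sum_left: "gam m \<Gamma> x (\<lambda>j. \<Sum>\<alpha>\<in>I. t \<alpha> * a \<alpha> j) b l = (\<Sum>\<alpha>\<in>I. t \<alpha> * gam m \<Gamma> x (a \<alpha>) b l)"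
proof -
  have "gam m \<Gamma> x (\<lambda>j. \<Sum>\<alpha>\<in>I. t \<alpha> * a \<alpha> j) b l = (\<Sum>j<m. \<Sum>k<m. \<Sum>\<alpha>\<in>I. t \<alpha> * (complex_of_real (\<Gamma> l j k x) * a \<alpha> j * b k))"
    unfolding gam_def by (simp add: sum_distrib_left sum_distrib_right mult_ac)
  also have "\<dots> = (\<Sum>\<alpha>\<in>I. \<Sum>j<m. \<Sum>k<m. t \<alpha> * (complex_of_real (\<Gamma> l j k x) * a \<alpha> j * b k))" by (rule sum_swap3)
  finally show ?thesis by (simp add: gam_def sum_distrib_left)
qed

lemma gam_sum_right: "gam m \<Gamma> x a (\<lambda>j. \<Sum>\<alpha>\<in>I. t \<alpha> * b \<alpha> j) l = (\<Sum>\<alpha>\<in>I. t \<alpha> * gam m \<Gamma> x a (b \<alpha>) l)"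
proof -
  have "gam m \<Gamma> x a (\<lambda>j. \<Sum>\<alpha>\<in>I. t \<alpha> * b \<alpha> j) l = (\<Sum>j<m. \<Sum>k<m. \<Sum>\<alpha>\<in>I. t \<alpha> * (complex_of_real (\<Gamma> l j k x) * a j * b \<alpha> k))"
    unfolding gam_def by (simp add: sum_distrib_left sum_distrib_right mult_ac)
  also have "\<dots> = (\<Sum>\<alpha>\<in>I. \<Sum>j<m. \<Sum>k<m. t \<alpha> * (complex_of_real (\<Gamma> l j k x) * a j * b \<alpha> k))" by (rule sum_swap3)
  finally show ?thesis by (simp add: gam_def sum_distrib_left)
qed

lemma pd_of_real:
  assumes "Ck_on (Suc 0) n U u" "x \<in> U" "a < n" "e \<in> Basis"
  shows "pd a e (\<lambda>x. complex_of_real (u x)) x = complex_of_real (pd a e u x)"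
  by (rule pd_eqI) (rule bounded_linear.has_vector_derivative[OF bounded_linear_of_real Ck_on_slice[OF assms(1,3,4,2)]])

lemma pd_cnj:
  assumes "Ck_on (Suc 0) n U u" "x \<in> U" "a < n" "e \<in> Basis"
  shows "pd a e (\<lambda>x. cnj (u x)) x = cnj (pd a e u x)"
  by (rule pd_eqI) (rule bounded_linear.has_vector_derivative[OF bounded_linear_cnj Ck_on_slice[OF assms(1,3,4,2)]])

lemma dz_cnj:
  assumes "Ck_on (Suc 0) n U u" "x \<in> U" "a < n"
  shows "dz a (\<lambda>x. cnj (u x)) x = cnj (dzbar a u x)" "dzbar a (\<lambda>x. cnj (u x)) x = cnj (dz a u x)"
  using pd_cnj[OF assms, of 1] pd_cnj[OF assms, of \<i>] by (simp_all add: dz_def dzbar_def Basis_complex_def)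

text \<open>Vanishing at the single point would not be enough: the derivative reads the field on a
  neighbourhood.\<close>

lemma covd_cong_zero:
  assumes "open N" "y \<in> N" "\<And>k z. k < m \<Longrightarrow> z \<in> N \<Longrightarrow> Z k z = 0" "l < m"
  shows "covd m \<Gamma> c d Z l y = 0"
proof -
  have "cder d (\<lambda>z. 0) y = cder d (Z l) y"
    by (rule cder_cong[OF assms(1,2)]) (use assms(3,4) in auto)
  hence "cder d (Z l) y = 0" by simp
  moreover have "gam m \<Gamma> (c y) e (\<lambda>k. Z k y) l = gam m \<Gamma> (c y) e (\<lambda>k. 0) l" for e
    by (rule gam_cong) (use assms in auto)
  ultimately show ?thesis unfolding covd_def by (simp add: gam_def)
qed

section \<open>Pluriharmonic maps in coordinates\<close>

locale pluriharmonic_map =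
  M: complex_manifold n A + N: riemannian_manifold m B g
  for n :: nat and A :: "('p, complex) chart set" and m :: nat and B :: "('q, real) chart set"
    and g :: "'q \<Rightarrow> ('q, real) tangent \<Rightarrow> ('q, real) tangent \<Rightarrow> real" +
  fixes f :: "'p \<Rightarrow> 'q"
  assumes ph: "pluriharmonic n A m B g f"
begin

definition dom :: "('p, complex) chart \<Rightarrow> ('q, real) chart \<Rightarrow> (nat \<Rightarrow> complex) set"
  where "dom \<kappa> \<kappa>' = snd \<kappa> ` (fst \<kappa> \<inter> f -` fst \<kappa>')"

definition rep :: "('p, complex) chart \<Rightarrow> ('q, real) chart \<Rightarrow> (nat \<Rightarrow> complex) \<Rightarrow> nat \<Rightarrow> real"
  where "rep \<kappa> \<kappa>' x = snd \<kappa>' (f (chart_inv \<kappa> x))"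

definition df :: "('p, complex) chart \<Rightarrow> ('q, real) chart \<Rightarrow> nat \<Rightarrow> (nat \<Rightarrow> complex) \<Rightarrow> nat \<Rightarrow> complex"
  where "df \<kappa> \<kappa>' \<alpha> x k = dz \<alpha> (local_rep \<kappa> \<kappa>' f k) x"

lemma f_continuous: "continuous_map (mtop A) (mtop B) f"
  using ph by (auto simp: pluriharmonic_def smooth_map_def)

lemma f_points: "p \<in> points A \<Longrightarrow> f p \<in> points B"
  using f_continuous continuous_map_image_subset_topspace
  by (metis M.topspace_mtop N.topspace_mtop image_subset_iff)

lemma openin_f_preimage: "\<kappa>' \<in> B \<Longrightarrow> openin (mtop A) {p \<in> points A. f p \<in> fst \<kappa>'}"
  using openin_continuous_map_preimage[OF f_continuous N.openin_chart_domain] by (simp add: M.topspace_mtop)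

lemma dom_open:
  assumes "\<kappa> \<in> A" "\<kappa>' \<in> B"
  shows "openin (top_of_set (coord_space n)) (dom \<kappa> \<kappa>')"
proof -
  have "fst \<kappa> \<inter> f -` fst \<kappa>' = fst \<kappa> \<inter> {p \<in> points A. f p \<in> fst \<kappa>'}"
    using assms(1) by (auto simp: points_def)
  thus ?thesis unfolding dom_def using M.openin_chart_image[OF openin_f_preimage[OF assms(2)] assms(1)] by simp
qed

lemma dom_point:
  assumes "\<kappa> \<in> A" "x \<in> dom \<kappa> \<kappa>'"
  shows "chart_inv \<kappa> x \<in> fst \<kappa>" "f (chart_inv \<kappa> x) \<in> fst \<kappa>'" "snd \<kappa> (chart_inv \<kappa> x) = x"
  using assms by (auto simp: dom_def)

lemma rep_in: "\<kappa> \<in> A \<Longrightarrow> x \<in> dom \<kappa> \<kappa>' \<Longrightarrow> rep \<kappa> \<kappa>' x \<in> snd \<kappa>' ` fst \<kappa>'"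
  using dom_point(2) by (auto simp: rep_def)

lemma rep_smooth:
  "\<kappa> \<in> A \<Longrightarrow> \<kappa>' \<in> B \<Longrightarrow> k < m \<Longrightarrow> Ck_on l n (dom \<kappa> \<kappa>') (\<lambda>x. rep \<kappa> \<kappa>' x k)"
  using ph by (auto simp: pluriharmonic_def smooth_map_def smooth_on_def dom_def rep_def)

lemma local_rep_eq: "local_rep \<kappa> \<kappa>' f k = (\<lambda>x. complex_of_real (rep \<kappa> \<kappa>' x k))"
  by (simp add: fun_eq_iff local_rep_def rep_def)

lemma local_rep_smooth:
  "\<kappa> \<in> A \<Longrightarrow> \<kappa>' \<in> B \<Longrightarrow> k < m \<Longrightarrow> smooth_on n (dom \<kappa> \<kappa>') (local_rep \<kappa> \<kappa>' f k)"
  unfolding smooth_on_def local_rep_eq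
  using Ck_on_bounded_linear[OF bounded_linear_of_real dom_open rep_smooth] by blast

lemma df_smooth:
  "\<kappa> \<in> A \<Longrightarrow> \<kappa>' \<in> B \<Longrightarrow> k < m \<Longrightarrow> \<alpha> < n \<Longrightarrow> smooth_on n (dom \<kappa> \<kappa>') (\<lambda>x. df \<kappa> \<kappa>' \<alpha> x k)"
  unfolding df_def by (rule smooth_on_dz[OF dom_open local_rep_smooth])

lemma df_Ck:
  "\<kappa> \<in> A \<Longrightarrow> \<kappa>' \<in> B \<Longrightarrow> k < m \<Longrightarrow> \<alpha> < n \<Longrightarrow> Ck_on l n (dom \<kappa> \<kappa>') (\<lambda>x. df \<kappa> \<kappa>' \<alpha> x k)"
  using df_smooth unfolding smooth_on_def by blast

lemma dzbar_local_rep: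
  assumes "\<kappa> \<in> A" "\<kappa>' \<in> B" "k < m" "\<alpha> < n" "x \<in> dom \<kappa> \<kappa>'"
  shows "dzbar \<alpha> (local_rep \<kappa> \<kappa>' f k) x = cnj (df \<kappa> \<kappa>' \<alpha> x k)"
  using dz_cnj(2)[OF smooth_on_imp_C1[OF local_rep_smooth[OF assms(1-3)]] assms(5,4)]
  by (simp add: df_def local_rep_eq)

text \<open>The second form is the conjugate of the first; it uses that the components of f and the
  Christoffel symbols are real.\<close>

lemma pluriharmonic_df:
  assumes "\<kappa> \<in> A" "\<kappa>' \<in> B" "l < m" "\<alpha> < n" "\<beta> < n" "x \<in> dom \<kappa> \<kappa>'"
  shows "dz \<alpha> (\<lambda>x. cnj (df \<kappa> \<kappa>' \<beta> x l)) x =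
      - gam m (christoffel m B g \<kappa>') (rep \<kappa> \<kappa>' x) (\<lambda>j. cnj (df \<kappa> \<kappa>' \<beta> x j)) (df \<kappa> \<kappa>' \<alpha> x) l"
    and "dzbar \<alpha> (\<lambda>x. df \<kappa> \<kappa>' \<beta> x l) x =
      - gam m (christoffel m B g \<kappa>') (rep \<kappa> \<kappa>' x) (df \<kappa> \<kappa>' \<beta> x) (\<lambda>k. cnj (df \<kappa> \<kappa>' \<alpha> x k)) l"
proof -
  note p = dom_point[OF assms(1,6)]
  have "dz \<alpha> (dzbar \<beta> (local_rep \<kappa> \<kappa>' f l)) (snd \<kappa> (chart_inv \<kappa> x))
      + (\<Sum>j<m. \<Sum>k<m. complex_of_real (christoffel m B g \<kappa>' l j k (snd \<kappa>' (f (chart_inv \<kappa> x))))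
          * dzbar \<beta> (local_rep \<kappa> \<kappa>' f j) (snd \<kappa> (chart_inv \<kappa> x))
          * dz \<alpha> (local_rep \<kappa> \<kappa>' f k) (snd \<kappa> (chart_inv \<kappa> x))) = 0"
    using ph assms p(1,2) unfolding pluriharmonic_def by blast
  moreover have "dz \<alpha> (dzbar \<beta> (local_rep \<kappa> \<kappa>' f l)) x = dz \<alpha> (\<lambda>x. cnj (df \<kappa> \<kappa>' \<beta> x l)) x"
    by (rule dz_cong[OF dom_open[OF assms(1,2)] assms(6,4)]) (rule dzbar_local_rep[OF assms(1,2,3,5)])
  moreover have "(\<Sum>j<m. \<Sum>k<m. complex_of_real (christoffel m B g \<kappa>' l j k (snd \<kappa>' (f (chart_inv \<kappa> x))))
          * dzbar \<beta> (local_rep \<kappa> \<kappa>' f j) x * dz \<alpha> (local_rep \<kappa> \<kappa>' f k) x) =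
      gam m (christoffel m B g \<kappa>') (rep \<kappa> \<kappa>' x) (\<lambda>j. cnj (df \<kappa> \<kappa>' \<beta> x j)) (df \<kappa> \<kappa>' \<alpha> x) l"
    unfolding gam_def rep_def[symmetric]
    by (intro sum.cong refl) (simp add: dzbar_local_rep[OF assms(1,2) _ assms(5,6)] df_def)
  ultimately show 1: "dz \<alpha> (\<lambda>x. cnj (df \<kappa> \<kappa>' \<beta> x l)) x =
      - gam m (christoffel m B g \<kappa>') (rep \<kappa> \<kappa>' x) (\<lambda>j. cnj (df \<kappa> \<kappa>' \<beta> x j)) (df \<kappa> \<kappa>' \<alpha> x) l"
    unfolding p(3) by (simp add: add_eq_0_iff2)
  have "dzbar \<alpha> (\<lambda>x. df \<kappa> \<kappa>' \<beta> x l) x = cnj (dz \<alpha> (\<lambda>x. cnj (df \<kappa> \<kappa>' \<beta> x l)) x)"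
    using dz_cnj(1)[OF df_Ck[OF assms(1,2,3,5), of "Suc 0"] assms(6,4)] by simp
  thus "dzbar \<alpha> (\<lambda>x. df \<kappa> \<kappa>' \<beta> x l) x =
      - gam m (christoffel m B g \<kappa>') (rep \<kappa> \<kappa>' x) (df \<kappa> \<kappa>' \<beta> x) (\<lambda>k. cnj (df \<kappa> \<kappa>' \<alpha> x k)) l"
    unfolding 1 by (simp add: cnj_gam)
qed

end

section \<open>The Bochner argument at a maximum\<close>

text \<open>The derivative of \<open>hom_vec\<close> in the direction \<open>v\<close>; the entry
  normalised to 1 is constant, hence the 0.\<close>

definition hom_dir :: "nat \<Rightarrow> nat \<Rightarrow> (nat \<Rightarrow> complex) \<Rightarrow> nat \<Rightarrow> complex"
  where "hom_dir n i v j = (if j = i then 0 else if j < i then v (n + j) else v (n + j - 1))"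

text \<open>The second direction has no fibre coordinates, so the vector W depends on \<zeta> alone,
  and affinely; in particular it is holomorphic in \<zeta>.\<close>

lemma hom_vec_aff:
  assumes "w \<in> coord_space n"
  shows "hom_vec n i (aff x v w z) j = hom_vec n i x j + fst z * hom_dir n i v j"
  using assms by (auto simp: hom_vec_def hom_dir_def aff_def coord_space_def)

lemma trunc_aff: "w \<in> coord_space n \<Longrightarrow> trunc n (aff x v w z) = aff (trunc n x) (trunc n v) w z"
  by (auto simp: trunc_def aff_def coord_space_def fun_eq_iff)

text \<open>The shape of the complex Hessian of the logarithm of a positive function with value r,
  first derivative D and complex Hessian A.\<close>

lemma Re_quotient:
  "Re (A * inverse (complex_of_real r) - D * cnj D * (inverse (complex_of_real r))\<^sup>2) = Re A / r - (norm D)\<^sup>2 / r\<^sup>2"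
proof -
  have 1: "D * cnj D = complex_of_real ((norm D)\<^sup>2)" by (simp only: complex_norm_square)
  have 2: "inverse (complex_of_real r) = complex_of_real (inverse r)" by simp
  have 3: "Re (A * complex_of_real s - complex_of_real t) = Re A * s - t" for s t by simp
  show ?thesis unfolding 1 2 of_real_power[symmetric] of_real_mult[symmetric] 3
    by (simp only: divide_inverse power_inverse)
qed

context pluriharmonic_map
begin

definition df_vec :: "('p, complex) chart \<Rightarrow> ('q, real) chart \<Rightarrow> nat \<Rightarrow> (nat \<Rightarrow> complex) \<Rightarrow> nat \<Rightarrow> complex"
  where "df_vec \<kappa> \<kappa>' i x k = (\<Sum>\<alpha><n. df \<kappa> \<kappa>' \<alpha> (trunc n x) k * hom_vec n i x \<alpha>)"

definition energy :: "('p, complex) chart \<Rightarrow> ('q, real) chart \<Rightarrow> nat \<Rightarrow> (nat \<Rightarrow> complex) \<Rightarrow> complex"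
  where "energy \<kappa> \<kappa>' i x = ip m (metric_comp m B g \<kappa>') (rep \<kappa> \<kappa>' (trunc n x))
    (df_vec \<kappa> \<kappa>' i x) (\<lambda>k. cnj (df_vec \<kappa> \<kappa>' i x k))"

end

text \<open>\<open>x0\<close> is a point of P(T_M) in an induced chart and \<open>v\<close> the
  direction of the complex line through it; its base part is \<open>u\<close> and may be
  zero.\<close>

locale pluriharmonic_germ = pluriharmonic_map n A m B g f
  for n :: nat and A :: "('p, complex) chart set" and m :: nat and B :: "('q, real) chart set"
    and g :: "'q \<Rightarrow> ('q, real) tangent \<Rightarrow> ('q, real) tangent \<Rightarrow> real" and f :: "'p \<Rightarrow> 'q" +
  fixes \<kappa> :: "('p, complex) chart" and \<kappa>' :: "('q, real) chart" and i :: nat and x0 v :: "nat \<Rightarrow> complex"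
  assumes \<kappa>: "\<kappa> \<in> A" and \<kappa>': "\<kappa>' \<in> B" and i: "i < n"
    and x0: "x0 \<in> coord_space (2 * n - 1)" "trunc n x0 \<in> dom \<kappa> \<kappa>'" and v: "v \<in> coord_space (2 * n - 1)"
begin

abbreviation "z0 \<equiv> trunc n x0"
abbreviation "u \<equiv> trunc n v"

text \<open>The second parameter \<open>\<eta>\<close> of the map \<open>\<psi>\<close> below is there only to realise \<open>S = \<partial>f(W)\<close> at the origin as
  the derivative \<open>\<partial>f/\<partial>\<eta>\<close>, so that \<open>R(X, S)\<bar>X = 0\<close> is a commutator of covariant derivatives.\<close>

definition W0 :: "nat \<Rightarrow> complex" where "W0 = trunc n (hom_vec n i x0)"

lemma W0_in [simp]: "W0 \<in> coord_space n" by (simp add: W0_def)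

lemma W0_in': "W0 \<in> coord_space (2 * n - 1)"
  using i W0_in by (auto simp: coord_space_def)

definition \<psi> :: "complex \<times> complex \<Rightarrow> nat \<Rightarrow> complex" where "\<psi> = aff z0 u W0"
definition Nb :: "(complex \<times> complex) set" where "Nb = \<psi> -` dom \<kappa> \<kappa>'"
definition c :: "complex \<times> complex \<Rightarrow> nat \<Rightarrow> real" where "c y = rep \<kappa> \<kappa>' (\<psi> y)"

abbreviation "U \<equiv> snd \<kappa>' ` fst \<kappa>'"
abbreviation "G \<equiv> metric_comp m B g \<kappa>'"
abbreviation "\<Gamma> \<equiv> christoffel m B g \<kappa>'"

lemma dom_open': "openin (top_of_set (coord_space n)) (dom \<kappa> \<kappa>')"
  by (rule dom_open[OF \<kappa> \<kappa>'])

lemma Nb_open: "open Nb"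
  unfolding Nb_def \<psi>_def by (rule open_aff_vimage[OF dom_open']) auto

lemma Nb_dom: "y \<in> Nb \<Longrightarrow> \<psi> y \<in> dom \<kappa> \<kappa>'" by (simp add: Nb_def)

lemma zero_in_Nb: "0 \<in> Nb" by (simp add: Nb_def \<psi>_def x0)

lemma compose_td:
  assumes "Ck_on (Suc (Suc 0)) n (dom \<kappa> \<kappa>') w"
  shows "twice_diff Nb (\<lambda>y. w (\<psi> y))"
  unfolding \<psi>_def
  by (rule aff_compose_twice_diff[OF dom_open' assms Nb_open]) (use Nb_dom in \<open>simp add: \<psi>_def\<close>)

lemma compose_cder:
  assumes "Ck_on (Suc 0) n (dom \<kappa> \<kappa>') w" "y \<in> Nb"
  shows "(\<lambda>y. w (\<psi> y)) differentiable (at y)"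
    and "cder d\<zeta> (\<lambda>y. w (\<psi> y)) y = (\<Sum>a<n. u a * dz a w (\<psi> y))"
    and "cder d\<zeta>' (\<lambda>y. w (\<psi> y)) y = (\<Sum>a<n. cnj (u a) * dzbar a w (\<psi> y))"
    and "cder d\<eta> (\<lambda>y. w (\<psi> y)) y = (\<Sum>a<n. W0 a * dz a w (\<psi> y))"
  using aff_cder[OF dom_open' assms(1) trunc_in_coord_space trunc_in_coord_space W0_in, of x0 v y]
    Nb_dom[OF assms(2)] unfolding \<psi>_def by blast+

sublocale MM: metric_map m U G \<Gamma> c Nb
proof -
  interpret C: metric_chart m U G \<Gamma> by (rule N.metric_chart_coordinates[OF \<kappa>'])
  show "metric_map m U G \<Gamma> c Nb"
  proof
    show "open Nb" by (rule Nb_open)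
    show "c z \<in> U" if "z \<in> Nb" for z
      unfolding c_def by (rule rep_in[OF \<kappa> Nb_dom[OF that]])
    show "twice_diff Nb (\<lambda>z. c z j)" if "j < m" for j
      unfolding c_def \<psi>_def
      by (rule twice_diff_compose[OF dom_open' rep_smooth[OF \<kappa> \<kappa>' that] Nb_open])
        (use Nb_dom aff_twice_diff[OF Nb_open] in \<open>auto simp: \<psi>_def\<close>)
  qed
qed

definition df' :: "nat \<Rightarrow> nat \<Rightarrow> complex \<times> complex \<Rightarrow> complex" where "df' \<alpha> k y = df \<kappa> \<kappa>' \<alpha> (\<psi> y) k"

text \<open>The components of \<partial>f(W), where the base point moves with both parameters and W
  with the first only.\<close>

definition S :: "nat \<Rightarrow> complex \<times> complex \<Rightarrow> complex"
  where "S k y = (\<Sum>\<alpha><n. (hom_vec n i x0 \<alpha> + fst y * hom_dir n i v \<alpha>) * df' \<alpha> k y)"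

text \<open>The components of the image under f of the conjugate of \<partial>/\<partial>\<zeta>,
  hence the conjugate of X.\<close>

definition Xb :: "nat \<Rightarrow> complex \<times> complex \<Rightarrow> complex"
  where "Xb k y = (\<Sum>a<n. cnj (u a) * cnj (df' a k y))"

lemma df'_td: "\<alpha> < n \<Longrightarrow> k < m \<Longrightarrow> twice_diff Nb (df' \<alpha> k)"
  unfolding df'_def[abs_def] by (rule compose_td[OF df_Ck[OF \<kappa> \<kappa>']])

lemma S_td: "k < m \<Longrightarrow> twice_diff Nb (S k)"
proof -
  assume "k < m"
  moreover have "twice_diff Nb (\<lambda>y :: complex \<times> complex. hom_vec n i x0 \<alpha> + fst y * hom_dir n i v \<alpha>)" for \<alpha>
    by (intro twice_diff_add twice_diff_const twice_diff_linear_map Nb_open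
        bounded_linear_compose[OF bounded_linear_mult_left] bounded_linear_fst)
  ultimately show ?thesis unfolding S_def[abs_def]
    by (intro twice_diff_sum twice_diff_mult Nb_open df'_td) auto
qed

lemma Xb_td: "k < m \<Longrightarrow> twice_diff Nb (Xb k)"
  unfolding Xb_def[abs_def]
  by (intro twice_diff_sum twice_diff_mult twice_diff_const Nb_open
      twice_diff_bounded_linear[OF bounded_linear_cnj] df'_td) auto

lemma cd_eq: "MM.cd d y k = cder d (\<lambda>y. local_rep \<kappa> \<kappa>' f k (\<psi> y)) y"
  unfolding MM.cd_def c_def local_rep_eq ..

lemma local_rep_C1: "k < m \<Longrightarrow> Ck_on (Suc 0) n (dom \<kappa> \<kappa>') (local_rep \<kappa> \<kappa>' f k)"
  by (rule smooth_on_imp_C1[OF local_rep_smooth[OF \<kappa> \<kappa>']])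

lemma cd_zeta: "y \<in> Nb \<Longrightarrow> k < m \<Longrightarrow> MM.cd d\<zeta> y k = (\<Sum>a<n. u a * df' a k y)"
  unfolding cd_eq by (simp add: compose_cder(2)[OF local_rep_C1] df'_def df_def)

lemma cd_zeta_bar: "y \<in> Nb \<Longrightarrow> k < m \<Longrightarrow> MM.cd d\<zeta>' y k = Xb k y"
  unfolding cd_eq Xb_def
  by (simp add: compose_cder(3)[OF local_rep_C1] df'_def dzbar_local_rep[OF \<kappa> \<kappa>' _ _ Nb_dom])

lemma cd_eta: "y \<in> Nb \<Longrightarrow> k < m \<Longrightarrow> MM.cd d\<eta> y k = (\<Sum>a<n. W0 a * df' a k y)"
  unfolding cd_eq by (simp add: compose_cder(4)[OF local_rep_C1] df'_def df_def)

lemma cd_zeta_cnj: "y \<in> Nb \<Longrightarrow> k < m \<Longrightarrow> MM.cd d\<zeta> y k = cnj (Xb k y)"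
  by (simp add: cd_zeta Xb_def)

text \<open>W is holomorphic in \<zeta>, so the derivative falls on \<partial>f only, and there the
  pluriharmonic equation produces precisely the negative of the Christoffel term.\<close>

lemma covd_S_zeta_bar:
  assumes y: "y \<in> Nb" and l: "l < m"
  shows "covd m \<Gamma> c d\<zeta>' S l y = 0"
proof -
  let ?W = "\<lambda>\<alpha> y :: complex \<times> complex. hom_vec n i x0 \<alpha> + fst y * hom_dir n i v \<alpha>"
  let ?\<gamma> = "gam m \<Gamma> (c y)"
  have Wd: "(?W \<alpha> has_derivative (\<lambda>h. fst h * hom_dir n i v \<alpha>)) (at y)" for \<alpha>
    by (auto intro!: derivative_eq_intros)
  have Wc: "cder d\<zeta>' (?W \<alpha>) y = 0" for \<alpha>
    unfolding cder_eqI[OF Wd] by (simp add: d\<zeta>'_def complex_eq_iff)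
  have dfd: "df' \<alpha> l differentiable (at y)" if "\<alpha> < n" for \<alpha>
    by (rule twice_diff_differentiable[OF df'_td[OF that l] y])
  have c1: "cder d\<zeta>' (df' \<alpha> l) y = - (\<Sum>a<n. cnj (u a) * ?\<gamma> (\<lambda>j. df' \<alpha> j y) (\<lambda>k. cnj (df' a k y)) l)"
    if "\<alpha> < n" for \<alpha>
  proof -
    have "cder d\<zeta>' (df' \<alpha> l) y = (\<Sum>a<n. cnj (u a) * dzbar a (\<lambda>x. df \<kappa> \<kappa>' \<alpha> x l) (\<psi> y))"
      unfolding df'_def[abs_def] by (rule compose_cder(3)[OF df_Ck[OF \<kappa> \<kappa>' l that] y])
    thus ?thesis using that
      by (simp add: pluriharmonic_df(2)[OF \<kappa> \<kappa>' l _ that Nb_dom[OF y]] sum_negf c_def df'_def)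
  qed
  have "cder d\<zeta>' (S l) y = (\<Sum>\<alpha><n. cder d\<zeta>' (\<lambda>y. ?W \<alpha> y * df' \<alpha> l y) y)"
    unfolding S_def[abs_def] using dfd differentiableI[OF Wd]
    by (intro cder_sum differentiable_mult) auto
  also have "\<dots> = (\<Sum>\<alpha><n. ?W \<alpha> y * cder d\<zeta>' (df' \<alpha> l) y)"
    using dfd differentiableI[OF Wd] by (intro sum.cong refl) (simp add: cder_mult Wc)
  also have "\<dots> = - (\<Sum>\<alpha><n. ?W \<alpha> y * (\<Sum>a<n. cnj (u a) * ?\<gamma> (\<lambda>j. df' \<alpha> j y) (\<lambda>k. cnj (df' a k y)) l))"
    by (simp add: c1 sum_negf)
  also have "\<dots> = - ?\<gamma> (\<lambda>k. S k y) (\<lambda>k. Xb k y) l"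
    unfolding S_def Xb_def gam_sum_left gam_sum_right ..
  also have "?\<gamma> (\<lambda>k. S k y) (\<lambda>k. Xb k y) l = ?\<gamma> (\<lambda>k. Xb k y) (\<lambda>k. S k y) l"
    by (rule MM.gam_sym[OF MM.c_in[OF y] l])
  also have "\<dots> = ?\<gamma> (MM.cd d\<zeta>' y) (\<lambda>k. S k y) l"
    by (rule gam_cong) (simp_all add: cd_zeta_bar[OF y])
  finally show ?thesis unfolding covd_def MM.cd_def[abs_def] by simp
qed

text \<open>\<open>Xb\<close> contracts the conjugate of \<partial>f with constant coefficients. The
  pluriharmonic equation makes its covariant derivative vanish in every direction of type (1,0), and
  \<zeta> and \<eta> both parametrise such directions.\<close>

lemma covd_Xb:
  assumes y: "y \<in> Nb" and l: "l < m"
  shows "covd m \<Gamma> c d\<zeta> Xb l y = 0" "covd m \<Gamma> c d\<eta> Xb l y = 0"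
proof -
  let ?\<gamma> = "gam m \<Gamma> (c y)"
  have w: "Ck_on k n (dom \<kappa> \<kappa>') (\<lambda>x. cnj (df \<kappa> \<kappa>' a x l))" if "a < n" for a k
    by (rule Ck_on_bounded_linear[OF bounded_linear_cnj dom_open' df_Ck[OF \<kappa> \<kappa>' l that]])
  have d: "cder d (Xb l) y = (\<Sum>a<n. cnj (u a) * cder d (\<lambda>y. cnj (df' a l y)) y)" for d
    unfolding Xb_def[abs_def]
    using twice_diff_differentiable[OF df'_td[OF _ l] y]
    by (subst cder_sum) (auto intro!: sum.cong differentiable_mult differentiable_cnj simp: cder_cmult differentiable_cnj)
  have ph': "dz b (\<lambda>x. cnj (df \<kappa> \<kappa>' a x l)) (\<psi> y) = - ?\<gamma> (\<lambda>j. cnj (df' a j y)) (\<lambda>k. df' b k y) l"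
    if "a < n" "b < n" for a b
    using pluriharmonic_df(1)[OF \<kappa> \<kappa>' l that(2,1) Nb_dom[OF y]] by (simp add: c_def df'_def)
  have main: "(\<Sum>a<n. cnj (u a) * (\<Sum>b<n. t b * dz b (\<lambda>x. cnj (df \<kappa> \<kappa>' a x l)) (\<psi> y)))
      = - ?\<gamma> (\<lambda>k. \<Sum>b<n. t b * df' b k y) (\<lambda>k. Xb k y) l" for t
  proof -
    have "(\<Sum>a<n. cnj (u a) * (\<Sum>b<n. t b * dz b (\<lambda>x. cnj (df \<kappa> \<kappa>' a x l)) (\<psi> y)))
      = - (\<Sum>a<n. cnj (u a) * (\<Sum>b<n. t b * ?\<gamma> (\<lambda>j. cnj (df' a j y)) (\<lambda>k. df' b k y) l))"
      by (simp add: ph' sum_negf)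
    also have "\<dots> = - ?\<gamma> (\<lambda>k. Xb k y) (\<lambda>k. \<Sum>b<n. t b * df' b k y) l"
      unfolding Xb_def gam_sum_left gam_sum_right ..
    finally show ?thesis using MM.gam_sym[OF MM.c_in[OF y] l] by simp
  qed
  have "cder d\<zeta> (\<lambda>y. cnj (df' a l y)) y = (\<Sum>b<n. u b * dz b (\<lambda>x. cnj (df \<kappa> \<kappa>' a x l)) (\<psi> y))" if "a < n" for a
    unfolding df'_def by (rule compose_cder(2)[OF w[OF that] y])
  hence "cder d\<zeta> (Xb l) y = - ?\<gamma> (\<lambda>k. \<Sum>b<n. u b * df' b k y) (\<lambda>k. Xb k y) l"
    unfolding d by (simp add: main[symmetric])
  moreover have "?\<gamma> (\<lambda>k. \<Sum>b<n. u b * df' b k y) (\<lambda>k. Xb k y) l = ?\<gamma> (MM.cd d\<zeta> y) (\<lambda>k. Xb k y) l"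
    by (rule gam_cong) (simp_all add: cd_zeta[OF y])
  ultimately show "covd m \<Gamma> c d\<zeta> Xb l y = 0" unfolding covd_def MM.cd_def[abs_def] by simp
  have "cder d\<eta> (\<lambda>y. cnj (df' a l y)) y = (\<Sum>b<n. W0 b * dz b (\<lambda>x. cnj (df \<kappa> \<kappa>' a x l)) (\<psi> y))" if "a < n" for a
    unfolding df'_def by (rule compose_cder(4)[OF w[OF that] y])
  hence "cder d\<eta> (Xb l) y = - ?\<gamma> (\<lambda>k. \<Sum>b<n. W0 b * df' b k y) (\<lambda>k. Xb k y) l"
    unfolding d by (simp add: main[symmetric])
  moreover have "?\<gamma> (\<lambda>k. \<Sum>b<n. W0 b * df' b k y) (\<lambda>k. Xb k y) l = ?\<gamma> (MM.cd d\<eta> y) (\<lambda>k. Xb k y) l"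
    by (rule gam_cong) (simp_all add: cd_eta[OF y])
  ultimately show "covd m \<Gamma> c d\<eta> Xb l y = 0" unfolding covd_def MM.cd_def[abs_def] by simp
qed

lemma curv_vanish:
  assumes l: "l < m"
  shows "curv m \<Gamma> (c 0) (\<lambda>k. cnj (Xb k 0)) (\<lambda>k. S k 0) (\<lambda>k. Xb k 0) l = 0"
proof -
  have "covd m \<Gamma> c d\<zeta> (covd m \<Gamma> c d\<eta> Xb) l 0 = 0" "covd m \<Gamma> c d\<eta> (covd m \<Gamma> c d\<zeta> Xb) l 0 = 0"
    by (rule covd_cong_zero[OF Nb_open zero_in_Nb _ l], use covd_Xb in blast)+
  hence "curv m \<Gamma> (c 0) (MM.cd d\<zeta> 0) (MM.cd d\<eta> 0) (\<lambda>k. Xb k 0) l = 0"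
    using MM.covd_commutator[where d=d\<zeta> and d'=d\<eta> and T=Xb, OF l zero_in_Nb Xb_td] by simp
  moreover have "curv m \<Gamma> (c 0) (MM.cd d\<zeta> 0) (MM.cd d\<eta> 0) (\<lambda>k. Xb k 0) l =
      curv m \<Gamma> (c 0) (\<lambda>k. cnj (Xb k 0)) (\<lambda>k. S k 0) (\<lambda>k. Xb k 0) l"
  proof (rule curv_cong)
    show "MM.cd d\<zeta> 0 j = cnj (Xb j 0)" if "j < m" for j by (rule cd_zeta_cnj[OF zero_in_Nb that])
    \<comment> \<open>This holds at the origin only: the \<eta>-direction is the fixed vector W at
      \<zeta> = 0, while S follows the moving W.\<close>
    show "MM.cd d\<eta> 0 j = S j 0" if "j < m" for j
      unfolding cd_eta[OF zero_in_Nb that] S_def by (intro sum.cong refl) (simp add: W0_def trunc_def)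
  qed simp
  ultimately show ?thesis by simp
qed

section \<open>The Bochner formula along the line\<close>

definition \<Phi> :: "complex \<times> complex \<Rightarrow> complex"
  where "\<Phi> y = ip m G (c y) (\<lambda>k. S k y) (\<lambda>k. cnj (S k y))"

lemma Sb_td: "k < m \<Longrightarrow> twice_diff Nb (\<lambda>y. cnj (S k y))"
  by (rule twice_diff_bounded_linear[OF bounded_linear_cnj Nb_open S_td])

lemma Phi_td: "twice_diff Nb \<Phi>"
  unfolding \<Phi>_def[abs_def] by (rule MM.ip_twice_diff[OF S_td Sb_td])

text \<open>The pulled back connection is real, so conjugation commutes with it once \<zeta> and its
  conjugate are exchanged.\<close>

lemma covd_cnj_S:
  assumes y: "y \<in> Nb" and l: "l < m"
  shows "covd m \<Gamma> c d\<zeta> (\<lambda>k y. cnj (S k y)) l y = 0"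
    and "covd m \<Gamma> c d\<zeta>' (\<lambda>k y. cnj (S k y)) l y = cnj (covd m \<Gamma> c d\<zeta> S l y)"
proof -
  have Sd: "S l differentiable (at y)" by (rule twice_diff_differentiable[OF S_td[OF l] y])
  have g1: "gam m \<Gamma> (c y) (MM.cd d\<zeta> y) (\<lambda>k. cnj (S k y)) l = cnj (gam m \<Gamma> (c y) (MM.cd d\<zeta>' y) (\<lambda>k. S k y) l)"
    and g2: "gam m \<Gamma> (c y) (MM.cd d\<zeta>' y) (\<lambda>k. cnj (S k y)) l = cnj (gam m \<Gamma> (c y) (MM.cd d\<zeta> y) (\<lambda>k. S k y) l)"
    unfolding cnj_gam by (rule gam_cong, simp_all add: cd_zeta_cnj[OF y] cd_zeta_bar[OF y])+
  have "covd m \<Gamma> c d\<zeta> (\<lambda>k y. cnj (S k y)) l y = cnj (covd m \<Gamma> c d\<zeta>' S l y)"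
    unfolding covd_def MM.cd_def[symmetric] using cder_cnj[OF Sd, of d\<zeta>] g1
    by (simp add: conj_wirtinger MM.cd_def[abs_def])
  thus "covd m \<Gamma> c d\<zeta> (\<lambda>k y. cnj (S k y)) l y = 0" using covd_S_zeta_bar[OF y l] by simp
  show "covd m \<Gamma> c d\<zeta>' (\<lambda>k y. cnj (S k y)) l y = cnj (covd m \<Gamma> c d\<zeta> S l y)"
    unfolding covd_def MM.cd_def[symmetric] using cder_cnj[OF Sd, of d\<zeta>'] g2
    by (simp add: conj_wirtinger MM.cd_def[abs_def])
qed

lemma cder_Phi:
  assumes y: "y \<in> Nb"
  shows "cder d\<zeta> \<Phi> y = ip m G (c y) (\<lambda>l. covd m \<Gamma> c d\<zeta> S l y) (\<lambda>k. cnj (S k y))"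
proof -
  have "cder d\<zeta> \<Phi> y = ip m G (c y) (\<lambda>l. covd m \<Gamma> c d\<zeta> S l y) (\<lambda>k. cnj (S k y))
      + ip m G (c y) (\<lambda>k. S k y) (\<lambda>l. covd m \<Gamma> c d\<zeta> (\<lambda>k y. cnj (S k y)) l y)"
    unfolding \<Phi>_def[abs_def]
    by (rule MM.cder_ip(2)[OF y twice_diff_differentiable[OF S_td y] twice_diff_differentiable[OF Sb_td y]])
  also have "ip m G (c y) (\<lambda>k. S k y) (\<lambda>l. covd m \<Gamma> c d\<zeta> (\<lambda>k y. cnj (S k y)) l y) = ip m G (c y) (\<lambda>k. S k y) (\<lambda>l. 0)"
    by (rule ip_cong) (simp_all add: covd_cnj_S(1)[OF y])
  finally show ?thesis by (simp add: ip_def)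
qed

text \<open>The conjugate \<zeta>-derivative of S vanishes near the origin, so applying it after the
  \<zeta>-derivative gives the whole commutator, that is, the curvature. The other term of the
  product rule is the squared norm of the \<zeta>-derivative of S.\<close>

lemma cder_cder_Phi:
  shows "cder d\<zeta>' (cder d\<zeta> \<Phi>) 0 =
    Rm m \<Gamma> G (c 0) (\<lambda>k. Xb k 0) (\<lambda>k. cnj (Xb k 0)) (\<lambda>k. S k 0) (\<lambda>k. cnj (S k 0))
    + ip m G (c 0) (\<lambda>l. covd m \<Gamma> c d\<zeta> S l 0) (\<lambda>l. cnj (covd m \<Gamma> c d\<zeta> S l 0))"
proof -
  let ?P = "covd m \<Gamma> c d\<zeta> S"
  note y = zero_in_Nb
  have "cder d\<zeta>' (cder d\<zeta> \<Phi>) 0 = cder d\<zeta>' (\<lambda>y. ip m G (c y) (\<lambda>l. ?P l y) (\<lambda>k. cnj (S k y))) 0"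
    by (rule cder_cong[OF Nb_open y cder_Phi cder_differentiable[OF Phi_td y]])
  also have "\<dots> = ip m G (c 0) (\<lambda>l. covd m \<Gamma> c d\<zeta>' ?P l 0) (\<lambda>k. cnj (S k 0))
      + ip m G (c 0) (\<lambda>l. ?P l 0) (\<lambda>l. covd m \<Gamma> c d\<zeta>' (\<lambda>k y. cnj (S k y)) l 0)"
    by (rule MM.cder_ip(2)[OF y MM.covd_differentiable[OF _ y S_td] twice_diff_differentiable[OF Sb_td y]])
  also have "ip m G (c 0) (\<lambda>l. ?P l 0) (\<lambda>l. covd m \<Gamma> c d\<zeta>' (\<lambda>k y. cnj (S k y)) l 0) =
      ip m G (c 0) (\<lambda>l. ?P l 0) (\<lambda>l. cnj (?P l 0))"
    by (rule ip_cong) (simp_all add: covd_cnj_S(2)[OF y])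
  also have "ip m G (c 0) (\<lambda>l. covd m \<Gamma> c d\<zeta>' ?P l 0) (\<lambda>k. cnj (S k 0)) =
      Rm m \<Gamma> G (c 0) (\<lambda>k. Xb k 0) (\<lambda>k. cnj (Xb k 0)) (\<lambda>k. S k 0) (\<lambda>k. cnj (S k 0))"
    unfolding Rm_def
  proof (rule ip_cong)
    fix l assume l: "l < m"
    have "covd m \<Gamma> c d\<zeta> (covd m \<Gamma> c d\<zeta>' S) l 0 = 0"
      by (rule covd_cong_zero[OF Nb_open y _ l]) (rule covd_S_zeta_bar)
    hence "covd m \<Gamma> c d\<zeta>' ?P l 0 = curv m \<Gamma> (c 0) (MM.cd d\<zeta>' 0) (MM.cd d\<zeta> 0) (\<lambda>k. S k 0) l"
      using MM.covd_commutator[where d=d\<zeta>' and d'=d\<zeta> and T=S, OF l y S_td] by simp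
    also have "\<dots> = curv m \<Gamma> (c 0) (\<lambda>k. Xb k 0) (\<lambda>k. cnj (Xb k 0)) (\<lambda>k. S k 0) l"
      by (rule curv_cong) (simp_all add: cd_zeta_bar[OF y] cd_zeta_cnj[OF y])
    finally show "covd m \<Gamma> c d\<zeta>' ?P l 0 = curv m \<Gamma> (c 0) (\<lambda>k. Xb k 0) (\<lambda>k. cnj (Xb k 0)) (\<lambda>k. S k 0) l" .
  qed simp
  finally show ?thesis .
qed

text \<open>The lift of \<psi> to the coordinates of P(T_M). Here W0 moves the base point only, so
  the fibre coordinates vary with \<zeta> alone.\<close>

definition c2 :: "complex \<times> complex \<Rightarrow> nat \<Rightarrow> complex" where "c2 = aff x0 v W0"

lemma energy_c2: "energy \<kappa> \<kappa>' i (c2 y) = \<Phi> y"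
proof -
  have t: "trunc n (c2 y) = \<psi> y" by (simp add: c2_def \<psi>_def trunc_aff)
  have "df_vec \<kappa> \<kappa>' i (c2 y) = (\<lambda>k. S k y)"
    unfolding df_vec_def S_def t df'_def fun_eq_iff by (intro allI sum.cong refl) (simp add: c2_def hom_vec_aff mult.commute)
  thus ?thesis by (simp add: energy_def \<Phi>_def c_def t)
qed

lemma Phi_real: "y \<in> Nb \<Longrightarrow> Im (\<Phi> y) = 0"
  unfolding \<Phi>_def by (rule MM.ip_self_nonneg(2)[OF MM.c_in])

text \<open>\<open>LH\<close> stands for the logarithm of the metric of the line bundle, and
  \<open>neg\<close> says that the Chern curvature is positive in the direction \<open>v\<close>.
  The function with a maximum would then have a positive complex Hessian along the line.\<close>

lemma no_local_maximum:
  assumes np: "nonpositive_sectional_curvature m B g"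
    and V: "openin (top_of_set (coord_space (2 * n - 1))) V" "x0 \<in> V"
    and LH: "Ck_on (Suc (Suc 0)) (2 * n - 1) V LH"
    and neg: "Re (\<Sum>b<2 * n - 1. cnj (v b) * (\<Sum>a<2 * n - 1. v a * dz a (dzbar b LH) x0)) < 0"
    and pos: "Re (energy \<kappa> \<kappa>' i x0) > 0"
    and max: "\<And>x. x \<in> V \<Longrightarrow> trunc n x \<in> dom \<kappa> \<kappa>' \<Longrightarrow> Re (energy \<kappa> \<kappa>' i x) > 0 \<Longrightarrow>
      ln (Re (energy \<kappa> \<kappa>' i x)) - Re (LH x) \<le> ln (Re (energy \<kappa> \<kappa>' i x0)) - Re (LH x0)"
  shows False
proof -
  let ?P = "\<lambda>l. covd m \<Gamma> c d\<zeta> S l 0"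
  have c20: "c2 0 = x0" by (simp add: c2_def)
  \<comment> \<open>The neighbourhood on which the logarithm is defined and the maximality
    hypothesis can be used.\<close>
  define M where "M = {y \<in> Nb. Re (\<Phi> y) > 0} \<inter> c2 -` V"
  have "continuous_on Nb \<Phi>"
    using twice_diff_differentiable[OF Phi_td] by (intro continuous_at_imp_continuous_on ballI differentiable_imp_continuous_within)
  hence "open (Nb \<inter> \<Phi> -` {z. Re z > 0})"
    by (intro continuous_open_preimage Nb_open open_halfspace_Re_gt)
  moreover have "Nb \<inter> \<Phi> -` {z. Re z > 0} = {y \<in> Nb. Re (\<Phi> y) > 0}" by auto
  moreover have "open (c2 -` V)" unfolding c2_def by (rule open_aff_vimage[OF V(1) x0(1) v W0_in'])
  ultimately have M: "open M" by (simp add: M_def open_Int)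
  have M0: "0 \<in> M" using zero_in_Nb pos energy_c2[of 0] V(2) by (simp add: M_def c20)
  have MN: "M \<subseteq> Nb" by (auto simp: M_def)
  note Ptd = twice_diff_subset[OF Phi_td MN]
  have Mp: "Re (\<Phi> z) > 0" "Im (\<Phi> z) = 0" if "z \<in> M" for z using that Phi_real by (auto simp: M_def)
  let ?l = "\<lambda>y. complex_of_real (ln (Re (\<Phi> y)))" and ?h = "\<lambda>y. LH (c2 y)"
  note ltd = twice_diff_ln(1)[OF M Ptd Mp] and lc = twice_diff_ln(2)[OF M Ptd Mp]
  have htd: "twice_diff M ?h"
    unfolding c2_def by (rule aff_compose_twice_diff[OF V(1) LH M]) (simp add: M_def c2_def)
  have utd: "twice_diff M (\<lambda>y. ?l y + (-1) * ?h y)"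
    by (intro twice_diff_add twice_diff_mult twice_diff_const M ltd htd)
  have umax: "Re (?l y + (-1) * ?h y) \<le> Re (?l 0 + (-1) * ?h 0)" if "y \<in> M" for y
  proof -
    have t: "trunc n (c2 y) = \<psi> y" by (simp add: c2_def \<psi>_def trunc_aff)
    show ?thesis using max[of "c2 y"] that Nb_dom energy_c2[of y] energy_c2[of 0] by (simp add: M_def t c20)
  qed
  have "Re (4 * cder d\<zeta>' (cder d\<zeta> (\<lambda>y. ?l y + (-1) * ?h y)) 0) \<le> 0"
    unfolding laplacian_cder[OF M utd M0]
    using second_derivative_test[OF M utd M0 umax, of "(1, 0)"] second_derivative_test[OF M utd M0 umax, of "(\<i>, 0)"]
    by simp
  moreover have "cder d\<zeta>' (cder d\<zeta> (\<lambda>y. ?l y + (-1) * ?h y)) 0 = cder d\<zeta>' (cder d\<zeta> ?l) 0 - cder d\<zeta>' (cder d\<zeta> ?h) 0"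
  proof -
    have "cder d\<zeta>' (cder d\<zeta> (\<lambda>y. ?l y + (-1) * ?h y)) 0 = cder d\<zeta>' (\<lambda>y. cder d\<zeta> ?l y - cder d\<zeta> ?h y) 0"
    proof (rule cder_cong[OF M M0 _ cder_differentiable[OF utd M0]])
      fix z assume z: "z \<in> M"
      note d = twice_diff_differentiable[OF ltd z] twice_diff_differentiable[OF htd z]
      show "cder d\<zeta> (\<lambda>y. ?l y + (-1) * ?h y) z = cder d\<zeta> ?l z - cder d\<zeta> ?h z"
        using cder_diff[OF d, of d\<zeta>] by simp
    qed
    also have "\<dots> = cder d\<zeta>' (cder d\<zeta> ?l) 0 - cder d\<zeta>' (cder d\<zeta> ?h) 0"
      by (rule cder_diff[OF cder_differentiable[OF ltd M0] cder_differentiable[OF htd M0]])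
    finally show ?thesis .
  qed
  ultimately have le: "Re (cder d\<zeta>' (cder d\<zeta> ?l) 0) \<le> Re (cder d\<zeta>' (cder d\<zeta> ?h) 0)" by simp
  have hneg: "Re (cder d\<zeta>' (cder d\<zeta> ?h) 0) < 0"
  proof -
    have LH1: "Ck_on (Suc 0) (2 * n - 1) V LH" using LH by (rule Ck_on_Suc_imp)
    have C1: "Ck_on (Suc 0) (2 * n - 1) V (dzbar b LH)" if "b < 2 * n - 1" for b
    proof -
      have "dzbar b LH = (\<lambda>x. inverse 2 * (pd b 1 LH x + \<i> * pd b \<i> LH x))" by (simp add: dzbar_def fun_eq_iff)
      moreover have "Ck_on (Suc 0) (2 * n - 1) V \<dots>"
        by (intro Ck_on_mult Ck_on_add Ck_on_const V(1) Ck_on_pd[OF LH that]) (auto simp: Basis_complex_def)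
      ultimately show ?thesis by simp
    qed
    \<comment> \<open>The order is exchanged to meet the form \<open>dz a (dzbar b _)\<close> of the
      curvature matrix.\<close>
    have "cder d\<zeta>' (cder d\<zeta> ?h) 0 = cder d\<zeta> (cder d\<zeta>' ?h) 0" by (rule cder_commute[OF M htd M0])
    also have "\<dots> = cder d\<zeta> (\<lambda>y. \<Sum>b<2 * n - 1. cnj (v b) * dzbar b LH (c2 y)) 0"
    proof (rule cder_cong[OF M M0 _ cder_differentiable[OF htd M0]])
      fix z assume "z \<in> M"
      thus "cder d\<zeta>' ?h z = (\<Sum>b<2 * n - 1. cnj (v b) * dzbar b LH (c2 z))"
        unfolding c2_def by (intro aff_cder(3)[OF V(1) LH1 x0(1) v W0_in']) (simp add: M_def c2_def)
    qed
    also have "\<dots> = (\<Sum>b<2 * n - 1. cnj (v b) * (\<Sum>a<2 * n - 1. v a * dz a (dzbar b LH) x0))"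
    proof -
      have xV: "aff x0 v W0 0 \<in> V" using V(2) by simp
      note a = aff_cder(1,2)[OF V(1) C1 x0(1) v W0_in' xV]
      have "cder d\<zeta> (\<lambda>y. \<Sum>b<2 * n - 1. cnj (v b) * dzbar b LH (c2 y)) 0 =
          (\<Sum>b<2 * n - 1. cder d\<zeta> (\<lambda>y. cnj (v b) * dzbar b LH (c2 y)) 0)"
        unfolding c2_def by (rule cder_sum) (auto intro!: differentiable_mult a(1))
      also have "\<dots> = (\<Sum>b<2 * n - 1. cnj (v b) * (\<Sum>a<2 * n - 1. v a * dz a (dzbar b LH) x0))"
        unfolding c2_def using a by (intro sum.cong refl) (simp add: cder_cmult)
      finally show ?thesis .
    qed
    finally show ?thesis using neg by simp
  qed
  have "Re (cder d\<zeta>' (cder d\<zeta> ?l) 0) \<ge> 0"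
  proof -
    let ?D = "cder d\<zeta> \<Phi> 0" and ?\<phi> = "Re (\<Phi> 0)"
    have \<phi>: "\<Phi> 0 = complex_of_real ?\<phi>" "?\<phi> > 0" using Mp[OF M0] by (simp_all add: complex_eq_iff)
    have nz: "\<Phi> 0 \<noteq> 0" using \<phi>(2) by auto
    note Pd = twice_diff_differentiable[OF Ptd M0]
    have bar: "cder d\<zeta>' \<Phi> 0 = cnj ?D"
    proof -
      have "cder d\<zeta>' \<Phi> 0 = cder d\<zeta>' (\<lambda>y. cnj (\<Phi> y)) 0"
        by (rule cder_cong[OF M M0 _ Pd]) (use Mp(2) in \<open>simp add: complex_eq_iff\<close>)
      thus ?thesis using cder_cnj[OF Pd, of d\<zeta>'] by (simp add: conj_wirtinger)
    qed
    have "cder d\<zeta>' (cder d\<zeta> ?l) 0 = cder d\<zeta>' (\<lambda>y. cder d\<zeta> \<Phi> y * inverse (\<Phi> y)) 0"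
      by (rule cder_cong[OF M M0 lc cder_differentiable[OF ltd M0]])
    also have "\<dots> = cder d\<zeta>' (cder d\<zeta> \<Phi>) 0 * inverse (\<Phi> 0) - ?D * cnj ?D * (inverse (\<Phi> 0))\<^sup>2"
      using cder_mult[OF cder_differentiable[OF Ptd M0] differentiable_inverse_complex(1)[OF Pd nz], of d\<zeta>' d\<zeta>]
        differentiable_inverse_complex(2)[OF Pd nz, of d\<zeta>'] bar by simp
    finally have l: "cder d\<zeta>' (cder d\<zeta> ?l) 0 =
        cder d\<zeta>' (cder d\<zeta> \<Phi>) 0 * inverse (\<Phi> 0) - ?D * cnj ?D * (inverse (\<Phi> 0))\<^sup>2" .
    have eq: "Re (cder d\<zeta>' (cder d\<zeta> ?l) 0) = Re (cder d\<zeta>' (cder d\<zeta> \<Phi>) 0) / ?\<phi> - (norm ?D)\<^sup>2 / ?\<phi>\<^sup>2"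
      unfolding l Re_quotient[symmetric] \<phi>(1)[symmetric] ..
    let ?pp = "Re (ip m G (c 0) ?P (\<lambda>l. cnj (?P l)))"
    have c0U: "c 0 \<in> U" by (rule MM.c_in[OF zero_in_Nb])
    \<comment> \<open>\<open>Rm_nonneg\<close> is applied with the conjugate of \<open>Xb\<close> as
      X; the double conjugate is left standing to match its statement.\<close>
    have "Re (Rm m \<Gamma> G (c 0) (\<lambda>k. cnj ((\<lambda>k. cnj (Xb k 0)) k)) (\<lambda>k. cnj (Xb k 0)) (\<lambda>k. S k 0) (\<lambda>k. cnj (S k 0))) \<ge> 0"
      by (rule MM.Rm_nonneg[OF c0U N.nonpositive_curvature_Rm[OF np \<kappa>' c0U]]) (simp add: curv_vanish)
    hence 1: "Re (cder d\<zeta>' (cder d\<zeta> \<Phi>) 0) \<ge> ?pp" unfolding cder_cder_Phi by simp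
    \<comment> \<open>The gradient term in the Hessian of the logarithm is the squared inner product
      of S with its \<zeta>-derivative, and so is absorbed by the squared norm of that
      derivative.\<close>
    have "(norm ?D)\<^sup>2 \<le> ?pp * ?\<phi>"
      unfolding cder_Phi[OF zero_in_Nb] \<Phi>_def by (rule MM.ip_cauchy_schwarz[OF c0U])
    hence "(norm ?D)\<^sup>2 / ?\<phi>\<^sup>2 \<le> ?pp * ?\<phi> / ?\<phi>\<^sup>2" by (rule divide_right_mono) simp
    also have "\<dots> = ?pp / ?\<phi>" using \<phi>(2) by (simp add: power2_eq_square)
    also have "\<dots> \<le> Re (cder d\<zeta>' (cder d\<zeta> \<Phi>) 0) / ?\<phi>" using 1 \<phi>(2) by (intro divide_right_mono) auto
    finally show ?thesis unfolding eq by simp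
  qed
  thus False using le hneg by simp
qed

end

section \<open>The ratio of the energy to the metric of the line bundle\<close>

lemma pd_of_has_derivative:
  assumes "((\<lambda>t. w (x(a := t))) has_derivative L) (at (x a))"
  shows "pd a e w x = L e"
proof (rule pd_eqI)
  interpret L: bounded_linear L using assms by (rule has_derivative_bounded_linear)
  have "((\<lambda>t::real. x a + t *\<^sub>R e) has_derivative (\<lambda>h. h *\<^sub>R e)) (at 0)" by (auto intro!: derivative_eq_intros)
  from has_derivative_compose[OF this, of "\<lambda>t. w (x(a := t))" L] assms
  have "((\<lambda>t::real. w (x(a := x a + t *\<^sub>R e))) has_derivative (\<lambda>h. L (h *\<^sub>R e))) (at 0)" by simp
  thus "((\<lambda>t::real. w (x(a := x a + t *\<^sub>R e))) has_vector_derivative L e) (at 0)"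
    by (simp add: has_vector_derivative_def L.scaleR)
qed

lemma dz_real_zero_imp_pd_zero:
  assumes "Ck_on (Suc 0) n U u" "x \<in> U" "a < n" "dz a (\<lambda>x. complex_of_real (u x)) x = 0" "e \<in> Basis"
  shows "pd a e u x = 0"
proof -
  have "pd a 1 u x = 0" "pd a \<i> u x = 0"
    using assms(4) pd_of_real[OF assms(1-3), of 1] pd_of_real[OF assms(1-3), of \<i>]
    by (simp_all add: dz_def Basis_complex_def complex_eq_iff)
  thus ?thesis using assms(5) by (auto simp: Basis_complex_def)
qed

lemma Ck_on_ln:
  fixes u :: "(nat \<Rightarrow> 'a::euclidean_space) \<Rightarrow> real"
  assumes U: "openin (top_of_set (coord_space n)) U" and u: "Ck_on (Suc k) n U u" and pos: "\<And>x. x \<in> U \<Longrightarrow> u x > 0"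
  shows "Ck_on (Suc k) n U (\<lambda>x. ln (u x))"
proof (rule Ck_on_SucI[OF U, where u'="\<lambda>i e x. inverse (u x) * pd i e u x"])
  have nz: "u x \<noteq> 0" if "x \<in> U" for x using pos[OF that] by simp
  show "continuous_on U (\<lambda>x. ln (u x))"
    using Ck_on_continuous[OF u] nz by (intro continuous_on_ln) auto
  show "((\<lambda>t::real. ln (u (x(i := x i + t *\<^sub>R e)))) has_vector_derivative inverse (u x) * pd i e u x) (at 0)"
    if "i < n" "e \<in> Basis" "x \<in> U" for i e x
  proof -
    have "((\<lambda>t::real. u (x(i := x i + t *\<^sub>R e))) has_real_derivative pd i e u x) (at 0)"
      using Ck_on_slice[OF u that] by (simp add: has_real_derivative_iff_has_vector_derivative)
    from DERIV_chain2[OF DERIV_ln[of "u (x(i := x i + 0 *\<^sub>R e))"] this] pos[OF that(3)]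
    show ?thesis by (simp add: has_real_derivative_iff_has_vector_derivative)
  qed
  show "Ck_on k n U (\<lambda>x. inverse (u x) * pd i e u x)" if "i < n" "e \<in> Basis" for i e
    by (rule Ck_on_mult[OF U Ck_on_inverse[OF U Ck_on_Suc_imp[OF u]] Ck_on_pd[OF u that]])
      (use nz in auto)
qed

text \<open>Tychonoff's theorem; the topology of pointwise convergence is the product
  topology.\<close>

lemma compact_coordinatewise:
  fixes C :: "nat \<Rightarrow> 'a::topological_space set"
  assumes "\<And>j. compact (C j)"
  shows "compact {x. \<forall>j. x j \<in> C j}"
proof -
  have "compactin (product_topology (\<lambda>i. euclidean) UNIV) (PiE UNIV C)"
    using assms by (simp add: compactin_PiE)
  moreover have "PiE UNIV C = {x. \<forall>j. x j \<in> C j}" by (auto simp: PiE_def extensional_def)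
  ultimately show ?thesis by (simp add: euclidean_product_topology)
qed

context pluriharmonic_map
begin

section \<open>Independence of the numerator from the charts\<close>

definition dfv :: "('p, complex) chart \<Rightarrow> ('q, real) chart \<Rightarrow> 'p \<Rightarrow> ('p, complex) tangent \<Rightarrow> nat \<Rightarrow> complex"
  where "dfv \<kappa> \<kappa>' p v k = (\<Sum>\<alpha><n. df \<kappa> \<kappa>' \<alpha> (snd \<kappa> p) k * v (\<kappa>, \<alpha>))"

definition num :: "('p, complex) chart \<Rightarrow> ('q, real) chart \<Rightarrow> 'p \<Rightarrow> ('p, complex) tangent \<Rightarrow> real"
  where "num \<kappa> \<kappa>' p v = Re (ip m (metric_comp m B g \<kappa>') (snd \<kappa>' (f p)) (dfv \<kappa> \<kappa>' p v) (\<lambda>k. cnj (dfv \<kappa> \<kappa>' p v k)))"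

lemma dom_mem: "p \<in> fst \<kappa> \<Longrightarrow> f p \<in> fst \<kappa>' \<Longrightarrow> snd \<kappa> p \<in> dom \<kappa> \<kappa>'"
  by (auto simp: dom_def)

text \<open>The transition map of the target is real, so its Jacobian matrix multiplies the two real
  partial derivatives alike and passes through the Wirtinger operator.\<close>

lemma df_target_change:
  assumes \<kappa>: "\<kappa> \<in> A" and \<kappa>1: "\<kappa>1 \<in> B" and \<kappa>2: "\<kappa>2 \<in> B" and p: "p \<in> fst \<kappa>" "f p \<in> fst \<kappa>1" "f p \<in> fst \<kappa>2"
    and k: "k < m" and a: "a < n"
  shows "df \<kappa> \<kappa>2 a (snd \<kappa> p) k = (\<Sum>j<m. complex_of_real (jac \<kappa>1 \<kappa>2 (f p) k j) * df \<kappa> \<kappa>1 a (snd \<kappa> p) j)"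
proof -
  let ?x = "snd \<kappa> p"
  have x: "?x \<in> dom \<kappa> \<kappa>1" "?x \<in> dom \<kappa> \<kappa>2" using dom_mem p by auto
  have r: "rep \<kappa> \<kappa>' ?x = snd \<kappa>' (f p)" for \<kappa>' using \<kappa> p(1) by (simp add: rep_def)
  have pd_eq: "pd a e (\<lambda>x. rep \<kappa> \<kappa>2 x k) ?x = (\<Sum>j<m. jac \<kappa>1 \<kappa>2 (f p) k j * pd a e (\<lambda>x. rep \<kappa> \<kappa>1 x j) ?x)"
    if e: "e \<in> Basis" for e
  proof (rule pd_eqI)
    let ?s = "\<lambda>t::real. ?x(a := ?x a + t *\<^sub>R e)"
    let ?c = "\<lambda>t. rep \<kappa> \<kappa>1 (?s t)"
    have ev: "\<forall>\<^sub>F t in nhds 0. ?s t \<in> dom \<kappa> \<kappa>1" "\<forall>\<^sub>F t in nhds 0. ?s t \<in> dom \<kappa> \<kappa>2"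
      by (rule eventually_slice_in[OF dom_open[OF \<kappa> \<kappa>1] x(1) a], rule eventually_slice_in[OF dom_open[OF \<kappa> \<kappa>2] x(2) a])
    have c0: "?c 0 = snd \<kappa>1 (f p)" using r by simp
    have "((\<lambda>t. snd \<kappa>2 (chart_inv \<kappa>1 (?c t)) k) has_field_derivative
        (\<Sum>j<m. jac \<kappa>1 \<kappa>2 (chart_inv \<kappa>1 (?c 0)) k j * pd a e (\<lambda>x. rep \<kappa> \<kappa>1 x j) ?x)) (at 0)"
    proof (rule N.trans_chain[OF \<kappa>1 \<kappa>2 k])
      show "?c 0 \<in> snd \<kappa>1 ` (fst \<kappa>1 \<inter> fst \<kappa>2)" unfolding c0 using p by blast
      show "\<forall>\<^sub>F t in nhds 0. ?c t \<in> coord_space m"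
        using ev(1) by eventually_elim (use rep_in[OF \<kappa>] openin_imp_subset[OF N.chart_image_open[OF \<kappa>1]] in blast)
      show "((\<lambda>t. ?c t j) has_field_derivative pd a e (\<lambda>x. rep \<kappa> \<kappa>1 x j) ?x) (at 0)" if "j < m" for j
        using Ck_on_slice[OF rep_smooth[OF \<kappa> \<kappa>1 that] a e x(1)]
        by (simp add: has_real_derivative_iff_has_vector_derivative)
    qed
    hence D: "((\<lambda>t. snd \<kappa>2 (chart_inv \<kappa>1 (?c t)) k) has_field_derivative
        (\<Sum>j<m. jac \<kappa>1 \<kappa>2 (f p) k j * pd a e (\<lambda>x. rep \<kappa> \<kappa>1 x j) ?x)) (at 0)"
      unfolding c0 using \<kappa>1 p by simp
    have eq: "\<forall>\<^sub>F t in nhds 0. rep \<kappa> \<kappa>2 (?s t) k = snd \<kappa>2 (chart_inv \<kappa>1 (?c t)) k"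
      using ev(1)
    proof eventually_elim
      case (elim t)
      show ?case using dom_point(2)[OF \<kappa> elim] \<kappa>1 unfolding rep_def by (simp only: N.chart_inv_chart)
    qed
    have "((\<lambda>t. rep \<kappa> \<kappa>2 (?s t) k) has_field_derivative
        (\<Sum>j<m. jac \<kappa>1 \<kappa>2 (f p) k j * pd a e (\<lambda>x. rep \<kappa> \<kappa>1 x j) ?x)) (at 0)"
      by (rule iffD2[OF DERIV_cong_ev[OF refl eq refl] D])
    thus "((\<lambda>t. rep \<kappa> \<kappa>2 (?s t) k) has_vector_derivative
        (\<Sum>j<m. jac \<kappa>1 \<kappa>2 (f p) k j * pd a e (\<lambda>x. rep \<kappa> \<kappa>1 x j) ?x)) (at 0)"
      by (simp add: has_real_derivative_iff_has_vector_derivative)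
  qed
  have B: "1 \<in> (Basis :: complex set)" "\<i> \<in> (Basis :: complex set)" by (auto simp: Basis_complex_def)
  have d: "df \<kappa> \<kappa>' a ?x j = (complex_of_real (pd a 1 (\<lambda>x. rep \<kappa> \<kappa>' x j) ?x) - \<i> * complex_of_real (pd a \<i> (\<lambda>x. rep \<kappa> \<kappa>' x j) ?x)) / 2"
    if "\<kappa>' \<in> B" "?x \<in> dom \<kappa> \<kappa>'" "j < m" for \<kappa>' j
    unfolding df_def dz_def local_rep_eq
    using pd_of_real[OF rep_smooth[OF \<kappa> that(1,3)] that(2) a] B by simp
  show ?thesis
    unfolding d[OF \<kappa>2 x(2) k] pd_eq[OF B(1)] pd_eq[OF B(2)]
    by (simp add: d[OF \<kappa>1 x(1)] sum_distrib_left sum_subtractf[symmetric] sum_divide_distrib algebra_simps)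
qed

text \<open>The transition map of the source is holomorphic: in the combination forming
  \<open>dz\<close> the antilinear part of the chain rule drops out, which leaves the complex
  Jacobian matrix.\<close>

lemma df_source_change:
  assumes \<kappa>1: "\<kappa>1 \<in> A" and \<kappa>2: "\<kappa>2 \<in> A" and \<kappa>': "\<kappa>' \<in> B" and p: "p \<in> fst \<kappa>1" "p \<in> fst \<kappa>2" "f p \<in> fst \<kappa>'"
    and k: "k < m" and a: "a < n"
  shows "df \<kappa>1 \<kappa>' a (snd \<kappa>1 p) k = (\<Sum>b<n. df \<kappa>2 \<kappa>' b (snd \<kappa>2 p) k * jac \<kappa>1 \<kappa>2 p b a)"
proof -
  let ?x = "snd \<kappa>1 p"
  let ?c = "\<lambda>t. snd \<kappa>2 (chart_inv \<kappa>1 (?x(a := t)))"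
  let ?u = "local_rep \<kappa>2 \<kappa>' f k"
  have x2: "snd \<kappa>2 p \<in> dom \<kappa>2 \<kappa>'" using dom_mem p by auto
  have c0: "?c (?x a) = snd \<kappa>2 p" using \<kappa>1 p by simp
  have ev: "\<forall>\<^sub>F t in nhds (?x a). ?x(a := t) \<in> snd \<kappa>1 ` (fst \<kappa>1 \<inter> fst \<kappa>2)"
    by (rule eventually_upd_in[OF M.chart_open[OF \<kappa>1 \<kappa>2] _ a]) (use p in auto)
  have evc: "\<forall>\<^sub>F t in nhds (?x a). ?c t \<in> coord_space n"
    using ev by eventually_elim (use \<kappa>1 M.chart_in_coord_space[OF \<kappa>2] in auto)
  have cd: "((\<lambda>t. ?c t b) has_derivative (\<lambda>h. jac \<kappa>1 \<kappa>2 p b a * h)) (at (?x a))" if "b < n" for b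
    using M.trans_slice[OF \<kappa>1 \<kappa>2 that p(1,2) a] by (simp add: has_field_derivative_def)
  have "((\<lambda>t. ?u (?c t)) has_derivative (\<lambda>h. \<Sum>b<n. \<Sum>e\<in>Basis. ((jac \<kappa>1 \<kappa>2 p b a * h) \<bullet> e) *\<^sub>R pd b e ?u (?c (?x a)))) (at (?x a))"
    by (rule C1_chain[OF dom_open[OF \<kappa>2 \<kappa>'] smooth_on_imp_C1[OF local_rep_smooth[OF \<kappa>2 \<kappa>' k]] _ evc cd])
      (simp add: c0[unfolded fun_upd_triv] x2 c0)
  hence D: "((\<lambda>t. ?u (?c t)) has_derivative (\<lambda>h. \<Sum>b<n. dz b ?u (snd \<kappa>2 p) * (jac \<kappa>1 \<kappa>2 p b a * h)
      + dzbar b ?u (snd \<kappa>2 p) * cnj (jac \<kappa>1 \<kappa>2 p b a * h))) (at (?x a))"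
    unfolding wirtinger_sum c0 .
  have "((\<lambda>t. local_rep \<kappa>1 \<kappa>' f k (?x(a := t))) has_derivative (\<lambda>h. \<Sum>b<n. dz b ?u (snd \<kappa>2 p) * (jac \<kappa>1 \<kappa>2 p b a * h)
      + dzbar b ?u (snd \<kappa>2 p) * cnj (jac \<kappa>1 \<kappa>2 p b a * h))) (at (?x a))"
  proof (rule has_derivative_transform_eventually[OF D])
    have "\<forall>\<^sub>F t in nhds (?x a). ?u (?c t) = local_rep \<kappa>1 \<kappa>' f k (?x(a := t))"
      using ev by eventually_elim (use \<kappa>1 \<kappa>2 in \<open>auto simp: local_rep_def\<close>)
    thus "\<forall>\<^sub>F t in at (?x a). ?u (?c t) = local_rep \<kappa>1 \<kappa>' f k (?x(a := t))" by (simp add: eventually_nhds_conv_at)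
    show "?u (?c (?x a)) = local_rep \<kappa>1 \<kappa>' f k (?x(a := ?x a))" using \<kappa>1 \<kappa>2 p by (simp add: local_rep_def)
  qed simp
  note pd = pd_of_has_derivative[OF this]
  show ?thesis
    unfolding df_def dz_def[of a] pd sum_distrib_left sum_subtractf[symmetric] sum_divide_distrib
    by (intro sum.cong refl) (simp add: complex_eq_iff field_simps)
qed

lemma dfv_source_change:
  assumes "\<kappa>1 \<in> A" "\<kappa>2 \<in> A" "\<kappa>' \<in> B" "p \<in> fst \<kappa>1" "p \<in> fst \<kappa>2" "f p \<in> fst \<kappa>'" "k < m"
    "v \<in> tangent_space n A p"
  shows "dfv \<kappa>1 \<kappa>' p v k = dfv \<kappa>2 \<kappa>' p v k"
proof -
  have v2: "v (\<kappa>2, b) = (\<Sum>a<n. jac \<kappa>1 \<kappa>2 p b a * v (\<kappa>1, a))" if "b < n" for b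
    using assms that unfolding tangent_space_def by blast
  have "dfv \<kappa>1 \<kappa>' p v k = (\<Sum>a<n. \<Sum>b<n. df \<kappa>2 \<kappa>' b (snd \<kappa>2 p) k * jac \<kappa>1 \<kappa>2 p b a * v (\<kappa>1, a))"
    unfolding dfv_def by (intro sum.cong refl) (simp add: df_source_change[OF assms(1-7)] sum_distrib_right)
  also have "\<dots> = (\<Sum>b<n. \<Sum>a<n. df \<kappa>2 \<kappa>' b (snd \<kappa>2 p) k * jac \<kappa>1 \<kappa>2 p b a * v (\<kappa>1, a))" by (rule sum.swap)
  also have "\<dots> = dfv \<kappa>2 \<kappa>' p v k"
    unfolding dfv_def by (intro sum.cong refl) (simp add: v2 sum_distrib_left mult.assoc)
  finally show ?thesis .
qed

lemma dfv_target_change: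
  assumes "\<kappa> \<in> A" "\<kappa>1 \<in> B" "\<kappa>2 \<in> B" "p \<in> fst \<kappa>" "f p \<in> fst \<kappa>1" "f p \<in> fst \<kappa>2" "k < m"
  shows "dfv \<kappa> \<kappa>2 p v k = (\<Sum>j<m. complex_of_real (jac \<kappa>1 \<kappa>2 (f p) k j) * dfv \<kappa> \<kappa>1 p v j)"
proof -
  have "dfv \<kappa> \<kappa>2 p v k = (\<Sum>a<n. \<Sum>j<m. complex_of_real (jac \<kappa>1 \<kappa>2 (f p) k j) * df \<kappa> \<kappa>1 a (snd \<kappa> p) j * v (\<kappa>, a))"
    unfolding dfv_def by (intro sum.cong refl) (simp add: df_target_change[OF assms] sum_distrib_right)
  also have "\<dots> = (\<Sum>j<m. \<Sum>a<n. complex_of_real (jac \<kappa>1 \<kappa>2 (f p) k j) * df \<kappa> \<kappa>1 a (snd \<kappa> p) j * v (\<kappa>, a))"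
    by (rule sum.swap)
  finally show ?thesis by (simp add: dfv_def sum_distrib_left mult.assoc)
qed

text \<open>Expressed through \<open>g\<close> on genuine tangent vectors, the numerator no longer
  refers to the metric coefficients of a chart; its invariance reduces to that of the real and
  imaginary parts of \<partial>f(v).\<close>

lemma num_eq_metric:
  assumes "\<kappa>' \<in> B" "f p \<in> fst \<kappa>'"
  shows "num \<kappa> \<kappa>' p v =
    g (f p) (N.tangent_vec \<kappa>' (\<lambda>k. Re (dfv \<kappa> \<kappa>' p v k)) (f p)) (N.tangent_vec \<kappa>' (\<lambda>k. Re (dfv \<kappa> \<kappa>' p v k)) (f p))
    + g (f p) (N.tangent_vec \<kappa>' (\<lambda>k. Im (dfv \<kappa> \<kappa>' p v k)) (f p)) (N.tangent_vec \<kappa>' (\<lambda>k. Im (dfv \<kappa> \<kappa>' p v k)) (f p))"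
proof -
  interpret C: metric_chart m "snd \<kappa>' ` fst \<kappa>'" "metric_comp m B g \<kappa>'" "christoffel m B g \<kappa>'"
    by (rule N.metric_chart_coordinates[OF assms(1)])
  have "snd \<kappa>' (f p) \<in> snd \<kappa>' ` fst \<kappa>'" using assms(2) by blast
  from C.ip_self[OF this] show ?thesis unfolding num_def N.metric_tangent_vec[OF assms] by simp
qed

lemma num_target_change:
  assumes "\<kappa> \<in> A" "\<kappa>1 \<in> B" "\<kappa>2 \<in> B" "p \<in> fst \<kappa>" "f p \<in> fst \<kappa>1" "f p \<in> fst \<kappa>2"
  shows "num \<kappa> \<kappa>1 p v = num \<kappa> \<kappa>2 p v"
proof -
  have tv: "N.tangent_vec \<kappa>1 a (f p) = N.tangent_vec \<kappa>2 b (f p)"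
    if "\<And>k. k < m \<Longrightarrow> b k = (\<Sum>j<m. jac \<kappa>1 \<kappa>2 (f p) k j * a j)" for a b
  proof (rule N.tangent_space_eqI[OF assms(3,6)])
    show "N.tangent_vec \<kappa>1 a (f p) (\<kappa>2, k) = N.tangent_vec \<kappa>2 b (f p) (\<kappa>2, k)" if "k < m" for k
      unfolding N.tangent_vec_component[OF assms(3,6) that]
      using that assms by (simp add: N.tangent_vec_def \<open>\<And>k. k < m \<Longrightarrow> b k = _ k\<close>)
  qed (use assms N.tangent_vec_in_tangent_space in auto)
  have re: "N.tangent_vec \<kappa>1 (\<lambda>k. Re (dfv \<kappa> \<kappa>1 p v k)) (f p) = N.tangent_vec \<kappa>2 (\<lambda>k. Re (dfv \<kappa> \<kappa>2 p v k)) (f p)"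
    and im: "N.tangent_vec \<kappa>1 (\<lambda>k. Im (dfv \<kappa> \<kappa>1 p v k)) (f p) = N.tangent_vec \<kappa>2 (\<lambda>k. Im (dfv \<kappa> \<kappa>2 p v k)) (f p)"
    by (rule tv, simp add: dfv_target_change[OF assms])+
  show ?thesis unfolding num_eq_metric[OF assms(2,5)] num_eq_metric[OF assms(3,6)] re im ..
qed

lemma num_source_change:
  assumes "\<kappa>1 \<in> A" "\<kappa>2 \<in> A" "\<kappa>' \<in> B" "p \<in> fst \<kappa>1" "p \<in> fst \<kappa>2" "f p \<in> fst \<kappa>'" "v \<in> tangent_space n A p"
  shows "num \<kappa>1 \<kappa>' p v = num \<kappa>2 \<kappa>' p v"
  unfolding num_def using dfv_source_change[OF assms(1-6) _ assms(7)]
  by (intro arg_cong[where f=Re] ip_cong) auto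

lemma num_scale: "num \<kappa> \<kappa>' p (\<lambda>x. c * v x) = (norm c)\<^sup>2 * num \<kappa> \<kappa>' p v"
proof -
  have "dfv \<kappa> \<kappa>' p (\<lambda>x. c * v x) = (\<lambda>k. c * dfv \<kappa> \<kappa>' p v k)"
    by (simp add: fun_eq_iff dfv_def sum_distrib_left mult.left_commute)
  moreover have "(\<lambda>k. cnj (c * dfv \<kappa> \<kappa>' p v k)) = (\<lambda>k. cnj c * cnj (dfv \<kappa> \<kappa>' p v k))" by simp
  ultimately have "num \<kappa> \<kappa>' p (\<lambda>x. c * v x) = Re (c * (cnj c * ip m (metric_comp m B g \<kappa>') (snd \<kappa>' (f p)) (dfv \<kappa> \<kappa>' p v) (\<lambda>k. cnj (dfv \<kappa> \<kappa>' p v k))))"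
    unfolding num_def by (simp only: ip_scale_left ip_scale_right)
  also have "\<dots> = Re (complex_of_real ((norm c)\<^sup>2) * ip m (metric_comp m B g \<kappa>') (snd \<kappa>' (f p)) (dfv \<kappa> \<kappa>' p v) (\<lambda>k. cnj (dfv \<kappa> \<kappa>' p v k)))"
    by (simp only: complex_norm_square mult.assoc)
  finally show ?thesis by (simp add: num_def)
qed

lemma energy_eq_num:
  assumes "\<kappa> \<in> A" "i < n" "x \<in> M.proj_region \<kappa> S"
  shows "Re (energy \<kappa> \<kappa>' i x) = num \<kappa> \<kappa>' (fst (M.proj_point \<kappa> i x)) (taut_frame \<kappa> i (M.proj_point \<kappa> i x))"
proof -
  note p = M.proj_region_chart_inv[OF assms(1,3)]
  have "df_vec \<kappa> \<kappa>' i x = dfv \<kappa> \<kappa>' (chart_inv \<kappa> (trunc n x)) (M.tangent_vec \<kappa> (hom_vec n i x) (chart_inv \<kappa> (trunc n x)))"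
    unfolding df_vec_def dfv_def p(3) fun_eq_iff using M.tangent_vec_component[OF assms(1) p(1)] by simp
  thus ?thesis
    unfolding energy_def num_def M.proj_point_in_dom(2)[OF assms] M.fst_proj_point rep_def by simp
qed

end

section \<open>The quotient on P(T_M) and its maximum\<close>

locale pluriharmonic_metric = pluriharmonic_map n A m B g f
  for n :: nat and A :: "('p, complex) chart set" and m :: nat and B :: "('q, real) chart set"
    and g :: "'q \<Rightarrow> ('q, real) tangent \<Rightarrow> ('q, real) tangent \<Rightarrow> real" and f :: "'p \<Rightarrow> 'q" +
  fixes h :: "'p ptangent \<Rightarrow> ('p, complex) tangent \<Rightarrow> ('p, complex) tangent \<Rightarrow> complex"
  assumes herm: "holomorphic_line_bundle.smooth_hermitian_metric (2 * n - 1) (proj_atlas n A) taut_fibre (taut_frames n A) h"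
begin

sublocale L: holomorphic_line_bundle "2 * n - 1" "proj_atlas n A" taut_fibre "taut_frames n A"
  by (rule M.taut_line_bundle)

lemma proj_dom_points: "q \<in> proj_dom n A \<kappa> i \<Longrightarrow> \<kappa> \<in> A \<Longrightarrow> i < n \<Longrightarrow> q \<in> points (proj_atlas n A)"
  unfolding M.points_proj_atlas by blast

lemma h_scale:
  assumes q: "q \<in> points (proj_atlas n A)" and v: "v \<in> snd q" and cv: "(\<lambda>a. c * v a) \<in> snd q"
  shows "h q (\<lambda>a. c * v a) (\<lambda>a. c * v a) = complex_of_real ((norm c)\<^sup>2) * h q v v"
proof -
  have s: "h q (\<lambda>a. c * v a) w = c * h q v w" and sym: "h q w v = cnj (h q v w)" if "v \<in> snd q" "w \<in> snd q" for v w c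
    using herm q that unfolding L.smooth_hermitian_metric_def taut_fibre_def by blast+
  have "h q (\<lambda>a. c * v a) (\<lambda>a. c * v a) = c * h q v (\<lambda>a. c * v a)" by (rule s[OF v cv])
  also have "h q v (\<lambda>a. c * v a) = cnj (h q (\<lambda>a. c * v a) v)" by (rule sym[OF cv v])
  also have "h q (\<lambda>a. c * v a) v = c * h q v v" by (rule s[OF v v])
  also have "cnj (c * h q v v) = cnj c * h q v v" using sym[OF v v] by simp
  finally show ?thesis by (simp only: complex_norm_square mult.assoc)
qed

lemma h_pos:
  assumes "q \<in> proj_dom n A \<kappa> i" "\<kappa> \<in> A" "i < n"
  shows "Re (h q (taut_frame \<kappa> i q) (taut_frame \<kappa> i q)) > 0"
proof -
  have "taut_frame \<kappa> i q \<in> snd q" using M.taut_frame_props(3)[OF assms(1)] complex_line_self by metis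
  moreover have "taut_frame \<kappa> i q \<noteq> (\<lambda>a. 0)" using M.taut_frame_props(2)[OF assms(1)] by (metis zero_neq_one)
  ultimately show ?thesis
    using herm proj_dom_points[OF assms] unfolding L.smooth_hermitian_metric_def taut_fibre_def by blast
qed

definition hloc :: "('p, complex) chart \<Rightarrow> nat \<Rightarrow> (nat \<Rightarrow> complex) \<Rightarrow> complex"
  where "hloc \<kappa> i x = (let q = chart_inv (proj_chart n A \<kappa> i) x in h q (taut_frame \<kappa> i q) (taut_frame \<kappa> i q))"

lemma hloc_smooth:
  assumes "\<kappa> \<in> A" "i < n"
  shows "smooth_on (2 * n - 1) (M.proj_region \<kappa> UNIV) (hloc \<kappa> i)"
proof -
  have mem: "(proj_dom n A \<kappa> i, taut_frame \<kappa> i) \<in> taut_frames n A" using assms unfolding taut_frames_def by blast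
  have "snd (proj_chart n A \<kappa> i) ` (fst (proj_chart n A \<kappa> i) \<inter> proj_dom n A \<kappa> i) = M.proj_region \<kappa> UNIV"
    using M.proj_chart_image[OF assms, of UNIV] by simp
  moreover have "smooth_on (2 * n - 1) (snd (proj_chart n A \<kappa> i) ` (fst (proj_chart n A \<kappa> i) \<inter> fst (proj_dom n A \<kappa> i, taut_frame \<kappa> i)))
      (\<lambda>x. let q = chart_inv (proj_chart n A \<kappa> i) x in h q (snd (proj_dom n A \<kappa> i, taut_frame \<kappa> i) q) (snd (proj_dom n A \<kappa> i, taut_frame \<kappa> i) q))"
    using herm mem M.proj_chart_in_atlas[OF assms] unfolding L.smooth_hermitian_metric_def by blast
  ultimately show ?thesis unfolding hloc_def[abs_def] by simp
qed

lemma hloc_eq: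
  assumes "\<kappa> \<in> A" "i < n" "x \<in> M.proj_region \<kappa> S"
  shows "hloc \<kappa> i x = h (M.proj_point \<kappa> i x) (taut_frame \<kappa> i (M.proj_point \<kappa> i x)) (taut_frame \<kappa> i (M.proj_point \<kappa> i x))"
  unfolding hloc_def M.chart_inv_proj_chart[OF assms] Let_def ..

lemma hloc_pos:
  assumes "\<kappa> \<in> A" "i < n" "x \<in> M.proj_region \<kappa> S"
  shows "Re (hloc \<kappa> i x) > 0"
  unfolding hloc_eq[OF assms] by (rule h_pos[OF M.proj_point_in_dom(1)[OF assms] assms(1,2)])

definition ratio :: "('p, complex) chart \<Rightarrow> ('q, real) chart \<Rightarrow> nat \<Rightarrow> 'p ptangent \<Rightarrow> real"
  where "ratio \<kappa> \<kappa>' i q = num \<kappa> \<kappa>' (fst q) (taut_frame \<kappa> i q) / Re (h q (taut_frame \<kappa> i q) (taut_frame \<kappa> i q))"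

text \<open>Two frames of the same line differ by a factor c, and numerator and denominator are both
  multiplied by the squared modulus of c.\<close>

lemma ratio_invariant:
  assumes 1: "\<kappa>1 \<in> A" "i1 < n" "q \<in> proj_dom n A \<kappa>1 i1" and 2: "\<kappa>2 \<in> A" "i2 < n" "q \<in> proj_dom n A \<kappa>2 i2"
    and B: "\<kappa>1' \<in> B" "f (fst q) \<in> fst \<kappa>1'" "\<kappa>2' \<in> B" "f (fst q) \<in> fst \<kappa>2'"
  shows "ratio \<kappa>1 \<kappa>1' i1 q = ratio \<kappa>2 \<kappa>2' i2 q"
proof -
  let ?v = "taut_frame \<kappa>1 i1 q" and ?c = "inverse (taut_frame \<kappa>1 i1 q (\<kappa>2, i2))"
  note p1 = M.taut_frame_props[OF 1(3)] and p2 = M.taut_frame_props[OF 2(3)]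
  have w: "taut_frame \<kappa>2 i2 q = (\<lambda>a. ?c * ?v a)" by (rule M.taut_frame_change[OF 1(3) 2(3)])
  have c: "?c \<noteq> 0" using M.proj_dom_iff[OF 1(3) 2(1)] 2(3) by simp
  have v: "?v \<in> snd q" using p1(3) complex_line_self by metis
  have cv: "(\<lambda>a. ?c * ?v a) \<in> snd q" using p2(3) complex_line_self w by metis
  have "num \<kappa>2 \<kappa>2' (fst q) (taut_frame \<kappa>2 i2 q) = (norm ?c)\<^sup>2 * num \<kappa>2 \<kappa>2' (fst q) ?v"
    unfolding w by (rule num_scale)
  also have "num \<kappa>2 \<kappa>2' (fst q) ?v = num \<kappa>1 \<kappa>2' (fst q) ?v"
    by (rule num_source_change[OF 2(1) 1(1) B(3) p2(4) p1(4) B(4) p1(1)])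
  also have "\<dots> = num \<kappa>1 \<kappa>1' (fst q) ?v"
    by (rule num_target_change[OF 1(1) B(3,1) p1(4) B(4,2)])
  finally have n2: "num \<kappa>2 \<kappa>2' (fst q) (taut_frame \<kappa>2 i2 q) = (norm ?c)\<^sup>2 * num \<kappa>1 \<kappa>1' (fst q) ?v" .
  have h2: "Re (h q (taut_frame \<kappa>2 i2 q) (taut_frame \<kappa>2 i2 q)) = (norm ?c)\<^sup>2 * Re (h q ?v ?v)"
    unfolding w h_scale[OF proj_dom_points[OF 1(3,1,2)] v cv] by simp
  show ?thesis unfolding ratio_def n2 h2 using c by simp
qed

lemma ratio_proj_point:
  assumes "\<kappa> \<in> A" "i < n" "x \<in> M.proj_region \<kappa> S"
  shows "ratio \<kappa> \<kappa>' i (M.proj_point \<kappa> i x) = Re (energy \<kappa> \<kappa>' i x) / Re (hloc \<kappa> i x)"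
  unfolding ratio_def energy_eq_num[OF assms] hloc_eq[OF assms] ..

lemma local_ratio_continuous:
  assumes "\<kappa> \<in> A" "\<kappa>' \<in> B" "i < n"
  shows "continuous_on {x \<in> coord_space (2 * n - 1). trunc n x \<in> dom \<kappa> \<kappa>'} (\<lambda>x. Re (energy \<kappa> \<kappa>' i x) / Re (hloc \<kappa> i x))"
proof -
  let ?D = "{x \<in> coord_space (2 * n - 1). trunc n x \<in> dom \<kappa> \<kappa>'}"
  have sub: "?D \<subseteq> M.proj_region \<kappa> UNIV" by (auto simp: M.proj_region_def dom_def)
  have t: "continuous_on ?D (\<lambda>x. w (trunc n x))" if "continuous_on (dom \<kappa> \<kappa>') w" for w :: "(nat \<Rightarrow> complex) \<Rightarrow> 'z::topological_space"
    by (rule continuous_on_compose2[OF that continuous_on_trunc]) auto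
  have r: "continuous_on (dom \<kappa> \<kappa>') (rep \<kappa> \<kappa>')"
  proof (rule continuous_on_coordinatewise_then_product)
    fix k
    show "continuous_on (dom \<kappa> \<kappa>') (\<lambda>x. rep \<kappa> \<kappa>' x k)"
    proof (cases "k < m")
      case True
      then show ?thesis using Ck_on_continuous[OF rep_smooth[OF assms(1,2)]] by blast
    next
      case False
      have "rep \<kappa> \<kappa>' x k = 0" if "x \<in> dom \<kappa> \<kappa>'" for x
        using rep_in[OF assms(1) that] openin_imp_subset[OF N.chart_image_open[OF assms(2)]] False
        by (auto simp: coord_space_def)
      thus ?thesis by (simp cong: continuous_on_cong)
    qed
  qed
  have G: "continuous_on ?D (\<lambda>x. metric_comp m B g \<kappa>' j k (rep \<kappa> \<kappa>' (trunc n x)))" if "j < m" "k < m" for j k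
  proof (rule t)
    have "continuous_on (snd \<kappa>' ` fst \<kappa>') (metric_comp m B g \<kappa>' j k)"
      using N.metric_smooth[OF assms(2) that] Ck_on_continuous unfolding smooth_on_def by blast
    thus "continuous_on (dom \<kappa> \<kappa>') (\<lambda>x. metric_comp m B g \<kappa>' j k (rep \<kappa> \<kappa>' x))"
      by (rule continuous_on_compose2[OF _ r]) (use rep_in[OF assms(1)] in blast)
  qed
  have d: "continuous_on ?D (\<lambda>x. df_vec \<kappa> \<kappa>' i x k)" if "k < m" for k
    unfolding df_vec_def
    using Ck_on_continuous[OF df_Ck[OF assms(1,2) that]]
    by (intro continuous_on_sum continuous_on_mult continuous_hom_vec t) auto
  have "continuous_on ?D (energy \<kappa> \<kappa>' i)"
    unfolding energy_def ip_def using G d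
    by (intro continuous_on_sum continuous_on_mult continuous_on_of_real continuous_on_cnj) auto
  moreover have "continuous_on ?D (hloc \<kappa> i)"
  proof -
    have "continuous_on (M.proj_region \<kappa> UNIV) (hloc \<kappa> i)"
      using hloc_smooth[OF assms(1,3)] Ck_on_continuous unfolding smooth_on_def by blast
    thus ?thesis using sub by (rule continuous_on_subset)
  qed
  moreover have "Re (hloc \<kappa> i x) \<noteq> 0" if "x \<in> ?D" for x
    using hloc_pos[OF assms(1,3), of x UNIV] sub that by force
  ultimately show ?thesis by (intro continuous_on_divide continuous_on_Re) auto
qed

text \<open>Instead of the compactness of P(T_M), finitely many compact coordinate sets are used
  that together contain every line. The local maxima over these sets are compared through the
  invariance of the quotient.\<close>

lemma ratio_attains_max:
  assumes cpt: "compact_space (mtop A)" and ne: "points A \<noteq> {}" and npos: "n > 0"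
  obtains \<kappa> \<kappa>' i x where "\<kappa> \<in> A" "\<kappa>' \<in> B" "i < n" "x \<in> coord_space (2 * n - 1)" "trunc n x \<in> dom \<kappa> \<kappa>'"
    "\<And>\<kappa>2 \<kappa>2' i2 q. \<kappa>2 \<in> A \<Longrightarrow> \<kappa>2' \<in> B \<Longrightarrow> i2 < n \<Longrightarrow> q \<in> proj_dom n A \<kappa>2 i2 \<Longrightarrow> f (fst q) \<in> fst \<kappa>2' \<Longrightarrow>
      ratio \<kappa>2 \<kappa>2' i2 q \<le> Re (energy \<kappa> \<kappa>' i x) / Re (hloc \<kappa> i x)"
proof -
  \<comment> \<open>The factor 2 leaves room for the closed box of radius \<open>d\<close>, which
    has to stay in the domain of the local expression.\<close>
  have "\<exists>\<kappa> \<kappa>' d. \<kappa> \<in> A \<and> \<kappa>' \<in> B \<and> p \<in> fst \<kappa> \<and> d > 0 \<and> coord_box n (snd \<kappa> p) (2 * d) \<subseteq> dom \<kappa> \<kappa>'" if p: "p \<in> points A" for p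
  proof -
    obtain \<kappa> where \<kappa>: "\<kappa> \<in> A" "p \<in> fst \<kappa>" using p by (auto simp: points_def)
    obtain \<kappa>' where \<kappa>': "\<kappa>' \<in> B" "f p \<in> fst \<kappa>'" using f_points[OF p] by (auto simp: points_def)
    obtain d where d: "d > 0" "coord_box n (snd \<kappa> p) d \<subseteq> dom \<kappa> \<kappa>'"
      using coord_box_subset_open[OF dom_open[OF \<kappa>(1) \<kappa>'(1)] dom_mem[OF \<kappa>(2) \<kappa>'(2)]] .
    show ?thesis
    proof (intro exI conjI)
      show "d / 2 > 0" using d(1) by simp
      show "coord_box n (snd \<kappa> p) (2 * (d / 2)) \<subseteq> dom \<kappa> \<kappa>'" using d(2) by simp
    qed (use \<kappa> \<kappa>' in auto)
  qed
  then obtain K K' D where K: "\<And>p. p \<in> points A \<Longrightarrow> K p \<in> A \<and> K' p \<in> B \<and> p \<in> fst (K p) \<and> D p > 0 \<and>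
      coord_box n (snd (K p) p) (2 * D p) \<subseteq> dom (K p) (K' p)" by metis
  define O' where "O' p = {p' \<in> fst (K p). snd (K p) p' \<in> coord_box n (snd (K p) p) (D p)}" for p
  have O_open: "openin (mtop A) (O' p)" if "p \<in> points A" for p
    unfolding O'_def by (rule M.openin_chart_preimage_rel[OF _ openin_coord_box]) (use K that in blast)
  have O_mem: "p \<in> O' p" if "p \<in> points A" for p
    unfolding O'_def using K[OF that] center_in_coord_box[OF M.chart_in_coord_space] by blast
  have cA: "compactin (mtop A) (points A)" using cpt by (simp add: compact_space_def M.topspace_mtop)
  have oA: "openin (mtop A) V" if "V \<in> O' ` points A" for V using O_open that by blast
  have sA: "points A \<subseteq> \<Union> (O' ` points A)" using O_mem by blast
  have "\<exists>F0. finite F0 \<and> F0 \<subseteq> O' ` points A \<and> points A \<subseteq> \<Union> F0"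
    by (rule compactinD[OF cA _ sA]) (rule oA)
  then obtain F0 where F0: "finite F0" "F0 \<subseteq> O' ` points A" "points A \<subseteq> \<Union> F0"
    by (elim exE conjE) rule
  then obtain F where F: "F \<subseteq> points A" "finite F" "points A \<subseteq> (\<Union>p\<in>F. O' p)"
    by (metis finite_subset_image)
  \<comment> \<open>A closed box around the base point times closed unit discs for the fibre
    coordinates; the entry {0} beyond the dimension keeps the set inside the model space and
    compact.\<close>
  define C where "C p = {x. \<forall>j. x j \<in> (if j < n then cball (snd (K p) p j) (D p) else if j < 2 * n - 1 then cball 0 1 else {0})}" for p
  have C_compact: "compact (C p)" for p
    unfolding C_def by (rule compact_coordinatewise) auto
  have C_sub: "C p \<subseteq> {x \<in> coord_space (2 * n - 1). trunc n x \<in> dom (K p) (K' p)}" if p: "p \<in> points A" for p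
  proof
    fix x assume x: "x \<in> C p"
    have xc: "x j = 0" if "j \<ge> 2 * n - 1" for j
    proof -
      have "\<not> j < n" using that npos by simp
      moreover have "x j \<in> (if j < n then cball (snd (K p) p j) (D p) else if j < 2 * n - 1 then cball 0 1 else {0})"
        using x unfolding C_def by blast
      ultimately show ?thesis using that by simp
    qed
    have "dist (x j) (snd (K p) p j) \<le> D p" if "j < n" for j
    proof -
      have "x j \<in> (if j < n then cball (snd (K p) p j) (D p) else if j < 2 * n - 1 then cball 0 1 else {0})"
        using x unfolding C_def by blast
      thus ?thesis using that by (simp add: dist_commute)
    qed
    hence "dist (x j) (snd (K p) p j) < 2 * D p" if "j < n" for j
      using that K[OF p] by (smt (verit))
    hence "trunc n x \<in> coord_box n (snd (K p) p) (2 * D p)" by (simp add: coord_box_def) (simp add: trunc_def)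
    thus "x \<in> {x \<in> coord_space (2 * n - 1). trunc n x \<in> dom (K p) (K' p)}"
      using K[OF p] xc by (auto simp: coord_space_def)
  qed
  have C_ne: "C p \<noteq> {}" if p: "p \<in> points A" for p
  proof -
    have "(\<lambda>j. if j < n then snd (K p) p j else 0) \<in> C p" unfolding C_def using K[OF p] by (auto simp: less_imp_le)
    thus ?thesis by blast
  qed
  let ?r = "\<lambda>p i x. Re (energy (K p) (K' p) i x) / Re (hloc (K p) i x)"
  have ex: "\<exists>x\<in>C p. \<forall>y\<in>C p. ?r p i y \<le> ?r p i x" if "p \<in> points A" "i < n" for p i
    by (rule continuous_attains_sup[OF C_compact C_ne[OF that(1)] continuous_on_subset[OF local_ratio_continuous C_sub[OF that(1)]]])
      (use K that in auto)
  define X where "X p i = (SOME x. x \<in> C p \<and> (\<forall>y\<in>C p. ?r p i y \<le> ?r p i x))" for p i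
  have X: "X p i \<in> C p \<and> (\<forall>y\<in>C p. ?r p i y \<le> ?r p i (X p i))" if "p \<in> points A" "i < n" for p i
  proof -
    have "\<exists>x. x \<in> C p \<and> (\<forall>y\<in>C p. ?r p i y \<le> ?r p i x)" using ex[OF that] by blast
    from someI_ex[OF this] show ?thesis unfolding X_def .
  qed
  have Fne: "F \<times> {..<n} \<noteq> {}" using F(3) ne npos by auto
  have fin: "finite (F \<times> {..<n})" using F(2) by simp
  obtain s where s: "s \<in> F \<times> {..<n}" "\<And>t. t \<in> F \<times> {..<n} \<Longrightarrow> ?r (fst t) (snd t) (X (fst t) (snd t)) \<le> ?r (fst s) (snd s) (X (fst s) (snd s))"
  proof -
    let ?R = "(\<lambda>t. ?r (fst t) (snd t) (X (fst t) (snd t))) ` (F \<times> {..<n})"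
    have "Max ?R \<in> ?R" using fin Fne by (intro Max_in) auto
    then obtain s0 where s0: "s0 \<in> F \<times> {..<n}" "Max ?R = ?r (fst s0) (snd s0) (X (fst s0) (snd s0))" by blast
    have mx: "?r (fst t) (snd t) (X (fst t) (snd t)) \<le> Max ?R" if "t \<in> F \<times> {..<n}" for t
      using fin that by (intro Max_ge) auto
    show ?thesis
    proof (rule that[OF s0(1)])
      fix t assume "t \<in> F \<times> {..<n}"
      from mx[OF this] show "?r (fst t) (snd t) (X (fst t) (snd t)) \<le> ?r (fst s0) (snd s0) (X (fst s0) (snd s0))"
        unfolding s0(2) .
    qed
  qed
  obtain p0 i0 where s': "s = (p0, i0)" by (cases s)
  have p0: "p0 \<in> F" "p0 \<in> points A" "i0 < n" using s(1) F(1) by (auto simp: s')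
  show ?thesis
  proof (rule that[of "K p0" "K' p0" i0 "X p0 i0"])
    show "K p0 \<in> A" "K' p0 \<in> B" "i0 < n" using K[OF p0(2)] p0 by auto
    have "X p0 i0 \<in> C p0" using X[OF p0(2,3)] by blast
    thus "X p0 i0 \<in> coord_space (2 * n - 1)" "trunc n (X p0 i0) \<in> dom (K p0) (K' p0)" using C_sub[OF p0(2)] by blast+
    fix \<kappa>2 \<kappa>2' i2 q assume q: "\<kappa>2 \<in> A" "\<kappa>2' \<in> B" "i2 < n" "q \<in> proj_dom n A \<kappa>2 i2" "f (fst q) \<in> fst \<kappa>2'"
    obtain p where p: "p \<in> F" "fst q \<in> O' p" using F(3) M.taut_frame_props(5)[OF q(4)] by blast
    have pA: "p \<in> points A" using p(1) F(1) by blast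
    note Kp = K[OF pA]
    have qk: "fst q \<in> fst (K p)" "snd (K p) (fst q) \<in> coord_box n (snd (K p) p) (D p)" using p(2) by (auto simp: O'_def)
    obtain j where j: "j < n" "q \<in> proj_dom n A (K p) j"
      using M.proj_point_cases[OF proj_dom_points[OF q(4,1,3)] _ qk(1)] Kp by blast
    \<comment> \<open>Normalising by a component of greatest modulus puts all fibre coordinates into
      the unit disc, so unit discs suffice for the whole fibre.\<close>
    let ?w = "\<lambda>k. norm (taut_frame (K p) j q (K p, k))"
    have "Max (?w ` {..<n}) \<in> ?w ` {..<n}" using npos by (intro Max_in) auto
    then obtain i where i: "i < n" "Max (?w ` {..<n}) = ?w i" by auto
    have wi: "?w k \<le> ?w i" if "k < n" for k unfolding i(2)[symmetric] using that by (intro Max_ge) auto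
    have "?w j = 1" using M.taut_frame_props(2)[OF j(2)] by simp
    hence wipos: "?w i > 0" using wi[OF j(1)] by linarith
    hence qi: "q \<in> proj_dom n A (K p) i" using M.proj_dom_iff[OF j(2), of "K p" i] Kp qk(1) by auto
    define x where "x = snd (proj_chart n A (K p) i) q"
    have fr: "norm (taut_frame (K p) i q (K p, k)) \<le> 1" if "k < n" for k
    proof -
      have "norm (taut_frame (K p) i q (K p, k)) = ?w k / ?w i"
        unfolding M.taut_frame_change[OF j(2) qi] by (simp add: norm_mult norm_inverse divide_inverse mult.commute)
      thus ?thesis using wi[OF that] wipos by simp
    qed
    have xC: "x \<in> C p"
      unfolding C_def
    proof (intro CollectI allI)
      fix l
      show "x l \<in> (if l < n then cball (snd (K p) p l) (D p) else if l < 2 * n - 1 then cball 0 1 else {0})"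
        using qk(2) fr i(1) by (auto simp: x_def M.snd_proj_chart coord_box_def dist_commute less_imp_le)
    qed
    have reg: "x \<in> M.proj_region (K p) UNIV"
      unfolding x_def by (rule M.proj_point_proj_chart(2)[OF _ i(1) qi]) (use Kp in auto)
    have qx: "M.proj_point (K p) i x = q"
      unfolding x_def by (rule M.proj_point_proj_chart(1)[OF _ i(1) qi]) (use Kp in auto)
    have "snd (K p) (fst q) \<in> dom (K p) (K' p)"
      using qk(2) Kp coord_box_mono[of "D p" "2 * D p" n "snd (K p) p"] by auto
    hence fq: "f (fst q) \<in> fst (K' p)" using dom_point(2)[of "K p" "snd (K p) (fst q)" "K' p"] Kp qk(1) by simp
    have "ratio \<kappa>2 \<kappa>2' i2 q = ratio (K p) (K' p) i q"
      by (rule ratio_invariant[OF q(1,3,4) _ i(1) qi q(2,5) _ fq]) (use Kp in auto)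
    also have "\<dots> = ?r p i x" using ratio_proj_point[of "K p" i x UNIV "K' p"] Kp i(1) reg qx by simp
    also have "\<dots> \<le> ?r p i (X p i)" using X[OF pA i(1)] xC by blast
    also have "\<dots> \<le> ?r p0 i0 (X p0 i0)" using s(2)[of "(p, i)"] p(1) i(1) by (simp add: s')
    finally show "ratio \<kappa>2 \<kappa>2' i2 q \<le> ?r p0 i0 (X p0 i0)" .
  qed
qed

end

section \<open>Conclusion\<close>

context pluriharmonic_metric
begin

lemma Ck_on_log_metric:
  assumes "\<kappa> \<in> A" "i < n"
  shows "Ck_on (Suc (Suc 0)) (2 * n - 1) (M.proj_region \<kappa> UNIV) (\<lambda>x. complex_of_real (ln (Re (hloc \<kappa> i x))))"
proof -
  let ?V = "M.proj_region \<kappa> UNIV"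
  have V: "openin (top_of_set (coord_space (2 * n - 1))) ?V"
    using M.openin_proj_region[OF assms(1) M.openin_chart_domain[OF assms(1)]]
    by (simp add: M.proj_region_def)
  have "Ck_on (Suc (Suc 0)) (2 * n - 1) ?V (hloc \<kappa> i)"
    using hloc_smooth[OF assms] unfolding smooth_on_def by blast
  hence "Ck_on (Suc (Suc 0)) (2 * n - 1) ?V (\<lambda>x. Re (hloc \<kappa> i x))"
    by (rule Ck_on_bounded_linear[OF bounded_linear_Re V])
  hence "Ck_on (Suc (Suc 0)) (2 * n - 1) ?V (\<lambda>x. ln (Re (hloc \<kappa> i x)))"
    by (rule Ck_on_ln[OF V]) (rule hloc_pos[OF assms])
  thus ?thesis by (rule Ck_on_bounded_linear[OF bounded_linear_of_real V])
qed

text \<open>An eigenvector for the positive eigenvalue at the maximum point yields a direction in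
  which the logarithm of the metric has negative complex Hessian. The logarithm of a positive
  quotient would then have a maximum that \<open>no_local_maximum\<close> excludes.\<close>

lemma no_positive_maximum:
  assumes np: "nonpositive_sectional_curvature m B g"
    and RC: "\<And>\<mu> \<sigma> q. \<mu> \<in> proj_atlas n A \<Longrightarrow> \<sigma> \<in> taut_frames n A \<Longrightarrow> q \<in> fst \<mu> \<inter> fst \<sigma> \<Longrightarrow>
      \<exists>r::real. r > 0 \<and> eigenvalue (L.chern_curvature h (snd \<sigma>) \<mu> q) (complex_of_real r)"
    and \<kappa>: "\<kappa> \<in> A" and \<kappa>': "\<kappa>' \<in> B" and i: "i < n"
    and x: "x \<in> coord_space (2 * n - 1)" "trunc n x \<in> dom \<kappa> \<kappa>'"
    and max: "\<And>q. q \<in> proj_dom n A \<kappa> i \<Longrightarrow> f (fst q) \<in> fst \<kappa>' \<Longrightarrow>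
      ratio \<kappa> \<kappa>' i q \<le> Re (energy \<kappa> \<kappa>' i x) / Re (hloc \<kappa> i x)"
  shows "Re (energy \<kappa> \<kappa>' i x) \<le> 0"
proof (rule ccontr)
  assume "\<not> ?thesis"
  hence pos: "Re (energy \<kappa> \<kappa>' i x) > 0" by simp
  let ?N = "2 * n - 1" and ?V = "M.proj_region \<kappa> UNIV" and ?\<mu> = "proj_chart n A \<kappa> i"
  let ?LH = "\<lambda>x. complex_of_real (ln (Re (hloc \<kappa> i x)))"
  have V: "openin (top_of_set (coord_space ?N)) ?V"
    using M.openin_proj_region[OF \<kappa> M.openin_chart_domain[OF \<kappa>]] by (simp add: M.proj_region_def)
  have domV: "y \<in> ?V" if "y \<in> coord_space ?N" "trunc n y \<in> dom \<kappa> \<kappa>'" for y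
    using that by (auto simp: M.proj_region_def dom_def)
  have xV: "x \<in> ?V" by (rule domV[OF x])
  let ?q = "M.proj_point \<kappa> i x"
  have q: "?q \<in> proj_dom n A \<kappa> i" by (rule M.proj_point_in_dom(1)[OF \<kappa> i xV])
  have qx: "snd ?\<mu> ?q = x" by (rule M.proj_chart_proj_point[OF \<kappa> i xV])
  have mem: "(proj_dom n A \<kappa> i, taut_frame \<kappa> i) \<in> taut_frames n A" using \<kappa> i unfolding taut_frames_def by blast
  obtain r where r: "r > 0" "eigenvalue (L.chern_curvature h (taut_frame \<kappa> i) ?\<mu> ?q) (complex_of_real r)"
    using RC[OF M.proj_chart_in_atlas[OF \<kappa> i] mem, of ?q] q by auto
  define C where "C = (\<lambda>a b. - dz a (dzbar b ?LH) x)"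
  have curv: "L.chern_curvature h (taut_frame \<kappa> i) ?\<mu> ?q = Matrix.mat ?N ?N (\<lambda>(a, b). C a b)"
    unfolding L.chern_curvature_def qx C_def hloc_def by (simp add: Let_def)
  obtain w where w: "w \<in> carrier_vec ?N" "w \<noteq> 0\<^sub>v ?N"
      "Matrix.mat ?N ?N (\<lambda>(a, b). C a b) *\<^sub>v w = complex_of_real r \<cdot>\<^sub>v w"
    using r(2) unfolding curv eigenvalue_def eigenvector_def by auto
  define W where "W = vec_index w"
  have row: "(\<Sum>b<?N. C a b * W b) = complex_of_real r * W a" if "a < ?N" for a
  proof -
    have "vec_index (Matrix.mat ?N ?N (\<lambda>(a, b). C a b) *\<^sub>v w) a = (\<Sum>b<?N. C a b * W b)"
      using that w(1) by (simp add: W_def scalar_prod_def atLeast0LessThan)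
    moreover have "vec_index (Matrix.mat ?N ?N (\<lambda>(a, b). C a b) *\<^sub>v w) a = complex_of_real r * W a"
      unfolding w(3) using w(1) that by (simp add: W_def)
    ultimately show ?thesis by (rule trans[OF sym])
  qed
  have Wne: "\<exists>a<?N. W a \<noteq> 0" using w(1,2) unfolding W_def by (metis eq_vecI carrier_vecD index_zero_vec(1,2))
  \<comment> \<open>the index \<open>a\<close> of the curvature matrix belongs to \<open>dz^a\<close>, hence the conjugate of the eigenvector\<close>
  define v where "v = (\<lambda>a. if a < ?N then cnj (W a) else 0)"
  have v: "v \<in> coord_space ?N" by (auto simp: v_def coord_space_def)
  have "(\<Sum>b<?N. cnj (v b) * (\<Sum>a<?N. v a * dz a (dzbar b ?LH) x)) = (\<Sum>b<?N. \<Sum>a<?N. - (cnj (W a) * (C a b * W b)))"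
    by (simp add: v_def C_def sum_distrib_left mult_ac)
  also have "\<dots> = (\<Sum>a<?N. - (cnj (W a) * (\<Sum>b<?N. C a b * W b)))"
    by (subst sum.swap) (simp add: sum_distrib_left sum_negf)
  also have "\<dots> = (\<Sum>a<?N. - complex_of_real (r * (norm (W a))\<^sup>2))"
  proof (intro sum.cong refl)
    fix a assume "a \<in> {..<?N}"
    hence "cnj (W a) * (\<Sum>b<?N. C a b * W b) = complex_of_real r * (W a * cnj (W a))" using row by simp
    thus "- (cnj (W a) * (\<Sum>b<?N. C a b * W b)) = - complex_of_real (r * (norm (W a))\<^sup>2)"
      by (simp only: complex_norm_square[symmetric] of_real_mult)
  qed
  \<comment> \<open>The Hermitian form of the curvature on its eigenvector is r times the squared
    norm; the sign is reversed because the curvature is minus the Hessian of the logarithm.\<close>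
  also have "\<dots> = complex_of_real (- (\<Sum>a<?N. r * (norm (W a))\<^sup>2))" by (simp add: sum_negf)
  finally have hess: "(\<Sum>b<?N. cnj (v b) * (\<Sum>a<?N. v a * dz a (dzbar b ?LH) x)) = complex_of_real (- (\<Sum>a<?N. r * (norm (W a))\<^sup>2))" .
  have "(\<Sum>a<?N. r * (norm (W a))\<^sup>2) > 0"
  proof -
    obtain a where "a < ?N" "W a \<noteq> 0" using Wne by blast
    thus ?thesis using r(1) by (intro sum_pos2[of _ a]) auto
  qed
  hence neg: "Re (\<Sum>b<?N. cnj (v b) * (\<Sum>a<?N. v a * dz a (dzbar b ?LH) x)) < 0" unfolding hess by simp
  have germ: "pluriharmonic_germ n A m B g f \<kappa> \<kappa>' i x v"
    by unfold_locales (use \<kappa> \<kappa>' i x v in auto)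
  show False
  proof (rule pluriharmonic_germ.no_local_maximum[OF germ np V xV Ck_on_log_metric[OF \<kappa> i] neg pos])
    fix y assume y: "y \<in> ?V" "trunc n y \<in> dom \<kappa> \<kappa>'" "Re (energy \<kappa> \<kappa>' i y) > 0"
    have "f (fst (M.proj_point \<kappa> i y)) \<in> fst \<kappa>'" unfolding M.fst_proj_point by (rule dom_point(2)[OF \<kappa> y(2)])
    from max[OF M.proj_point_in_dom(1)[OF \<kappa> i y(1)] this]
    have le: "Re (energy \<kappa> \<kappa>' i y) / Re (hloc \<kappa> i y) \<le> Re (energy \<kappa> \<kappa>' i x) / Re (hloc \<kappa> i x)"
      unfolding ratio_proj_point[OF \<kappa> i y(1)] .
    note hy = hloc_pos[OF \<kappa> i y(1)] and hx = hloc_pos[OF \<kappa> i xV]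
    have "ln (Re (energy \<kappa> \<kappa>' i y) / Re (hloc \<kappa> i y)) \<le> ln (Re (energy \<kappa> \<kappa>' i x) / Re (hloc \<kappa> i x))"
      using le y(3) pos hy hx by simp
    thus "ln (Re (energy \<kappa> \<kappa>' i y)) - Re (?LH y) \<le> ln (Re (energy \<kappa> \<kappa>' i x)) - Re (?LH x)"
      using y(3) pos hy hx by (simp add: ln_div)
  qed
qed

text \<open>The maximum is at most 0, so the nonnegative numerator vanishes on every line; testing
  it on the coordinate vectors gives each component of \<partial>f.\<close>

lemma df_zero:
  assumes np: "nonpositive_sectional_curvature m B g" and cpt: "compact_space (mtop A)"
    and RC: "\<And>\<mu> \<sigma> q. \<mu> \<in> proj_atlas n A \<Longrightarrow> \<sigma> \<in> taut_frames n A \<Longrightarrow> q \<in> fst \<mu> \<inter> fst \<sigma> \<Longrightarrow>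
      \<exists>r::real. r > 0 \<and> eigenvalue (L.chern_curvature h (snd \<sigma>) \<mu> q) (complex_of_real r)"
    and \<kappa>: "\<kappa> \<in> A" and \<kappa>': "\<kappa>' \<in> B" and p: "p \<in> fst \<kappa>" "f p \<in> fst \<kappa>'" and a: "a < n" and k: "k < m"
  shows "df \<kappa> \<kappa>' a (snd \<kappa> p) k = 0"
proof -
  have ne: "points A \<noteq> {}" "n > 0" using \<kappa> p(1) a by (auto simp: points_def)
  obtain \<kappa>0 \<kappa>0' i0 x0 where 0: "\<kappa>0 \<in> A" "\<kappa>0' \<in> B" "i0 < n" "x0 \<in> coord_space (2 * n - 1)" "trunc n x0 \<in> dom \<kappa>0 \<kappa>0'"
    "\<And>\<kappa>2 \<kappa>2' i2 q. \<kappa>2 \<in> A \<Longrightarrow> \<kappa>2' \<in> B \<Longrightarrow> i2 < n \<Longrightarrow> q \<in> proj_dom n A \<kappa>2 i2 \<Longrightarrow> f (fst q) \<in> fst \<kappa>2' \<Longrightarrow>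
      ratio \<kappa>2 \<kappa>2' i2 q \<le> Re (energy \<kappa>0 \<kappa>0' i0 x0) / Re (hloc \<kappa>0 i0 x0)"
    by (rule ratio_attains_max[OF cpt ne]) blast
  have le: "Re (energy \<kappa>0 \<kappa>0' i0 x0) \<le> 0"
    by (rule no_positive_maximum[OF np RC 0(1-5) 0(6)[OF 0(1-3)]])
  have "x0 \<in> M.proj_region \<kappa>0 UNIV" using 0(4,5) by (auto simp: M.proj_region_def dom_def)
  hence "Re (hloc \<kappa>0 i0 x0) > 0" by (rule hloc_pos[OF 0(1,3)])
  hence le0: "Re (energy \<kappa>0 \<kappa>0' i0 x0) / Re (hloc \<kappa>0 i0 x0) \<le> 0" using le by (simp add: divide_le_0_iff)
  define v where "v = M.tangent_vec \<kappa> (\<lambda>b. if b = a then 1 else 0) p"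
  have vc: "v (\<kappa>, b) = (if b = a then 1 else 0)" if "b < n" for b
    unfolding v_def by (rule M.tangent_vec_component[OF \<kappa> p(1) that])
  have va: "v (\<kappa>, a) = 1" using vc[OF a] by simp
  let ?q = "(p, complex_line v)"
  have q: "?q \<in> proj_dom n A \<kappa> a"
    by (rule M.proj_domI[OF \<kappa> p(1)]) (use va M.tangent_vec_in_tangent_space[OF \<kappa> p(1)] in \<open>auto simp: v_def\<close>)
  have tf: "taut_frame \<kappa> a ?q = v" by (rule M.taut_frame_eq) (rule va)
  have "ratio \<kappa> \<kappa>' a ?q \<le> 0" using 0(6)[OF \<kappa> \<kappa>' a q] p(2) le0 by simp
  moreover have "Re (h ?q v v) > 0" using h_pos[OF q \<kappa> a] unfolding tf .
  ultimately have num: "num \<kappa> \<kappa>' p v \<le> 0" unfolding ratio_def tf by (simp add: divide_le_0_iff)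
  interpret C: metric_chart m "snd \<kappa>' ` fst \<kappa>'" "metric_comp m B g \<kappa>'" "christoffel m B g \<kappa>'"
    by (rule N.metric_chart_coordinates[OF \<kappa>'])
  have y: "snd \<kappa>' (f p) \<in> snd \<kappa>' ` fst \<kappa>'" using p(2) by blast
  have "ip m (metric_comp m B g \<kappa>') (snd \<kappa>' (f p)) (dfv \<kappa> \<kappa>' p v) (\<lambda>k. cnj (dfv \<kappa> \<kappa>' p v k)) = 0"
    using num C.ip_self_nonneg[OF y, of "dfv \<kappa> \<kappa>' p v"] unfolding num_def by (simp add: complex_eq_iff)
  hence "dfv \<kappa> \<kappa>' p v k = 0" by (rule C.ip_self_zero[OF y _ k])
  moreover have "dfv \<kappa> \<kappa>' p v k = (\<Sum>b<n. if b = a then df \<kappa> \<kappa>' a (snd \<kappa> p) k else 0)"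
    unfolding dfv_def by (intro sum.cong refl) (simp add: vc)
  ultimately show ?thesis using a by simp
qed

end

context pluriharmonic_map
begin

text \<open>f is real, so the vanishing of \<partial>f kills all real partial derivatives of its
  components. These are then constant along straight segments in a coordinate box.\<close>

lemma locally_constant_of_df_zero:
  assumes df0: "\<And>\<kappa> \<kappa>' p a k. \<kappa> \<in> A \<Longrightarrow> \<kappa>' \<in> B \<Longrightarrow> p \<in> fst \<kappa> \<Longrightarrow> f p \<in> fst \<kappa>' \<Longrightarrow> a < n \<Longrightarrow> k < m \<Longrightarrow>
      df \<kappa> \<kappa>' a (snd \<kappa> p) k = 0"
    and p: "p \<in> points A"
  shows "\<exists>W. openin (mtop A) W \<and> p \<in> W \<and> (\<forall>p'\<in>W. f p' = f p)"
proof -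
  obtain \<kappa> where \<kappa>: "\<kappa> \<in> A" "p \<in> fst \<kappa>" using p by (auto simp: points_def)
  obtain \<kappa>' where \<kappa>': "\<kappa>' \<in> B" "f p \<in> fst \<kappa>'" using f_points[OF p] by (auto simp: points_def)
  let ?x = "snd \<kappa> p"
  obtain d where d: "d > 0" "coord_box n ?x d \<subseteq> dom \<kappa> \<kappa>'"
    using coord_box_subset_open[OF dom_open[OF \<kappa>(1) \<kappa>'(1)] dom_mem[OF \<kappa>(2) \<kappa>'(2)]] .
  have xc: "?x \<in> coord_space n" by (rule M.chart_in_coord_space[OF \<kappa>])
  let ?W = "{p' \<in> fst \<kappa>. snd \<kappa> p' \<in> coord_box n ?x d}"
  have pd0: "pd a e (\<lambda>x. rep \<kappa> \<kappa>' x k) y = 0" if "y \<in> dom \<kappa> \<kappa>'" "a < n" "k < m" "e \<in> Basis" for a e k y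
  proof (rule dz_real_zero_imp_pd_zero[OF rep_smooth[OF \<kappa>(1) \<kappa>'(1) that(3)] that(1,2) _ that(4)])
    note y = dom_point[OF \<kappa>(1) that(1)]
    show "dz a (\<lambda>x. complex_of_real (rep \<kappa> \<kappa>' x k)) y = 0"
      using df0[OF \<kappa>(1) \<kappa>'(1) y(1,2) that(2,3)] unfolding df_def local_rep_eq y(3) .
  qed
  have const: "rep \<kappa> \<kappa>' y k = rep \<kappa> \<kappa>' ?x k" if y: "y \<in> coord_box n ?x d" and k: "k < m" for y k
  proof -
    let ?c = "\<lambda>t::real. \<lambda>j. ?x j + t *\<^sub>R (y j - ?x j)"
    have cbox: "?c t \<in> coord_box n ?x d" if "t \<in> {0..1}" for t
    proof -
      have "norm (t *\<^sub>R (y j - ?x j)) < d" if "j < n" for j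
      proof -
        have "norm (t *\<^sub>R (y j - ?x j)) \<le> 1 * norm (y j - ?x j)"
          unfolding norm_scaleR using \<open>t \<in> {0..1}\<close> by (intro mult_right_mono) auto
        also have "\<dots> < d" using y that by (simp add: coord_box_def dist_norm)
        finally show ?thesis .
      qed
      thus ?thesis using xc y by (auto simp: coord_box_def coord_space_def dist_norm)
    qed
    have "((\<lambda>t. rep \<kappa> \<kappa>' (?c t) k) has_derivative (\<lambda>h. 0)) (at t within {0..1})" if t: "t \<in> {0..1}" for t
    proof -
      have cd: "((\<lambda>t. ?c t j) has_derivative (\<lambda>h. h *\<^sub>R (y j - ?x j))) (at t)" for j
        by (auto intro!: derivative_eq_intros)
      have cc: "\<forall>\<^sub>F t in nhds t. ?c t \<in> coord_space n"
        using xc y by (intro always_eventually) (auto simp: coord_box_def coord_space_def)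
      have cU: "?c t \<in> dom \<kappa> \<kappa>'" using cbox[OF t] d(2) by blast
      have "((\<lambda>t. rep \<kappa> \<kappa>' (?c t) k) has_derivative (\<lambda>h. \<Sum>j<n. \<Sum>e\<in>Basis. ((h *\<^sub>R (y j - ?x j)) \<bullet> e) *\<^sub>R pd j e (\<lambda>x. rep \<kappa> \<kappa>' x k) (?c t))) (at t)"
        by (rule C1_chain[OF dom_open[OF \<kappa>(1) \<kappa>'(1)] rep_smooth[OF \<kappa>(1) \<kappa>'(1) k] cU cc cd])
      hence "((\<lambda>t. rep \<kappa> \<kappa>' (?c t) k) has_derivative (\<lambda>h. 0)) (at t)"
        using pd0[OF cU _ k] by simp
      thus ?thesis by (rule has_derivative_at_withinI)
    qed
    then obtain C where "\<And>t. t \<in> {0..1} \<Longrightarrow> rep \<kappa> \<kappa>' (?c t) k = C"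
      using has_derivative_zero_constant[of "{0..1::real}" "\<lambda>t. rep \<kappa> \<kappa>' (?c t) k"] by auto
    from this[of 0] this[of 1] show ?thesis by simp
  qed
  have "f p' = f p" if p': "p' \<in> ?W" for p'
  proof -
    have y: "snd \<kappa> p' \<in> dom \<kappa> \<kappa>'" using p' d(2) by blast
    have fp': "f p' \<in> fst \<kappa>'" using dom_point(2)[OF \<kappa>(1) y] \<kappa>(1) p' by simp
    have r: "rep \<kappa> \<kappa>' (snd \<kappa> p') = snd \<kappa>' (f p')" "rep \<kappa> \<kappa>' ?x = snd \<kappa>' (f p)"
      using \<kappa> p' by (simp_all add: rep_def)
    have "snd \<kappa>' (f p') = snd \<kappa>' (f p)"
    proof
      fix k
      show "snd \<kappa>' (f p') k = snd \<kappa>' (f p) k"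
      proof (cases "k < m")
        case True
        then show ?thesis using const[of "snd \<kappa> p'" k] p' by (simp add: r)
      next
        case False
        then show ?thesis
          using N.chart_in_coord_space[OF \<kappa>'(1) fp'] N.chart_in_coord_space[OF \<kappa>'] by (simp add: coord_space_def)
      qed
    qed
    thus ?thesis using N.chart_inj[OF \<kappa>'(1)] fp' \<kappa>'(2) by (meson inj_onD)
  qed
  moreover have "openin (mtop A) ?W" by (rule M.openin_chart_preimage_rel[OF \<kappa>(1) openin_coord_box])
  moreover have "p \<in> ?W" using \<kappa>(2) center_in_coord_box[OF xc d(1)] by simp
  ultimately show ?thesis by blast
qed

lemma constant_of_locally_constant:
  assumes lc: "\<And>p. p \<in> points A \<Longrightarrow> \<exists>W. openin (mtop A) W \<and> p \<in> W \<and> (\<forall>p'\<in>W. f p' = f p)"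
  shows "f constant_on (points A)"
proof (rule ccontr)
  assume nc: "\<not> ?thesis"
  then obtain p0 p1 where p: "p0 \<in> points A" "p1 \<in> points A" "f p1 \<noteq> f p0" unfolding constant_on_def by metis
  let ?S = "{p \<in> points A. f p = f p0}" and ?T = "{p \<in> points A. f p \<noteq> f p0}"
  have op: "openin (mtop A) {p \<in> points A. Q (f p)}" for Q
  proof (subst openin_subopen, rule ballI)
    fix p assume p: "p \<in> {p \<in> points A. Q (f p)}"
    then obtain W where W: "openin (mtop A) W" "p \<in> W" "\<forall>p'\<in>W. f p' = f p" using lc by blast
    have "W \<subseteq> {p \<in> points A. Q (f p)}" using openin_subset[OF W(1)] W(3) p by (auto simp: M.topspace_mtop)
    thus "\<exists>W. openin (mtop A) W \<and> p \<in> W \<and> W \<subseteq> {p \<in> points A. Q (f p)}" using W by blast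
  qed
  show False
    using M.connected op[of "\<lambda>y. y = f p0"] op[of "\<lambda>y. y \<noteq> f p0"] p
    unfolding connected_space_def M.topspace_mtop by blast
qed

end

theorem theorem1p10:
  fixes n m :: nat
    and A :: "('p, complex) chart set"
    and B :: "('q, real) chart set"
    and g :: "'q \<Rightarrow> ('q, real) tangent \<Rightarrow> ('q, real) tangent \<Rightarrow> real"
    and f :: "'p \<Rightarrow> 'q"
  assumes "complex_manifold n A"
    and "compact_space (mtop A)"
    and "riemannian_manifold m B g"
    and "nonpositive_sectional_curvature m B g"
    and "pluriharmonic n A m B g f"
    and "holomorphic_line_bundle.RC_positive (2 * n - 1) (proj_atlas n A) taut_fibre (taut_frames n A)"
  shows "f constant_on (points A)"
proof -
  interpret pluriharmonic_map n A m B g f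
    using assms(1,3,5) by (intro pluriharmonic_map.intro pluriharmonic_map_axioms.intro)
  interpret L: holomorphic_line_bundle "2 * n - 1" "proj_atlas n A" taut_fibre "taut_frames n A"
    by (rule M.taut_line_bundle)
  obtain h where herm: "L.smooth_hermitian_metric h"
    and RC: "\<forall>\<mu>\<in>proj_atlas n A. \<forall>\<sigma>\<in>taut_frames n A. \<forall>q \<in> fst \<mu> \<inter> fst \<sigma>. \<exists>r::real. r > 0 \<and>
        eigenvalue (L.chern_curvature h (snd \<sigma>) \<mu> q) (complex_of_real r)"
    using assms(6) unfolding L.RC_positive_def by blast
  interpret H: pluriharmonic_metric n A m B g f h
    by unfold_locales (rule herm)
  \<comment> \<open>For n = 0 there is nothing to show here, and no maximum on the then empty P(T_M)
    is sought: the bound a < n already provides n > 0 in \<open>df_zero\<close>.\<close>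
  have "df \<kappa> \<kappa>' a (snd \<kappa> p) k = 0"
    if "\<kappa> \<in> A" "\<kappa>' \<in> B" "p \<in> fst \<kappa>" "f p \<in> fst \<kappa>'" "a < n" "k < m" for \<kappa> \<kappa>' p a k
    by (rule H.df_zero[OF assms(4,2) _ that]) (use RC in blast)
  thus ?thesis by (intro constant_of_locally_constant locally_constant_of_df_zero)
qed

end
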